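(* Let $(x,X)$ be a local, noetherian, Cohen–Macaulay scheme of dimension $\ge 3$. Let $\Omega$ be a torsion free, coherent sheaf on $X$ such that, for every torsion free, Cohen–Macaulay coherent sheaf $M$ on $X$, its dual $\mathcal{H}om_X(M,\Omega)$ is also torsion free and Cohen–Macaulay. Then $\Omega$ is a direct sum of copies of $\omega_X$.
   Context: A local scheme $(x,X)$ is the spectrum of a local ring with closed point $x$. A coherent sheaf is torsion free if all of its associated points are generic points of $X$. $\omega_X$ denotes the dualizing sheaf of $X$: writing $X=\operatorname{Spec}R$ with $R$ local Cohen–Macaulay with residue field $k$, it is the coherent sheaf corresponding to a dualizing module of $R$, that is, a finite $R$-module $\omega_R$ such that $\operatorname{Ext}^i_R(k,\omega_R)\cong k$ for $i=\dim R$ and $\operatorname{Ext}^i_R(k,\omega_R)=0$ for $i\ne\dim R$. *)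

theory Defs
  imports "HOL-Algebra.Algebra" "HOL-Library.Extended_Nat"
begin

text \<open>
  A local scheme is the spectrum of a local ring \<open>R\<close>, and a coherent sheaf on the spectrum of
  a noetherian ring \<open>R\<close> is a finite \<open>R\<close>-module. Points of the spectrum are prime ideals of \<open>R\<close>.

  The record type of modules extends that of rings; the fields \<open>mult\<close> and \<open>one\<close> play no role
  for a module and are left \<open>undefined\<close> in the modules constructed below.

  Every finite \<open>R\<close>-module is isomorphic to a quotient of a free module \<open>R\<^sup>n\<close>, whose elements are
  cosets, that is, sets of functions \<open>nat \<Rightarrow> 'a\<close>. Hence quantifying over finite modules with
  elements of type \<open>(nat \<Rightarrow> 'a) set\<close> covers all finite modules up to isomorphism.
\<close>

definition local_ring :: "('a, 'r) ring_scheme \<Rightarrow> bool" where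
  "local_ring R \<longleftrightarrow> cring R \<and> (\<exists>!m. maximalideal m R)"

definition max_ideal :: "('a, 'r) ring_scheme \<Rightarrow> 'a set" where
  "max_ideal R = (THE m. maximalideal m R)"

definition spec :: "('a, 'r) ring_scheme \<Rightarrow> 'a set set" where
  "spec R = {p. primeideal p R}"

definition generic_points :: "('a, 'r) ring_scheme \<Rightarrow> 'a set set" where
  "generic_points R = {p \<in> spec R. \<forall>q \<in> spec R. q \<subseteq> p \<longrightarrow> q = p}"

definition chain_dim :: "'a set set \<Rightarrow> enat" where
  "chain_dim S = Sup {enat n | n. \<exists>p :: nat \<Rightarrow> 'a set.
     (\<forall>i \<le> n. p i \<in> S) \<and> (\<forall>i < n. p i \<subset> p (Suc i))}"

definition krull_dim :: "('a, 'r) ring_scheme \<Rightarrow> enat" where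
  "krull_dim R = chain_dim (spec R)"

definition finite_module :: "('a, 'r) ring_scheme \<Rightarrow> ('a, 'b) module \<Rightarrow> bool" where
  "finite_module R M \<longleftrightarrow> module R M \<and>
     (\<exists>A \<subseteq> carrier M. finite A \<and> (\<forall>N. submodule N R M \<and> A \<subseteq> N \<longrightarrow> N = carrier M))"

definition linear_maps ::
    "('a, 'r) ring_scheme \<Rightarrow> ('a, 'b) module \<Rightarrow> ('a, 'c) module \<Rightarrow> ('b \<Rightarrow> 'c) set" where
  "linear_maps R M N = {f \<in> carrier M \<rightarrow> carrier N.
     (\<forall>x \<in> carrier M. \<forall>y \<in> carrier M. f (x \<oplus>\<^bsub>M\<^esub> y) = f x \<oplus>\<^bsub>N\<^esub> f y) \<and>
     (\<forall>r \<in> carrier R. \<forall>x \<in> carrier M. f (r \<odot>\<^bsub>M\<^esub> x) = r \<odot>\<^bsub>N\<^esub> f x)}"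

definition iso_modules ::
    "('a, 'r) ring_scheme \<Rightarrow> ('a, 'b) module \<Rightarrow> ('a, 'c) module \<Rightarrow> bool" where
  "iso_modules R M N \<longleftrightarrow> (\<exists>f \<in> linear_maps R M N. bij_betw f (carrier M) (carrier N))"

text \<open>Homomorphisms are represented by functions that are \<open>undefined\<close> outside \<open>carrier M\<close>, so
  that equality in the carrier is equality of maps on \<open>M\<close>.\<close>

definition hom_module ::
    "('a, 'r) ring_scheme \<Rightarrow> ('a, 'b) module \<Rightarrow> ('a, 'c) module \<Rightarrow> ('a, 'b \<Rightarrow> 'c) module" where
  "hom_module R M N =
     \<lparr>carrier = linear_maps R M N \<inter> extensional (carrier M),
      monoid.mult = undefined, one = undefined,
      ring.zero = (\<lambda>x \<in> carrier M. \<zero>\<^bsub>N\<^esub>),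
      ring.add = (\<lambda>f g. \<lambda>x \<in> carrier M. f x \<oplus>\<^bsub>N\<^esub> g x),
      smult = (\<lambda>r f. \<lambda>x \<in> carrier M. r \<odot>\<^bsub>N\<^esub> f x)\<rparr>"

text \<open>The quotient of \<open>M\<close> by a submodule \<open>N\<close>, with cosets as elements as in \<^const>\<open>FactRing\<close>.\<close>

definition quot_module :: "('a, 'b) module \<Rightarrow> 'b set \<Rightarrow> ('a, 'b set) module" where
  "quot_module M N =
     \<lparr>carrier = a_rcosets\<^bsub>M\<^esub> N,
      monoid.mult = undefined, one = undefined,
      ring.zero = N,
      ring.add = set_add M,
      smult = (\<lambda>r C. \<Union>x \<in> C. N +>\<^bsub>M\<^esub> (r \<odot>\<^bsub>M\<^esub> x))\<rparr>"

text \<open>The direct sum of \<open>n\<close> copies of \<open>M\<close>; the zero module for \<open>n = 0\<close>.\<close>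

definition direct_power :: "nat \<Rightarrow> ('a, 'b) module \<Rightarrow> ('a, nat \<Rightarrow> 'b) module" where
  "direct_power n M =
     \<lparr>carrier = {..<n} \<rightarrow>\<^sub>E carrier M,
      monoid.mult = undefined, one = undefined,
      ring.zero = (\<lambda>i \<in> {..<n}. \<zero>\<^bsub>M\<^esub>),
      ring.add = (\<lambda>x y. \<lambda>i \<in> {..<n}. x i \<oplus>\<^bsub>M\<^esub> y i),
      smult = (\<lambda>r x. \<lambda>i \<in> {..<n}. r \<odot>\<^bsub>M\<^esub> x i)\<rparr>"

definition self_module :: "('a, 'r) ring_scheme \<Rightarrow> ('a, 'a) module" where
  "self_module R =
     \<lparr>carrier = carrier R, monoid.mult = undefined, one = undefined,
      ring.zero = \<zero>\<^bsub>R\<^esub>, ring.add = (\<oplus>\<^bsub>R\<^esub>), smult = (\<otimes>\<^bsub>R\<^esub>)\<rparr>"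

definition residue_field :: "('a, 'r) ring_scheme \<Rightarrow> ('a, 'a set) module" where
  "residue_field R = quot_module (self_module R) (max_ideal R)"

definition annihilator ::
    "('a, 'r) ring_scheme \<Rightarrow> ('a, 'b) module \<Rightarrow> 'b \<Rightarrow> 'a set" where
  "annihilator R M x = {r \<in> carrier R. r \<odot>\<^bsub>M\<^esub> x = \<zero>\<^bsub>M\<^esub>}"

definition associated_points :: "('a, 'r) ring_scheme \<Rightarrow> ('a, 'b) module \<Rightarrow> 'a set set" where
  "associated_points R M = {p \<in> spec R. \<exists>x \<in> carrier M. p = annihilator R M x}"

definition torsion_free :: "('a, 'r) ring_scheme \<Rightarrow> ('a, 'b) module \<Rightarrow> bool" where
  "torsion_free R M \<longleftrightarrow> associated_points R M \<subseteq> generic_points R"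

text \<open>The localization of \<open>M\<close> at \<open>p\<close> is nonzero if and only if the image of some \<open>x\<close> in it is
  nonzero, that is, if and only if no element outside \<open>p\<close> annihilates \<open>x\<close>.\<close>

definition support :: "('a, 'r) ring_scheme \<Rightarrow> ('a, 'b) module \<Rightarrow> 'a set set" where
  "support R M = {p \<in> spec R. \<exists>x \<in> carrier M. annihilator R M x \<subseteq> p}"

definition module_dim :: "('a, 'r) ring_scheme \<Rightarrow> ('a, 'b) module \<Rightarrow> enat" where
  "module_dim R M = chain_dim (support R M)"

text \<open>The submodule \<open>(x\<^sub>1, \<dots>, x\<^sub>k) M\<close> generated by a list of ring elements.\<close>

definition seq_mult :: "('a, 'b) module \<Rightarrow> 'a list \<Rightarrow> 'b set" where
  "seq_mult M xs = {finsum M (\<lambda>j. (xs ! j) \<odot>\<^bsub>M\<^esub> f j) {..<length xs} | f.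
     f \<in> {..<length xs} \<rightarrow> carrier M}"

definition regular_sequence ::
    "('a, 'r) ring_scheme \<Rightarrow> ('a, 'b) module \<Rightarrow> 'a list \<Rightarrow> bool" where
  "regular_sequence R M xs \<longleftrightarrow> set xs \<subseteq> carrier R \<and>
     (\<forall>i < length xs. \<forall>m \<in> carrier M.
        (xs ! i) \<odot>\<^bsub>M\<^esub> m \<in> seq_mult M (take i xs) \<longrightarrow> m \<in> seq_mult M (take i xs)) \<and>
     seq_mult M xs \<noteq> carrier M"

definition depth :: "('a, 'r) ring_scheme \<Rightarrow> ('a, 'b) module \<Rightarrow> enat" where
  "depth R M = Sup {enat (length xs) | xs. set xs \<subseteq> max_ideal R \<and> regular_sequence R M xs}"

text \<open>The zero module counts as Cohen--Macaulay.\<close>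

definition cohen_macaulay :: "('a, 'r) ring_scheme \<Rightarrow> ('a, 'b) module \<Rightarrow> bool" where
  "cohen_macaulay R M \<longleftrightarrow> carrier M = {\<zero>\<^bsub>M\<^esub>} \<or> depth R M = module_dim R M"

definition cohen_macaulay_ring :: "('a, 'r) ring_scheme \<Rightarrow> bool" where
  "cohen_macaulay_ring R \<longleftrightarrow> cohen_macaulay R (self_module R)"

text \<open>A resolution \<open>\<dots> \<rightarrow> R\<^bsup>n 1\<^esup> \<rightarrow> R\<^bsup>n 0\<^esup> \<rightarrow> M \<rightarrow> 0\<close> by free modules of finite rank, with
  augmentation \<open>e\<close> and differentials \<open>d i\<close> from \<open>R\<^bsup>n (i + 1)\<^esup>\<close> to \<open>R\<^bsup>n i\<^esup>\<close>.\<close>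

definition free_resolution ::
    "('a, 'r) ring_scheme \<Rightarrow> ('a, 'b) module \<Rightarrow> (nat \<Rightarrow> nat) \<Rightarrow>
     (nat \<Rightarrow> (nat \<Rightarrow> 'a) \<Rightarrow> (nat \<Rightarrow> 'a)) \<Rightarrow> ((nat \<Rightarrow> 'a) \<Rightarrow> 'b) \<Rightarrow> bool" where
  "free_resolution R M n d e \<longleftrightarrow>
     (let F = (\<lambda>i. direct_power (n i) (self_module R)) in
        e \<in> linear_maps R (F 0) M \<and>
        e ` carrier (F 0) = carrier M \<and>
        (\<forall>i. d i \<in> linear_maps R (F (Suc i)) (F i)) \<and>
        d 0 ` carrier (F 1) = {x \<in> carrier (F 0). e x = \<zero>\<^bsub>M\<^esub>} \<and>
        (\<forall>i. d (Suc i) ` carrier (F (Suc (Suc i))) =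
               {x \<in> carrier (F (Suc i)). d i x = \<zero>\<^bsub>F i\<^esub>}))"

text \<open>The \<open>i\<close>-th cohomology of the complex of homomorphisms from the resolution \<open>(n, d)\<close> to \<open>N\<close>.\<close>

definition hom_cohomology ::
    "('a, 'r) ring_scheme \<Rightarrow> (nat \<Rightarrow> nat) \<Rightarrow> (nat \<Rightarrow> (nat \<Rightarrow> 'a) \<Rightarrow> (nat \<Rightarrow> 'a)) \<Rightarrow>
     nat \<Rightarrow> ('a, 'c) module \<Rightarrow> ('a, ((nat \<Rightarrow> 'a) \<Rightarrow> 'c) set) module" where
  "hom_cohomology R n d i N =
     (let F = (\<lambda>j. direct_power (n j) (self_module R));
          H = (\<lambda>j. hom_module R (F j) N);
          D = (\<lambda>j f. compose (carrier (F (Suc j))) f (d j));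
          Z = {f \<in> carrier (H i). D i f = \<zero>\<^bsub>H (Suc i)\<^esub>};
          B = (case i of 0 \<Rightarrow> {\<zero>\<^bsub>H 0\<^esub>} | Suc j \<Rightarrow> D j ` carrier (H j))
      in quot_module ((H i)\<lparr>carrier := Z\<rparr>) B)"

text \<open>For \<open>R\<close> noetherian and \<open>M\<close> finite, free resolutions by modules of finite rank exist, and up
  to isomorphism the result does not depend on the chosen one.\<close>

definition Ext ::
    "('a, 'r) ring_scheme \<Rightarrow> nat \<Rightarrow> ('a, 'b) module \<Rightarrow> ('a, 'c) module \<Rightarrow>
     ('a, ((nat \<Rightarrow> 'a) \<Rightarrow> 'c) set) module" where
  "Ext R i M N =
     (let (n, d) = (SOME (n, d). \<exists>e. free_resolution R M n d e) in hom_cohomology R n d i N)"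

definition dualizing_module :: "('a, 'r) ring_scheme \<Rightarrow> ('a, 'b) module \<Rightarrow> bool" where
  "dualizing_module R W \<longleftrightarrow> finite_module R W \<and>
     (\<forall>i. if enat i = krull_dim R
          then iso_modules R (Ext R i (residue_field R) W) (residue_field R)
          else carrier (Ext R i (residue_field R) W) = {\<zero>\<^bsub>Ext R i (residue_field R) W\<^esub>})"

end

theory Submission
  imports Defs
begin

text \<open>
  Let \<open>k\<close> be the residue field and \<open>d\<close> the dimension of \<open>R\<close>. The proof compares \<open>\<Omega>\<close> and \<open>\<omega>\<close> through the modules \<open>Ext\<^sup>j(k, _)\<close>, all
  computed from one free resolution of \<open>k\<close> by modules \<open>F\<^sub>j\<close> with syzygies \<open>Z\<^sub>j\<close> contained in \<open>F\<^sub>j\<close>.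

  The first step shows \<open>Ext\<^sup>j(k, \<Omega>) = 0\<close> for \<open>j \<noteq> d\<close>. A nonzero finite module is torsion free and Cohen--Macaulay if and only if the
  maximal ideal contains a sequence of length \<open>d\<close> that is regular on the module (\<open>torsion_free_cm_depth\<close>,
  \<open>maximal_depth_imp_torsion_free_cm\<close>). So by hypothesis the dual into \<open>\<Omega>\<close> of a module of depth \<open>d\<close> has depth \<open>d\<close> or is zero. The dual
  of \<open>R\<close> is \<open>\<Omega>\<close>, which settles \<open>j < d\<close>. For \<open>j > d\<close> the syzygies \<open>Z\<^sub>j\<^sub>-\<^sub>2\<close> and \<open>Z\<^sub>j\<^sub>-\<^sub>1\<close> have depth \<open>d\<close>, and there is an exact sequence
  \<open>0 \<rightarrow> Hom(Z\<^sub>j\<^sub>-\<^sub>2, \<Omega>) \<rightarrow> Hom(F\<^sub>j\<^sub>-\<^sub>1, \<Omega>) \<rightarrow> Hom(Z\<^sub>j\<^sub>-\<^sub>1, \<Omega>) \<rightarrow> Ext\<^sup>j(k, \<Omega>) \<rightarrow> 0\<close>. Its first three terms have depth at least three or are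
  zero; this is where \<open>d \<ge> 3\<close> enters. Hence the last term contains no nonzero element killed by the maximal ideal. But the maximal
  ideal kills all of \<open>Ext\<^sup>j(k, \<Omega>)\<close>, so this module is zero (\<open>EV_of_dual_syzygies\<close>, \<open>EV_of_cm_duals\<close>).

  The second step is the comparison. Prime avoidance yields a sequence \<open>xs\<close> of length \<open>d\<close> in the maximal ideal that is regular on
  \<open>R\<close>, \<open>\<omega>\<close> and \<open>\<Omega>\<close> at the same time (\<open>common_regular_sequence\<close>). By Rees' change of rings, \<open>Ext\<^sup>d\<^sup>+\<^sup>1(k, _) = 0\<close> over \<open>R\<close> becomes
  \<open>Ext\<^sup>1(k, _) = 0\<close> over \<open>R / (xs)\<close> for the quotients \<open>E = \<omega> / xs \<omega>\<close> and \<open>\<Omega> / xs \<Omega>\<close>. As \<open>R / (xs)\<close> has only one prime, these quotients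
  are injective over it (\<open>injective_of_EV\<close>, \<open>injective_extension\<close>). The socle of \<open>E\<close> is simple because \<open>Ext\<^sup>d(k, \<omega>)\<close> is \<open>k\<close>, and so
  \<open>\<Omega> / xs \<Omega>\<close> is isomorphic to a direct power \<open>E\<^sup>n\<close> (\<open>injective_direct_sum\<close>).

  The isomorphism is lifted through the quotients by \<open>x\<^sub>1, \<dots>, x\<^sub>i\<close> for decreasing \<open>i\<close>. A lift exists since \<open>Ext\<^sup>1(\<omega>, _)\<close> vanishes on
  the quotients of \<open>\<Omega>\<close>; this holds for \<open>i = d\<close> by injectivity and descends by Nakayama's lemma (\<open>extends_from_kernel\<close>,
  \<open>extends_from_descend\<close>, \<open>lift_hom_level\<close>). By Nakayama's lemma again, a lift of an isomorphism along a regular element is an isomorphism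
  (\<open>reg_step_bijective\<close>). For \<open>i = 0\<close> this is the isomorphism of \<open>\<Omega>\<close> with \<open>\<omega>\<^sup>n\<close>.
\<close>

section \<open>Linear maps, free modules, quotients and modules of homomorphisms\<close>

context cring
begin

lemma mod_closed [simp]:
  assumes "module R M"
  shows "\<zero>\<^bsub>M\<^esub> \<in> carrier M"
    and "x \<in> carrier M \<Longrightarrow> y \<in> carrier M \<Longrightarrow> x \<oplus>\<^bsub>M\<^esub> y \<in> carrier M"
    and "x \<in> carrier M \<Longrightarrow> \<ominus>\<^bsub>M\<^esub> x \<in> carrier M"
    and "x \<in> carrier M \<Longrightarrow> y \<in> carrier M \<Longrightarrow> x \<ominus>\<^bsub>M\<^esub> y \<in> carrier M"
    and "r \<in> carrier R \<Longrightarrow> x \<in> carrier M \<Longrightarrow> r \<odot>\<^bsub>M\<^esub> x \<in> carrier M"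
proof -
  interpret M: module R M by fact
  show "\<zero>\<^bsub>M\<^esub> \<in> carrier M"
    and "x \<in> carrier M \<Longrightarrow> y \<in> carrier M \<Longrightarrow> x \<oplus>\<^bsub>M\<^esub> y \<in> carrier M"
    and "x \<in> carrier M \<Longrightarrow> \<ominus>\<^bsub>M\<^esub> x \<in> carrier M"
    and "x \<in> carrier M \<Longrightarrow> y \<in> carrier M \<Longrightarrow> x \<ominus>\<^bsub>M\<^esub> y \<in> carrier M"
    and "r \<in> carrier R \<Longrightarrow> x \<in> carrier M \<Longrightarrow> r \<odot>\<^bsub>M\<^esub> x \<in> carrier M" by auto
qed

lemma mod_simps [simp]:
  assumes "module R M"
  shows "x \<in> carrier M \<Longrightarrow> \<zero>\<^bsub>M\<^esub> \<oplus>\<^bsub>M\<^esub> x = x"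
    and "x \<in> carrier M \<Longrightarrow> x \<oplus>\<^bsub>M\<^esub> \<zero>\<^bsub>M\<^esub> = x"
    and "x \<in> carrier M \<Longrightarrow> \<one> \<odot>\<^bsub>M\<^esub> x = x"
    and "x \<in> carrier M \<Longrightarrow> \<zero> \<odot>\<^bsub>M\<^esub> x = \<zero>\<^bsub>M\<^esub>"
    and "r \<in> carrier R \<Longrightarrow> r \<odot>\<^bsub>M\<^esub> \<zero>\<^bsub>M\<^esub> = \<zero>\<^bsub>M\<^esub>"
    and "x \<in> carrier M \<Longrightarrow> x \<ominus>\<^bsub>M\<^esub> x = \<zero>\<^bsub>M\<^esub>"
    and "x \<in> carrier M \<Longrightarrow> \<ominus>\<^bsub>M\<^esub> (\<ominus>\<^bsub>M\<^esub> x) = x"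
    and "\<ominus>\<^bsub>M\<^esub> \<zero>\<^bsub>M\<^esub> = \<zero>\<^bsub>M\<^esub>"
    and "x \<in> carrier M \<Longrightarrow> \<ominus>\<^bsub>M\<^esub> x \<oplus>\<^bsub>M\<^esub> x = \<zero>\<^bsub>M\<^esub>"
    and "x \<in> carrier M \<Longrightarrow> x \<oplus>\<^bsub>M\<^esub> \<ominus>\<^bsub>M\<^esub> x = \<zero>\<^bsub>M\<^esub>"
    and "x \<in> carrier M \<Longrightarrow> y \<in> carrier M \<Longrightarrow> \<ominus>\<^bsub>M\<^esub> x \<oplus>\<^bsub>M\<^esub> (x \<oplus>\<^bsub>M\<^esub> y) = y"
    and "x \<in> carrier M \<Longrightarrow> y \<in> carrier M \<Longrightarrow> x \<oplus>\<^bsub>M\<^esub> (\<ominus>\<^bsub>M\<^esub> x \<oplus>\<^bsub>M\<^esub> y) = y"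
proof -
  interpret M: module R M by fact
  show "x \<in> carrier M \<Longrightarrow> \<zero>\<^bsub>M\<^esub> \<oplus>\<^bsub>M\<^esub> x = x"
    and "x \<in> carrier M \<Longrightarrow> x \<oplus>\<^bsub>M\<^esub> \<zero>\<^bsub>M\<^esub> = x"
    and "x \<in> carrier M \<Longrightarrow> \<one> \<odot>\<^bsub>M\<^esub> x = x"
    and "x \<in> carrier M \<Longrightarrow> \<zero> \<odot>\<^bsub>M\<^esub> x = \<zero>\<^bsub>M\<^esub>"
    and "r \<in> carrier R \<Longrightarrow> r \<odot>\<^bsub>M\<^esub> \<zero>\<^bsub>M\<^esub> = \<zero>\<^bsub>M\<^esub>"
    and "x \<in> carrier M \<Longrightarrow> x \<ominus>\<^bsub>M\<^esub> x = \<zero>\<^bsub>M\<^esub>"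
    and "x \<in> carrier M \<Longrightarrow> \<ominus>\<^bsub>M\<^esub> (\<ominus>\<^bsub>M\<^esub> x) = x"
    and "\<ominus>\<^bsub>M\<^esub> \<zero>\<^bsub>M\<^esub> = \<zero>\<^bsub>M\<^esub>"
    and "x \<in> carrier M \<Longrightarrow> \<ominus>\<^bsub>M\<^esub> x \<oplus>\<^bsub>M\<^esub> x = \<zero>\<^bsub>M\<^esub>"
    and "x \<in> carrier M \<Longrightarrow> x \<oplus>\<^bsub>M\<^esub> \<ominus>\<^bsub>M\<^esub> x = \<zero>\<^bsub>M\<^esub>"
    and "x \<in> carrier M \<Longrightarrow> y \<in> carrier M \<Longrightarrow> \<ominus>\<^bsub>M\<^esub> x \<oplus>\<^bsub>M\<^esub> (x \<oplus>\<^bsub>M\<^esub> y) = y"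
    and "x \<in> carrier M \<Longrightarrow> y \<in> carrier M \<Longrightarrow> x \<oplus>\<^bsub>M\<^esub> (\<ominus>\<^bsub>M\<^esub> x \<oplus>\<^bsub>M\<^esub> y) = y"
    by (auto simp: M.minus_eq M.r_neg M.l_neg M.r_neg1 M.r_neg2)
qed

lemma mod_ac:
  assumes "module R M"
  shows "x \<in> carrier M \<Longrightarrow> y \<in> carrier M \<Longrightarrow> z \<in> carrier M \<Longrightarrow> (x \<oplus>\<^bsub>M\<^esub> y) \<oplus>\<^bsub>M\<^esub> z = x \<oplus>\<^bsub>M\<^esub> (y \<oplus>\<^bsub>M\<^esub> z)"
    and "x \<in> carrier M \<Longrightarrow> y \<in> carrier M \<Longrightarrow> x \<oplus>\<^bsub>M\<^esub> y = y \<oplus>\<^bsub>M\<^esub> x"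
    and "x \<in> carrier M \<Longrightarrow> y \<in> carrier M \<Longrightarrow> z \<in> carrier M \<Longrightarrow> x \<oplus>\<^bsub>M\<^esub> (y \<oplus>\<^bsub>M\<^esub> z) = y \<oplus>\<^bsub>M\<^esub> (x \<oplus>\<^bsub>M\<^esub> z)"
    and "x \<ominus>\<^bsub>M\<^esub> y = x \<oplus>\<^bsub>M\<^esub> \<ominus>\<^bsub>M\<^esub> y"
    and "x \<in> carrier M \<Longrightarrow> y \<in> carrier M \<Longrightarrow> \<ominus>\<^bsub>M\<^esub> (x \<oplus>\<^bsub>M\<^esub> y) = \<ominus>\<^bsub>M\<^esub> x \<oplus>\<^bsub>M\<^esub> \<ominus>\<^bsub>M\<^esub> y"
proof -
  interpret M: module R M by fact
  show "x \<in> carrier M \<Longrightarrow> y \<in> carrier M \<Longrightarrow> z \<in> carrier M \<Longrightarrow> (x \<oplus>\<^bsub>M\<^esub> y) \<oplus>\<^bsub>M\<^esub> z = x \<oplus>\<^bsub>M\<^esub> (y \<oplus>\<^bsub>M\<^esub> z)"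
    and "x \<in> carrier M \<Longrightarrow> y \<in> carrier M \<Longrightarrow> x \<oplus>\<^bsub>M\<^esub> y = y \<oplus>\<^bsub>M\<^esub> x"
    and "x \<in> carrier M \<Longrightarrow> y \<in> carrier M \<Longrightarrow> z \<in> carrier M \<Longrightarrow> x \<oplus>\<^bsub>M\<^esub> (y \<oplus>\<^bsub>M\<^esub> z) = y \<oplus>\<^bsub>M\<^esub> (x \<oplus>\<^bsub>M\<^esub> z)"
    and "x \<ominus>\<^bsub>M\<^esub> y = x \<oplus>\<^bsub>M\<^esub> \<ominus>\<^bsub>M\<^esub> y"
    and "x \<in> carrier M \<Longrightarrow> y \<in> carrier M \<Longrightarrow> \<ominus>\<^bsub>M\<^esub> (x \<oplus>\<^bsub>M\<^esub> y) = \<ominus>\<^bsub>M\<^esub> x \<oplus>\<^bsub>M\<^esub> \<ominus>\<^bsub>M\<^esub> y"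
    by (auto simp: M.minus_eq M.a_assoc M.a_comm M.a_lcomm M.minus_add)
qed

lemma mod_smult:
  assumes "module R M"
  shows "r \<in> carrier R \<Longrightarrow> x \<in> carrier M \<Longrightarrow> y \<in> carrier M \<Longrightarrow> r \<odot>\<^bsub>M\<^esub> (x \<oplus>\<^bsub>M\<^esub> y) = r \<odot>\<^bsub>M\<^esub> x \<oplus>\<^bsub>M\<^esub> r \<odot>\<^bsub>M\<^esub> y"
    and "r \<in> carrier R \<Longrightarrow> s \<in> carrier R \<Longrightarrow> x \<in> carrier M \<Longrightarrow> (r \<oplus> s) \<odot>\<^bsub>M\<^esub> x = r \<odot>\<^bsub>M\<^esub> x \<oplus>\<^bsub>M\<^esub> s \<odot>\<^bsub>M\<^esub> x"
    and "r \<in> carrier R \<Longrightarrow> s \<in> carrier R \<Longrightarrow> x \<in> carrier M \<Longrightarrow> (r \<otimes> s) \<odot>\<^bsub>M\<^esub> x = r \<odot>\<^bsub>M\<^esub> (s \<odot>\<^bsub>M\<^esub> x)"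
    and "r \<in> carrier R \<Longrightarrow> x \<in> carrier M \<Longrightarrow> \<ominus> r \<odot>\<^bsub>M\<^esub> x = \<ominus>\<^bsub>M\<^esub> (r \<odot>\<^bsub>M\<^esub> x)"
    and "r \<in> carrier R \<Longrightarrow> x \<in> carrier M \<Longrightarrow> r \<odot>\<^bsub>M\<^esub> (\<ominus>\<^bsub>M\<^esub> x) = \<ominus>\<^bsub>M\<^esub> (r \<odot>\<^bsub>M\<^esub> x)"
    and "r \<in> carrier R \<Longrightarrow> x \<in> carrier M \<Longrightarrow> y \<in> carrier M \<Longrightarrow> r \<odot>\<^bsub>M\<^esub> (x \<ominus>\<^bsub>M\<^esub> y) = r \<odot>\<^bsub>M\<^esub> x \<ominus>\<^bsub>M\<^esub> r \<odot>\<^bsub>M\<^esub> y"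
    and "r \<in> carrier R \<Longrightarrow> s \<in> carrier R \<Longrightarrow> x \<in> carrier M \<Longrightarrow> (r \<ominus> s) \<odot>\<^bsub>M\<^esub> x = r \<odot>\<^bsub>M\<^esub> x \<ominus>\<^bsub>M\<^esub> s \<odot>\<^bsub>M\<^esub> x"
proof -
  interpret M: module R M by fact
  show "r \<in> carrier R \<Longrightarrow> x \<in> carrier M \<Longrightarrow> y \<in> carrier M \<Longrightarrow> r \<odot>\<^bsub>M\<^esub> (x \<oplus>\<^bsub>M\<^esub> y) = r \<odot>\<^bsub>M\<^esub> x \<oplus>\<^bsub>M\<^esub> r \<odot>\<^bsub>M\<^esub> y"
    and "r \<in> carrier R \<Longrightarrow> s \<in> carrier R \<Longrightarrow> x \<in> carrier M \<Longrightarrow> (r \<oplus> s) \<odot>\<^bsub>M\<^esub> x = r \<odot>\<^bsub>M\<^esub> x \<oplus>\<^bsub>M\<^esub> s \<odot>\<^bsub>M\<^esub> x"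
    and "r \<in> carrier R \<Longrightarrow> s \<in> carrier R \<Longrightarrow> x \<in> carrier M \<Longrightarrow> (r \<otimes> s) \<odot>\<^bsub>M\<^esub> x = r \<odot>\<^bsub>M\<^esub> (s \<odot>\<^bsub>M\<^esub> x)"
    and "r \<in> carrier R \<Longrightarrow> x \<in> carrier M \<Longrightarrow> \<ominus> r \<odot>\<^bsub>M\<^esub> x = \<ominus>\<^bsub>M\<^esub> (r \<odot>\<^bsub>M\<^esub> x)"
    and "r \<in> carrier R \<Longrightarrow> x \<in> carrier M \<Longrightarrow> r \<odot>\<^bsub>M\<^esub> (\<ominus>\<^bsub>M\<^esub> x) = \<ominus>\<^bsub>M\<^esub> (r \<odot>\<^bsub>M\<^esub> x)"
    and "r \<in> carrier R \<Longrightarrow> x \<in> carrier M \<Longrightarrow> y \<in> carrier M \<Longrightarrow> r \<odot>\<^bsub>M\<^esub> (x \<ominus>\<^bsub>M\<^esub> y) = r \<odot>\<^bsub>M\<^esub> x \<ominus>\<^bsub>M\<^esub> r \<odot>\<^bsub>M\<^esub> y"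
    and "r \<in> carrier R \<Longrightarrow> s \<in> carrier R \<Longrightarrow> x \<in> carrier M \<Longrightarrow> (r \<ominus> s) \<odot>\<^bsub>M\<^esub> x = r \<odot>\<^bsub>M\<^esub> x \<ominus>\<^bsub>M\<^esub> s \<odot>\<^bsub>M\<^esub> x"
    by (auto simp: M.minus_eq M.smult_r_distr M.smult_l_distr M.smult_assoc1 M.smult_l_minus M.smult_r_minus minus_eq)
qed

lemma mod_eq_iff:
  assumes "module R M" "x \<in> carrier M" "y \<in> carrier M"
  shows "x \<ominus>\<^bsub>M\<^esub> y = \<zero>\<^bsub>M\<^esub> \<longleftrightarrow> x = y"
proof -
  interpret M: module R M by fact
  show ?thesis using assms by (metis M.minus_equality M.minus_minus M.minus_eq M.r_neg M.a_inv_closed)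
qed

lemma mod_solve:
  assumes "module R M" "x \<in> carrier M" "y \<in> carrier M" "z \<in> carrier M"
  shows "x \<ominus>\<^bsub>M\<^esub> y = z \<longleftrightarrow> x = y \<oplus>\<^bsub>M\<^esub> z"
  using assms by (auto simp: mod_ac[OF assms(1)])

abbreviation lin :: "('a, 'm) module \<Rightarrow> ('a, 'n) module \<Rightarrow> ('m \<Rightarrow> 'n) set"
  where "lin M N \<equiv> linear_maps R M N"

lemma linI:
  assumes "\<And>x. x \<in> carrier M \<Longrightarrow> f x \<in> carrier N"
    and "\<And>x y. x \<in> carrier M \<Longrightarrow> y \<in> carrier M \<Longrightarrow> f (x \<oplus>\<^bsub>M\<^esub> y) = f x \<oplus>\<^bsub>N\<^esub> f y"
    and "\<And>r x. r \<in> carrier R \<Longrightarrow> x \<in> carrier M \<Longrightarrow> f (r \<odot>\<^bsub>M\<^esub> x) = r \<odot>\<^bsub>N\<^esub> f x"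
  shows "f \<in> lin M N"
  using assms by (auto simp: linear_maps_def)

lemma lin_closed: "f \<in> lin M N \<Longrightarrow> x \<in> carrier M \<Longrightarrow> f x \<in> carrier N"
  by (auto simp: linear_maps_def)

lemma lin_add: "f \<in> lin M N \<Longrightarrow> x \<in> carrier M \<Longrightarrow> y \<in> carrier M \<Longrightarrow> f (x \<oplus>\<^bsub>M\<^esub> y) = f x \<oplus>\<^bsub>N\<^esub> f y"
  by (auto simp: linear_maps_def)

lemma lin_smult: "f \<in> lin M N \<Longrightarrow> r \<in> carrier R \<Longrightarrow> x \<in> carrier M \<Longrightarrow> f (r \<odot>\<^bsub>M\<^esub> x) = r \<odot>\<^bsub>N\<^esub> f x"
  by (auto simp: linear_maps_def)

lemma lin_zero:
  assumes "f \<in> lin M N" "module R M" "module R N"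
  shows "f \<zero>\<^bsub>M\<^esub> = \<zero>\<^bsub>N\<^esub>"
  using lin_smult[OF assms(1), of \<zero> "\<zero>\<^bsub>M\<^esub>"] assms lin_closed[OF assms(1), of "\<zero>\<^bsub>M\<^esub>"] by simp

lemma lin_neg:
  assumes "f \<in> lin M N" "module R M" "module R N" "x \<in> carrier M"
  shows "f (\<ominus>\<^bsub>M\<^esub> x) = \<ominus>\<^bsub>N\<^esub> f x"
  using lin_smult[OF assms(1), of "\<ominus> \<one>" x] assms lin_closed[OF assms(1), of "x"]
  by (simp add: mod_smult)

lemma lin_minus:
  assumes "f \<in> lin M N" "module R M" "module R N" "x \<in> carrier M" "y \<in> carrier M"
  shows "f (x \<ominus>\<^bsub>M\<^esub> y) = f x \<ominus>\<^bsub>N\<^esub> f y"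
  using assms by (simp add: mod_ac(4)[OF assms(2)] mod_ac(4)[OF assms(3)] lin_neg[OF assms(1-3)] lin_add[OF assms(1)])

lemmas lin_simps = lin_add lin_smult lin_zero lin_neg lin_minus

lemma lin_comp:
  assumes "f \<in> lin M N" "g \<in> lin L M"
  shows "(\<lambda>x. f (g x)) \<in> lin L N"
  using assms by (auto simp: linear_maps_def Pi_iff)

lemma lin_cong: "f \<in> lin M N \<Longrightarrow> (\<And>x. x \<in> carrier M \<Longrightarrow> g x = f x) \<Longrightarrow> module R M \<Longrightarrow> g \<in> lin M N"
  by (rule linI) (auto simp: lin_add lin_smult lin_closed[of f M N])

lemma lin_plus:
  assumes "module R N" "f \<in> lin M N" "g \<in> lin M N"
  shows "(\<lambda>x. f x \<oplus>\<^bsub>N\<^esub> g x) \<in> lin M N"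
  using assms(1) lin_closed[OF assms(2)] lin_closed[OF assms(3)]
  by (intro linI)
    (simp_all add: lin_add[OF assms(2)] lin_add[OF assms(3)] lin_smult[OF assms(2)] lin_smult[OF assms(3)]
      mod_smult[OF assms(1)] mod_ac[OF assms(1)])

lemma mod_smult_comm:
  assumes "module R M" "r \<in> carrier R" "s \<in> carrier R" "x \<in> carrier M"
  shows "r \<odot>\<^bsub>M\<^esub> (s \<odot>\<^bsub>M\<^esub> x) = s \<odot>\<^bsub>M\<^esub> (r \<odot>\<^bsub>M\<^esub> x)"
  using mod_smult(3)[OF assms(1)] assms m_comm by metis

lemma lin_scale:
  assumes "module R N" "f \<in> lin M N" "a \<in> carrier R"
  shows "(\<lambda>x. a \<odot>\<^bsub>N\<^esub> f x) \<in> lin M N"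
  using assms lin_closed[OF assms(2)]
  by (intro linI)
    (simp_all add: lin_add[OF assms(2)] lin_smult[OF assms(2)] mod_smult(1)[OF assms(1)]
      mod_smult_comm[OF assms(1,3)])

lemma lin_diff:
  assumes "module R N" "f \<in> lin M N" "g \<in> lin M N"
  shows "(\<lambda>x. f x \<ominus>\<^bsub>N\<^esub> g x) \<in> lin M N"
  using assms(1) lin_closed[OF assms(2)] lin_closed[OF assms(3)]
  by (intro linI)
    (simp_all add: lin_add[OF assms(2)] lin_add[OF assms(3)] lin_smult[OF assms(2)] lin_smult[OF assms(3)]
      mod_smult[OF assms(1)] mod_ac[OF assms(1)])

lemma lin_zero_map: "module R N \<Longrightarrow> (\<lambda>x. \<zero>\<^bsub>N\<^esub>) \<in> lin M N"
  by (rule linI) auto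

lemma lin_id: "(\<lambda>x. x) \<in> lin M M"
  by (rule linI) auto

lemma lin_mult: "module R M \<Longrightarrow> a \<in> carrier R \<Longrightarrow> (\<lambda>x. a \<odot>\<^bsub>M\<^esub> x) \<in> lin M M"
  by (rule lin_scale[OF _ lin_id])

lemma inj_on_lin:
  assumes "module R M" "module R N" "f \<in> lin M N" "\<And>x. x \<in> carrier M \<Longrightarrow> f x = \<zero>\<^bsub>N\<^esub> \<Longrightarrow> x = \<zero>\<^bsub>M\<^esub>"
  shows "inj_on f (carrier M)"
proof (rule inj_onI)
  fix x y assume xy: "x \<in> carrier M" "y \<in> carrier M" "f x = f y"
  then have "f (x \<ominus>\<^bsub>M\<^esub> y) = \<zero>\<^bsub>N\<^esub>" using assms by (simp add: lin_minus lin_closed[OF assms(3)])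
  then have "x \<ominus>\<^bsub>M\<^esub> y = \<zero>\<^bsub>M\<^esub>" using assms xy by simp
  then show "x = y" using mod_eq_iff[OF assms(1)] xy by simp
qed

lemma submodule_closed:
  assumes "module R M" "submodule K R M"
  shows "K \<subseteq> carrier M" "\<zero>\<^bsub>M\<^esub> \<in> K"
    "x \<in> K \<Longrightarrow> y \<in> K \<Longrightarrow> x \<oplus>\<^bsub>M\<^esub> y \<in> K" "x \<in> K \<Longrightarrow> \<ominus>\<^bsub>M\<^esub> x \<in> K"
    "r \<in> carrier R \<Longrightarrow> x \<in> K \<Longrightarrow> r \<odot>\<^bsub>M\<^esub> x \<in> K"
    "x \<in> K \<Longrightarrow> y \<in> K \<Longrightarrow> x \<ominus>\<^bsub>M\<^esub> y \<in> K"
proof -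
  interpret M: module R M by fact
  note E = M.submoduleE[OF assms(2)]
  show "K \<subseteq> carrier M" "x \<in> K \<Longrightarrow> y \<in> K \<Longrightarrow> x \<oplus>\<^bsub>M\<^esub> y \<in> K" "x \<in> K \<Longrightarrow> \<ominus>\<^bsub>M\<^esub> x \<in> K"
    "r \<in> carrier R \<Longrightarrow> x \<in> K \<Longrightarrow> r \<odot>\<^bsub>M\<^esub> x \<in> K"
    "x \<in> K \<Longrightarrow> y \<in> K \<Longrightarrow> x \<ominus>\<^bsub>M\<^esub> y \<in> K" using E by (auto simp: M.minus_eq)
  obtain x where "x \<in> K" using E(2) by auto
  then show "\<zero>\<^bsub>M\<^esub> \<in> K" using E(1) E(4)[of \<zero> x] by auto
qed

lemma submodI:
  assumes "module R M" "K \<subseteq> carrier M" "\<zero>\<^bsub>M\<^esub> \<in> K"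
    "\<And>x y. x \<in> K \<Longrightarrow> y \<in> K \<Longrightarrow> x \<oplus>\<^bsub>M\<^esub> y \<in> K" 
    "\<And>r x. r \<in> carrier R \<Longrightarrow> x \<in> K \<Longrightarrow> r \<odot>\<^bsub>M\<^esub> x \<in> K"
  shows "submodule K R M"
proof -
  interpret M: module R M by fact
  show ?thesis
  proof (rule M.submoduleI)
    fix a assume a: "a \<in> K"
    then have "\<ominus> \<one> \<odot>\<^bsub>M\<^esub> a = \<ominus>\<^bsub>M\<^esub> a" using assms(1,2) by (subst mod_smult(4)) auto
    then show "\<ominus>\<^bsub>M\<^esub> a \<in> K" using assms(5)[of "\<ominus> \<one>" a] a by simp
  qed (use assms in auto)
qed

lemma submod_module: "module R M \<Longrightarrow> submodule K R M \<Longrightarrow> module R (M\<lparr>carrier := K\<rparr>)"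
  by (rule submodule.submodule_is_module)

lemma submod_whole: "module R M \<Longrightarrow> submodule (carrier M) R M"
  by (rule module.carrier_is_submodule)

lemma submod_Int: 
  assumes "module R M" "submodule K R M" "submodule L R M"
  shows "submodule (K \<inter> L) R M"
  using submodule_closed[OF assms(1,2)] submodule_closed[OF assms(1,3)]
  by (intro submodI[OF assms(1)]) auto

lemma submod_ker:
  assumes "module R M" "module R N" "f \<in> lin M N"
  shows "submodule {x \<in> carrier M. f x = \<zero>\<^bsub>N\<^esub>} R M"
  using assms by (intro submodI) (auto simp: lin_simps)

lemma submod_image:
  assumes "module R M" "module R N" "f \<in> lin M N" "submodule K R M"
  shows "submodule (f ` K) R N"
proof (rule submodI[OF assms(2)])
  note K = submodule_closed[OF assms(1,4)]
  show "f ` K \<subseteq> carrier N" using K(1) lin_closed[OF assms(3)] by auto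
  show "\<zero>\<^bsub>N\<^esub> \<in> f ` K" using K(2) lin_zero[OF assms(3,1,2)] by (metis imageI)
  show "x \<oplus>\<^bsub>N\<^esub> y \<in> f ` K" if xy: "x \<in> f ` K" "y \<in> f ` K" for x y
  proof -
    obtain a b where ab: "a \<in> K" "b \<in> K" "x = f a" "y = f b" using xy by auto
    then have "x \<oplus>\<^bsub>N\<^esub> y = f (a \<oplus>\<^bsub>M\<^esub> b)" using lin_add[OF assms(3), of a b] K(1) by (simp add: subset_iff)
    then show ?thesis using K(3) ab by simp
  qed
  show "r \<odot>\<^bsub>N\<^esub> x \<in> f ` K" if rx: "r \<in> carrier R" "x \<in> f ` K" for r x
  proof -
    obtain a where ab: "a \<in> K" "x = f a" using rx by auto
    then have "r \<odot>\<^bsub>N\<^esub> x = f (r \<odot>\<^bsub>M\<^esub> a)" using lin_smult[OF assms(3), of r a] K(1) rx by (simp add: subset_iff)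
    then show ?thesis using K(5) ab rx by simp
  qed
qed

lemma submod_preimage:
  assumes "module R M" "module R N" "f \<in> lin M N" "submodule K R N"
  shows "submodule {x \<in> carrier M. f x \<in> K} R M"
  using submodule_closed[OF assms(2,4)] assms by (intro submodI) (auto simp: lin_simps)

lemma submod_zero: "module R M \<Longrightarrow> submodule {\<zero>\<^bsub>M\<^esub>} R M"
  by (rule submodI) auto

lemma submod_sum:
  assumes "module R M" "submodule K R M" "submodule L R M"
  shows "submodule {k \<oplus>\<^bsub>M\<^esub> l | k l. k \<in> K \<and> l \<in> L} R M" (is "submodule ?S R M")
proof (rule submodI[OF assms(1)])
  note K = submodule_closed[OF assms(1,2)] and L = submodule_closed[OF assms(1,3)]
  show "?S \<subseteq> carrier M" using K(1) L(1) assms(1) by (auto simp: subset_iff)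
  show "\<zero>\<^bsub>M\<^esub> \<in> ?S" 
  proof -
    have "\<zero>\<^bsub>M\<^esub> = \<zero>\<^bsub>M\<^esub> \<oplus>\<^bsub>M\<^esub> \<zero>\<^bsub>M\<^esub>" using assms(1) by simp
    then show ?thesis using K(2) L(2) by blast
  qed
  show "x \<oplus>\<^bsub>M\<^esub> y \<in> ?S" if xy: "x \<in> ?S" "y \<in> ?S" for x y
  proof -
    obtain a b c d where ab: "a \<in> K" "b \<in> L" "x = a \<oplus>\<^bsub>M\<^esub> b" "c \<in> K" "d \<in> L" "y = c \<oplus>\<^bsub>M\<^esub> d" using xy by auto
    then have c: "a \<in> carrier M" "b \<in> carrier M" "c \<in> carrier M" "d \<in> carrier M" using K L by auto
    have "x \<oplus>\<^bsub>M\<^esub> y = (a \<oplus>\<^bsub>M\<^esub> c) \<oplus>\<^bsub>M\<^esub> (b \<oplus>\<^bsub>M\<^esub> d)" using c ab assms(1) by (simp add: mod_ac)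
    then show ?thesis using K(3) L(3) ab by blast
  qed
  show "r \<odot>\<^bsub>M\<^esub> x \<in> ?S" if rx: "r \<in> carrier R" "x \<in> ?S" for r x
  proof -
    obtain a b where ab: "a \<in> K" "b \<in> L" "x = a \<oplus>\<^bsub>M\<^esub> b" using rx by auto
    then have "r \<odot>\<^bsub>M\<^esub> x = r \<odot>\<^bsub>M\<^esub> a \<oplus>\<^bsub>M\<^esub> r \<odot>\<^bsub>M\<^esub> b" using K L assms(1) rx by (simp add: mod_smult subset_iff)
    then show ?thesis using K(5) L(5) ab rx by blast
  qed
qed

lemma submod_span1:
  assumes "module R M" "y \<in> carrier M"
  shows "submodule {r \<odot>\<^bsub>M\<^esub> y | r. r \<in> carrier R} R M" (is "submodule ?S R M")
proof (rule submodI[OF assms(1)])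
  show "?S \<subseteq> carrier M" using assms by auto
  show "\<zero>\<^bsub>M\<^esub> \<in> ?S" using assms mod_simps(4)[OF assms] by (smt (verit) mem_Collect_eq zero_closed)
  show "a \<oplus>\<^bsub>M\<^esub> b \<in> ?S" if "a \<in> ?S" "b \<in> ?S" for a b
    using that assms mod_smult(2)[OF assms(1), symmetric] by auto
  show "r \<odot>\<^bsub>M\<^esub> a \<in> ?S" if "r \<in> carrier R" "a \<in> ?S" for r a
    using that assms mod_smult(3)[OF assms(1), symmetric] by auto
qed

text \<open>The module axioms pass to every structure onto which a module maps compatibly with the operations. For cosets this replaces a check
  of every law.\<close>

lemma module_of_surj:
  assumes M: "module R M"
    and c: "carrier N = p ` carrier M"
    and z: "\<zero>\<^bsub>N\<^esub> = p \<zero>\<^bsub>M\<^esub>"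
    and a: "\<And>x y. x \<in> carrier M \<Longrightarrow> y \<in> carrier M \<Longrightarrow> p x \<oplus>\<^bsub>N\<^esub> p y = p (x \<oplus>\<^bsub>M\<^esub> y)"
    and s: "\<And>r x. r \<in> carrier R \<Longrightarrow> x \<in> carrier M \<Longrightarrow> r \<odot>\<^bsub>N\<^esub> p x = p (r \<odot>\<^bsub>M\<^esub> x)"
  shows "module R N" and "p \<in> lin M N"
proof -
  show "p \<in> lin M N" using assms by (intro linI) auto
  have "abelian_group N"
  proof (rule abelian_groupI)
    fix x assume "x \<in> carrier N"
    then obtain u where u: "u \<in> carrier M" "x = p u" using c by auto
    show "\<exists>y\<in>carrier N. y \<oplus>\<^bsub>N\<^esub> x = \<zero>\<^bsub>N\<^esub>"
      by (rule bexI[of _ "p (\<ominus>\<^bsub>M\<^esub> u)"]) (use u a z c M in auto)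
  qed (use M c z in \<open>auto simp: a mod_ac\<close>)
  then show "module R N"
    using M c by (intro moduleI) (auto simp: a s mod_smult local.cring_axioms)
qed

lemma dp_simps:
  shows "carrier (direct_power n M) = {..<n} \<rightarrow>\<^sub>E carrier M"
    and "\<zero>\<^bsub>direct_power n M\<^esub> = (\<lambda>i \<in> {..<n}. \<zero>\<^bsub>M\<^esub>)"
    and "x \<oplus>\<^bsub>direct_power n M\<^esub> y = (\<lambda>i \<in> {..<n}. x i \<oplus>\<^bsub>M\<^esub> y i)"
    and "r \<odot>\<^bsub>direct_power n M\<^esub> x = (\<lambda>i \<in> {..<n}. r \<odot>\<^bsub>M\<^esub> x i)"
  by (auto simp: direct_power_def)

lemma dp_eqI:
  assumes "x \<in> carrier (direct_power n M)" "y \<in> carrier (direct_power n M)" "\<And>i. i < n \<Longrightarrow> x i = y i"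
  shows "x = y"
  using assms unfolding dp_simps by (metis PiE_ext lessThan_iff)

lemma dp_coord: "x \<in> carrier (direct_power n M) \<Longrightarrow> i < n \<Longrightarrow> x i \<in> carrier M"
  by (auto simp: dp_simps)

lemma dpI: "(\<And>i. i < n \<Longrightarrow> h i \<in> carrier M) \<Longrightarrow> (\<lambda>i\<in>{..<n}. h i) \<in> carrier (direct_power n M)"
  by (simp add: dp_simps(1))

lemma dp_module [simp]:
  assumes M: "module R M" shows "module R (direct_power n M)"
proof -
  let ?D = "direct_power n M"
  have add: "x \<oplus>\<^bsub>?D\<^esub> y \<in> carrier ?D" if "x \<in> carrier ?D" "y \<in> carrier ?D" for x y
    unfolding dp_simps(3) by (rule dpI) (use that M in \<open>simp add: dp_coord[of _ n M]\<close>)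
  have sm: "r \<odot>\<^bsub>?D\<^esub> x \<in> carrier ?D" if "x \<in> carrier ?D" "r \<in> carrier R" for x r
    unfolding dp_simps(4) by (rule dpI) (use that M in \<open>simp add: dp_coord[of _ n M]\<close>)
  have z: "\<zero>\<^bsub>?D\<^esub> \<in> carrier ?D" unfolding dp_simps(2) using M by (intro dpI) simp
  note c = dp_coord[of _ n M] and E = dp_eqI[where n = n and M = M]
  have "abelian_group ?D"
  proof (rule abelian_groupI)
    fix x y w assume "x \<in> carrier ?D" "y \<in> carrier ?D" "w \<in> carrier ?D"
    then show "(x \<oplus>\<^bsub>?D\<^esub> y) \<oplus>\<^bsub>?D\<^esub> w = x \<oplus>\<^bsub>?D\<^esub> (y \<oplus>\<^bsub>?D\<^esub> w)"
      by (intro E add) (simp_all add: dp_simps(3) c mod_ac(1)[OF M])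
  next
    fix x y assume "x \<in> carrier ?D" "y \<in> carrier ?D"
    then show "x \<oplus>\<^bsub>?D\<^esub> y = y \<oplus>\<^bsub>?D\<^esub> x"
      by (intro E add) (simp_all add: dp_simps(3) c mod_ac(2)[OF M])
  next
    fix x assume x: "x \<in> carrier ?D"
    then show "\<zero>\<^bsub>?D\<^esub> \<oplus>\<^bsub>?D\<^esub> x = x"
      using M by (intro E add z) (simp_all add: dp_simps(2,3) c)
    show "\<exists>y\<in>carrier ?D. y \<oplus>\<^bsub>?D\<^esub> x = \<zero>\<^bsub>?D\<^esub>"
    proof (rule bexI)
      show y: "\<ominus> \<one> \<odot>\<^bsub>?D\<^esub> x \<in> carrier ?D" using x by (intro sm) auto
      show "(\<ominus> \<one> \<odot>\<^bsub>?D\<^esub> x) \<oplus>\<^bsub>?D\<^esub> x = \<zero>\<^bsub>?D\<^esub>"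
        using M x by (intro E add z y) (simp_all add: dp_simps(2-4) c mod_smult[OF M])
    qed
  qed (use add z in auto)
  moreover have "\<one> \<odot>\<^bsub>?D\<^esub> x = x" if "x \<in> carrier ?D" for x
    using M that by (intro E sm) (simp_all add: dp_simps(4) c)
  moreover have "r \<odot>\<^bsub>?D\<^esub> (x \<oplus>\<^bsub>?D\<^esub> y) = r \<odot>\<^bsub>?D\<^esub> x \<oplus>\<^bsub>?D\<^esub> r \<odot>\<^bsub>?D\<^esub> y"
    if "x \<in> carrier ?D" "y \<in> carrier ?D" "r \<in> carrier R" for x y r
    by (rule E) (use that in \<open>simp_all add: add sm, simp add: dp_simps(3,4) c mod_smult(1)[OF M]\<close>)
  moreover have "(r \<oplus> s) \<odot>\<^bsub>?D\<^esub> x = r \<odot>\<^bsub>?D\<^esub> x \<oplus>\<^bsub>?D\<^esub> s \<odot>\<^bsub>?D\<^esub> x"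
    if "x \<in> carrier ?D" "r \<in> carrier R" "s \<in> carrier R" for x r s
    by (rule E) (use that in \<open>simp_all add: add sm, simp add: dp_simps(3,4) c mod_smult(2)[OF M]\<close>)
  moreover have "(r \<otimes> s) \<odot>\<^bsub>?D\<^esub> x = r \<odot>\<^bsub>?D\<^esub> (s \<odot>\<^bsub>?D\<^esub> x)"
    if "x \<in> carrier ?D" "r \<in> carrier R" "s \<in> carrier R" for x r s
    by (rule E) (use that in \<open>simp_all add: add sm, simp add: dp_simps(3,4) c mod_smult(3)[OF M]\<close>)
  ultimately show ?thesis using sm
    by (intro moduleI local.cring_axioms) simp_all
qed

lemma dp_coord_lin: "i < n \<Longrightarrow> (\<lambda>x. x i) \<in> lin (direct_power n M) M"
  by (rule linI) (simp_all add: dp_coord[of _ n M] dp_simps(3,4))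

lemma self_simps [simp]:
  shows "carrier (self_module R) = carrier R" "\<zero>\<^bsub>self_module R\<^esub> = \<zero>" "x \<oplus>\<^bsub>self_module R\<^esub> y = x \<oplus> y"
    "r \<odot>\<^bsub>self_module R\<^esub> x = r \<otimes> x"
  by (auto simp: self_module_def)

lemma self_is_module [simp]: "module R (self_module R)"
proof -
  have "abelian_group (self_module R)"
    by (rule abelian_groupI) (auto simp: a_ac l_neg intro!: bexI[of _ "\<ominus> _"])
  then show ?thesis by (intro moduleI local.cring_axioms) (auto simp: l_distr r_distr m_assoc)
qed

lemma self_neg [simp]: "x \<in> carrier R \<Longrightarrow> \<ominus>\<^bsub>self_module R\<^esub> x = \<ominus> x"
  using mod_smult(4)[OF self_is_module, of \<one> x] by (simp add: l_minus)

lemma dp_sum_lin: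
  assumes M: "module R M" and N: "module R N" and f: "\<And>i. i < n \<Longrightarrow> f i \<in> lin M N"
  shows "(\<lambda>x. finsum N (\<lambda>i. f i (x i)) {..<n}) \<in> lin (direct_power n M) N"
proof -
  interpret N: module R N by fact
  have c: "f i (x i) \<in> carrier N" if "i < n" "x \<in> carrier (direct_power n M)" for i x
    using lin_closed[OF f[OF that(1)]] dp_coord[OF that(2,1)] by auto
  show ?thesis
  proof (rule linI)
    fix x assume x: "x \<in> carrier (direct_power n M)"
    show "finsum N (\<lambda>i. f i (x i)) {..<n} \<in> carrier N" using c[OF _ x] by (intro N.finsum_closed) auto
    fix y assume y: "y \<in> carrier (direct_power n M)"
    have "finsum N (\<lambda>i. f i ((x \<oplus>\<^bsub>direct_power n M\<^esub> y) i)) {..<n} = finsum N (\<lambda>i. f i (x i) \<oplus>\<^bsub>N\<^esub> f i (y i)) {..<n}"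
      using c x y dp_coord[OF x] dp_coord[OF y]
      by (intro N.finsum_cong') (auto simp: dp_simps(3) lin_add[OF f])
    then show "finsum N (\<lambda>i. f i ((x \<oplus>\<^bsub>direct_power n M\<^esub> y) i)) {..<n} =
        finsum N (\<lambda>i. f i (x i)) {..<n} \<oplus>\<^bsub>N\<^esub> finsum N (\<lambda>i. f i (y i)) {..<n}"
      using c x y by (subst (asm) N.finsum_addf) auto
  next
    fix r x assume r: "r \<in> carrier R" and x: "x \<in> carrier (direct_power n M)"
    have "finsum N (\<lambda>i. f i ((r \<odot>\<^bsub>direct_power n M\<^esub> x) i)) {..<n} = finsum N (\<lambda>i. r \<odot>\<^bsub>N\<^esub> f i (x i)) {..<n}"
      using c x r dp_coord[OF x]
      by (intro N.finsum_cong') (auto simp: dp_simps(4) lin_smult[OF f])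
    then show "finsum N (\<lambda>i. f i ((r \<odot>\<^bsub>direct_power n M\<^esub> x) i)) {..<n} = r \<odot>\<^bsub>N\<^esub> finsum N (\<lambda>i. f i (x i)) {..<n}"
      using c x r by (subst N.finsum_smult_ldistr) auto
  qed
qed

abbreviation Fr :: "nat \<Rightarrow> ('a, nat \<Rightarrow> 'a) module" where "Fr g \<equiv> direct_power g (self_module R)"

definition unitv :: "nat \<Rightarrow> nat \<Rightarrow> nat \<Rightarrow> 'a" where
  "unitv g l = (\<lambda>i\<in>{..<g}. if i = l then \<one> else \<zero>)"

lemma unitv_closed [simp]: "unitv g l \<in> carrier (Fr g)"
  unfolding unitv_def by (rule dpI) simp

lemma Fr_module [simp]: "module R (Fr g)"
  by simp

definition lcomb :: "('a, 'm) module \<Rightarrow> nat \<Rightarrow> (nat \<Rightarrow> 'm) \<Rightarrow> (nat \<Rightarrow> 'a) \<Rightarrow> 'm" where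
  "lcomb M g b y = finsum M (\<lambda>i. y i \<odot>\<^bsub>M\<^esub> b i) {..<g}"

lemma lcomb_lin:
  assumes M: "module R M" and b: "\<And>i. i < g \<Longrightarrow> b i \<in> carrier M"
  shows "lcomb M g b \<in> lin (Fr g) M"
  unfolding lcomb_def
  by (rule dp_sum_lin[OF self_is_module M]) (use b M in \<open>auto intro!: linI simp: mod_smult\<close>)

lemma lcomb_unitv:
  assumes M: "module R M" and b: "\<And>i. i < g \<Longrightarrow> b i \<in> carrier M" and l: "l < g"
  shows "lcomb M g b (unitv g l) = b l"
proof -
  interpret M: module R M by fact
  have "lcomb M g b (unitv g l) = finsum M (\<lambda>i. if l = i then b i else \<zero>\<^bsub>M\<^esub>) {..<g}"
    unfolding lcomb_def using b by (intro M.finsum_cong') (auto simp: unitv_def)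
  also have "\<dots> = b l" using b l by (intro M.finsum_singleton) auto
  finally show ?thesis .
qed

lemma lin_Fr_eq_lcomb:
  assumes M: "module R M" and f: "f \<in> lin (Fr g) M" and y: "y \<in> carrier (Fr g)"
  shows "f y = lcomb M g (\<lambda>l. f (unitv g l)) y"
proof -
  interpret M: module R M by fact
  have yc: "y i \<in> carrier R" if "i < g" for i using dp_coord[OF y that] by simp
  have fc: "f (unitv g i) \<in> carrier M" for i using lin_closed[OF f] by auto
  have "f (\<lambda>i\<in>{..<g}. if i < k then y i else \<zero>) = finsum M (\<lambda>i. y i \<odot>\<^bsub>M\<^esub> f (unitv g i)) {..<k}"
    if "k \<le> g" for k using that
  proof (induct k)
    case 0
    have "(\<lambda>i\<in>{..<g}. if i < 0 then y i else \<zero>) = \<zero>\<^bsub>Fr g\<^esub>" by (auto simp: dp_simps)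
    then show ?case using lin_zero[OF f Fr_module M] by simp
  next
    case (Suc k)
    let ?u = "\<lambda>i\<in>{..<g}. if i < k then y i else \<zero>"
    have u: "?u \<in> carrier (Fr g)" using yc by (intro dpI) simp
    have "(\<lambda>i\<in>{..<g}. if i < Suc k then y i else \<zero>) = ?u \<oplus>\<^bsub>Fr g\<^esub> (y k \<odot>\<^bsub>Fr g\<^esub> unitv g k)"
      using yc Suc(2) by (auto simp: dp_simps unitv_def fun_eq_iff less_Suc_eq)
    then have "f (\<lambda>i\<in>{..<g}. if i < Suc k then y i else \<zero>) = f ?u \<oplus>\<^bsub>M\<^esub> y k \<odot>\<^bsub>M\<^esub> f (unitv g k)"
      using u yc[of k] Suc(2) M by (simp add: lin_add[OF f] lin_smult[OF f])
    also have "f ?u = finsum M (\<lambda>i. y i \<odot>\<^bsub>M\<^esub> f (unitv g i)) {..<k}"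
      using Suc(1)[OF Suc_leD[OF Suc(2)]] .
    also have "\<dots> \<oplus>\<^bsub>M\<^esub> y k \<odot>\<^bsub>M\<^esub> f (unitv g k) = finsum M (\<lambda>i. y i \<odot>\<^bsub>M\<^esub> f (unitv g i)) {..<Suc k}"
      using Suc(2) yc fc M unfolding lessThan_Suc by (subst M.finsum_insert) (auto simp: M.a_comm Pi_iff)
    finally show ?case .
  qed
  from this[of g] have "f (\<lambda>i\<in>{..<g}. if i < g then y i else \<zero>) = lcomb M g (\<lambda>l. f (unitv g l)) y"
    by (simp add: lcomb_def)
  also have "(\<lambda>i\<in>{..<g}. if i < g then y i else \<zero>) = y" using y by (auto simp: dp_simps PiE_def extensional_def fun_eq_iff)
  finally show ?thesis .
qed

lemma lin_Fr_eqI: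
  assumes M: "module R M" and f: "f \<in> lin (Fr g) M" and h: "h \<in> lin (Fr g) M"
    and e: "\<And>l. l < g \<Longrightarrow> f (unitv g l) = h (unitv g l)" and y: "y \<in> carrier (Fr g)"
  shows "f y = h y"
proof -
  interpret M: module R M by fact
  show ?thesis unfolding lin_Fr_eq_lcomb[OF M f y] lin_Fr_eq_lcomb[OF M h y] lcomb_def
    using e lin_closed[OF h] dp_coord[OF y] by (intro M.finsum_cong') auto
qed

text \<open>The submodule \<open>K\<close> allows the lift to be chosen with values in a prescribed place, such as the image of the next differential.\<close>

lemma free_lift:
  assumes A: "module R A" and B: "module R B" and p: "p \<in> lin A B" and f: "f \<in> lin (Fr g) B"
    and K: "\<And>y. y \<in> carrier (Fr g) \<Longrightarrow> f y \<in> p ` K" "submodule K R A"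
  shows "\<exists>h \<in> lin (Fr g) A. (\<forall>y \<in> carrier (Fr g). p (h y) = f y \<and> h y \<in> K)"
proof -
  have "\<forall>l. \<exists>a. a \<in> K \<and> p a = f (unitv g l)" using K(1)[OF unitv_closed] by (metis imageE)
  then obtain a where a: "\<And>l. a l \<in> K" "\<And>l. p (a l) = f (unitv g l)" by metis
  note Kc = submodule_closed[OF A K(2)]
  have ac: "a l \<in> carrier A" for l using a Kc by auto
  have h: "lcomb A g a \<in> lin (Fr g) A" using lcomb_lin[OF A] ac by simp
  have "p (lcomb A g a y) = f y" if "y \<in> carrier (Fr g)" for y
    by (rule lin_Fr_eqI[OF B lin_comp[OF p h] f _ that]) (use lcomb_unitv[OF A] a ac in auto)
  moreover have "lcomb (A\<lparr>carrier := K\<rparr>) g a \<in> lin (Fr g) (A\<lparr>carrier := K\<rparr>)"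
    using lcomb_lin[OF submod_module[OF A K(2)]] a by simp
  then have "lcomb A g a y \<in> K" if "y \<in> carrier (Fr g)" for y
  proof -
    have hK: "lcomb (A\<lparr>carrier := K\<rparr>) g a \<in> lin (Fr g) (A\<lparr>carrier := K\<rparr>)" (is "?h \<in> _")
      using lcomb_lin[OF submod_module[OF A K(2)]] a by simp
    have "?h \<in> lin (Fr g) A" using hK Kc(1) by (auto simp: linear_maps_def Pi_iff subset_iff)
    then have "?h y = lcomb A g a y"
      using lcomb_unitv[OF A, of g a] lcomb_unitv[OF submod_module[OF A K(2)], of g a] a ac
      by (intro lin_Fr_eqI[OF A _ h _ that]) auto
    then show ?thesis using lin_closed[OF hK that] by simp
  qed
  ultimately show ?thesis using h by blast
qed

lemma quot_props:
  assumes M: "module R M" and T: "submodule T R M"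
  shows "module R (quot_module M T)"
    and "(\<lambda>x. T +>\<^bsub>M\<^esub> x) \<in> lin M (quot_module M T)"
    and "carrier (quot_module M T) = (\<lambda>x. T +>\<^bsub>M\<^esub> x) ` carrier M"
    and "\<And>x. x \<in> carrier M \<Longrightarrow> T +>\<^bsub>M\<^esub> x = \<zero>\<^bsub>quot_module M T\<^esub> \<longleftrightarrow> x \<in> T"
proof -
  interpret M: module R M by fact
  note Tc = submodule_closed[OF M T]
  have sg: "subgroup T (add_monoid M)" using T by (rule submodule.axioms(1))
  interpret ag: abelian_subgroup T M
    by (intro abelian_subgroupI3 additive_subgroupI sg M.abelian_group_axioms)
  show c: "carrier (quot_module M T) = (\<lambda>x. T +>\<^bsub>M\<^esub> x) ` carrier M"
    by (auto simp: quot_module_def A_RCOSETS_def')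
  have z: "\<zero>\<^bsub>quot_module M T\<^esub> = T +>\<^bsub>M\<^esub> \<zero>\<^bsub>M\<^esub>"
    using Tc by (simp add: quot_module_def)
  have a: "(T +>\<^bsub>M\<^esub> x) \<oplus>\<^bsub>quot_module M T\<^esub> (T +>\<^bsub>M\<^esub> y) = T +>\<^bsub>M\<^esub> (x \<oplus>\<^bsub>M\<^esub> y)"
    if "x \<in> carrier M" "y \<in> carrier M" for x y
    using ag.a_rcos_sum[OF that] by (simp add: quot_module_def)
  have s: "r \<odot>\<^bsub>quot_module M T\<^esub> (T +>\<^bsub>M\<^esub> x) = T +>\<^bsub>M\<^esub> (r \<odot>\<^bsub>M\<^esub> x)"
    if r: "r \<in> carrier R" and x: "x \<in> carrier M" for r x
  proof -
    have "T +>\<^bsub>M\<^esub> (r \<odot>\<^bsub>M\<^esub> w) = T +>\<^bsub>M\<^esub> (r \<odot>\<^bsub>M\<^esub> x)" if w: "w \<in> T +>\<^bsub>M\<^esub> x" for w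
    proof -
      obtain t where t: "t \<in> T" "w = t \<oplus>\<^bsub>M\<^esub> x" using w by (auto simp: a_r_coset_def')
      then have "r \<odot>\<^bsub>M\<^esub> w = r \<odot>\<^bsub>M\<^esub> t \<oplus>\<^bsub>M\<^esub> r \<odot>\<^bsub>M\<^esub> x" using Tc x r by (auto simp: M.smult_r_distr)
      then have "r \<odot>\<^bsub>M\<^esub> w \<in> T +>\<^bsub>M\<^esub> (r \<odot>\<^bsub>M\<^esub> x)" using t Tc(5)[OF r] by (auto simp: a_r_coset_def')
      then show ?thesis using M.a_repr_independence[OF _ _ sg, of "r \<odot>\<^bsub>M\<^esub> w" "r \<odot>\<^bsub>M\<^esub> x"] r x by simp
    qed
    moreover have "x \<in> T +>\<^bsub>M\<^esub> x" unfolding a_r_coset_def' using Tc(2) x by (intro UN_I[of "\<zero>\<^bsub>M\<^esub>"]) simp_all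
    ultimately have "(\<Union>w \<in> T +>\<^bsub>M\<^esub> x. T +>\<^bsub>M\<^esub> (r \<odot>\<^bsub>M\<^esub> w)) = T +>\<^bsub>M\<^esub> (r \<odot>\<^bsub>M\<^esub> x)" by blast
    then show ?thesis by (simp add: quot_module_def)
  qed
  show "module R (quot_module M T)" "(\<lambda>x. T +>\<^bsub>M\<^esub> x) \<in> lin M (quot_module M T)"
    using module_of_surj[OF M c z a s] by auto
  show "T +>\<^bsub>M\<^esub> x = \<zero>\<^bsub>quot_module M T\<^esub> \<longleftrightarrow> x \<in> T" if "x \<in> carrier M" for x
    using that M.a_coset_join1[OF _ that sg] M.a_coset_join2[OF that sg] by (auto simp: quot_module_def)
qed

lemma lin_factor:
  assumes A: "module R A" and B: "module R B" and C: "module R C"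
    and p: "p \<in> lin A B" "p ` carrier A = carrier B" and f: "f \<in> lin A C"
    and k: "\<And>x. x \<in> carrier A \<Longrightarrow> p x = \<zero>\<^bsub>B\<^esub> \<Longrightarrow> f x = \<zero>\<^bsub>C\<^esub>"
  shows "\<exists>h \<in> lin B C. \<forall>x \<in> carrier A. h (p x) = f x"
proof -
  have eq: "f x = f y" if "x \<in> carrier A" "y \<in> carrier A" "p x = p y" for x y
  proof -
    have "p (x \<ominus>\<^bsub>A\<^esub> y) = \<zero>\<^bsub>B\<^esub>" using that A B lin_closed[OF p(1)] by (simp add: lin_minus[OF p(1)])
    then have "f x \<ominus>\<^bsub>C\<^esub> f y = \<zero>\<^bsub>C\<^esub>" using k[of "x \<ominus>\<^bsub>A\<^esub> y"] that A C by (simp add: lin_minus[OF f])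
    then show ?thesis using mod_eq_iff[OF C] lin_closed[OF f] that by simp
  qed
  define h where "h = (\<lambda>b. f (SOME x. x \<in> carrier A \<and> p x = b))"
  have h: "h (p x) = f x" if "x \<in> carrier A" for x
  proof -
    have "(SOME u. u \<in> carrier A \<and> p u = p x) \<in> carrier A \<and> p (SOME u. u \<in> carrier A \<and> p u = p x) = p x"
      by (rule someI[of _ x]) (use that in simp)
    then show ?thesis unfolding h_def using eq[OF _ that] by simp
  qed
  have "h \<in> lin B C"
  proof (rule linI)
    show "h b \<in> carrier C" if "b \<in> carrier B" for b
    proof -
      obtain x where "x \<in> carrier A" "b = p x" using \<open>b \<in> carrier B\<close> p(2) by blast
      then show ?thesis using h lin_closed[OF f] by simp
    qed
    fix b c assume "b \<in> carrier B" "c \<in> carrier B"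
    then obtain x y where xy: "x \<in> carrier A" "b = p x" "y \<in> carrier A" "c = p y" unfolding p(2)[symmetric] by blast
    then have "b \<oplus>\<^bsub>B\<^esub> c = p (x \<oplus>\<^bsub>A\<^esub> y)" using lin_add[OF p(1)] by simp
    then show "h (b \<oplus>\<^bsub>B\<^esub> c) = h b \<oplus>\<^bsub>C\<^esub> h c" using xy h A lin_add[OF f] by simp
  next
    fix r b assume r: "r \<in> carrier R" and "b \<in> carrier B"
    then obtain x where xy: "x \<in> carrier A" "b = p x" unfolding p(2)[symmetric] by blast
    then have "r \<odot>\<^bsub>B\<^esub> b = p (r \<odot>\<^bsub>A\<^esub> x)" using lin_smult[OF p(1)] r by simp
    then show "h (r \<odot>\<^bsub>B\<^esub> b) = r \<odot>\<^bsub>C\<^esub> h b" using xy h A r lin_smult[OF f] by simp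
  qed
  then show ?thesis using h by blast
qed

text \<open>Applied with \<open>j\<close> the multiplication by a regular element, this divides a linear map with values in \<open>xM\<close> by \<open>x\<close>.\<close>

lemma lin_divide:
  assumes A: "module R A" and B: "module R B" and C: "module R C"
    and j: "j \<in> lin B C" "\<And>x. x \<in> carrier B \<Longrightarrow> j x = \<zero>\<^bsub>C\<^esub> \<Longrightarrow> x = \<zero>\<^bsub>B\<^esub>" and f: "f \<in> lin A C"
    and k: "\<And>x. x \<in> carrier A \<Longrightarrow> f x \<in> j ` carrier B"
  shows "\<exists>h \<in> lin A B. \<forall>x \<in> carrier A. j (h x) = f x"
proof -
  have inj: "inj_on j (carrier B)" by (rule inj_on_lin[OF B C j])
  obtain h where h: "\<And>x. x \<in> carrier A \<Longrightarrow> h x \<in> carrier B \<and> j (h x) = f x"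
    using k unfolding image_iff Bex_def by metis
  have "h \<in> lin A B"
  proof (rule linI)
    fix x y assume "x \<in> carrier A" "y \<in> carrier A"
    then show "h (x \<oplus>\<^bsub>A\<^esub> y) = h x \<oplus>\<^bsub>B\<^esub> h y"
      using h A B by (intro inj_onD[OF inj]) (auto simp: lin_add[OF j(1)] lin_add[OF f])
  next
    fix r x assume "r \<in> carrier R" "x \<in> carrier A"
    then show "h (r \<odot>\<^bsub>A\<^esub> x) = r \<odot>\<^bsub>B\<^esub> h x"
      using h A B by (intro inj_onD[OF inj]) (auto simp: lin_smult[OF j(1)] lin_smult[OF f])
  qed (use h in auto)
  then show ?thesis using h by blast
qed

lemma hom_simps:
  shows "carrier (hom_module R M N) = lin M N \<inter> extensional (carrier M)"
    and "\<zero>\<^bsub>hom_module R M N\<^esub> = (\<lambda>x \<in> carrier M. \<zero>\<^bsub>N\<^esub>)"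
    and "f \<oplus>\<^bsub>hom_module R M N\<^esub> h = (\<lambda>x \<in> carrier M. f x \<oplus>\<^bsub>N\<^esub> h x)"
    and "r \<odot>\<^bsub>hom_module R M N\<^esub> f = (\<lambda>x \<in> carrier M. r \<odot>\<^bsub>N\<^esub> f x)"
  by (auto simp: hom_module_def)

lemma lin_restrict: "module R M \<Longrightarrow> f \<in> lin M N \<Longrightarrow> restrict f (carrier M) \<in> carrier (hom_module R M N)"
  unfolding hom_simps(1) 
  by (rule IntI, rule lin_cong[of f M N]) simp_all

lemma hom_eqI:
  assumes "f \<in> carrier (hom_module R M N)" "h \<in> carrier (hom_module R M N)" "\<And>x. x \<in> carrier M \<Longrightarrow> f x = h x"
  shows "f = h"
  using assms by (intro extensionalityI[of f "carrier M"]) (auto simp: hom_simps(1))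

lemma hom_is_module [simp]:
  assumes M: "module R M" and N: "module R N"
  shows "module R (hom_module R M N)"
proof -
  let ?H = "hom_module R M N"
  have c: "f x \<in> carrier N" if "f \<in> carrier ?H" "x \<in> carrier M" for f x
    using that lin_closed[of f M N x] by (simp add: hom_simps(1))
  have add: "f \<oplus>\<^bsub>?H\<^esub> h \<in> carrier ?H" if "f \<in> carrier ?H" "h \<in> carrier ?H" for f h
    unfolding hom_simps(3) using that by (intro lin_restrict[OF M] lin_plus[OF N]) (auto simp: hom_simps(1))
  have sm: "r \<odot>\<^bsub>?H\<^esub> f \<in> carrier ?H" if "f \<in> carrier ?H" "r \<in> carrier R" for f r
    unfolding hom_simps(4) using that by (intro lin_restrict[OF M] lin_scale[OF N]) (auto simp: hom_simps(1))
  have z: "\<zero>\<^bsub>?H\<^esub> \<in> carrier ?H"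
    unfolding hom_simps(2) by (intro lin_restrict[OF M] lin_zero_map[OF N])
  note E = hom_eqI[where M = M and N = N]
  have "abelian_group ?H"
  proof (rule abelian_groupI)
    fix x y w assume "x \<in> carrier ?H" "y \<in> carrier ?H" "w \<in> carrier ?H"
    then show "(x \<oplus>\<^bsub>?H\<^esub> y) \<oplus>\<^bsub>?H\<^esub> w = x \<oplus>\<^bsub>?H\<^esub> (y \<oplus>\<^bsub>?H\<^esub> w)"
      by (intro E add) (simp_all add: hom_simps(3) c mod_ac(1)[OF N])
  next
    fix x y assume "x \<in> carrier ?H" "y \<in> carrier ?H"
    then show "x \<oplus>\<^bsub>?H\<^esub> y = y \<oplus>\<^bsub>?H\<^esub> x"
      by (intro E add) (simp_all add: hom_simps(3) c mod_ac(2)[OF N])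
  next
    fix x assume x: "x \<in> carrier ?H"
    then show "\<zero>\<^bsub>?H\<^esub> \<oplus>\<^bsub>?H\<^esub> x = x"
      using N by (intro E add z) (simp_all add: hom_simps(2,3) c)
    show "\<exists>y\<in>carrier ?H. y \<oplus>\<^bsub>?H\<^esub> x = \<zero>\<^bsub>?H\<^esub>"
    proof (rule bexI)
      show y: "\<ominus> \<one> \<odot>\<^bsub>?H\<^esub> x \<in> carrier ?H" using x by (intro sm) auto
      show "(\<ominus> \<one> \<odot>\<^bsub>?H\<^esub> x) \<oplus>\<^bsub>?H\<^esub> x = \<zero>\<^bsub>?H\<^esub>"
        using N x by (intro E add z y) (simp_all add: hom_simps(2-4) c mod_smult[OF N])
    qed
  qed (use add z in auto)
  moreover have "\<one> \<odot>\<^bsub>?H\<^esub> x = x" if "x \<in> carrier ?H" for x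
    using N that by (intro E sm) (simp_all add: hom_simps(4) c)
  moreover have "r \<odot>\<^bsub>?H\<^esub> (x \<oplus>\<^bsub>?H\<^esub> y) = r \<odot>\<^bsub>?H\<^esub> x \<oplus>\<^bsub>?H\<^esub> r \<odot>\<^bsub>?H\<^esub> y"
    if "x \<in> carrier ?H" "y \<in> carrier ?H" "r \<in> carrier R" for x y r
    by (rule E) (use that in \<open>simp_all add: add sm, simp add: hom_simps(3,4) c mod_smult(1)[OF N]\<close>)
  moreover have "(r \<oplus> s) \<odot>\<^bsub>?H\<^esub> x = r \<odot>\<^bsub>?H\<^esub> x \<oplus>\<^bsub>?H\<^esub> s \<odot>\<^bsub>?H\<^esub> x"
    if "x \<in> carrier ?H" "r \<in> carrier R" "s \<in> carrier R" for x r s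
    by (rule E) (use that in \<open>simp_all add: add sm, simp add: hom_simps(3,4) c mod_smult(2)[OF N]\<close>)
  moreover have "(r \<otimes> s) \<odot>\<^bsub>?H\<^esub> x = r \<odot>\<^bsub>?H\<^esub> (s \<odot>\<^bsub>?H\<^esub> x)"
    if "x \<in> carrier ?H" "r \<in> carrier R" "s \<in> carrier R" for x r s
    by (rule E) (use that in \<open>simp_all add: add sm, simp add: hom_simps(3,4) c mod_smult(3)[OF N]\<close>)
  ultimately show ?thesis using sm
    by (intro moduleI local.cring_axioms) simp_all
qed

end

section \<open>Noetherian modules, associated primes and Nakayama's lemma\<close>

context cring
begin

text \<open>Finite generation of a submodule \<open>K\<close> of \<open>M\<close>, expressed inside \<open>M\<close>, so that no change of the carrier is needed.\<close>

definition fg_sub :: "('a, 'm) module \<Rightarrow> 'm set \<Rightarrow> bool" where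
  "fg_sub M K \<longleftrightarrow> (\<exists>A. finite A \<and> A \<subseteq> K \<and> (\<forall>N. submodule N R M \<and> A \<subseteq> N \<longrightarrow> K \<subseteq> N))"

definition noeth :: "('a, 'm) module \<Rightarrow> bool" where
  "noeth M \<longleftrightarrow> module R M \<and> (\<forall>K. submodule K R M \<longrightarrow> fg_sub M K)"

lemma fg_subE:
  assumes "fg_sub M K"
  obtains A where "finite A" "A \<subseteq> K" "\<And>N. submodule N R M \<Longrightarrow> A \<subseteq> N \<Longrightarrow> K \<subseteq> N"
  using assms unfolding fg_sub_def by metis

lemma noeth_fg_sub: "noeth M \<Longrightarrow> submodule K R M \<Longrightarrow> fg_sub M K"
  by (simp add: noeth_def)

lemma noeth_module: "noeth M \<Longrightarrow> module R M"
  by (simp add: noeth_def)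

text \<open>Generators of the image, lifted to \<open>K\<close>, and generators of the kernel together generate \<open>K\<close>.\<close>

lemma fg_sub_extension:
  assumes M: "module R M" and M': "module R M'" and f: "f \<in> lin M M'" and K: "submodule K R M"
    and fg: "fg_sub M' (f ` K)" "fg_sub M {x \<in> K. f x = \<zero>\<^bsub>M'\<^esub>}"
  shows "fg_sub M K"
proof -
  note Kc = submodule_closed[OF M K]
  obtain A' where A': "finite A'" "A' \<subseteq> f ` K" "\<And>N. submodule N R M' \<Longrightarrow> A' \<subseteq> N \<Longrightarrow> f ` K \<subseteq> N"
    by (rule fg_subE[OF fg(1)], rule that)
  obtain A1 where A1: "finite A1" "A1 \<subseteq> K" "A' = f ` A1" using A'(1,2) by (meson finite_subset_image)
  obtain A2 where A2: "finite A2" "A2 \<subseteq> {x \<in> K. f x = \<zero>\<^bsub>M'\<^esub>}"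
    "\<And>N. submodule N R M \<Longrightarrow> A2 \<subseteq> N \<Longrightarrow> {x \<in> K. f x = \<zero>\<^bsub>M'\<^esub>} \<subseteq> N"
    by (rule fg_subE[OF fg(2)], rule that)
  have "K \<subseteq> N" if N: "submodule N R M" "A1 \<union> A2 \<subseteq> N" for N
  proof
    fix k assume k: "k \<in> K"
    note Nc = submodule_closed[OF M N(1)]
    have "A' \<subseteq> f ` (K \<inter> N)" using A1 N(2) by auto
    then have "f ` K \<subseteq> f ` (K \<inter> N)" using A'(3) submod_image[OF M M' f submod_Int[OF M K N(1)]] by simp
    then obtain n where n: "n \<in> K" "n \<in> N" "f k = f n" using k by blast
    have c: "k \<in> carrier M" "n \<in> carrier M" using k n Kc(1) by auto
    have "f (k \<ominus>\<^bsub>M\<^esub> n) = \<zero>\<^bsub>M'\<^esub>" using c n(3) M M' lin_closed[OF f c(2)] by (simp add: lin_minus[OF f])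
    then have "k \<ominus>\<^bsub>M\<^esub> n \<in> N" using A2(3)[OF N(1)] N(2) Kc(6)[OF k n(1)] by auto
    then have "n \<oplus>\<^bsub>M\<^esub> (k \<ominus>\<^bsub>M\<^esub> n) \<in> N" using Nc(3) n by simp
    then show "k \<in> N" using mod_solve[OF M c, of "k \<ominus>\<^bsub>M\<^esub> n"] M c by simp
  qed
  then show ?thesis unfolding fg_sub_def using A1(1,2) A2(1,2) by (intro exI[of _ "A1 \<union> A2"]) auto
qed

lemma fg_sub_zero: "module R M \<Longrightarrow> fg_sub M {\<zero>\<^bsub>M\<^esub>}"
  unfolding fg_sub_def using submodule_closed(2) by (intro exI[of _ "{}"]) auto

lemma noeth_surj:
  assumes M: "noeth M" and N: "module R N" and p: "p \<in> lin M N" "p ` carrier M = carrier N"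
  shows "noeth N"
  unfolding noeth_def
proof (intro conjI allI impI N)
  note M' = noeth_module[OF M]
  fix K assume K: "submodule K R N"
  let ?L = "{x \<in> carrier M. p x \<in> K}"
  have L: "submodule ?L R M" by (rule submod_preimage[OF M' N p(1) K])
  obtain A where A: "finite A" "A \<subseteq> ?L" "\<And>L. submodule L R M \<Longrightarrow> A \<subseteq> L \<Longrightarrow> ?L \<subseteq> L"
    by (rule fg_subE[OF noeth_fg_sub[OF M L]], rule that)
  have "K \<subseteq> N'" if N': "submodule N' R N" "p ` A \<subseteq> N'" for N'
  proof
    fix k assume k: "k \<in> K"
    then have "k \<in> p ` carrier M" using submodule_closed(1)[OF N K] p(2) by blast
    then obtain x where x: "x \<in> carrier M" "k = p x" by blast
    have "?L \<subseteq> {x \<in> carrier M. p x \<in> N'}"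
      using A(2) N'(2) by (intro A(3) submod_preimage[OF M' N p(1) N'(1)]) auto
    then show "k \<in> N'" using x k by auto
  qed
  then show "fg_sub N K" unfolding fg_sub_def using A(1,2) by (intro exI[of _ "p ` A"]) auto
qed

lemma noeth_inj:
  assumes M: "module R M" and N: "noeth N" and j: "j \<in> lin M N"
    "\<And>x. x \<in> carrier M \<Longrightarrow> j x = \<zero>\<^bsub>N\<^esub> \<Longrightarrow> x = \<zero>\<^bsub>M\<^esub>"
  shows "noeth M"
  unfolding noeth_def
proof (intro conjI allI impI M)
  note N' = noeth_module[OF N]
  fix K assume K: "submodule K R M"
  have "{x \<in> K. j x = \<zero>\<^bsub>N\<^esub>} = {\<zero>\<^bsub>M\<^esub>}"
    using submodule_closed(1,2)[OF M K] j(2) lin_zero[OF j(1) M N'] by auto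
  moreover have "fg_sub N (j ` K)" using submod_image[OF M N' j(1) K] N by (simp add: noeth_def)
  ultimately show "fg_sub M K" using fg_sub_extension[OF M N' j(1) K] fg_sub_zero[OF M] by simp
qed

lemma noeth_sub: "noeth M \<Longrightarrow> submodule K R M \<Longrightarrow> noeth (M\<lparr>carrier := K\<rparr>)"
  using submodule_closed(1)[OF noeth_module, of M K]
  by (intro noeth_inj[OF submod_module[OF noeth_module], of M K M "\<lambda>x. x"] linI) auto

lemma noeth_dp:
  assumes M: "noeth M" shows "noeth (direct_power n M)"
  unfolding noeth_def
proof (intro conjI allI impI)
  let ?D = "direct_power n M"
  note M' = noeth_module[OF M]
  show D: "module R ?D" using M' by simp
  have "fg_sub ?D K" if "k \<le> n" "submodule K R ?D" "\<And>x i. x \<in> K \<Longrightarrow> k \<le> i \<Longrightarrow> i < n \<Longrightarrow> x i = \<zero>\<^bsub>M\<^esub>" for k K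
    using that
  proof (induct k arbitrary: K)
    case 0
    note Kc = submodule_closed[OF D 0(2)]
    have "x = \<zero>\<^bsub>?D\<^esub>" if x: "x \<in> K" for x
      by (rule dp_eqI[of _ n M]) (use x Kc 0(3) D in \<open>auto simp: dp_simps(2)\<close>)
    then have "K = {\<zero>\<^bsub>?D\<^esub>}" using Kc(2) by fast
    then show ?case using fg_sub_zero[OF D] by simp
  next
    case (Suc k)
    note Kc = submodule_closed[OF D Suc(3)]
    have l: "(\<lambda>x. x k) \<in> lin ?D M" using dp_coord_lin[of k n M] Suc(2) by simp
    have "fg_sub M ((\<lambda>x. x k) ` K)" using submod_image[OF D M' l Suc(3)] M by (simp add: noeth_def)
    moreover have "fg_sub ?D {x \<in> K. x k = \<zero>\<^bsub>M\<^esub>}"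
    proof (rule Suc(1))
      have "{x \<in> K. x k = \<zero>\<^bsub>M\<^esub>} = K \<inter> {x \<in> carrier ?D. x k = \<zero>\<^bsub>M\<^esub>}" using Kc(1) by auto
      then show "submodule {x \<in> K. x k = \<zero>\<^bsub>M\<^esub>} R ?D"
        using submod_Int[OF D Suc(3) submod_ker[OF D M' l]] by simp
      show "x i = \<zero>\<^bsub>M\<^esub>" if "x \<in> {x \<in> K. x k = \<zero>\<^bsub>M\<^esub>}" "k \<le> i" "i < n" for x i
        using that Suc(4)[of x i] by (cases "i = k") auto
    qed (use Suc in simp)
    ultimately show ?case by (rule fg_sub_extension[OF D M' l Suc(3)])
  qed
  then show "fg_sub ?D K" if "submodule K R ?D" for K using that by (metis le_less_trans less_irrefl order_refl)
qed

lemma self_submodule_iff: "submodule I R (self_module R) \<longleftrightarrow> ideal I R"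
proof
  assume "submodule I R (self_module R)"
  note c = submodule_closed[OF self_is_module this]
  show "ideal I R"
  proof (rule idealI[OF local.ring_axioms])
    show "subgroup I (add_monoid R)"
      using c(1-4) by (intro add.subgroupI) (auto simp: a_inv_def[symmetric] subset_iff simp flip: self_neg)
    fix a x assume a: "a \<in> I" "x \<in> carrier R"
    show xa: "x \<otimes> a \<in> I" using a c(5)[of x a] by simp
    have "a \<in> carrier R" using a c(1) by auto
    then show "a \<otimes> x \<in> I" using xa m_comm[of a x] a by simp
  qed
next
  assume I: "ideal I R"
  interpret ideal I R by fact
  show "submodule I R (self_module R)"
    by (rule submodI[OF self_is_module]) (auto simp: I_l_closed a_Hcarr)
qed

lemma noeth_self:
  assumes "noetherian_ring R" shows "noeth (self_module R)"
  unfolding noeth_def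
proof (intro conjI allI impI self_is_module)
  fix K assume "submodule K R (self_module R)"
  then have K: "ideal K R" by (simp add: self_submodule_iff)
  then obtain A where A: "A \<subseteq> carrier R" "finite A" "K = Idl A"
    using noetherian_ring.finetely_gen[OF assms] by blast
  have "A \<subseteq> K" using A genideal_self by simp
  moreover have "K \<subseteq> N" if "submodule N R (self_module R)" "A \<subseteq> N" for N
    using that genideal_minimal A(3) by (simp add: self_submodule_iff)
  ultimately show "fg_sub (self_module R) K" unfolding fg_sub_def using A(2) by blast
qed

lemma fg_sub_cover:
  assumes M: "module R M" and K: "submodule K R M" "fg_sub M K"
  shows "\<exists>g. \<exists>p \<in> lin (Fr g) M. p ` carrier (Fr g) = K"
proof -
  note Kc = submodule_closed[OF M K(1)]
  obtain A where A: "finite A" "A \<subseteq> K" "\<And>N. submodule N R M \<Longrightarrow> A \<subseteq> N \<Longrightarrow> K \<subseteq> N"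
    by (rule fg_subE[OF K(2)], rule that)
  obtain xs where xs: "set xs = A" using finite_list[OF A(1)] by blast
  let ?p = "lcomb M (length xs) ((!) xs)"
  have xc: "xs ! i \<in> K" if "i < length xs" for i using that xs A(2) nth_mem by blast
  have p: "?p \<in> lin (Fr (length xs)) M" using xc Kc(1) by (intro lcomb_lin[OF M]) auto
  have s: "submodule (?p ` carrier (Fr (length xs))) R M"
    by (rule submod_image[OF Fr_module M p submod_whole[OF Fr_module]])
  have "a \<in> ?p ` carrier (Fr (length xs))" if a: "a \<in> A" for a
  proof -
    obtain i where i: "i < length xs" "a = xs ! i" using a xs by (metis in_set_conv_nth)
    then have "a = ?p (unitv (length xs) i)" using lcomb_unitv[OF M, of "length xs" "(!) xs" i] xc Kc(1) by (simp add: subset_iff)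
    then show ?thesis by (metis image_eqI unitv_closed)
  qed
  then have 1: "K \<subseteq> ?p ` carrier (Fr (length xs))" using A(3)[OF s] by blast
  have "?p \<in> lin (Fr (length xs)) (M\<lparr>carrier := K\<rparr>)"
  proof -
    have h: "lcomb (M\<lparr>carrier := K\<rparr>) (length xs) ((!) xs) \<in> lin (Fr (length xs)) (M\<lparr>carrier := K\<rparr>)" (is "?h \<in> _")
      using xc by (intro lcomb_lin submod_module[OF M K(1)]) auto
    have "?h \<in> lin (Fr (length xs)) M" using h Kc(1) by (auto simp: linear_maps_def Pi_iff subset_iff)
    then have "?h y = ?p y" if "y \<in> carrier (Fr (length xs))" for y
      using lcomb_unitv[OF M, of "length xs" "(!) xs"] xc Kc(1)
        lcomb_unitv[OF submod_module[OF M K(1)], of "length xs" "(!) xs"]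
      by (intro lin_Fr_eqI[OF M _ p _ that]) (simp_all add: subset_iff)
    then show ?thesis by (intro lin_cong[OF h]) auto
  qed
  then have "?p ` carrier (Fr (length xs)) \<subseteq> K" using lin_closed by fastforce
  then show ?thesis using 1 p by blast
qed

lemma finite_module_cover:
  assumes "finite_module R M"
  shows "\<exists>g. \<exists>p \<in> lin (Fr g) M. p ` carrier (Fr g) = carrier M"
proof -
  have M: "module R M" using assms by (simp add: finite_module_def)
  have "fg_sub M (carrier M)" using assms unfolding finite_module_def fg_sub_def by blast
  then show ?thesis using fg_sub_cover[OF M submod_whole[OF M]] by simp
qed

lemma noeth_imp_finite_module: "noeth M \<Longrightarrow> finite_module R M"
proof -
  assume M: "noeth M"
  note M' = noeth_module[OF M]
  obtain A where "finite A" "A \<subseteq> carrier M" "\<And>N. submodule N R M \<Longrightarrow> A \<subseteq> N \<Longrightarrow> carrier M \<subseteq> N"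
    using M submod_whole[OF M'] unfolding noeth_def fg_sub_def by metis
  then show ?thesis unfolding finite_module_def
    using M' submodule_closed(1)[OF M'] by (intro conjI exI[of _ A]) blast+
qed

lemma noeth_maximal:
  assumes M: "noeth M" and F: "\<F> \<noteq> {}" "\<And>K. K \<in> \<F> \<Longrightarrow> submodule K R M"
  shows "\<exists>K \<in> \<F>. \<forall>L \<in> \<F>. K \<subseteq> L \<longrightarrow> L = K"
proof (rule subset_Zorn_nonempty[OF F(1)])
  note M' = noeth_module[OF M]
  fix \<C> assume C: "\<C> \<noteq> {}" "subset.chain \<F> \<C>"
  then have sub: "\<C> \<subseteq> \<F>" and tot: "\<And>A B. A \<in> \<C> \<Longrightarrow> B \<in> \<C> \<Longrightarrow> A \<subseteq> B \<or> B \<subseteq> A"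
    by (auto simp: subset_chain_def)
  note c = submodule_closed[OF M' F(2)]
  have U: "submodule (\<Union>\<C>) R M"
  proof (rule submodI[OF M'])
    show "\<Union>\<C> \<subseteq> carrier M" using c(1) sub by blast
    show "\<zero>\<^bsub>M\<^esub> \<in> \<Union>\<C>" using C(1) c(2) sub by blast
    show "r \<odot>\<^bsub>M\<^esub> x \<in> \<Union>\<C>" if "r \<in> carrier R" "x \<in> \<Union>\<C>" for r x using that c(5) sub by blast
    show "x \<oplus>\<^bsub>M\<^esub> y \<in> \<Union>\<C>" if "x \<in> \<Union>\<C>" "y \<in> \<Union>\<C>" for x y
    proof -
      obtain A B where "A \<in> \<C>" "B \<in> \<C>" "x \<in> A" "y \<in> B" using \<open>x \<in> \<Union>\<C>\<close> \<open>y \<in> \<Union>\<C>\<close> by blast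
      then show ?thesis using tot[of A B] c(3)[of A x y] c(3)[of B x y] sub by blast
    qed
  qed
  obtain A where A: "finite A" "A \<subseteq> \<Union>\<C>" "\<And>N. submodule N R M \<Longrightarrow> A \<subseteq> N \<Longrightarrow> \<Union>\<C> \<subseteq> N"
    by (rule fg_subE[OF noeth_fg_sub[OF M U]], rule that)
  have "\<exists>B \<in> \<C>. A \<subseteq> B" using A(1,2)
  proof (induct A)
    case empty then show ?case using C(1) by auto
  next
    case (insert a A)
    then obtain B B' where "B \<in> \<C>" "A \<subseteq> B" "B' \<in> \<C>" "a \<in> B'" by blast
    then show ?case using tot[of B B'] by blast
  qed
  then obtain B where B: "B \<in> \<C>" "A \<subseteq> B" by blast
  then have "\<Union>\<C> = B" using A(3)[of B] F(2) sub by blast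
  then show "\<Union>\<C> \<in> \<F>" using B sub by blast
qed

lemma ann_ideal:
  assumes M: "module R M" and y: "y \<in> carrier M" shows "ideal (annihilator R M y) R"
proof -
  have "annihilator R M y = {r \<in> carrier (self_module R). r \<odot>\<^bsub>M\<^esub> y = \<zero>\<^bsub>M\<^esub>}" by (auto simp: annihilator_def)
  moreover have "(\<lambda>r. r \<odot>\<^bsub>M\<^esub> y) \<in> lin (self_module R) M"
    using M y by (intro linI) (simp_all add: mod_smult[OF M])
  ultimately show ?thesis using submod_ker[OF self_is_module M] self_submodule_iff by metis
qed

lemma ann_mono: 
  assumes M: "module R M" and y: "y \<in> carrier M" "r \<in> carrier R" shows "annihilator R M y \<subseteq> annihilator R M (r \<odot>\<^bsub>M\<^esub> y)"
  using M y by (auto simp: annihilator_def mod_smult_comm[OF M, of _ r])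

text \<open>An annihilator that does not grow when the element is multiplied is prime: if \<open>ab\<close> kills \<open>y\<close> and \<open>a\<close> does not, then \<open>b\<close>
  kills \<open>ay\<close>, hence it kills \<open>y\<close>.\<close>

lemma primeideal_annI:
  assumes M: "module R M" and y: "y \<in> carrier M" "y \<noteq> \<zero>\<^bsub>M\<^esub>"
    and max: "\<And>a. a \<in> carrier R \<Longrightarrow> a \<notin> annihilator R M y \<Longrightarrow>
        annihilator R M (a \<odot>\<^bsub>M\<^esub> y) \<subseteq> annihilator R M y"
  shows "primeideal (annihilator R M y) R"
proof (rule primeidealI[OF ann_ideal[OF M y(1)] local.cring_axioms])
  show "carrier R \<noteq> annihilator R M y"
    using y M one_closed unfolding annihilator_def by (metis (mono_tags, lifting) mem_Collect_eq mod_simps(3))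
  fix a b assume ab: "a \<in> carrier R" "b \<in> carrier R" "a \<otimes> b \<in> annihilator R M y"
  show "a \<in> annihilator R M y \<or> b \<in> annihilator R M y"
  proof (rule disjCI)
    assume "b \<notin> annihilator R M y"
    then have "annihilator R M (b \<odot>\<^bsub>M\<^esub> y) \<subseteq> annihilator R M y" using max ab by simp
    then show "a \<in> annihilator R M y" using ab y by (auto simp: annihilator_def mod_smult(3)[OF M])
  qed
qed

text \<open>A maximal element among the annihilators of the nonzero multiples of \<open>y\<close> is an associated prime.\<close>

lemma ass_above:
  assumes S: "noeth (self_module R)" and M: "module R M" and y: "y \<in> carrier M" "y \<noteq> \<zero>\<^bsub>M\<^esub>"
  shows "\<exists>r \<in> carrier R. primeideal (annihilator R M (r \<odot>\<^bsub>M\<^esub> y)) R \<and>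
     annihilator R M y \<subseteq> annihilator R M (r \<odot>\<^bsub>M\<^esub> y) \<and> r \<odot>\<^bsub>M\<^esub> y \<noteq> \<zero>\<^bsub>M\<^esub>"
proof -
  let ?F = "{annihilator R M (r \<odot>\<^bsub>M\<^esub> y) | r. r \<in> carrier R \<and> r \<odot>\<^bsub>M\<^esub> y \<noteq> \<zero>\<^bsub>M\<^esub>}"
  have ne: "?F \<noteq> {}" using y M by (auto intro!: exI[of _ \<one>])
  have sm: "submodule K R (self_module R)" if "K \<in> ?F" for K
    using that ann_ideal[OF M] M y self_submodule_iff by fastforce
  have "\<exists>K \<in> ?F. \<forall>L \<in> ?F. K \<subseteq> L \<longrightarrow> L = K"
    by (rule noeth_maximal[OF S ne sm])
  then obtain K where K0: "K \<in> ?F" "\<forall>L \<in> ?F. K \<subseteq> L \<longrightarrow> L = K" by blast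
  note K = K0(1) K0(2)[rule_format]
  obtain r where r: "r \<in> carrier R" "r \<odot>\<^bsub>M\<^esub> y \<noteq> \<zero>\<^bsub>M\<^esub>" "K = annihilator R M (r \<odot>\<^bsub>M\<^esub> y)" using K(1) by auto
  have max: "annihilator R M (s \<odot>\<^bsub>M\<^esub> y) = annihilator R M (r \<odot>\<^bsub>M\<^esub> y)"
    if "s \<in> carrier R" "s \<odot>\<^bsub>M\<^esub> y \<noteq> \<zero>\<^bsub>M\<^esub>" "annihilator R M (r \<odot>\<^bsub>M\<^esub> y) \<subseteq> annihilator R M (s \<odot>\<^bsub>M\<^esub> y)" for s
    using that K(2)[of "annihilator R M (s \<odot>\<^bsub>M\<^esub> y)"] r(3) by auto
  have "primeideal (annihilator R M (r \<odot>\<^bsub>M\<^esub> y)) R"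
  proof (rule primeideal_annI[OF M _ r(2)])
    show ry: "r \<odot>\<^bsub>M\<^esub> y \<in> carrier M" using M r y by simp
    fix a assume a: "a \<in> carrier R" "a \<notin> annihilator R M (r \<odot>\<^bsub>M\<^esub> y)"
    then show "annihilator R M (a \<odot>\<^bsub>M\<^esub> (r \<odot>\<^bsub>M\<^esub> y)) \<subseteq> annihilator R M (r \<odot>\<^bsub>M\<^esub> y)"
      using max[of "a \<otimes> r"] r y ann_mono[OF M ry a(1)] by (simp add: mod_smult(3)[OF M] annihilator_def)
  qed
  then show ?thesis using r ann_mono[OF M y(1) r(1)] by blast
qed

text \<open>The prime is a maximal element among the annihilators of elements of \<open>M\<close> that are contained in \<open>q\<close>.\<close>

lemma ass_below:
  assumes S: "noeth (self_module R)" and M: "module R M" and y: "y \<in> carrier M"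
    and q: "primeideal q R" "annihilator R M y \<subseteq> q"
  shows "\<exists>p \<in> associated_points R M. p \<subseteq> q"
proof -
  interpret q: primeideal q R by fact
  let ?F = "{annihilator R M z | z. z \<in> carrier M \<and> annihilator R M z \<subseteq> q}"
  have ne: "?F \<noteq> {}" using y q by auto
  have sm: "submodule K R (self_module R)" if "K \<in> ?F" for K
    using that ann_ideal[OF M] self_submodule_iff by fastforce
  have "\<exists>K \<in> ?F. \<forall>L \<in> ?F. K \<subseteq> L \<longrightarrow> L = K"
    by (rule noeth_maximal[OF S ne sm])
  then obtain K where K0: "K \<in> ?F" "\<forall>L \<in> ?F. K \<subseteq> L \<longrightarrow> L = K" by blast
  note K = K0(1) K0(2)[rule_format]
  obtain z where z: "z \<in> carrier M" "annihilator R M z \<subseteq> q" "K = annihilator R M z" using K(1) by auto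
  have max: "annihilator R M w = annihilator R M z"
    if "w \<in> carrier M" "annihilator R M w \<subseteq> q" "annihilator R M z \<subseteq> annihilator R M w" for w
    using that K(2)[of "annihilator R M w"] z(3) by auto
  have "primeideal (annihilator R M z) R"
  proof (rule primeideal_annI[OF M z(1)])
    show "z \<noteq> \<zero>\<^bsub>M\<^esub>"
    proof
      assume "z = \<zero>\<^bsub>M\<^esub>"
      then have "annihilator R M z = carrier R" using M by (auto simp: annihilator_def)
      then show False using z(2) q.I_notcarr q.a_subset by blast
    qed
    fix a assume a: "a \<in> carrier R" "a \<notin> annihilator R M z"
    show "annihilator R M (a \<odot>\<^bsub>M\<^esub> z) \<subseteq> annihilator R M z"
    proof (cases "annihilator R M (a \<odot>\<^bsub>M\<^esub> z) \<subseteq> q")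
      case True
      then show ?thesis using max[of "a \<odot>\<^bsub>M\<^esub> z"] M z a ann_mono[OF M z(1) a(1)] by simp
    next
      \<comment> \<open>otherwise a multiple of \<open>z\<close> by an element outside \<open>q\<close> has a larger annihilator inside \<open>q\<close>\<close>
      case False
      then obtain s where s: "s \<in> carrier R" "s \<odot>\<^bsub>M\<^esub> (a \<odot>\<^bsub>M\<^esub> z) = \<zero>\<^bsub>M\<^esub>" "s \<notin> q" by (auto simp: annihilator_def)
      have "annihilator R M (s \<odot>\<^bsub>M\<^esub> z) \<subseteq> q"
      proof
        fix t assume t: "t \<in> annihilator R M (s \<odot>\<^bsub>M\<^esub> z)"
        then have "t \<otimes> s \<in> annihilator R M z" using s z by (auto simp: annihilator_def mod_smult(3)[OF M])
        then show "t \<in> q" using q.I_prime[of t s] t s z(2) by (auto simp: annihilator_def)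
      qed
      then have "annihilator R M (s \<odot>\<^bsub>M\<^esub> z) = annihilator R M z"
        using max[of "s \<odot>\<^bsub>M\<^esub> z"] s z M ann_mono[OF M z(1) s(1)] by simp
      moreover have "a \<in> annihilator R M (s \<odot>\<^bsub>M\<^esub> z)"
        using a s z by (simp add: annihilator_def mod_smult_comm[OF M, of a s])
      ultimately show ?thesis using a by simp
    qed
  qed
  then show ?thesis using z unfolding associated_points_def spec_def by blast
qed

text \<open>The maps \<open>M \<rightarrow> M'\<close> with the properties of the projection \<open>M \<rightarrow> M / xM\<close> for an element \<open>x\<close> that is regular on \<open>M\<close>.
  The target is not required to be the quotient itself, so that iterated quotients and direct powers are covered.\<close>

definition reg_step :: "'a \<Rightarrow> ('a, 'm) module \<Rightarrow> ('a, 'n) module \<Rightarrow> ('m \<Rightarrow> 'n) \<Rightarrow> bool" where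
  "reg_step x M M' \<pi> \<longleftrightarrow> module R M \<and> module R M' \<and> x \<in> carrier R \<and> \<pi> \<in> lin M M' \<and>
     \<pi> ` carrier M = carrier M' \<and>
     (\<forall>m \<in> carrier M. \<pi> m = \<zero>\<^bsub>M'\<^esub> \<longrightarrow> (\<exists>n \<in> carrier M. m = x \<odot>\<^bsub>M\<^esub> n)) \<and>
     (\<forall>n \<in> carrier M. \<pi> (x \<odot>\<^bsub>M\<^esub> n) = \<zero>\<^bsub>M'\<^esub>) \<and>
     (\<forall>m \<in> carrier M. x \<odot>\<^bsub>M\<^esub> m = \<zero>\<^bsub>M\<^esub> \<longrightarrow> m = \<zero>\<^bsub>M\<^esub>)"

lemma reg_stepD:
  assumes "reg_step x M M' \<pi>"
  shows "module R M" "module R M'" "x \<in> carrier R" "\<pi> \<in> lin M M'" "\<pi> ` carrier M = carrier M'"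
    "\<And>m. m \<in> carrier M \<Longrightarrow> \<pi> m = \<zero>\<^bsub>M'\<^esub> \<Longrightarrow> \<exists>n \<in> carrier M. m = x \<odot>\<^bsub>M\<^esub> n"
    "\<And>n. n \<in> carrier M \<Longrightarrow> \<pi> (x \<odot>\<^bsub>M\<^esub> n) = \<zero>\<^bsub>M'\<^esub>"
    "\<And>m. m \<in> carrier M \<Longrightarrow> x \<odot>\<^bsub>M\<^esub> m = \<zero>\<^bsub>M\<^esub> \<Longrightarrow> m = \<zero>\<^bsub>M\<^esub>"
  using assms unfolding reg_step_def by blast+

lemma reg_step_surjD: "reg_step x M M' \<pi> \<Longrightarrow> m \<in> carrier M' \<Longrightarrow> \<exists>n \<in> carrier M. m = \<pi> n"
  using reg_stepD(5)[of x M M' \<pi>] by blast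

text \<open>A prime containing the annihilator of an element of \<open>M / xM\<close> contains \<open>x\<close>. It also contains an associated prime of \<open>M\<close>, and
  this one does not contain \<open>x\<close>, since \<open>x\<close> is regular on \<open>M\<close>. Thus the inclusion is strict.\<close>

lemma reg_step_down:
  assumes S: "noeth (self_module R)" and r: "reg_step x M M' \<pi>" and y: "y \<in> carrier M'"
    and q: "primeideal q R" "annihilator R M' y \<subseteq> q"
  shows "\<exists>p \<in> associated_points R M. p \<subset> q"
proof -
  note rs = reg_stepD[OF r]
  obtain z where z: "z \<in> carrier M" "y = \<pi> z" using reg_step_surjD[OF r y] by blast
  have "annihilator R M z \<subseteq> annihilator R M' y"
    using z lin_smult[OF rs(4)] lin_zero[OF rs(4,1,2)] by (auto simp: annihilator_def) metis
  then obtain p where p: "p \<in> associated_points R M" "p \<subseteq> q" using ass_below[OF S rs(1) z(1) q(1)] q(2) by blast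
  then obtain w where w: "w \<in> carrier M" "p = annihilator R M w" "primeideal p R" 
    unfolding associated_points_def spec_def by blast
  have "w \<noteq> \<zero>\<^bsub>M\<^esub>"
  proof
    assume "w = \<zero>\<^bsub>M\<^esub>"
    then have "p = carrier R" using w rs(1) by (auto simp: annihilator_def)
    then show False using primeideal.I_notcarr[OF w(3)] by simp
  qed
  then have "x \<notin> p" using w rs(8) by (auto simp: annihilator_def)
  moreover have "x \<in> q" using q(2) rs(3) rs(7)[OF z(1)] z lin_smult[OF rs(4,3) z(1)] by (auto simp: annihilator_def)
  ultimately show ?thesis using p by blast
qed

end

locale noeth_local = cring R for R (structure) +
  assumes loc: "local_ring R" and noe: "noetherian_ring R"
begin

abbreviation "mx \<equiv> max_ideal R"

lemma noeth_R: "noeth (self_module R)"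
  by (rule noeth_self[OF noe])

lemma noeth_Fr: "noeth (Fr g)"
  by (rule noeth_dp[OF noeth_R])

lemma finite_module_noeth: "finite_module R M \<Longrightarrow> noeth M"
proof -
  assume f: "finite_module R M"
  then have "module R M" by (simp add: finite_module_def)
  then show ?thesis using finite_module_cover[OF f] noeth_surj[OF noeth_Fr] by metis
qed

lemma mx_maximal: "maximalideal mx R"
  unfolding max_ideal_def using loc unfolding local_ring_def by (metis theI')

lemma mx_unique: "maximalideal m R \<Longrightarrow> m = mx"
  using loc mx_maximal unfolding local_ring_def by blast

lemma mx_ideal: "ideal mx R"
  using mx_maximal maximalideal.axioms(1) by blast

lemma mx_closed:
  shows mx_sub: "mx \<subseteq> carrier R" and mx_carr: "a \<in> mx \<Longrightarrow> a \<in> carrier R" and mx_zero: "\<zero> \<in> mx"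
    and mx_add: "a \<in> mx \<Longrightarrow> b \<in> mx \<Longrightarrow> a \<oplus> b \<in> mx"
    and mx_neg: "a \<in> mx \<Longrightarrow> \<ominus> a \<in> mx"
    and mx_mult: "a \<in> mx \<Longrightarrow> r \<in> carrier R \<Longrightarrow> r \<otimes> a \<in> mx" "a \<in> mx \<Longrightarrow> r \<in> carrier R \<Longrightarrow> a \<otimes> r \<in> mx"
proof -
  interpret ideal mx R by (rule mx_ideal)
  show "mx \<subseteq> carrier R" "a \<in> mx \<Longrightarrow> a \<in> carrier R" "\<zero> \<in> mx" "a \<in> mx \<Longrightarrow> b \<in> mx \<Longrightarrow> a \<oplus> b \<in> mx"
    "a \<in> mx \<Longrightarrow> \<ominus> a \<in> mx" "a \<in> mx \<Longrightarrow> r \<in> carrier R \<Longrightarrow> r \<otimes> a \<in> mx" "a \<in> mx \<Longrightarrow> r \<in> carrier R \<Longrightarrow> a \<otimes> r \<in> mx"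
    using a_subset by (auto simp: I_l_closed I_r_closed)
qed

lemma ideal_sub_mx:
  assumes I: "ideal I R" "I \<noteq> carrier R" shows "I \<subseteq> mx"
proof -
  let ?F = "{J. ideal J R \<and> I \<subseteq> J \<and> J \<noteq> carrier R}"
  have ne: "?F \<noteq> {}" "\<And>K. K \<in> ?F \<Longrightarrow> submodule K R (self_module R)" using I by (auto simp: self_submodule_iff)
  have "\<exists>K \<in> ?F. \<forall>L \<in> ?F. K \<subseteq> L \<longrightarrow> L = K"
    by (rule noeth_maximal[OF noeth_R ne])
  then obtain K where K0: "K \<in> ?F" "\<forall>L \<in> ?F. K \<subseteq> L \<longrightarrow> L = K" by blast
  note K = K0(1) K0(2)[rule_format]
  have "maximalideal K R"
  proof (rule maximalidealI)
    fix J assume J: "ideal J R" "K \<subseteq> J" "J \<subseteq> carrier R"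
    then show "J = K \<or> J = carrier R" using K(1) K(2)[of J] by auto
  qed (use K(1) in auto)
  then show ?thesis using mx_unique K(1) by blast
qed

lemma one_notin_mx: "\<one> \<notin> mx"
  using ideal.one_imp_carrier[OF mx_ideal] maximalideal.I_notcarr[OF mx_maximal] by auto

lemma mx_prime: "primeideal mx R"
  by (rule maximalideal_prime[OF mx_maximal])

lemma prime_sub_mx: "primeideal q R \<Longrightarrow> q \<subseteq> mx"
  using ideal_sub_mx primeideal.axioms(1) primeideal.I_notcarr by metis

lemma unit_notin_mx:
  assumes "r \<in> carrier R" "r \<notin> mx" shows "\<exists>s \<in> carrier R. s \<otimes> r = \<one>"
proof -
  have "PIdl r = carrier R"
    using ideal_sub_mx[OF cgenideal_ideal[OF assms(1)]] cgenideal_self[OF assms(1)] assms(2) by blast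
  then have "\<one> \<in> PIdl r" by simp
  then show ?thesis unfolding cgenideal_def by auto
qed

lemma unit_one_minus:
  assumes "a \<in> mx" shows "\<exists>s \<in> carrier R. s \<otimes> (\<one> \<ominus> a) = \<one>"
proof (rule unit_notin_mx)
  show "\<one> \<ominus> a \<in> carrier R" using assms mx_carr by simp
  show "\<one> \<ominus> a \<notin> mx"
  proof
    assume "\<one> \<ominus> a \<in> mx"
    then have "(\<one> \<ominus> a) \<oplus> a \<in> mx" using assms mx_add by blast
    moreover have "(\<one> \<ominus> a) \<oplus> a = \<one>" using assms mx_carr by algebra
    ultimately show False using one_notin_mx by simp
  qed
qed

text \<open>Let \<open>N\<close> be maximal among the submodules that contain \<open>V\<close> but not \<open>K\<close>, and let \<open>k\<close> be in \<open>K\<close> and not in \<open>N\<close>. Then \<open>K\<close> lies in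
  \<open>N + R k\<close>, and the assumption puts \<open>(1 - xr) k\<close> into \<open>N\<close> for some \<open>r\<close>, where \<open>1 - xr\<close> is a unit.\<close>

lemma nakayama:
  assumes M: "noeth M" and K: "submodule K R M" and V: "submodule V R M" and x: "x \<in> mx"
    and KV: "\<And>k. k \<in> K \<Longrightarrow> \<exists>v \<in> V. \<exists>k' \<in> K. k = v \<oplus>\<^bsub>M\<^esub> x \<odot>\<^bsub>M\<^esub> k'"
  shows "K \<subseteq> V"
proof (rule ccontr)
  note M' = noeth_module[OF M]
  assume nK: "\<not> K \<subseteq> V"
  let ?F = "{N. submodule N R M \<and> V \<subseteq> N \<and> \<not> K \<subseteq> N}"
  have ne: "?F \<noteq> {}" "\<And>N. N \<in> ?F \<Longrightarrow> submodule N R M" using V nK by auto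
  have "\<exists>N \<in> ?F. \<forall>L \<in> ?F. N \<subseteq> L \<longrightarrow> L = N"
    by (rule noeth_maximal[OF M ne])
  then obtain N where N'0: "N \<in> ?F" "\<forall>L \<in> ?F. N \<subseteq> L \<longrightarrow> L = N" by blast
  note N' = N'0(1) N'0(2)[rule_format]
  have N: "submodule N R M" "V \<subseteq> N" "\<not> K \<subseteq> N" using N'(1) by auto
  have max: "L = N" if "submodule L R M" "V \<subseteq> L" "\<not> K \<subseteq> L" "N \<subseteq> L" for L using that N'(2)[of L] by simp
  obtain k where k: "k \<in> K" "k \<notin> N" using N(3) by blast
  note Kc = submodule_closed[OF M' K] and Nc = submodule_closed[OF M' N(1)]
  have kc: "k \<in> carrier M" using k Kc by auto
  let ?L = "{n \<oplus>\<^bsub>M\<^esub> l | n l. n \<in> N \<and> l \<in> {r \<odot>\<^bsub>M\<^esub> k | r. r \<in> carrier R}}"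
  have L: "submodule ?L R M" by (rule submod_sum[OF M' N(1) submod_span1[OF M' kc]])
  have "N \<subseteq> ?L"
  proof
    fix n assume n: "n \<in> N"
    then have "n = n \<oplus>\<^bsub>M\<^esub> \<zero> \<odot>\<^bsub>M\<^esub> k" using kc M' Nc(1) by auto
    then show "n \<in> ?L" using n by blast
  qed
  moreover have "k \<in> ?L"
  proof -
    have "k = \<zero>\<^bsub>M\<^esub> \<oplus>\<^bsub>M\<^esub> \<one> \<odot>\<^bsub>M\<^esub> k" using kc M' by simp
    then show ?thesis using Nc(2) by blast
  qed
  ultimately have KL: "K \<subseteq> ?L" using max[OF L] N(2) k by blast
  obtain v k' where v: "v \<in> V" "k' \<in> K" "k = v \<oplus>\<^bsub>M\<^esub> x \<odot>\<^bsub>M\<^esub> k'" using KV[OF k(1)] by blast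
  obtain n r where n: "n \<in> N" "r \<in> carrier R" "k' = n \<oplus>\<^bsub>M\<^esub> r \<odot>\<^bsub>M\<^esub> k" using KL v(2) by blast
  note xc = mx_carr[OF x]
  have c: "v \<in> carrier M" "n \<in> carrier M" "k' \<in> carrier M" using v(1,2) n(1) N(2) Nc(1) Kc(1) by auto
  have "k = (v \<oplus>\<^bsub>M\<^esub> x \<odot>\<^bsub>M\<^esub> n) \<oplus>\<^bsub>M\<^esub> (x \<otimes> r) \<odot>\<^bsub>M\<^esub> k"
    using v(3) n(3) c kc n(2) xc M' by (simp add: mod_smult[OF M'] mod_ac[OF M'])
  then have "k \<ominus>\<^bsub>M\<^esub> (x \<otimes> r) \<odot>\<^bsub>M\<^esub> k = v \<oplus>\<^bsub>M\<^esub> x \<odot>\<^bsub>M\<^esub> n"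
    using c kc n(2) xc M' by (subst mod_solve[OF M']) (auto simp: mod_ac[OF M'])
  then have "(\<one> \<ominus> x \<otimes> r) \<odot>\<^bsub>M\<^esub> k \<in> N"
    using v(1) N(2) n(1) Nc xc kc n(2) M' by (auto simp: mod_smult(7)[OF M'])
  moreover obtain s where s: "s \<in> carrier R" "s \<otimes> (\<one> \<ominus> x \<otimes> r) = \<one>"
    using unit_one_minus[of "x \<otimes> r"] x n(2) mx_mult by blast
  ultimately have "s \<odot>\<^bsub>M\<^esub> ((\<one> \<ominus> x \<otimes> r) \<odot>\<^bsub>M\<^esub> k) \<in> N" using Nc(5) by blast
  then show False using s k(2) kc n(2) xc M' by (simp add: mod_smult(3)[OF M', symmetric])
qed

text \<open>The annihilator of a suitable multiple of \<open>y\<close> is an associated prime. It contains \<open>Y\<close>, hence it is the maximal ideal. In this way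
  finite length of the quotient by \<open>Y\<close> is used without a notion of length.\<close>

lemma socle_multiple:
  fixes M :: "('a, 'm) module"
  assumes M: "module R M" and y: "y \<in> carrier M" "y \<noteq> \<zero>\<^bsub>M\<^esub>"
    and J: "\<And>q. primeideal q R \<Longrightarrow> Y \<subseteq> q \<Longrightarrow> q = mx" "\<And>a. a \<in> Y \<Longrightarrow> a \<odot>\<^bsub>M\<^esub> y = \<zero>\<^bsub>M\<^esub>" "Y \<subseteq> carrier R"
  shows "\<exists>r \<in> carrier R. r \<odot>\<^bsub>M\<^esub> y \<noteq> \<zero>\<^bsub>M\<^esub> \<and> (\<forall>a \<in> mx. a \<odot>\<^bsub>M\<^esub> (r \<odot>\<^bsub>M\<^esub> y) = \<zero>\<^bsub>M\<^esub>)"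
proof -
  obtain r where r: "r \<in> carrier R" "primeideal (annihilator R M (r \<odot>\<^bsub>M\<^esub> y)) R"
    "annihilator R M y \<subseteq> annihilator R M (r \<odot>\<^bsub>M\<^esub> y)" "r \<odot>\<^bsub>M\<^esub> y \<noteq> \<zero>\<^bsub>M\<^esub>" using ass_above[OF noeth_R M y] by blast
  have "Y \<subseteq> annihilator R M y" using J by (auto simp: annihilator_def)
  then have "annihilator R M (r \<odot>\<^bsub>M\<^esub> y) = mx" using J(1) r by blast
  then have "a \<odot>\<^bsub>M\<^esub> (r \<odot>\<^bsub>M\<^esub> y) = \<zero>\<^bsub>M\<^esub>" if "a \<in> mx" for a using that unfolding annihilator_def by blast
  then show ?thesis using r by blast
qed

text \<open>Let \<open>N\<close> be the submodule of the elements of \<open>M\<close> killed by \<open>p\<close>. If \<open>N\<close> were contained in \<open>xM\<close>, then \<open>N = xN\<close> by regularity of \<open>x\<close>,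
  and \<open>N\<close> would vanish. So some element of \<open>M / xM\<close> other than zero is killed by \<open>p\<close> and by \<open>x\<close>, and \<open>x\<close> is not in \<open>p\<close>.\<close>

lemma reg_step_up:
  assumes r: "reg_step x M M' \<pi>" and x: "x \<in> mx" and M: "noeth M" and p: "p \<in> associated_points R M"
  shows "\<exists>q \<in> associated_points R M'. p \<subset> q"
proof -
  note rs = reg_stepD[OF r]
  obtain y where y: "primeideal p R" "y \<in> carrier M" "p = annihilator R M y"
    using p unfolding associated_points_def spec_def by blast
  have y0: "y \<noteq> \<zero>\<^bsub>M\<^esub>"
  proof
    assume "y = \<zero>\<^bsub>M\<^esub>"
    then have "p = carrier R" using y rs(1) by (auto simp: annihilator_def)
    then show False using primeideal.I_notcarr[OF y(1)] by simp
  qed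
  then have xp: "x \<notin> p" using y rs(8) by (auto simp: annihilator_def)
  have pc: "p \<subseteq> carrier R" using y(3) by (auto simp: annihilator_def)
  \<comment> \<open>the submodule of elements killed by \<open>p\<close>\<close>
  let ?N = "{m \<in> carrier M. \<forall>a \<in> p. a \<odot>\<^bsub>M\<^esub> m = \<zero>\<^bsub>M\<^esub>}"
  have N: "submodule ?N R M"
  proof (rule submodI[OF rs(1)])
    fix m n assume "m \<in> ?N" "n \<in> ?N" then show "m \<oplus>\<^bsub>M\<^esub> n \<in> ?N"
      using rs(1) pc by (auto simp: mod_smult(1)[OF rs(1)] subset_iff)
  next
    fix s m assume "s \<in> carrier R" "m \<in> ?N" then show "s \<odot>\<^bsub>M\<^esub> m \<in> ?N"
      using rs(1) pc by (auto simp: mod_smult_comm[OF rs(1), of _ s] subset_iff)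
  qed (use rs(1) pc in auto)
  have "\<exists>n \<in> ?N. \<pi> n \<noteq> \<zero>\<^bsub>M'\<^esub>"
  proof (rule ccontr)
    assume n: "\<not> ?thesis"
    have "?N \<subseteq> {\<zero>\<^bsub>M\<^esub>}"
    proof (rule nakayama[OF M N submod_zero[OF rs(1)] x])
      fix k assume k: "k \<in> ?N"
      then have "\<pi> k = \<zero>\<^bsub>M'\<^esub>" "k \<in> carrier M" using n by auto
      then obtain k' where k': "k' \<in> carrier M" "k = x \<odot>\<^bsub>M\<^esub> k'" using rs(6) by blast
      have "a \<odot>\<^bsub>M\<^esub> k' = \<zero>\<^bsub>M\<^esub>" if a: "a \<in> p" for a
      proof (rule rs(8))
        have ac: "a \<in> carrier R" using a pc by auto
        show "a \<odot>\<^bsub>M\<^esub> k' \<in> carrier M" using ac k' rs(1) by simp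
        show "x \<odot>\<^bsub>M\<^esub> (a \<odot>\<^bsub>M\<^esub> k') = \<zero>\<^bsub>M\<^esub>" using mod_smult_comm[OF rs(1,3) ac k'(1)] k a k'(2) by simp
      qed
      then have "k' \<in> ?N" "k = \<zero>\<^bsub>M\<^esub> \<oplus>\<^bsub>M\<^esub> x \<odot>\<^bsub>M\<^esub> k'" using k' rs(1,3) by simp_all
      then show "\<exists>v\<in>{\<zero>\<^bsub>M\<^esub>}. \<exists>k'\<in>?N. k = v \<oplus>\<^bsub>M\<^esub> x \<odot>\<^bsub>M\<^esub> k'" by blast
    qed
    moreover have "y \<in> ?N" using y by (auto simp: annihilator_def)
    ultimately show False using y0 by auto
  qed
  then obtain n where n: "n \<in> carrier M" "\<And>a. a \<in> p \<Longrightarrow> a \<odot>\<^bsub>M\<^esub> n = \<zero>\<^bsub>M\<^esub>" "\<pi> n \<noteq> \<zero>\<^bsub>M'\<^esub>" by blast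
  note nc = lin_closed[OF rs(4) n(1)]
  have pn: "p \<subseteq> annihilator R M' (\<pi> n)"
  proof
    fix a assume a: "a \<in> p"
    then have "a \<odot>\<^bsub>M'\<^esub> \<pi> n = \<pi> (a \<odot>\<^bsub>M\<^esub> n)" using lin_smult[OF rs(4) _ n(1)] pc by auto
    then show "a \<in> annihilator R M' (\<pi> n)" using n(2)[OF a] a pc lin_zero[OF rs(4,1,2)] by (auto simp: annihilator_def)
  qed
  have xn: "x \<in> annihilator R M' (\<pi> n)" using rs(3) rs(7)[OF n(1)] lin_smult[OF rs(4,3) n(1)] by (simp add: annihilator_def)
  obtain s where s: "s \<in> carrier R" "primeideal (annihilator R M' (s \<odot>\<^bsub>M'\<^esub> \<pi> n)) R"
    "annihilator R M' (\<pi> n) \<subseteq> annihilator R M' (s \<odot>\<^bsub>M'\<^esub> \<pi> n)" using ass_above[OF noeth_R rs(2) nc n(3)] by blast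
  have "annihilator R M' (s \<odot>\<^bsub>M'\<^esub> \<pi> n) \<in> associated_points R M'"
    using s rs(2) nc unfolding associated_points_def spec_def by auto
  then show ?thesis using pn xn xp s(3) by blast
qed

end

section \<open>Regular sequences, chains of primes and depth\<close>

context cring
begin

lemma seq_mult_Nil: "module R M \<Longrightarrow> seq_mult M [] = {\<zero>\<^bsub>M\<^esub>}"
proof -
  assume "module R M"
  then interpret M: module R M .
  show ?thesis by (auto simp: seq_mult_def)
qed

lemma seq_mult_snoc:
  assumes M: "module R M" and xs: "set xs \<subseteq> carrier R" "x \<in> carrier R"
  shows "seq_mult M (xs @ [x]) = {t \<oplus>\<^bsub>M\<^esub> x \<odot>\<^bsub>M\<^esub> m | t m. t \<in> seq_mult M xs \<and> m \<in> carrier M}"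
proof -
  interpret M: module R M by fact
  let ?n = "length xs"
  have xc: "xs ! j \<in> carrier R" if "j < ?n" for j using that xs nth_mem by blast
  have split: "finsum M (\<lambda>j. ((xs @ [x]) ! j) \<odot>\<^bsub>M\<^esub> f j) {..<length (xs @ [x])} =
      finsum M (\<lambda>j. (xs ! j) \<odot>\<^bsub>M\<^esub> f j) {..<?n} \<oplus>\<^bsub>M\<^esub> x \<odot>\<^bsub>M\<^esub> f ?n"
    if f: "\<And>j. j \<le> ?n \<Longrightarrow> f j \<in> carrier M" for f
  proof -
    have "finsum M (\<lambda>j. ((xs @ [x]) ! j) \<odot>\<^bsub>M\<^esub> f j) {..<length (xs @ [x])} =
      x \<odot>\<^bsub>M\<^esub> f ?n \<oplus>\<^bsub>M\<^esub> finsum M (\<lambda>j. ((xs @ [x]) ! j) \<odot>\<^bsub>M\<^esub> f j) {..<?n}"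
      using f xs xc by (simp add: lessThan_Suc nth_append Pi_iff)
    also have "finsum M (\<lambda>j. ((xs @ [x]) ! j) \<odot>\<^bsub>M\<^esub> f j) {..<?n} = finsum M (\<lambda>j. (xs ! j) \<odot>\<^bsub>M\<^esub> f j) {..<?n}"
      using f xc by (intro M.finsum_cong') (simp_all add: nth_append Pi_iff)
    finally show ?thesis using f xs xc by (simp add: M.a_comm Pi_iff)
  qed
  show ?thesis
  proof (intro equalityI subsetI)
    fix y assume "y \<in> seq_mult M (xs @ [x])"
    then obtain f where f: "f \<in> {..<length (xs @ [x])} \<rightarrow> carrier M"
      "y = finsum M (\<lambda>j. ((xs @ [x]) ! j) \<odot>\<^bsub>M\<^esub> f j) {..<length (xs @ [x])}" unfolding seq_mult_def by blast
    have fc: "f j \<in> carrier M" if "j \<le> ?n" for j using f(1) that by (simp add: Pi_iff)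
    have "finsum M (\<lambda>j. (xs ! j) \<odot>\<^bsub>M\<^esub> f j) {..<?n} \<in> seq_mult M xs"
      unfolding seq_mult_def using fc by (auto simp: Pi_iff)
    then show "y \<in> {t \<oplus>\<^bsub>M\<^esub> x \<odot>\<^bsub>M\<^esub> m | t m. t \<in> seq_mult M xs \<and> m \<in> carrier M}"
      using f(2) split[OF fc] fc[of ?n] by auto
  next
    fix y assume "y \<in> {t \<oplus>\<^bsub>M\<^esub> x \<odot>\<^bsub>M\<^esub> m | t m. t \<in> seq_mult M xs \<and> m \<in> carrier M}"
    then obtain f m where f: "f \<in> {..<?n} \<rightarrow> carrier M" "m \<in> carrier M"
      "y = finsum M (\<lambda>j. (xs ! j) \<odot>\<^bsub>M\<^esub> f j) {..<?n} \<oplus>\<^bsub>M\<^esub> x \<odot>\<^bsub>M\<^esub> m" unfolding seq_mult_def by blast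
    let ?f = "f(?n := m)"
    have fc: "?f j \<in> carrier M" if "j \<le> ?n" for j using f(1,2) that by (auto simp: Pi_iff)
    have "finsum M (\<lambda>j. (xs ! j) \<odot>\<^bsub>M\<^esub> ?f j) {..<?n} = finsum M (\<lambda>j. (xs ! j) \<odot>\<^bsub>M\<^esub> f j) {..<?n}"
      using f(1) xc by (intro M.finsum_cong') (simp_all add: Pi_iff)
    then have "y = finsum M (\<lambda>j. ((xs @ [x]) ! j) \<odot>\<^bsub>M\<^esub> ?f j) {..<length (xs @ [x])}"
      using split[OF fc] f(3) by simp
    moreover have "?f \<in> {..<length (xs @ [x])} \<rightarrow> carrier M" using fc by (simp add: Pi_iff less_Suc_eq_le)
    ultimately show "y \<in> seq_mult M (xs @ [x])" unfolding seq_mult_def by blast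
  qed
qed

lemma seq_mult_submodule:
  assumes M: "module R M" and "set xs \<subseteq> carrier R" shows "submodule (seq_mult M xs) R M"
  using assms(2)
proof (induct xs rule: rev_induct)
  case Nil then show ?case using submod_zero[OF M] seq_mult_Nil[OF M] by simp
next
  case (snoc x xs)
  have l: "(\<lambda>m. x \<odot>\<^bsub>M\<^esub> m) \<in> lin M M" using lin_mult[OF M] snoc(2) by simp
  have "{t \<oplus>\<^bsub>M\<^esub> x \<odot>\<^bsub>M\<^esub> m | t m. t \<in> seq_mult M xs \<and> m \<in> carrier M} =
    {t \<oplus>\<^bsub>M\<^esub> k | t k. t \<in> seq_mult M xs \<and> k \<in> (\<lambda>m. x \<odot>\<^bsub>M\<^esub> m) ` carrier M}" by blast
  then show ?case using seq_mult_snoc[OF M, of xs x] snoc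
      submod_sum[OF M _ submod_image[OF M M l submod_whole[OF M]], of "seq_mult M xs"] by simp
qed

lemma seq_mult_take_Suc:
  assumes M: "module R M" and xs: "set xs \<subseteq> carrier R" and i: "i < length xs"
  shows "seq_mult M (take (Suc i) xs) =
    {t \<oplus>\<^bsub>M\<^esub> (xs ! i) \<odot>\<^bsub>M\<^esub> m | t m. t \<in> seq_mult M (take i xs) \<and> m \<in> carrier M}"
proof -
  have "set (take i xs) \<subseteq> carrier R" "xs ! i \<in> carrier R" using xs i set_take_subset[of i xs] nth_mem[OF i] by auto
  then show ?thesis using seq_mult_snoc[OF M] take_Suc_conv_app_nth[OF i] by simp
qed

text \<open>This characterizes \<open>(x\<^sub>1, \<dots>, x\<^sub>k) M\<close> as the least submodule containing all \<open>x\<^sub>i M\<close> and replaces calculations with the finite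
  sums that define it.\<close>

lemma seq_mult_least:
  assumes M: "module R M" and xs: "set xs \<subseteq> carrier R" and K: "submodule K R M"
    and k: "\<And>x m. x \<in> set xs \<Longrightarrow> m \<in> carrier M \<Longrightarrow> x \<odot>\<^bsub>M\<^esub> m \<in> K"
  shows "seq_mult M xs \<subseteq> K"
  using xs k
proof (induct xs rule: rev_induct)
  case Nil then show ?case using seq_mult_Nil[OF M] submodule_closed(2)[OF M K] by simp
next
  case (snoc x xs)
  have "seq_mult M xs \<subseteq> K" using snoc by simp
  moreover have "x \<odot>\<^bsub>M\<^esub> m \<in> K" if "m \<in> carrier M" for m using snoc(3)[of x m] that by simp
  ultimately show ?case using seq_mult_snoc[OF M, of xs x] snoc(2) submodule_closed(3)[OF M K] by auto
qed

lemma seq_mult_gen: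
  assumes M: "module R M" and xs: "set xs \<subseteq> carrier R" and x: "x \<in> set xs" and m: "m \<in> carrier M"
  shows "x \<odot>\<^bsub>M\<^esub> m \<in> seq_mult M xs"
  using xs x
proof (induct xs rule: rev_induct)
  case (snoc y xs)
  have sub: "submodule (seq_mult M xs) R M" using seq_mult_submodule[OF M] snoc(2) by simp
  have eq: "seq_mult M (xs @ [y]) = {t \<oplus>\<^bsub>M\<^esub> y \<odot>\<^bsub>M\<^esub> m | t m. t \<in> seq_mult M xs \<and> m \<in> carrier M}"
    using seq_mult_snoc[OF M, of xs y] snoc(2) by simp
  have xc: "x \<in> carrier R" "y \<in> carrier R" using snoc by auto
  consider "x \<in> set xs" | "x = y" using snoc(3) by auto
  then show ?case
  proof cases
    case 1
    then have "x \<odot>\<^bsub>M\<^esub> m \<in> seq_mult M xs" using snoc by simp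
    moreover have "x \<odot>\<^bsub>M\<^esub> m = x \<odot>\<^bsub>M\<^esub> m \<oplus>\<^bsub>M\<^esub> y \<odot>\<^bsub>M\<^esub> \<zero>\<^bsub>M\<^esub>" using M m xc by simp
    ultimately show ?thesis unfolding eq using mod_closed(1)[OF M] by blast
  next
    case 2
    have "x \<odot>\<^bsub>M\<^esub> m = \<zero>\<^bsub>M\<^esub> \<oplus>\<^bsub>M\<^esub> y \<odot>\<^bsub>M\<^esub> m" using M m xc 2 by simp
    then show ?thesis unfolding eq using submodule_closed(2)[OF M sub] m by blast
  qed
qed simp

lemma seq_mult_lin:
  assumes M: "module R M" and N: "module R N" and f: "f \<in> lin M N" and xs: "set xs \<subseteq> carrier R"
  shows "f ` seq_mult M xs = seq_mult (N\<lparr>carrier := f ` carrier M\<rparr>) xs"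
proof -
  let ?N = "N\<lparr>carrier := f ` carrier M\<rparr>"
  have N': "module R ?N" by (rule submod_module[OF N submod_image[OF M N f submod_whole[OF M]]])
  show ?thesis using xs
  proof (induct xs rule: rev_induct)
    case Nil then show ?case using seq_mult_Nil[OF M] seq_mult_Nil[OF N'] lin_zero[OF f M N] by simp
  next
    case (snoc x xs)
    note e1 = seq_mult_snoc[OF M, of xs x] and e2 = seq_mult_snoc[OF N', of xs x]
    have sub: "seq_mult M xs \<subseteq> carrier M" using submodule_closed(1)[OF M seq_mult_submodule[OF M]] snoc(2) by simp
    have eq: "f (t \<oplus>\<^bsub>M\<^esub> x \<odot>\<^bsub>M\<^esub> m) = f t \<oplus>\<^bsub>N\<^esub> x \<odot>\<^bsub>N\<^esub> f m" if "t \<in> seq_mult M xs" "m \<in> carrier M" for t m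
      using that sub snoc(2) M by (simp add: lin_add[OF f] lin_smult[OF f] subset_iff)
    have ih: "f ` seq_mult M xs = seq_mult ?N xs" using snoc by simp
    show ?case
    proof (intro equalityI subsetI)
      fix y assume "y \<in> f ` seq_mult M (xs @ [x])"
      then obtain t m where tm: "t \<in> seq_mult M xs" "m \<in> carrier M" "y = f (t \<oplus>\<^bsub>M\<^esub> x \<odot>\<^bsub>M\<^esub> m)" using e1 snoc(2) by auto
      moreover have "f t \<in> seq_mult ?N xs" using ih tm(1) by blast
      ultimately show "y \<in> seq_mult ?N (xs @ [x])" using e2 eq snoc(2) by auto
    next
      fix y assume "y \<in> seq_mult ?N (xs @ [x])"
      then obtain t m where tm: "t \<in> seq_mult ?N xs" "m \<in> carrier M" "y = t \<oplus>\<^bsub>N\<^esub> x \<odot>\<^bsub>N\<^esub> f m" using e2 snoc(2) by auto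
      then obtain t' where "t' \<in> seq_mult M xs" "t = f t'" unfolding ih[symmetric] by blast
      then have "y = f (t' \<oplus>\<^bsub>M\<^esub> x \<odot>\<^bsub>M\<^esub> m)" "t' \<oplus>\<^bsub>M\<^esub> x \<odot>\<^bsub>M\<^esub> m \<in> seq_mult M (xs @ [x])"
        using eq tm e1 snoc(2) by auto
      then show "y \<in> f ` seq_mult M (xs @ [x])" by blast
    qed
  qed
qed

lemma seq_mult_lin_surj:
  assumes "module R M" "module R N" "f \<in> lin M N" "set xs \<subseteq> carrier R" "f ` carrier M = carrier N"
  shows "f ` seq_mult M xs = seq_mult N xs"
  using seq_mult_lin[OF assms(1-4)] assms(5) by simp

text \<open>A weakly regular sequence: \<open>(x\<^sub>1, \<dots>, x\<^sub>k) M\<close> is allowed to be all of \<open>M\<close>, so that zero modules, which occur as syzygies, need no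
  separate treatment. For a nonzero noetherian module and a sequence in the maximal ideal there is no difference.\<close>

definition wreg :: "('a, 'm) module \<Rightarrow> 'a list \<Rightarrow> bool" where
  "wreg M xs \<longleftrightarrow> set xs \<subseteq> carrier R \<and> (\<forall>i < length xs. \<forall>m \<in> carrier M.
     (xs ! i) \<odot>\<^bsub>M\<^esub> m \<in> seq_mult M (take i xs) \<longrightarrow> m \<in> seq_mult M (take i xs))"

lemma wreg_carr: "wreg M xs \<Longrightarrow> set xs \<subseteq> carrier R"
  by (simp add: wreg_def)

lemma wregD: "wreg M xs \<Longrightarrow> i < length xs \<Longrightarrow> m \<in> carrier M \<Longrightarrow>
    (xs ! i) \<odot>\<^bsub>M\<^esub> m \<in> seq_mult M (take i xs) \<Longrightarrow> m \<in> seq_mult M (take i xs)"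
  by (simp add: wreg_def)

lemma regular_sequence_iff: "regular_sequence R M xs \<longleftrightarrow> wreg M xs \<and> seq_mult M xs \<noteq> carrier M"
  by (auto simp: regular_sequence_def wreg_def)

lemma wreg_take: "wreg M xs \<Longrightarrow> wreg M (take k xs)"
  unfolding wreg_def using set_take_subset[of k xs] by (auto simp: min_def)

lemma wreg_snoc:
  assumes "wreg M xs" "x \<in> carrier R" "\<And>m. m \<in> carrier M \<Longrightarrow> x \<odot>\<^bsub>M\<^esub> m \<in> seq_mult M xs \<Longrightarrow> m \<in> seq_mult M xs"
  shows "wreg M (xs @ [x])"
  using assms unfolding wreg_def by (auto simp: nth_append less_Suc_eq)

text \<open>The quotients \<open>M / (x\<^sub>1, \<dots>, x\<^sub>i) M\<close>, along which the inductions on a regular sequence run.\<close>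

definition level :: "('a, 'm) module \<Rightarrow> 'a list \<Rightarrow> nat \<Rightarrow> ('a, 'm set) module" where
  "level M xs i = quot_module M (seq_mult M (take i xs))"

definition lproj :: "('a, 'm) module \<Rightarrow> 'a list \<Rightarrow> nat \<Rightarrow> 'm \<Rightarrow> 'm set" where
  "lproj M xs i = (\<lambda>x. seq_mult M (take i xs) +>\<^bsub>M\<^esub> x)"

lemma seq_mult_take_submodule:
  "module R M \<Longrightarrow> set xs \<subseteq> carrier R \<Longrightarrow> submodule (seq_mult M (take i xs)) R M"
  using seq_mult_submodule[of M "take i xs"] set_take_subset[of i xs] by auto

lemma level_props:
  assumes "module R M" "set xs \<subseteq> carrier R"
  shows level_module: "module R (level M xs i)"
    and lproj_lin: "lproj M xs i \<in> lin M (level M xs i)"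
    and lproj_surj: "lproj M xs i ` carrier M = carrier (level M xs i)"
    and "m \<in> carrier M \<Longrightarrow> lproj M xs i m = \<zero>\<^bsub>level M xs i\<^esub> \<longleftrightarrow> m \<in> seq_mult M (take i xs)"
  unfolding level_def lproj_def
  using quot_props[OF assms(1) seq_mult_take_submodule[OF assms, of i]] by auto

lemma level_surjD:
  assumes "module R M" "set xs \<subseteq> carrier R" "y \<in> carrier (level M xs i)"
  shows "\<exists>m \<in> carrier M. y = lproj M xs i m"
  using lproj_surj[OF assms(1,2), of i] assms(3) by blast

lemma level_step:
  assumes M: "module R M" and xs: "wreg M xs" and i: "i < length xs"
  shows "\<exists>\<pi>. reg_step (xs ! i) (level M xs i) (level M xs (Suc i)) \<pi> \<and>
    (\<forall>m \<in> carrier M. \<pi> (lproj M xs i m) = lproj M xs (Suc i) m)"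
proof -
  note xc = wreg_carr[OF xs]
  note S = seq_mult_take_Suc[OF M xc i]
  have x: "xs ! i \<in> carrier R" using xc i nth_mem by blast
  note sub = submodule_closed[OF M seq_mult_take_submodule[OF M xc, of i]]
  have le: "t \<in> seq_mult M (take (Suc i) xs)" if "t \<in> seq_mult M (take i xs)" for t
  proof -
    have "t = t \<oplus>\<^bsub>M\<^esub> (xs ! i) \<odot>\<^bsub>M\<^esub> \<zero>\<^bsub>M\<^esub>" using that sub(1) M x by auto
    then show ?thesis unfolding S using that mod_closed(1)[OF M] by blast
  qed
  note L = level_props[OF M xc]
  have "\<exists>\<pi> \<in> lin (level M xs i) (level M xs (Suc i)). \<forall>m \<in> carrier M. \<pi> (lproj M xs i m) = lproj M xs (Suc i) m"
    using le L(4) by (intro lin_factor[OF M L(1) L(1) L(2,3) L(2)]) simp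
  then obtain \<pi> where p: "\<pi> \<in> lin (level M xs i) (level M xs (Suc i))"
    "\<And>m. m \<in> carrier M \<Longrightarrow> \<pi> (lproj M xs i m) = lproj M xs (Suc i) m" by blast
  have sm: "(xs ! i) \<odot>\<^bsub>level M xs i\<^esub> lproj M xs i m = lproj M xs i ((xs ! i) \<odot>\<^bsub>M\<^esub> m)" if "m \<in> carrier M" for m
    using lin_smult[OF L(2) x that] by simp
  have "reg_step (xs ! i) (level M xs i) (level M xs (Suc i)) \<pi>"
    unfolding reg_step_def
  proof (intro conjI L(1) x p(1) ballI impI)
    show "\<pi> ` carrier (level M xs i) = carrier (level M xs (Suc i))"
      unfolding L(3)[symmetric] image_image using p(2) by (intro image_cong) auto
  next
    fix y assume y: "y \<in> carrier (level M xs i)" "\<pi> y = \<zero>\<^bsub>level M xs (Suc i)\<^esub>"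
    then obtain m where m: "m \<in> carrier M" "y = lproj M xs i m" using level_surjD[OF M xc] by blast
    then have "m \<in> seq_mult M (take (Suc i) xs)" using y(2) p(2) L(4) by simp
    then obtain t n where t: "t \<in> seq_mult M (take i xs)" "n \<in> carrier M" "m = t \<oplus>\<^bsub>M\<^esub> (xs ! i) \<odot>\<^bsub>M\<^esub> n" unfolding S by blast
    then have tc: "t \<in> carrier M" using sub(1) by blast
    have "y = lproj M xs i t \<oplus>\<^bsub>level M xs i\<^esub> lproj M xs i ((xs ! i) \<odot>\<^bsub>M\<^esub> n)"
      using t m tc M x by (simp add: lin_add[OF L(2)])
    also have "lproj M xs i t = \<zero>\<^bsub>level M xs i\<^esub>" using t(1) tc L(4) by simp
    finally have "y = (xs ! i) \<odot>\<^bsub>level M xs i\<^esub> lproj M xs i n"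
      using sm[OF t(2)] L(1) lin_closed[OF L(2)] M x t(2) by simp
    then show "\<exists>n\<in>carrier (level M xs i). y = (xs ! i) \<odot>\<^bsub>level M xs i\<^esub> n" using lin_closed[OF L(2) t(2)] by blast
  next
    fix y assume y: "y \<in> carrier (level M xs i)"
    then obtain m where m: "m \<in> carrier M" "y = lproj M xs i m" using level_surjD[OF M xc] by blast
    have "(xs ! i) \<odot>\<^bsub>M\<^esub> m = \<zero>\<^bsub>M\<^esub> \<oplus>\<^bsub>M\<^esub> (xs ! i) \<odot>\<^bsub>M\<^esub> m" using M x m by simp
    then have "(xs ! i) \<odot>\<^bsub>M\<^esub> m \<in> seq_mult M (take (Suc i) xs)" unfolding S using sub(2) m(1) by blast
    then show "\<pi> ((xs ! i) \<odot>\<^bsub>level M xs i\<^esub> y) = \<zero>\<^bsub>level M xs (Suc i)\<^esub>"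
      using m sm p(2) L(4) M x by simp
    assume "(xs ! i) \<odot>\<^bsub>level M xs i\<^esub> y = \<zero>\<^bsub>level M xs i\<^esub>"
    then have "(xs ! i) \<odot>\<^bsub>M\<^esub> m \<in> seq_mult M (take i xs)" using m sm L(4) M x by simp
    then show "y = \<zero>\<^bsub>level M xs i\<^esub>" using wregD[OF xs i m(1)] L(4) m by simp
  qed
  then show ?thesis using p(2) by blast
qed

lemma level_killed:
  assumes M: "module R M" and xs: "set xs \<subseteq> carrier R" and x: "x \<in> set (take i xs)" and y: "y \<in> carrier (level M xs i)"
  shows "x \<odot>\<^bsub>level M xs i\<^esub> y = \<zero>\<^bsub>level M xs i\<^esub>"
proof -
  note L = level_props[OF M xs]
  have xc: "set (take i xs) \<subseteq> carrier R" using xs set_take_subset[of i xs] by auto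
  obtain m where m: "m \<in> carrier M" "y = lproj M xs i m" using level_surjD[OF M xs y] by blast
  have "x \<odot>\<^bsub>level M xs i\<^esub> y = lproj M xs i (x \<odot>\<^bsub>M\<^esub> m)" using lin_smult[OF L(2)] m x xc by auto
  moreover have "x \<odot>\<^bsub>M\<^esub> m \<in> carrier M" using M m(1) x xc by auto
  ultimately show ?thesis using L(4)[of "x \<odot>\<^bsub>M\<^esub> m" i] seq_mult_gen[OF M xc x m(1)] by simp
qed

lemma lproj0_inj:
  assumes M: "module R M" and xs: "set xs \<subseteq> carrier R" and m: "m \<in> carrier M" "lproj M xs 0 m = \<zero>\<^bsub>level M xs 0\<^esub>"
  shows "m = \<zero>\<^bsub>M\<^esub>"
  using level_props(4)[OF M xs m(1), of 0] m(2) seq_mult_Nil[OF M] by simp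

lemma level_noeth: "noeth M \<Longrightarrow> set xs \<subseteq> carrier R \<Longrightarrow> noeth (level M xs i)"
  using noeth_surj[OF _ level_module lproj_lin lproj_surj] noeth_module by blast

lemma ann_lproj0:
  assumes M: "module R M" and xs: "set xs \<subseteq> carrier R" and m: "m \<in> carrier M"
  shows "annihilator R (level M xs 0) (lproj M xs 0 m) = annihilator R M m"
proof -
  note L = level_props[OF M xs]
  have "r \<odot>\<^bsub>level M xs 0\<^esub> lproj M xs 0 m = \<zero>\<^bsub>level M xs 0\<^esub> \<longleftrightarrow> r \<odot>\<^bsub>M\<^esub> m = \<zero>\<^bsub>M\<^esub>" if "r \<in> carrier R" for r
    using lin_smult[OF L(2) that m, of 0] lproj0_inj[OF M xs, of "r \<odot>\<^bsub>M\<^esub> m"] lin_zero[OF L(2) M L(1), of 0] M m that by auto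
  then show ?thesis by (auto simp: annihilator_def)
qed

text \<open>Strict chains of \<open>r + 1\<close> primes beginning with \<open>p\<close>; \<open>chain_down\<close> is the same with the last prime prescribed.\<close>

definition chain_up :: "nat \<Rightarrow> 'a set \<Rightarrow> bool" where
  "chain_up r p \<longleftrightarrow> (\<exists>P :: nat \<Rightarrow> 'a set. P 0 = p \<and> (\<forall>i \<le> r. primeideal (P i) R) \<and> (\<forall>i < r. P i \<subset> P (Suc i)))"

definition chain_down :: "nat \<Rightarrow> 'a set \<Rightarrow> bool" where
  "chain_down r q \<longleftrightarrow> (\<exists>P :: nat \<Rightarrow> 'a set. P r = q \<and> (\<forall>i \<le> r. primeideal (P i) R) \<and> (\<forall>i < r. P i \<subset> P (Suc i)))"

lemma chain_up_Suc:
  assumes "primeideal p R" "p \<subset> q" "chain_up r q" shows "chain_up (Suc r) p"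
proof -
  obtain P where P: "P 0 = q" "\<forall>i \<le> r. primeideal (P i) R" "\<forall>i < r. P i \<subset> P (Suc i)"
    using assms(3) unfolding chain_up_def by blast
  show ?thesis unfolding chain_up_def
    by (rule exI[of _ "case_nat p P"]) (use P assms(1,2) in \<open>auto split: nat.splits\<close>)
qed

lemma chain_down_Suc:
  assumes "primeideal q R" "p \<subset> q" "chain_down r p" shows "chain_down (Suc r) q"
proof -
  obtain P where P: "P r = p" "\<forall>i \<le> r. primeideal (P i) R" "\<forall>i < r. P i \<subset> P (Suc i)"
    using assms(3) unfolding chain_down_def by blast
  show ?thesis unfolding chain_down_def
    by (rule exI[of _ "P(Suc r := q)"]) (use P assms(1,2) in \<open>auto simp: le_Suc_eq less_Suc_eq\<close>)
qed

lemma chain_dim_ge: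
  assumes "\<forall>i \<le> r. P i \<in> S" "\<forall>i < r. P i \<subset> P (Suc i)" shows "enat r \<le> chain_dim S"
  unfolding chain_dim_def using assms by (intro Sup_upper) blast

lemma chain_mono:
  assumes "\<forall>i < r. P i \<subset> P (Suc i)" "i \<le> r" shows "P 0 \<subseteq> (P i :: 'x set)"
  using assms(2)
proof (induct i)
  case (Suc i)
  then have "P i \<subset> P (Suc i)" using assms(1) by simp
  then show ?case using Suc by auto
qed simp

lemma chain_up_dim:
  assumes "chain_up r p" "\<And>q. primeideal q R \<Longrightarrow> p \<subseteq> q \<Longrightarrow> q \<in> S" shows "enat r \<le> chain_dim S"
proof -
  obtain P where P: "P 0 = p" "\<forall>i \<le> r. primeideal (P i) R" "\<forall>i < r. P i \<subset> P (Suc i)"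
    using assms(1) unfolding chain_up_def by blast
  show ?thesis using P chain_mono[OF P(3)] assms(2) by (intro chain_dim_ge[of r P]) auto
qed

lemma chain_up_krull: "chain_up r p \<Longrightarrow> enat r \<le> krull_dim R"
  unfolding krull_dim_def by (rule chain_up_dim) (auto simp: spec_def)

lemma chain_down_krull: "chain_down r p \<Longrightarrow> enat r \<le> krull_dim R"
  unfolding krull_dim_def chain_down_def spec_def by (metis (mono_tags, lifting) chain_dim_ge mem_Collect_eq)

lemma chain_dim_mono: "S \<subseteq> T \<Longrightarrow> chain_dim S \<le> chain_dim T"
  unfolding chain_dim_def by (rule Sup_subset_mono) blast

end

context noeth_local
begin

text \<open>Every step of the sequence moves an associated prime to a strictly larger one, by \<open>reg_step_up\<close>.\<close>

lemma ass_chain_up: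
  assumes M: "noeth M" and xs: "wreg M xs" "set xs \<subseteq> mx" and p: "p \<in> associated_points R M"
  shows "chain_up (length xs) p"
proof -
  note M' = noeth_module[OF M] and xc = wreg_carr[OF xs(1)]
  have "\<forall>p \<in> associated_points R (level M xs i). chain_up (length xs - i) p" if "i \<le> length xs" for i
    using that
  proof (induct i rule: inc_induct)
    case base
    show ?case unfolding chain_up_def associated_points_def spec_def by (auto intro!: exI)
  next
    case (step i)
    obtain \<pi> where r: "reg_step (xs ! i) (level M xs i) (level M xs (Suc i)) \<pi>" using level_step[OF M' xs(1) step(2)] by blast
    have x: "xs ! i \<in> mx" using xs(2) step(2) nth_mem by blast
    show ?case
    proof
      fix p assume p: "p \<in> associated_points R (level M xs i)"
      obtain q where q: "q \<in> associated_points R (level M xs (Suc i))" "p \<subset> q"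
        using reg_step_up[OF r x level_noeth[OF M xc] p] by blast
      have "primeideal p R" using p by (simp add: associated_points_def spec_def)
      then have "chain_up (Suc (length xs - Suc i)) p" using chain_up_Suc q step(3) by blast
      then show "chain_up (length xs - i) p" using step(2) by (simp add: Suc_diff_Suc)
    qed
  qed
  from this[of 0] have "\<And>p. p \<in> associated_points R (level M xs 0) \<Longrightarrow> chain_up (length xs) p" by simp
  moreover have "p \<in> associated_points R (level M xs 0)"
    using p ann_lproj0[OF M' xc] lin_closed[OF lproj_lin[OF M' xc, of 0]] unfolding associated_points_def by fastforce
  ultimately show ?thesis by blast
qed

text \<open>Every step back in the sequence gives a strictly smaller prime, by \<open>reg_step_down\<close>.\<close>

lemma support_chain_down:
  assumes M: "module R M" and xs: "wreg M xs" and i: "i \<le> length xs"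
    and y: "y \<in> carrier (level M xs i)" and q: "primeideal q R" "annihilator R (level M xs i) y \<subseteq> q"
  shows "chain_down i q"
  using i y q
proof (induct i arbitrary: q y)
  case 0
  then show ?case unfolding chain_down_def by (auto intro!: exI[of _ "\<lambda>_. q"])
next
  case (Suc i)
  obtain \<pi> where r: "reg_step (xs ! i) (level M xs i) (level M xs (Suc i)) \<pi>" using level_step[OF M xs, of i] Suc(2) by auto
  obtain p where p: "p \<in> associated_points R (level M xs i)" "p \<subset> q"
    using reg_step_down[OF noeth_R r Suc(3-5)] by blast
  then obtain z where "z \<in> carrier (level M xs i)" "p = annihilator R (level M xs i) z" "primeideal p R"
    unfolding associated_points_def spec_def by blast
  then have "chain_down i p" using Suc(1)[of z p] Suc(2) by simp
  then show ?case using chain_down_Suc[OF Suc(4) p(2)] by simp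
qed

text \<open>A regular sequence of length \<open>dim R\<close> is a system of parameters: below a prime that contains it there is a chain of length
  \<open>dim R\<close>, so there is no room for the maximal ideal above it.\<close>

lemma prime_contains_sop:
  assumes d: "krull_dim R = enat d" and xs: "wreg (self_module R) xs" "length xs = d"
    and q: "primeideal q R" "set xs \<subseteq> q"
  shows "q = mx"
proof (rule ccontr)
  note xc = wreg_carr[OF xs(1)] and S = self_is_module
  note L = level_props[OF S xc]
  assume "q \<noteq> mx"
  then have qm: "q \<subset> mx" using prime_sub_mx[OF q(1)] by blast
  interpret q: primeideal q R by fact
  let ?y = "lproj (self_module R) xs d \<one>"
  have "annihilator R (level (self_module R) xs d) ?y \<subseteq> q"
  proof
    fix r assume r: "r \<in> annihilator R (level (self_module R) xs d) ?y"
    then have rc: "r \<in> carrier R" by (simp add: annihilator_def)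
    have "r \<odot>\<^bsub>level (self_module R) xs d\<^esub> ?y = lproj (self_module R) xs d r"
      using lin_smult[OF L(2), of r \<one> d] rc by simp
    then have "r \<in> seq_mult (self_module R) xs" using r L(4)[of r d] rc xs(2) by (simp add: annihilator_def)
    moreover have "seq_mult (self_module R) xs \<subseteq> q"
      using q(2) by (intro seq_mult_least[OF S xc]) (auto simp: self_submodule_iff q.ideal_axioms q.I_r_closed subset_iff)
    ultimately show "r \<in> q" by blast
  qed
  then have "chain_down d q" using support_chain_down[OF S xs(1), of d ?y q] xs(2) lin_closed[OF L(2), of \<one> d] q(1) by simp
  then have "enat (Suc d) \<le> enat d" using chain_down_krull chain_down_Suc[OF mx_prime qm] d by metis
  then show False by simp
qed

text \<open>Below the supremum there is a regular sequence of at least the required length, and it can be cut off.\<close>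

lemma depth_ge:
  assumes "enat r \<le> depth R M" shows "\<exists>xs. length xs = r \<and> set xs \<subseteq> mx \<and> wreg M xs"
proof (cases r)
  case 0
  then show ?thesis by (auto simp: wreg_def)
next
  case (Suc k)
  then have "enat k < depth R M" using assms by (metis enat_ord_simps(2) lessI order_less_le_trans)
  then obtain e where e: "e \<in> {enat (length xs) | xs. set xs \<subseteq> mx \<and> regular_sequence R M xs}" "enat k < e"
    unfolding depth_def less_Sup_iff by blast
  then obtain xs where xs: "set xs \<subseteq> mx" "regular_sequence R M xs" "k < length xs" by auto
  then have "length (take r xs) = r \<and> set (take r xs) \<subseteq> mx \<and> wreg M (take r xs)"
    using Suc wreg_take[of M xs r] set_take_subset[of r xs] regular_sequence_iff[of M xs] by auto
  then show ?thesis by blast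
qed

lemma generic_in_ass:
  assumes "p \<in> generic_points R" shows "p \<in> associated_points R (self_module R)"
proof -
  have p: "primeideal p R" "\<And>q. primeideal q R \<Longrightarrow> q \<subseteq> p \<Longrightarrow> q = p" using assms by (auto simp: generic_points_def spec_def)
  interpret primeideal p R by (rule p(1))
  have "annihilator R (self_module R) \<one> \<subseteq> p" by (auto simp: annihilator_def)
  then obtain q where "q \<in> associated_points R (self_module R)" "q \<subseteq> p"
    using ass_below[OF noeth_R self_is_module _ p(1), of \<one>] by auto
  then show ?thesis using p(2) by (auto simp: associated_points_def spec_def)
qed

text \<open>An associated prime of a torsion free module is minimal, hence it is associated to \<open>R\<close>, and there is a chain of primes of
  length \<open>dim R\<close> above it. So the support of \<open>M\<close> has full dimension, and so has its depth if \<open>M\<close> is Cohen--Macaulay.\<close>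

lemma torsion_free_cm_depth:
  assumes xs: "wreg (self_module R) xs" "set xs \<subseteq> mx"
    and M: "module R M" "torsion_free R M" "cohen_macaulay R M" "carrier M \<noteq> {\<zero>\<^bsub>M\<^esub>}"
  shows "enat (length xs) \<le> depth R M"
proof -
  obtain y where y: "y \<in> carrier M" "y \<noteq> \<zero>\<^bsub>M\<^esub>" using M(4) mod_closed(1)[OF M(1)] by blast
  obtain r where r: "r \<in> carrier R" "primeideal (annihilator R M (r \<odot>\<^bsub>M\<^esub> y)) R" using ass_above[OF noeth_R M(1) y] by blast
  let ?p = "annihilator R M (r \<odot>\<^bsub>M\<^esub> y)"
  have ry: "r \<odot>\<^bsub>M\<^esub> y \<in> carrier M" using M(1) r y by simp
  have "?p \<in> associated_points R M" unfolding associated_points_def spec_def using r(2) ry by blast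
  then have "?p \<in> associated_points R (self_module R)" using M(2) generic_in_ass unfolding torsion_free_def by blast
  then have "chain_up (length xs) ?p" by (rule ass_chain_up[OF noeth_R xs])
  then have "enat (length xs) \<le> module_dim R M" unfolding module_dim_def
    by (rule chain_up_dim) (use ry in \<open>auto simp: support_def spec_def\<close>)
  then show ?thesis using M(3,4) by (simp add: cohen_macaulay_def)
qed

text \<open>By Nakayama's lemma, applied to the entries from the last to the first.\<close>

lemma seq_mult_proper:
  assumes M: "noeth M" "carrier M \<noteq> {\<zero>\<^bsub>M\<^esub>}" and xs: "set xs \<subseteq> mx"
  shows "seq_mult M xs \<noteq> carrier M"
proof
  assume e: "seq_mult M xs = carrier M"
  note M' = noeth_module[OF M(1)]
  have xc: "set xs \<subseteq> carrier R" using xs mx_sub by blast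
  have "carrier M \<subseteq> seq_mult M (take i xs)" if "i \<le> length xs" for i
    using that
  proof (induct i rule: inc_induct)
    case base
    then show ?case using e by simp
  next
    case (step i)
    have "xs ! i \<in> mx" using xs step(2) nth_mem by blast
    moreover have "\<exists>v\<in>seq_mult M (take i xs). \<exists>k'\<in>carrier M. k = v \<oplus>\<^bsub>M\<^esub> (xs ! i) \<odot>\<^bsub>M\<^esub> k'" if "k \<in> carrier M" for k
      using step(3) seq_mult_take_Suc[OF M' xc step(2)] that by blast
    ultimately show ?case
      by (intro nakayama[OF M(1) submod_whole[OF M'] seq_mult_take_submodule[OF M' xc]]) auto
  qed
  from this[of 0] show False using M(2) seq_mult_Nil[OF M'] mod_closed(1)[OF M'] by auto
qed

text \<open>The converse of \<open>torsion_free_cm_depth\<close>. Chains of length \<open>dim R\<close> start at every associated prime, which is therefore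
  minimal, and the dimension of the support lies between the depth and \<open>dim R\<close>.\<close>

lemma maximal_depth_imp_torsion_free_cm:
  assumes d: "krull_dim R = enat (length xs)" and xs: "set xs \<subseteq> mx" and M: "noeth M" "wreg M xs"
  shows "torsion_free R M" "cohen_macaulay R M"
proof -
  note M' = noeth_module[OF M(1)]
  show tf: "torsion_free R M" unfolding torsion_free_def
  proof
    fix p assume p: "p \<in> associated_points R M"
    then have up: "chain_up (length xs) p" by (rule ass_chain_up[OF M xs])
    have "q = p" if "primeideal q R" "q \<subseteq> p" for q
    proof (rule ccontr)
      assume "q \<noteq> p"
      then have "chain_up (Suc (length xs)) q" using chain_up_Suc[OF that(1) _ up] that(2) by blast
      then show False using chain_up_krull d by fastforce
    qed
    then show "p \<in> generic_points R" using p by (auto simp: generic_points_def associated_points_def spec_def)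
  qed
  show "cohen_macaulay R M"
  proof (cases "carrier M = {\<zero>\<^bsub>M\<^esub>}")
    case False
    obtain y where y: "y \<in> carrier M" "y \<noteq> \<zero>\<^bsub>M\<^esub>" using False mod_closed(1)[OF M'] by blast
    obtain r where r: "r \<in> carrier R" "primeideal (annihilator R M (r \<odot>\<^bsub>M\<^esub> y)) R" using ass_above[OF noeth_R M' y] by blast
    let ?p = "annihilator R M (r \<odot>\<^bsub>M\<^esub> y)"
    have ry: "r \<odot>\<^bsub>M\<^esub> y \<in> carrier M" using M' r y by simp
    have p: "?p \<in> associated_points R M" unfolding associated_points_def spec_def using r(2) ry by blast
    have "regular_sequence R M xs" using M(2) seq_mult_proper[OF M(1) False xs] regular_sequence_iff by blast
    then have 1: "enat (length xs) \<le> depth R M" unfolding depth_def using xs by (intro Sup_upper) blast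
    have "enat (length ys) \<le> module_dim R M" if "set ys \<subseteq> mx" "regular_sequence R M ys" for ys
      unfolding module_dim_def
      by (rule chain_up_dim[OF ass_chain_up[OF M(1) _ that(1) p]])
        (use ry that(2) regular_sequence_iff in \<open>auto simp: support_def spec_def\<close>)
    then have 2: "depth R M \<le> module_dim R M" unfolding depth_def by (intro Sup_least) auto
    have 3: "module_dim R M \<le> enat (length xs)"
      unfolding module_dim_def d[symmetric] krull_dim_def by (rule chain_dim_mono) (auto simp: support_def)
    have "depth R M = module_dim R M" using 1 2 3 by (meson antisym order_trans)
    then show ?thesis by (simp add: cohen_macaulay_def)
  qed (simp add: cohen_macaulay_def)
qed

lemma cm_ring_depth:
  assumes "cohen_macaulay_ring R" shows "depth R (self_module R) = krull_dim R"
proof -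
  have "carrier (self_module R) \<noteq> {\<zero>\<^bsub>self_module R\<^esub>}"
  proof
    assume "carrier (self_module R) = {\<zero>\<^bsub>self_module R\<^esub>}"
    then have "\<one> = \<zero>" using one_closed by (simp only: self_simps) blast
    then show False using one_notin_mx mx_zero by simp
  qed
  then have "depth R (self_module R) = module_dim R (self_module R)"
    using assms by (simp add: cohen_macaulay_ring_def cohen_macaulay_def)
  moreover have "support R (self_module R) = spec R"
  proof -
    have "annihilator R (self_module R) \<one> \<subseteq> p" if "primeideal p R" for p
    proof -
      interpret primeideal p R by fact
      show ?thesis by (auto simp: annihilator_def)
    qed
    then show ?thesis unfolding support_def spec_def by (auto intro!: bexI[of _ \<one>])
  qed
  ultimately show ?thesis by (simp add: module_dim_def krull_dim_def)
qed

lemma prime_not_containing: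
  assumes p: "primeideal p R" and Q: "finite \<Q>" "\<And>Q. Q \<in> \<Q> \<Longrightarrow> ideal Q R \<and> \<not> Q \<subseteq> p"
  shows "\<exists>z \<in> carrier R. z \<notin> p \<and> (\<forall>Q \<in> \<Q>. z \<in> Q)"
  using Q
proof (induct \<Q>)
  case empty
  interpret primeideal p R by fact
  show ?case using I_notcarr a_subset by blast
next
  case (insert Q \<Q>)
  interpret p: primeideal p R by fact
  obtain z where z: "z \<in> carrier R" "z \<notin> p" "\<forall>Q \<in> \<Q>. z \<in> Q" using insert by blast
  interpret Q: ideal Q R using insert by blast
  obtain w where w: "w \<in> Q" "w \<notin> p" using insert by blast
  have wc: "w \<in> carrier R" using w Q.a_subset by blast
  have "z \<otimes> w \<notin> p" using p.I_prime[OF z(1) wc] z w by blast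
  moreover have "z \<otimes> w \<in> Q" using Q.I_l_closed[OF w(1) z(1)] .
  moreover have "z \<otimes> w \<in> Q'" if "Q' \<in> \<Q>" for Q'
    using ideal.I_r_closed[of Q' R z w] z(3) wc that insert(4) by blast
  ultimately show ?case using z wc by blast
qed

text \<open>A prime contained in another member of the family can be dropped. If there is none, take \<open>x\<close> avoiding all primes but \<open>p\<close>; if \<open>x\<close> lies
  in \<open>p\<close>, add an element of the maximal ideal and all other primes that is not in \<open>p\<close>.\<close>

lemma prime_avoidance:
  assumes "finite \<P>" "\<And>p. p \<in> \<P> \<Longrightarrow> primeideal p R \<and> p \<noteq> mx"
  shows "\<exists>x \<in> mx. \<forall>p \<in> \<P>. x \<notin> p"
  using assms
proof (induct "card \<P>" arbitrary: \<P> rule: less_induct)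
  case less
  show ?case
  proof (cases "\<exists>p \<in> \<P>. \<exists>q \<in> \<P>. q \<noteq> p \<and> q \<subseteq> p")
    case True
    then obtain p q where pq: "p \<in> \<P>" "q \<in> \<P>" "q \<noteq> p" "q \<subseteq> p" by blast
    obtain x where x: "x \<in> mx" "\<forall>p \<in> \<P> - {q}. x \<notin> p"
      using less(1)[of "\<P> - {q}"] less(2,3) pq(2) card_Diff1_less by (metis DiffD1 finite_Diff)
    then show ?thesis using pq by blast
  next
    case False
    show ?thesis
    proof (cases "\<P> = {}")
      case True
      then show ?thesis using mx_zero by blast
    next
      case ne: False
      then obtain p where p: "p \<in> \<P>" by blast
      obtain x where x: "x \<in> mx" "\<forall>q \<in> \<P> - {p}. x \<notin> q"
        using less(1)[of "\<P> - {p}"] less(2,3) p card_Diff1_less by (metis DiffD1 finite_Diff)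
      show ?thesis
      proof (cases "x \<in> p")
        case True
        have pp: "primeideal p R" using less p by blast
        have "\<not> mx \<subseteq> p" using prime_sub_mx[OF pp] less(3)[OF p] by blast
        then have "ideal Q R \<and> \<not> Q \<subseteq> p" if "Q \<in> insert mx (\<P> - {p})" for Q
          using that False p mx_ideal less(3) primeideal.axioms(1) by blast
        then obtain z where z: "z \<in> carrier R" "z \<notin> p" "\<forall>Q \<in> insert mx (\<P> - {p}). z \<in> Q"
          using prime_not_containing[OF pp, of "insert mx (\<P> - {p})"] less(2) by blast
        have xz: "x \<oplus> z \<in> mx" using mx_add x(1) z(3) by blast
        have "x \<oplus> z \<notin> q" if q: "q \<in> \<P>" for q
        proof
          assume s: "x \<oplus> z \<in> q"
          interpret q: primeideal q R using less q by blast
          have c: "x \<in> carrier R" "z \<in> carrier R" using x(1) z(1) mx_carr by auto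
          show False
          proof (cases "q = p")
            case True
            then have "(x \<oplus> z) \<oplus> \<ominus> x \<in> p" using s \<open>x \<in> p\<close> q.a_closed q.a_inv_closed by blast
            moreover have "(x \<oplus> z) \<oplus> \<ominus> x = z" using c by algebra
            ultimately show False using z(2) by simp
          next
            case False
            then have "(x \<oplus> z) \<oplus> \<ominus> z \<in> q" using s z(3) q q.a_closed q.a_inv_closed by blast
            moreover have "(x \<oplus> z) \<oplus> \<ominus> z = x" using c by algebra
            ultimately show False using x(2) q False by simp
          qed
        qed
        then show ?thesis using xz by blast
      qed (use x in blast)
    qed
  qed
qed

text \<open>Consider the elements \<open>?Y\<close> with maximal annihilator; these annihilators are prime, and every zero divisor lies in one of
  them. By the noetherian property, finitely many elements \<open>A\<close> of \<open>?Y\<close> generate the submodule spanned by \<open>?Y\<close>. If the annihilator of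
  some \<open>y\<close> in \<open>?Y\<close> were different from those of the elements of \<open>A\<close>, an element outside it would kill \<open>A\<close>, hence kill \<open>y\<close>.\<close>

lemma zero_divisors_finite_union:
  assumes M: "noeth M"
  shows "\<exists>\<P>. finite \<P> \<and> \<P> \<subseteq> associated_points R M \<and>
    (\<forall>a \<in> carrier R. \<forall>y \<in> carrier M. y \<noteq> \<zero>\<^bsub>M\<^esub> \<longrightarrow> a \<odot>\<^bsub>M\<^esub> y = \<zero>\<^bsub>M\<^esub> \<longrightarrow> (\<exists>p \<in> \<P>. a \<in> p))"
proof -
  note M' = noeth_module[OF M]
  let ?Y = "{y \<in> carrier M. y \<noteq> \<zero>\<^bsub>M\<^esub> \<and> (\<forall>z \<in> carrier M. z \<noteq> \<zero>\<^bsub>M\<^esub> \<longrightarrow>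
     annihilator R M y \<subseteq> annihilator R M z \<longrightarrow> annihilator R M z = annihilator R M y)}"
  have prime: "primeideal (annihilator R M y) R" if y: "y \<in> ?Y" for y
  proof (rule primeideal_annI[OF M'])
    fix a assume a: "a \<in> carrier R" "a \<notin> annihilator R M y"
    then have "a \<odot>\<^bsub>M\<^esub> y \<noteq> \<zero>\<^bsub>M\<^esub>" "a \<odot>\<^bsub>M\<^esub> y \<in> carrier M" using y M' by (auto simp: annihilator_def)
    then show "annihilator R M (a \<odot>\<^bsub>M\<^esub> y) \<subseteq> annihilator R M y" using y ann_mono[OF M' _ a(1)] by blast
  qed (use y in auto)
  let ?F = "{N. submodule N R M \<and> (\<exists>A. finite A \<and> A \<subseteq> ?Y \<and> (\<forall>L. submodule L R M \<longrightarrow> A \<subseteq> L \<longrightarrow> N \<subseteq> L))}"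
  have ne: "?F \<noteq> {}"
  proof -
    have "{\<zero>\<^bsub>M\<^esub>} \<in> ?F" using submod_zero[OF M'] submodule_closed(2)[OF M'] by (auto intro!: exI[of _ "{}"])
    then show ?thesis by blast
  qed
  have "\<exists>N \<in> ?F. \<forall>L \<in> ?F. N \<subseteq> L \<longrightarrow> L = N" by (rule noeth_maximal[OF M ne]) simp
  then obtain N where N0: "N \<in> ?F" "\<forall>L \<in> ?F. N \<subseteq> L \<longrightarrow> L = N" by blast
  obtain A where A: "finite A" "A \<subseteq> ?Y" "\<forall>L. submodule L R M \<longrightarrow> A \<subseteq> L \<longrightarrow> N \<subseteq> L" using N0(1) by blast
  have N: "submodule N R M" using N0(1) by blast
  note Nc = submodule_closed[OF M' N]
  have YN: "y \<in> N" if y: "y \<in> ?Y" for y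
  proof -
    let ?L = "{n \<oplus>\<^bsub>M\<^esub> l | n l. n \<in> N \<and> l \<in> {r \<odot>\<^bsub>M\<^esub> y | r. r \<in> carrier R}}"
    have yc: "y \<in> carrier M" using y by simp
    have L: "submodule ?L R M" by (rule submod_sum[OF M' N submod_span1[OF M' yc]])
    have sub: "?L \<subseteq> K" if K: "submodule K R M" "insert y A \<subseteq> K" for K
      using A(3) K submodule_closed(3,5)[OF M' K(1)] by blast
    have "\<exists>A'. finite A' \<and> A' \<subseteq> ?Y \<and> (\<forall>K. submodule K R M \<longrightarrow> A' \<subseteq> K \<longrightarrow> ?L \<subseteq> K)"
    proof (intro exI conjI allI impI)
      show "finite (insert y A)" using A(1) by simp
      show "insert y A \<subseteq> ?Y" using A(2) y by blast
    qed (rule sub)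
    then have LF: "?L \<in> ?F" using L by (intro CollectI conjI)
    have NL: "N \<subseteq> ?L"
    proof
      fix n assume n: "n \<in> N"
      then have "n = n \<oplus>\<^bsub>M\<^esub> \<zero> \<odot>\<^bsub>M\<^esub> y" using yc M' Nc(1) by auto
      then show "n \<in> ?L" using n by blast
    qed
    have LN: "?L = N" using N0(2)[rule_format, OF LF NL] .
    have "y = \<zero>\<^bsub>M\<^esub> \<oplus>\<^bsub>M\<^esub> \<one> \<odot>\<^bsub>M\<^esub> y" using yc M' by simp
    then have "y \<in> ?L" using Nc(2) by blast
    then show ?thesis unfolding LN .
  qed
  have ann: "\<exists>a \<in> A. annihilator R M y = annihilator R M a" if y: "y \<in> ?Y" for y
  proof (rule ccontr)
    assume n: "\<not> ?thesis"
    have "ideal Q R \<and> \<not> Q \<subseteq> annihilator R M y" if "Q \<in> annihilator R M ` A" for Q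
    proof -
      obtain a where a: "a \<in> A" "Q = annihilator R M a" using \<open>Q \<in> annihilator R M ` A\<close> by blast
      have aY: "a \<in> ?Y" using a A(2) by blast
      then have "\<not> Q \<subseteq> annihilator R M y" using n a y by auto
      then show ?thesis using ann_ideal[OF M'] a(2) aY by simp
    qed
    then obtain z where z: "z \<in> carrier R" "z \<notin> annihilator R M y" "\<forall>Q \<in> annihilator R M ` A. z \<in> Q"
      using prime_not_containing[OF prime[OF y], of "annihilator R M ` A"] A(1) by blast
    have "submodule {m \<in> carrier M. z \<odot>\<^bsub>M\<^esub> m = \<zero>\<^bsub>M\<^esub>} R M" by (rule submod_ker[OF M' M' lin_mult[OF M' z(1)]])
    moreover have "A \<subseteq> {m \<in> carrier M. z \<odot>\<^bsub>M\<^esub> m = \<zero>\<^bsub>M\<^esub>}" using A(2) z(3) by (auto simp: annihilator_def)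
    ultimately have "N \<subseteq> {m \<in> carrier M. z \<odot>\<^bsub>M\<^esub> m = \<zero>\<^bsub>M\<^esub>}" using A(3) by blast
    then show False using YN[OF y] z(1,2) by (auto simp: annihilator_def)
  qed
  have "\<exists>p \<in> annihilator R M ` A. a \<in> p" if a: "a \<in> carrier R" and y: "y \<in> carrier M" "y \<noteq> \<zero>\<^bsub>M\<^esub>" "a \<odot>\<^bsub>M\<^esub> y = \<zero>\<^bsub>M\<^esub>" for a y
  proof -
    let ?G = "{annihilator R M z | z. z \<in> carrier M \<and> z \<noteq> \<zero>\<^bsub>M\<^esub> \<and> annihilator R M y \<subseteq> annihilator R M z}"
    have G1: "?G \<noteq> {}" using y by blast
    have G2: "submodule K R (self_module R)" if "K \<in> ?G" for K
      using that ann_ideal[OF M'] self_submodule_iff by fastforce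
    have "\<exists>K \<in> ?G. \<forall>L \<in> ?G. K \<subseteq> L \<longrightarrow> L = K" by (rule noeth_maximal[OF noeth_R G1 G2])
    then obtain K where K: "K \<in> ?G" "\<forall>L \<in> ?G. K \<subseteq> L \<longrightarrow> L = K" by blast
    obtain z where z: "z \<in> carrier M" "z \<noteq> \<zero>\<^bsub>M\<^esub>" "annihilator R M y \<subseteq> annihilator R M z" "K = annihilator R M z" using K(1) by blast
    have "annihilator R M w = annihilator R M z"
      if "w \<in> carrier M" "w \<noteq> \<zero>\<^bsub>M\<^esub>" "annihilator R M z \<subseteq> annihilator R M w" for w
      using that K(2)[rule_format, of "annihilator R M w"] z(3,4) by auto
    then have "z \<in> ?Y" using z by simp
    then obtain b where "b \<in> A" "annihilator R M z = annihilator R M b" using ann by blast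
    moreover have "a \<in> annihilator R M z" using z(3) a y(3) by (auto simp: annihilator_def)
    ultimately show ?thesis by blast
  qed
  moreover have "annihilator R M ` A \<subseteq> associated_points R M"
    using A(2) prime by (auto simp: associated_points_def spec_def)
  ultimately show ?thesis using A(1) by (intro exI[of _ "annihilator R M ` A"]) blast
qed

definition no_socle :: "('a, 'm) module \<Rightarrow> bool" where
  "no_socle M \<longleftrightarrow> (\<forall>y \<in> carrier M. (\<forall>a \<in> mx. a \<odot>\<^bsub>M\<^esub> y = \<zero>\<^bsub>M\<^esub>) \<longrightarrow> y = \<zero>\<^bsub>M\<^esub>)"

lemma no_socle_zero_divisors:
  assumes M: "noeth M" "no_socle M"
  shows "\<exists>\<P>. finite \<P> \<and> (\<forall>p \<in> \<P>. primeideal p R \<and> p \<noteq> mx) \<and>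
    (\<forall>a \<in> carrier R. \<forall>y \<in> carrier M. y \<noteq> \<zero>\<^bsub>M\<^esub> \<longrightarrow> a \<odot>\<^bsub>M\<^esub> y = \<zero>\<^bsub>M\<^esub> \<longrightarrow> (\<exists>p \<in> \<P>. a \<in> p))"
proof -
  obtain \<P> where P: "finite \<P>" "\<P> \<subseteq> associated_points R M"
    "\<forall>a \<in> carrier R. \<forall>y \<in> carrier M. y \<noteq> \<zero>\<^bsub>M\<^esub> \<longrightarrow> a \<odot>\<^bsub>M\<^esub> y = \<zero>\<^bsub>M\<^esub> \<longrightarrow> (\<exists>p \<in> \<P>. a \<in> p)"
    using zero_divisors_finite_union[OF M(1)] by blast
  have "mx \<notin> associated_points R M"
  proof
    assume "mx \<in> associated_points R M"
    then obtain y where y: "y \<in> carrier M" "mx = annihilator R M y" unfolding associated_points_def by blast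
    then have "a \<odot>\<^bsub>M\<^esub> y = \<zero>\<^bsub>M\<^esub>" if "a \<in> mx" for a using that by (simp add: annihilator_def)
    then have "y = \<zero>\<^bsub>M\<^esub>" using M(2) y(1) unfolding no_socle_def by blast
    then have "\<one> \<in> mx" unfolding y(2) using noeth_module[OF M(1)] by (simp add: annihilator_def)
    then show False using one_notin_mx by simp
  qed
  then have "primeideal p R \<and> p \<noteq> mx" if "p \<in> \<P>" for p
    using P(2) that by (auto simp: associated_points_def spec_def)
  then show ?thesis using P(1,3) by blast
qed

text \<open>The three modules will be the ring, the dualizing module and the module to be compared with it; one element has to serve them all.\<close>

lemma exists_regular_element:
  fixes M1 :: "('a, 'm1) module" and M2 :: "('a, 'm2) module" and M3 :: "('a, 'm3) module"
  assumes "noeth M1" "no_socle M1" "noeth M2" "no_socle M2" "noeth M3" "no_socle M3"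
  shows "\<exists>x \<in> mx. (\<forall>y \<in> carrier M1. x \<odot>\<^bsub>M1\<^esub> y = \<zero>\<^bsub>M1\<^esub> \<longrightarrow> y = \<zero>\<^bsub>M1\<^esub>) \<and>
    (\<forall>y \<in> carrier M2. x \<odot>\<^bsub>M2\<^esub> y = \<zero>\<^bsub>M2\<^esub> \<longrightarrow> y = \<zero>\<^bsub>M2\<^esub>) \<and>
    (\<forall>y \<in> carrier M3. x \<odot>\<^bsub>M3\<^esub> y = \<zero>\<^bsub>M3\<^esub> \<longrightarrow> y = \<zero>\<^bsub>M3\<^esub>)"
proof -
  obtain P1 where P1: "finite P1" "\<forall>p \<in> P1. primeideal p R \<and> p \<noteq> mx"
    "\<forall>a \<in> carrier R. \<forall>y \<in> carrier M1. y \<noteq> \<zero>\<^bsub>M1\<^esub> \<longrightarrow> a \<odot>\<^bsub>M1\<^esub> y = \<zero>\<^bsub>M1\<^esub> \<longrightarrow> (\<exists>p \<in> P1. a \<in> p)"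
    using no_socle_zero_divisors[OF assms(1,2)] by blast
  obtain P2 where P2: "finite P2" "\<forall>p \<in> P2. primeideal p R \<and> p \<noteq> mx"
    "\<forall>a \<in> carrier R. \<forall>y \<in> carrier M2. y \<noteq> \<zero>\<^bsub>M2\<^esub> \<longrightarrow> a \<odot>\<^bsub>M2\<^esub> y = \<zero>\<^bsub>M2\<^esub> \<longrightarrow> (\<exists>p \<in> P2. a \<in> p)"
    using no_socle_zero_divisors[OF assms(3,4)] by blast
  obtain P3 where P3: "finite P3" "\<forall>p \<in> P3. primeideal p R \<and> p \<noteq> mx"
    "\<forall>a \<in> carrier R. \<forall>y \<in> carrier M3. y \<noteq> \<zero>\<^bsub>M3\<^esub> \<longrightarrow> a \<odot>\<^bsub>M3\<^esub> y = \<zero>\<^bsub>M3\<^esub> \<longrightarrow> (\<exists>p \<in> P3. a \<in> p)"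
    using no_socle_zero_divisors[OF assms(5,6)] by blast
  obtain x where x: "x \<in> mx" "\<forall>p \<in> P1 \<union> P2 \<union> P3. x \<notin> p"
    using prime_avoidance[of "P1 \<union> P2 \<union> P3"] P1(1,2) P2(1,2) P3(1,2) by blast
  have xc: "x \<in> carrier R" using x(1) mx_carr by blast
  show ?thesis
    using x P1(3)[rule_format, OF xc] P2(3)[rule_format, OF xc] P3(3)[rule_format, OF xc] by blast
qed

end

section \<open>Vanishing of Ext of the residue field\<close>

context cring
begin

lemma lin_inverse:
  assumes M: "module R M" and N: "module R N" and f: "f \<in> lin M N" "f ` carrier M = carrier N"
    "\<And>x. x \<in> carrier M \<Longrightarrow> f x = \<zero>\<^bsub>N\<^esub> \<Longrightarrow> x = \<zero>\<^bsub>M\<^esub>"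
  shows "\<exists>h \<in> lin N M. (\<forall>y \<in> carrier N. f (h y) = y) \<and> (\<forall>x \<in> carrier M. h (f x) = x)"
proof -
  obtain h where h: "h \<in> lin N M" "\<forall>y \<in> carrier N. f (h y) = y"
    using lin_divide[OF N M N f(1,3) lin_id] f(2) by blast
  have "h (f x) = x" if "x \<in> carrier M" for x
    using inj_onD[OF inj_on_lin[OF M N f(1,3)], of "h (f x)" x] h lin_closed[OF h(1)] lin_closed[OF f(1)] that by simp
  then show ?thesis using h by blast
qed

end

context noeth_local
begin

abbreviation (input) rf :: "('a, 'a set) module" where "rf \<equiv> residue_field R"

lemma mx_submodule: "submodule mx R (self_module R)"
  using mx_ideal self_submodule_iff by blast

lemma rf_props:
  shows rf_module: "module R rf"
    and rf_lin: "(\<lambda>r. mx +>\<^bsub>self_module R\<^esub> r) \<in> lin (self_module R) rf"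
    and rf_surj: "(\<lambda>r. mx +>\<^bsub>self_module R\<^esub> r) ` carrier R = carrier rf"
    and rf_zero_iff: "r \<in> carrier R \<Longrightarrow> mx +>\<^bsub>self_module R\<^esub> r = \<zero>\<^bsub>rf\<^esub> \<longleftrightarrow> r \<in> mx"
  using quot_props[OF self_is_module mx_submodule] unfolding residue_field_def by auto

lemma rf_noeth: "noeth rf"
  using noeth_surj[OF noeth_R rf_module rf_lin] rf_surj by simp

text \<open>Choose covers by free modules of the successive kernels, which are finitely generated.\<close>

lemma free_resolution_exists:
  assumes M: "noeth M" shows "\<exists>n d e. free_resolution R M n d e"
proof -
  note M' = noeth_module[OF M]
  obtain g e where e: "e \<in> lin (Fr g) M" "e ` carrier (Fr g) = carrier M"
    using fg_sub_cover[OF M' submod_whole[OF M'] noeth_fg_sub[OF M submod_whole[OF M']]] by blast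
  let ?P = "\<lambda>(i::nat) (nK :: nat \<times> (nat \<Rightarrow> 'a) set). submodule (snd nK) R (Fr (fst nK)) \<and>
     (i = 0 \<longrightarrow> nK = (g, {x \<in> carrier (Fr g). e x = \<zero>\<^bsub>M\<^esub>}))"
  let ?Q = "\<lambda>(i::nat) nK nK'. \<exists>p \<in> lin (Fr (fst nK')) (Fr (fst nK)). p ` carrier (Fr (fst nK')) = snd nK \<and>
     snd nK' = {x \<in> carrier (Fr (fst nK')). p x = \<zero>\<^bsub>Fr (fst nK)\<^esub>}"
  have "\<exists>f. \<forall>i. ?P i (f i) \<and> ?Q i (f i) (f (Suc i))"
  proof (rule dependent_nat_choice)
    show "\<exists>nK. ?P 0 nK" using submod_ker[OF Fr_module M' e(1)] by auto
  next
    fix nK and i :: nat assume "?P i nK"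
    then have K: "submodule (snd nK) R (Fr (fst nK))" by blast
    obtain h p where p: "p \<in> lin (Fr h) (Fr (fst nK))" "p ` carrier (Fr h) = snd nK"
      using fg_sub_cover[OF Fr_module K noeth_fg_sub[OF noeth_Fr K]] by blast
    have "?P (Suc i) (h, {x \<in> carrier (Fr h). p x = \<zero>\<^bsub>Fr (fst nK)\<^esub>})"
      using submod_ker[OF Fr_module Fr_module p(1)] by simp
    moreover have "?Q i nK (h, {x \<in> carrier (Fr h). p x = \<zero>\<^bsub>Fr (fst nK)\<^esub>})"
      using p by (intro bexI[of _ p]) simp_all
    ultimately show "\<exists>nK'. ?P (Suc i) nK' \<and> ?Q i nK nK'" by blast
  qed
  then obtain f where f': "\<forall>i. ?P i (f i) \<and> ?Q i (f i) (f (Suc i))" by (rule exE)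
  note f = f'[THEN spec, THEN conjunct1] f'[THEN spec, THEN conjunct2]
  define n where "n = (\<lambda>i. fst (f i))"
  have "\<forall>i. \<exists>p. p \<in> lin (Fr (n (Suc i))) (Fr (n i)) \<and> p ` carrier (Fr (n (Suc i))) = snd (f i) \<and>
     snd (f (Suc i)) = {x \<in> carrier (Fr (n (Suc i))). p x = \<zero>\<^bsub>Fr (n i)\<^esub>}"
    using f(2) unfolding n_def by blast
  then have "\<exists>d. \<forall>i. d i \<in> lin (Fr (n (Suc i))) (Fr (n i)) \<and> d i ` carrier (Fr (n (Suc i))) = snd (f i) \<and>
     snd (f (Suc i)) = {x \<in> carrier (Fr (n (Suc i))). d i x = \<zero>\<^bsub>Fr (n i)\<^esub>}" by (rule choice)
  then obtain d where d': "\<forall>i. d i \<in> lin (Fr (n (Suc i))) (Fr (n i)) \<and> d i ` carrier (Fr (n (Suc i))) = snd (f i) \<and>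
     snd (f (Suc i)) = {x \<in> carrier (Fr (n (Suc i))). d i x = \<zero>\<^bsub>Fr (n i)\<^esub>}" by (rule exE)
  note d = d'[THEN spec, THEN conjunct1] d'[THEN spec, THEN conjunct2, THEN conjunct1] d'[THEN spec, THEN conjunct2, THEN conjunct2]
  have n0: "n 0 = g" "snd (f 0) = {x \<in> carrier (Fr g). e x = \<zero>\<^bsub>M\<^esub>}" using f(1)[of 0] by (auto simp: n_def)
  have "free_resolution R M n d e"
    unfolding free_resolution_def Let_def using e d n0 by simp
  then show ?thesis by blast
qed

end

locale resolved = noeth_local +
  fixes n :: "nat \<Rightarrow> nat" and D :: "nat \<Rightarrow> (nat \<Rightarrow> 'a) \<Rightarrow> (nat \<Rightarrow> 'a)" and e :: "(nat \<Rightarrow> 'a) \<Rightarrow> 'a set"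
  assumes res: "free_resolution R (residue_field R) n D e"
begin

abbreviation F :: "nat \<Rightarrow> ('a, nat \<Rightarrow> 'a) module" where "F i \<equiv> Fr (n i)"

lemma res_props:
  shows e_lin: "e \<in> lin (F 0) rf" and e_surj: "e ` carrier (F 0) = carrier rf"
    and D_lin: "D i \<in> lin (F (Suc i)) (F i)"
    and im_D0: "D 0 ` carrier (F (Suc 0)) = {x \<in> carrier (F 0). e x = \<zero>\<^bsub>rf\<^esub>}"
    and im_D: "D (Suc i) ` carrier (F (Suc (Suc i))) = {x \<in> carrier (F (Suc i)). D i x = \<zero>\<^bsub>F i\<^esub>}"
  using res unfolding free_resolution_def Let_def by auto

lemma DD: "v \<in> carrier (F (Suc (Suc i))) \<Longrightarrow> D i (D (Suc i) v) = \<zero>\<^bsub>F i\<^esub>"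
  using im_D[of i] by blast

text \<open>The augmentation onto the residue field lifts to a linear form \<open>\<epsilon>\<close> on \<open>R\<^bsup>n 0\<^esup>\<close> that takes a unit as a value.\<close>

lemma augmentation:
  shows "\<exists>\<epsilon> y0 u. \<epsilon> \<in> lin (F 0) (self_module R) \<and> (\<forall>y \<in> carrier (F 0). e y = \<zero>\<^bsub>rf\<^esub> \<longleftrightarrow> \<epsilon> y \<in> mx) \<and>
    y0 \<in> carrier (F 0) \<and> u \<in> carrier R \<and> u \<otimes> \<epsilon> y0 = \<one>"
proof -
  let ?k = "\<lambda>r. mx +>\<^bsub>self_module R\<^esub> r"
  have "e y \<in> ?k ` carrier (self_module R)" if "y \<in> carrier (F 0)" for y
    using lin_closed[OF e_lin that] rf_surj by simp
  then obtain \<epsilon> where eps: "\<epsilon> \<in> lin (F 0) (self_module R)" "\<forall>y \<in> carrier (F 0). ?k (\<epsilon> y) = e y \<and> \<epsilon> y \<in> carrier (self_module R)"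
    using free_lift[OF self_is_module rf_module rf_lin e_lin _ submod_whole[OF self_is_module]] by blast
  have 1: "e y = \<zero>\<^bsub>rf\<^esub> \<longleftrightarrow> \<epsilon> y \<in> mx" if "y \<in> carrier (F 0)" for y
    using eps(2)[rule_format, OF that] rf_zero_iff[of "\<epsilon> y"] by simp
  have "?k \<one> \<in> carrier rf" using lin_closed[OF rf_lin, of \<one>] by simp
  then obtain y0 where y0: "y0 \<in> carrier (F 0)" "e y0 = ?k \<one>" using e_surj by (metis imageE)
  have "?k \<one> \<noteq> \<zero>\<^bsub>rf\<^esub>" using rf_zero_iff[of \<one>] one_notin_mx by simp
  then have "\<epsilon> y0 \<notin> mx" using 1[OF y0(1)] y0(2) by simp
  then obtain u where "u \<in> carrier R" "u \<otimes> \<epsilon> y0 = \<one>"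
    using unit_notin_mx[of "\<epsilon> y0"] eps(2)[rule_format, OF y0(1)] by auto
  then show ?thesis using eps(1) 1 y0(1) by blast
qed

lemma augmentation_D:
  assumes "\<forall>y \<in> carrier (F 0). e y = \<zero>\<^bsub>rf\<^esub> \<longleftrightarrow> \<epsilon> y \<in> mx" "v \<in> carrier (F (Suc 0))"
  shows "\<epsilon> (D 0 v) \<in> mx"
  using assms im_D0 by blast

text \<open>Cocycles and coboundaries of the complex of homomorphisms are handled as linear maps and not as elements of a module of
  homomorphisms, which spares the restriction of every map to its domain.\<close>

definition cocyc :: "nat \<Rightarrow> ('a, 'm) module \<Rightarrow> ((nat \<Rightarrow> 'a) \<Rightarrow> 'm) \<Rightarrow> bool" where
  "cocyc j M z \<longleftrightarrow> z \<in> lin (F j) M \<and> (\<forall>v \<in> carrier (F (Suc j)). z (D j v) = \<zero>\<^bsub>M\<^esub>)"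

definition cobdry :: "nat \<Rightarrow> ('a, 'm) module \<Rightarrow> ((nat \<Rightarrow> 'a) \<Rightarrow> 'm) \<Rightarrow> bool" where
  "cobdry j M z \<longleftrightarrow> (case j of 0 \<Rightarrow> \<forall>v \<in> carrier (F 0). z v = \<zero>\<^bsub>M\<^esub>
     | Suc i \<Rightarrow> \<exists>h \<in> lin (F i) M. \<forall>v \<in> carrier (F (Suc i)). z v = h (D i v))"

text \<open>\<open>EV j M\<close> says that \<open>Ext\<^sup>j(k, M)\<close> vanishes, where \<open>k\<close> is the residue field.\<close>

definition EV :: "nat \<Rightarrow> ('a, 'm) module \<Rightarrow> bool" where
  "EV j M \<longleftrightarrow> (\<forall>z. cocyc j M z \<longrightarrow> cobdry j M z)"

lemma EVD: "EV j M \<Longrightarrow> cocyc j M z \<Longrightarrow> cobdry j M z"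
  by (simp add: EV_def)

lemma cocyc_lin: "cocyc j M z \<Longrightarrow> z \<in> lin (F j) M"
  by (simp add: cocyc_def)

lemma cobdry_cong:
  assumes "cobdry j M z" "\<And>v. v \<in> carrier (F j) \<Longrightarrow> z' v = z v" shows "cobdry j M z'"
  using assms unfolding cobdry_def by (cases j) auto

lemma cobdry_0: "cobdry 0 M z \<longleftrightarrow> (\<forall>v \<in> carrier (F 0). z v = \<zero>\<^bsub>M\<^esub>)"
  by (simp add: cobdry_def)

lemma cobdry_Suc: "cobdry (Suc i) M z \<longleftrightarrow> (\<exists>h \<in> lin (F i) M. \<forall>v \<in> carrier (F (Suc i)). z v = h (D i v))"
  by (simp add: cobdry_def)

lemma cobdry_image:
  assumes M: "module R M" "module R M'" "\<pi> \<in> lin M M'" and z: "cobdry j M z"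
  shows "cobdry j M' (\<lambda>v. \<pi> (z v))"
proof (cases j)
  case 0
  then show ?thesis using z lin_zero[OF M(3,1,2)] by (simp add: cobdry_0)
next
  case (Suc i)
  then obtain h where "h \<in> lin (F i) M" "\<forall>v \<in> carrier (F (Suc i)). z v = h (D i v)" using z by (auto simp: cobdry_Suc)
  then show ?thesis unfolding Suc cobdry_Suc using lin_comp[OF M(3)] by (intro bexI[of _ "\<lambda>v. \<pi> (h v)"]) auto
qed

lemma cocyc_image:
  assumes M: "module R M" "module R M'" "\<pi> \<in> lin M M'" and z: "cocyc j M z"
  shows "cocyc j M' (\<lambda>v. \<pi> (z v))"
  using z lin_comp[OF M(3) cocyc_lin[OF z]] lin_zero[OF M(3,1,2)] by (simp add: cocyc_def)

text \<open>Multiplication by \<open>a\<close> is zero on the residue field, so it is homotopic to zero on the resolution.\<close>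

lemma homotopy:
  assumes a: "a \<in> mx"
  shows "\<exists>s \<in> lin (F j) (F (Suc j)). (\<forall>w \<in> D j ` carrier (F (Suc j)). D j (s w) = a \<odot>\<^bsub>F j\<^esub> w) \<and>
    (j = 0 \<longrightarrow> (\<forall>w \<in> carrier (F 0). D 0 (s w) = a \<odot>\<^bsub>F 0\<^esub> w))"
proof (induct j)
  case 0
  have ac: "a \<in> carrier R" using mx_carr[OF a] .
  obtain \<epsilon> y0 u where eps: "\<epsilon> \<in> lin (F 0) (self_module R)" "\<forall>y \<in> carrier (F 0). e y = \<zero>\<^bsub>rf\<^esub> \<longleftrightarrow> \<epsilon> y \<in> mx"
    using augmentation by blast
  have "a \<odot>\<^bsub>F 0\<^esub> w \<in> D 0 ` carrier (F (Suc 0))" if w: "w \<in> carrier (F 0)" for w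
  proof -
    have "\<epsilon> (a \<odot>\<^bsub>F 0\<^esub> w) = a \<otimes> \<epsilon> w" using lin_smult[OF eps(1) ac w] by simp
    then have "\<epsilon> (a \<odot>\<^bsub>F 0\<^esub> w) \<in> mx" using mx_mult(2)[OF a] lin_closed[OF eps(1) w] by simp
    then show ?thesis unfolding im_D0 using eps(2) w ac by simp
  qed
  then obtain s where "s \<in> lin (F 0) (F (Suc 0))" "\<forall>w \<in> carrier (F 0). D 0 (s w) = a \<odot>\<^bsub>F 0\<^esub> w"
    using free_lift[OF Fr_module Fr_module D_lin lin_mult[OF Fr_module ac] _ submod_whole[OF Fr_module]] by blast
  then show ?case using lin_closed[OF D_lin[of 0]] by (intro bexI[of _ s]) auto
next
  case (Suc i)
  have ac: "a \<in> carrier R" using mx_carr[OF a] .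
  obtain s where s: "s \<in> lin (F i) (F (Suc i))" "\<And>w. w \<in> D i ` carrier (F (Suc i)) \<Longrightarrow> D i (s w) = a \<odot>\<^bsub>F i\<^esub> w"
    using Suc by blast
  let ?f = "\<lambda>w. a \<odot>\<^bsub>F (Suc i)\<^esub> w \<ominus>\<^bsub>F (Suc i)\<^esub> s (D i w)"
  have f: "?f \<in> lin (F (Suc i)) (F (Suc i))"
    by (rule lin_diff[OF Fr_module lin_mult[OF Fr_module ac] lin_comp[OF s(1) D_lin]])
  have "?f w \<in> D (Suc i) ` carrier (F (Suc (Suc i)))" if w: "w \<in> carrier (F (Suc i))" for w
  proof -
    have Dw: "D i w \<in> carrier (F i)" "s (D i w) \<in> carrier (F (Suc i))" using lin_closed[OF D_lin w] lin_closed[OF s(1)] by auto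
    have "D i (?f w) = a \<odot>\<^bsub>F i\<^esub> D i w \<ominus>\<^bsub>F i\<^esub> D i (s (D i w))"
      using w Dw ac by (simp add: lin_minus[OF D_lin] lin_smult[OF D_lin])
    also have "\<dots> = \<zero>\<^bsub>F i\<^esub>" using s(2)[of "D i w"] w Dw ac by simp
    finally show ?thesis unfolding im_D using lin_closed[OF f w] by simp
  qed
  then obtain t where t: "t \<in> lin (F (Suc i)) (F (Suc (Suc i)))" "\<And>w. w \<in> carrier (F (Suc i)) \<Longrightarrow> D (Suc i) (t w) = ?f w"
    using free_lift[OF Fr_module Fr_module D_lin f _ submod_whole[OF Fr_module]] by blast
  have "D (Suc i) (t w) = a \<odot>\<^bsub>F (Suc i)\<^esub> w" if w: "w \<in> D (Suc i) ` carrier (F (Suc (Suc i)))" for w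
  proof -
    have wc: "w \<in> carrier (F (Suc i))" "D i w = \<zero>\<^bsub>F i\<^esub>" using w unfolding im_D by auto
    have "?f w = a \<odot>\<^bsub>F (Suc i)\<^esub> w \<ominus>\<^bsub>F (Suc i)\<^esub> \<zero>\<^bsub>F (Suc i)\<^esub>"
      using wc lin_zero[OF s(1) Fr_module Fr_module] by simp
    also have "\<dots> = a \<odot>\<^bsub>F (Suc i)\<^esub> w" using wc ac by (simp add: mod_ac(4)[OF Fr_module])
    finally show ?thesis using t(2) wc by simp
  qed
  then show ?case using t(1) by blast
qed

lemma mx_kills_cohomology:
  assumes a: "a \<in> mx" and M: "module R M" and z: "cocyc j M z"
  shows "cobdry j M (\<lambda>v. a \<odot>\<^bsub>M\<^esub> z v)"
proof -
  have ac: "a \<in> carrier R" using mx_carr[OF a] .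
  note zl = cocyc_lin[OF z]
  have z0: "z (D j v) = \<zero>\<^bsub>M\<^esub>" if "v \<in> carrier (F (Suc j))" for v using z that by (simp add: cocyc_def)
  show ?thesis
  proof (cases j)
    case 0
    obtain s where s: "s \<in> lin (F 0) (F (Suc 0))" "\<forall>w \<in> carrier (F 0). D 0 (s w) = a \<odot>\<^bsub>F 0\<^esub> w" using homotopy[OF a, of 0] by blast
    have "a \<odot>\<^bsub>M\<^esub> z v = \<zero>\<^bsub>M\<^esub>" if v: "v \<in> carrier (F 0)" for v
      using lin_smult[OF zl ac, of v] z0[of "s v"] lin_closed[OF s(1) v] s(2) v 0 by simp
    then show ?thesis unfolding 0 cobdry_0 by blast
  next
    case (Suc i)
    obtain s where s: "s \<in> lin (F i) (F (Suc i))" "\<And>w. w \<in> D i ` carrier (F (Suc i)) \<Longrightarrow> D i (s w) = a \<odot>\<^bsub>F i\<^esub> w"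
      using homotopy[OF a, of i] by blast
    have "a \<odot>\<^bsub>M\<^esub> z v = z (s (D i v))" if v: "v \<in> carrier (F (Suc i))" for v
    proof -
      have Dv: "D i v \<in> carrier (F i)" "s (D i v) \<in> carrier (F (Suc i))" using lin_closed[OF D_lin v] lin_closed[OF s(1)] by auto
      let ?w = "a \<odot>\<^bsub>F (Suc i)\<^esub> v \<ominus>\<^bsub>F (Suc i)\<^esub> s (D i v)"
      have w: "?w \<in> carrier (F (Suc i))" using v Dv ac by simp
      have "D i ?w = a \<odot>\<^bsub>F i\<^esub> D i v \<ominus>\<^bsub>F i\<^esub> D i (s (D i v))"
        using v Dv ac by (simp add: lin_minus[OF D_lin] lin_smult[OF D_lin])
      also have "\<dots> = \<zero>\<^bsub>F i\<^esub>" using s(2)[of "D i v"] v Dv ac by simp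
      finally have "?w \<in> D (Suc i) ` carrier (F (Suc (Suc i)))" unfolding im_D using w by simp
      then obtain u where "u \<in> carrier (F (Suc (Suc i)))" "?w = D (Suc i) u" by blast
      then have "z ?w = \<zero>\<^bsub>M\<^esub>" using z0[of u] Suc by simp
      moreover have "z ?w = a \<odot>\<^bsub>M\<^esub> z v \<ominus>\<^bsub>M\<^esub> z (s (D i v))"
        using v Dv ac M zl[unfolded Suc] by (simp add: lin_minus[OF zl[unfolded Suc]] lin_smult[OF zl[unfolded Suc]])
      ultimately show ?thesis using mod_eq_iff[OF M, of "a \<odot>\<^bsub>M\<^esub> z v" "z (s (D i v))"] M ac
          lin_closed[OF zl[unfolded Suc]] v Dv by simp
    qed
    then show ?thesis unfolding Suc cobdry_Suc using lin_comp[OF zl[unfolded Suc] s(1)] by (intro bexI[of _ "\<lambda>v. z (s v)"]) auto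
  qed
qed

text \<open>The connecting homomorphism \<open>Ext\<^sup>j(k, M') \<rightarrow> Ext\<^sup>j\<^sup>+\<^sup>1(k, M)\<close> of \<open>0 \<rightarrow> M \<rightarrow> M \<rightarrow> M' \<rightarrow> 0\<close> on the level of cocycles: \<open>y\<close> is the image of \<open>z\<close>.\<close>

lemma connecting_cocycle:
  assumes r: "reg_step x M M' \<pi>" and z: "cocyc j M' z"
  shows "\<exists>w y. w \<in> lin (F j) M \<and> (\<forall>v \<in> carrier (F j). \<pi> (w v) = z v) \<and> cocyc (Suc j) M y \<and>
    (\<forall>v \<in> carrier (F (Suc j)). w (D j v) = x \<odot>\<^bsub>M\<^esub> y v)"
proof -
  note rs = reg_stepD[OF r] and zl = cocyc_lin[OF z]
  have "z v \<in> \<pi> ` carrier M" if "v \<in> carrier (F j)" for v using lin_closed[OF zl that] rs(5) by simp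
  then obtain w where w: "w \<in> lin (F j) M" "\<And>v. v \<in> carrier (F j) \<Longrightarrow> \<pi> (w v) = z v"
    using free_lift[OF rs(1,2,4) zl _ submod_whole[OF rs(1)]] by blast
  have "w (D j v) \<in> (\<lambda>m. x \<odot>\<^bsub>M\<^esub> m) ` carrier M" if v: "v \<in> carrier (F (Suc j))" for v
  proof -
    have "\<pi> (w (D j v)) = \<zero>\<^bsub>M'\<^esub>" using w(2) lin_closed[OF D_lin v] z v by (simp add: cocyc_def)
    then show ?thesis using rs(6) lin_closed[OF w(1) lin_closed[OF D_lin v]] by blast
  qed
  then obtain y where y: "y \<in> lin (F (Suc j)) M" "\<And>v. v \<in> carrier (F (Suc j)) \<Longrightarrow> x \<odot>\<^bsub>M\<^esub> y v = w (D j v)"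
    using lin_divide[OF Fr_module rs(1,1) lin_mult[OF rs(1,3)] rs(8) lin_comp[OF w(1) D_lin]] by blast
  have "y (D (Suc j) v) = \<zero>\<^bsub>M\<^esub>" if v: "v \<in> carrier (F (Suc (Suc j)))" for v
  proof (rule rs(8))
    show "y (D (Suc j) v) \<in> carrier M" using lin_closed[OF y(1) lin_closed[OF D_lin v]] .
    show "x \<odot>\<^bsub>M\<^esub> y (D (Suc j) v) = \<zero>\<^bsub>M\<^esub>"
      using y(2)[OF lin_closed[OF D_lin v]] DD[OF v] lin_zero[OF w(1) Fr_module rs(1)] by simp
  qed
  then have "cocyc (Suc j) M y" using y(1) by (simp add: cocyc_def)
  then show ?thesis using w y(2) by (intro exI[of _ w] exI[of _ y]) simp
qed

text \<open>The connecting homomorphism is injective if \<open>Ext\<^sup>j(k, M) = 0\<close>: if \<open>y\<close> is the coboundary of \<open>h\<close>, then \<open>w - x h\<close> is a cocycle, and it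
  has the same image as \<open>w\<close> in \<open>M'\<close>.\<close>

lemma connecting_injective:
  assumes r: "reg_step x M M' \<pi>" and EV: "EV j M" and w: "w \<in> lin (F j) M"
    and wy: "\<And>v. v \<in> carrier (F (Suc j)) \<Longrightarrow> w (D j v) = x \<odot>\<^bsub>M\<^esub> y v" and y: "cobdry (Suc j) M y"
  shows "cobdry j M' (\<lambda>v. \<pi> (w v))"
proof -
  note rs = reg_stepD[OF r]
  obtain h where h: "h \<in> lin (F j) M" "\<And>v. v \<in> carrier (F (Suc j)) \<Longrightarrow> y v = h (D j v)"
    using y unfolding cobdry_Suc by blast
  let ?t = "\<lambda>v. w v \<ominus>\<^bsub>M\<^esub> x \<odot>\<^bsub>M\<^esub> h v"
  have t: "?t \<in> lin (F j) M" by (rule lin_diff[OF rs(1) w lin_scale[OF rs(1) h(1) rs(3)]])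
  have "?t (D j v) = \<zero>\<^bsub>M\<^esub>" if v: "v \<in> carrier (F (Suc j))" for v
    using wy[OF v] h(2)[OF v] lin_closed[OF h(1) lin_closed[OF D_lin v]] rs(1,3) by simp
  then have "cocyc j M ?t" using t by (simp add: cocyc_def)
  then have "cobdry j M' (\<lambda>v. \<pi> (?t v))" using EVD[OF EV] cobdry_image[OF rs(1,2,4)] by blast
  moreover have "\<pi> (w v) = \<pi> (?t v)" if v: "v \<in> carrier (F j)" for v
  proof -
    have c: "w v \<in> carrier M" "h v \<in> carrier M" using lin_closed[OF w v] lin_closed[OF h(1) v] by auto
    have "\<pi> (?t v) = \<pi> (w v) \<ominus>\<^bsub>M'\<^esub> \<zero>\<^bsub>M'\<^esub>" using c rs(1,2,3,7) by (simp add: lin_minus[OF rs(4)])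
    then show ?thesis using lin_closed[OF rs(4) c(1)] rs(2) by (simp add: mod_ac(4)[OF rs(2)])
  qed
  ultimately show ?thesis by (rule cobdry_cong)
qed

lemma EV_quotient:
  assumes r: "reg_step x M M' \<pi>" and EV: "EV j M" "EV (Suc j) M" shows "EV j M'"
  unfolding EV_def
proof (intro allI impI)
  fix z assume z: "cocyc j M' z"
  obtain w y where w: "w \<in> lin (F j) M" "\<And>v. v \<in> carrier (F j) \<Longrightarrow> \<pi> (w v) = z v" "cocyc (Suc j) M y"
    "\<And>v. v \<in> carrier (F (Suc j)) \<Longrightarrow> w (D j v) = x \<odot>\<^bsub>M\<^esub> y v" using connecting_cocycle[OF r z] by blast
  show "cobdry j M' z"
    using cobdry_cong[OF connecting_injective[OF r EV(1) w(1,4) EVD[OF EV(2) w(3)]]] w(2) by simp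
qed

text \<open>\<open>Ext\<^sup>j(k, M)\<close> is a vector space over \<open>k\<close>; the condition says that its dimension is at most one, as any two classes are linearly
  dependent with a coefficient that is a unit of \<open>R\<close>.\<close>

definition dim_le1 :: "nat \<Rightarrow> ('a, 'm) module \<Rightarrow> bool" where
  "dim_le1 j M \<longleftrightarrow> (\<forall>z z'. cocyc j M z \<longrightarrow> cocyc j M z' \<longrightarrow> (\<exists>r \<in> carrier R. \<exists>s \<in> carrier R.
     (r \<notin> mx \<or> s \<notin> mx) \<and> cobdry j M (\<lambda>v. r \<odot>\<^bsub>M\<^esub> z v \<oplus>\<^bsub>M\<^esub> s \<odot>\<^bsub>M\<^esub> z' v)))"

text \<open>The connecting homomorphism embeds \<open>Ext\<^sup>j(k, M')\<close> into \<open>Ext\<^sup>j\<^sup>+\<^sup>1(k, M)\<close>.\<close>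

lemma dim_le1_quotient:
  assumes r: "reg_step x M M' \<pi>" and EV: "EV j M" and d: "dim_le1 (Suc j) M" shows "dim_le1 j M'"
  unfolding dim_le1_def
proof (intro allI impI)
  note rs = reg_stepD[OF r]
  fix z z' assume z: "cocyc j M' z" "cocyc j M' z'"
  obtain w y where w: "w \<in> lin (F j) M" "\<And>v. v \<in> carrier (F j) \<Longrightarrow> \<pi> (w v) = z v" "cocyc (Suc j) M y"
    "\<And>v. v \<in> carrier (F (Suc j)) \<Longrightarrow> w (D j v) = x \<odot>\<^bsub>M\<^esub> y v" using connecting_cocycle[OF r z(1)] by blast
  obtain w' y' where w': "w' \<in> lin (F j) M" "\<And>v. v \<in> carrier (F j) \<Longrightarrow> \<pi> (w' v) = z' v" "cocyc (Suc j) M y'"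
    "\<And>v. v \<in> carrier (F (Suc j)) \<Longrightarrow> w' (D j v) = x \<odot>\<^bsub>M\<^esub> y' v" using connecting_cocycle[OF r z(2)] by blast
  obtain a b where ab: "a \<in> carrier R" "b \<in> carrier R" "a \<notin> mx \<or> b \<notin> mx"
    "cobdry (Suc j) M (\<lambda>v. a \<odot>\<^bsub>M\<^esub> y v \<oplus>\<^bsub>M\<^esub> b \<odot>\<^bsub>M\<^esub> y' v)" using d w(3) w'(3) unfolding dim_le1_def by blast
  let ?w = "\<lambda>v. a \<odot>\<^bsub>M\<^esub> w v \<oplus>\<^bsub>M\<^esub> b \<odot>\<^bsub>M\<^esub> w' v"
  have wl: "?w \<in> lin (F j) M" by (rule lin_plus[OF rs(1) lin_scale[OF rs(1) w(1) ab(1)] lin_scale[OF rs(1) w'(1) ab(2)]])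
  have "?w (D j v) = x \<odot>\<^bsub>M\<^esub> (a \<odot>\<^bsub>M\<^esub> y v \<oplus>\<^bsub>M\<^esub> b \<odot>\<^bsub>M\<^esub> y' v)" if v: "v \<in> carrier (F (Suc j))" for v
  proof -
    have c: "y v \<in> carrier M" "y' v \<in> carrier M" using lin_closed[OF cocyc_lin[OF w(3)] v] lin_closed[OF cocyc_lin[OF w'(3)] v] by auto
    show ?thesis using c ab(1,2) rs(1,3) w(4)[OF v] w'(4)[OF v]
      by (simp add: mod_smult(1)[OF rs(1)] mod_smult_comm[OF rs(1,3)])
  qed
  then have "cobdry j M' (\<lambda>v. \<pi> (?w v))" by (rule connecting_injective[OF r EV wl _ ab(4)])
  moreover have "a \<odot>\<^bsub>M'\<^esub> z v \<oplus>\<^bsub>M'\<^esub> b \<odot>\<^bsub>M'\<^esub> z' v = \<pi> (?w v)" if v: "v \<in> carrier (F j)" for v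
    using lin_closed[OF w(1) v] lin_closed[OF w'(1) v] ab(1,2) rs(1) w(2)[OF v] w'(2)[OF v]
    by (simp add: lin_add[OF rs(4)] lin_smult[OF rs(4)])
  ultimately have "cobdry j M' (\<lambda>v. a \<odot>\<^bsub>M'\<^esub> z v \<oplus>\<^bsub>M'\<^esub> b \<odot>\<^bsub>M'\<^esub> z' v)" by (rule cobdry_cong)
  then show "\<exists>r\<in>carrier R. \<exists>s\<in>carrier R. (r \<notin> mx \<or> s \<notin> mx) \<and> cobdry j M' (\<lambda>v. r \<odot>\<^bsub>M'\<^esub> z v \<oplus>\<^bsub>M'\<^esub> s \<odot>\<^bsub>M'\<^esub> z' v)"
    using ab(1-3) by blast
qed

text \<open>Multiplication by \<open>x\<close> is zero on \<open>Ext\<^sup>j(k, M)\<close>, so this module is a quotient of \<open>Ext\<^sup>j\<^sup>-\<^sup>1(k, M')\<close>.\<close>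

lemma EV_of_quotient:
  assumes r: "reg_step x M M' \<pi>" and x: "x \<in> mx" and EV: "\<And>i. j = Suc i \<Longrightarrow> EV i M'"
  shows "EV j M"
  unfolding EV_def
proof (intro allI impI)
  note rs = reg_stepD[OF r]
  fix z assume z: "cocyc j M z"
  note zl = cocyc_lin[OF z]
  have xz: "cobdry j M (\<lambda>v. x \<odot>\<^bsub>M\<^esub> z v)" by (rule mx_kills_cohomology[OF x rs(1) z])
  show "cobdry j M z"
  proof (cases j)
    case 0
    then show ?thesis using xz rs(8) lin_closed[OF zl] by (simp add: cobdry_0)
  next
    case (Suc i)
    obtain h where h: "h \<in> lin (F i) M" "\<And>v. v \<in> carrier (F (Suc i)) \<Longrightarrow> x \<odot>\<^bsub>M\<^esub> z v = h (D i v)"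
      using xz unfolding Suc cobdry_Suc by blast
    note zl' = zl[unfolded Suc]
    have "cocyc i M' (\<lambda>v. \<pi> (h v))" unfolding cocyc_def
      using lin_comp[OF rs(4) h(1)] h(2)[symmetric] rs(7) lin_closed[OF zl'] by simp
    then have b: "cobdry i M' (\<lambda>v. \<pi> (h v))" using EVD[OF EV[OF Suc]] by blast
    \<comment> \<open>modify \<open>h\<close> by a cocycle so that it becomes divisible by \<open>x\<close>\<close>
    have "\<exists>h' \<in> lin (F i) M. (\<forall>v \<in> carrier (F i). \<pi> (h' v) = \<pi> (h v)) \<and> (\<forall>v \<in> carrier (F (Suc i)). h' (D i v) = \<zero>\<^bsub>M\<^esub>)"
    proof (cases i)
      case 0
      then have "\<forall>v \<in> carrier (F i). \<zero>\<^bsub>M'\<^esub> = \<pi> (h v)" using b by (simp add: cobdry_0)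
      then show ?thesis using lin_zero_map[OF rs(1)] lin_zero[OF rs(4,1,2)] by (intro bexI[of _ "\<lambda>v. \<zero>\<^bsub>M\<^esub>"]) auto
    next
      case (Suc l)
      obtain g where g: "g \<in> lin (F l) M'" "\<And>v. v \<in> carrier (F i) \<Longrightarrow> \<pi> (h v) = g (D l v)" using b unfolding Suc cobdry_Suc by blast
      have "g v \<in> \<pi> ` carrier M" if "v \<in> carrier (F l)" for v using lin_closed[OF g(1) that] rs(5) by simp
      then obtain g' where g': "g' \<in> lin (F l) M" "\<And>v. v \<in> carrier (F l) \<Longrightarrow> \<pi> (g' v) = g v"
        using free_lift[OF rs(1,2,4) g(1) _ submod_whole[OF rs(1)]] by blast
      have c: "D l v \<in> carrier (F l)" if "v \<in> carrier (F i)" for v using lin_closed[OF D_lin[of l]] that Suc by simp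
      have dd: "D l (D i v) = \<zero>\<^bsub>F l\<^esub>" if "v \<in> carrier (F (Suc i))" for v using DD[of v l] that Suc by simp
      have "(\<lambda>v. g' (D l v)) \<in> lin (F i) M" using lin_comp[OF g'(1) D_lin[of l]] Suc by simp
      then show ?thesis using g(2) g'(2)[OF c] dd lin_zero[OF g'(1) Fr_module rs(1)]
        by (intro bexI[of _ "\<lambda>v. g' (D l v)"]) auto
    qed
    then obtain h' where h': "h' \<in> lin (F i) M" "\<And>v. v \<in> carrier (F i) \<Longrightarrow> \<pi> (h' v) = \<pi> (h v)"
      "\<And>v. v \<in> carrier (F (Suc i)) \<Longrightarrow> h' (D i v) = \<zero>\<^bsub>M\<^esub>" by blast
    let ?t = "\<lambda>v. h v \<ominus>\<^bsub>M\<^esub> h' v"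
    have t: "?t \<in> lin (F i) M" by (rule lin_diff[OF rs(1) h(1) h'(1)])
    have "?t v \<in> (\<lambda>m. x \<odot>\<^bsub>M\<^esub> m) ` carrier M" if v: "v \<in> carrier (F i)" for v
    proof -
      have c: "h v \<in> carrier M" "h' v \<in> carrier M" using lin_closed[OF h(1) v] lin_closed[OF h'(1) v] by auto
      have "\<pi> (?t v) = \<zero>\<^bsub>M'\<^esub>" using c rs(1,2) h'(2)[OF v] lin_closed[OF rs(4)] by (simp add: lin_minus[OF rs(4)])
      then show ?thesis using rs(6) lin_closed[OF t v] by blast
    qed
    then obtain y where y: "y \<in> lin (F i) M" "\<And>v. v \<in> carrier (F i) \<Longrightarrow> x \<odot>\<^bsub>M\<^esub> y v = ?t v"
      using lin_divide[OF Fr_module rs(1,1) lin_mult[OF rs(1,3)] rs(8) t] by blast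
    have "z v = y (D i v)" if v: "v \<in> carrier (F (Suc i))" for v
    proof (rule inj_onD[OF inj_on_lin[OF rs(1,1) lin_mult[OF rs(1,3)] rs(8)]])
      have Dv: "D i v \<in> carrier (F i)" using lin_closed[OF D_lin v] .
      have "x \<odot>\<^bsub>M\<^esub> y (D i v) = h (D i v) \<ominus>\<^bsub>M\<^esub> \<zero>\<^bsub>M\<^esub>" using y(2)[OF Dv] h'(3)[OF v] by simp
      then show "x \<odot>\<^bsub>M\<^esub> z v = x \<odot>\<^bsub>M\<^esub> y (D i v)"
        using h(2)[OF v] lin_closed[OF h(1) Dv] rs(1) by (simp add: mod_ac(4)[OF rs(1)])
      show "z v \<in> carrier M" "y (D i v) \<in> carrier M" using lin_closed[OF zl' v] lin_closed[OF y(1) Dv] by auto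
    qed
    then show ?thesis unfolding Suc cobdry_Suc using y(1) by blast
  qed
qed

lemma EV_iso:
  assumes M: "module R M" and N: "module R N" and f: "f \<in> lin M N" "f ` carrier M = carrier N"
    "\<And>x. x \<in> carrier M \<Longrightarrow> f x = \<zero>\<^bsub>N\<^esub> \<Longrightarrow> x = \<zero>\<^bsub>M\<^esub>" and EV: "EV j M"
  shows "EV j N"
  unfolding EV_def
proof (intro allI impI)
  fix z assume z: "cocyc j N z"
  obtain h where h: "h \<in> lin N M" "\<And>y. y \<in> carrier N \<Longrightarrow> f (h y) = y" using lin_inverse[OF M N f] by blast
  have "cobdry j N (\<lambda>v. f (h (z v)))" using EVD[OF EV cocyc_image[OF N M h(1) z]] cobdry_image[OF M N f(1)] by blast
  then show "cobdry j N z" by (rule cobdry_cong) (use h(2) lin_closed[OF cocyc_lin[OF z]] in simp)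
qed

lemma EV_iso_back:
  assumes M: "module R M" and N: "module R N" and f: "f \<in> lin M N" "f ` carrier M = carrier N"
    "\<And>x. x \<in> carrier M \<Longrightarrow> f x = \<zero>\<^bsub>N\<^esub> \<Longrightarrow> x = \<zero>\<^bsub>M\<^esub>" and EV: "EV j N"
  shows "EV j M"
proof -
  obtain h where h: "h \<in> lin N M" "\<And>y. y \<in> carrier N \<Longrightarrow> f (h y) = y" "\<And>x. x \<in> carrier M \<Longrightarrow> h (f x) = x"
    using lin_inverse[OF M N f] by blast
  have s: "h ` carrier N = carrier M"
  proof
    show "h ` carrier N \<subseteq> carrier M" using lin_closed[OF h(1)] by blast
    show "carrier M \<subseteq> h ` carrier N" using h(3) lin_closed[OF f(1)] by (metis image_eqI subsetI)
  qed
  show ?thesis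
    by (rule EV_iso[OF N M h(1) s _ EV]) (use h(2) lin_zero[OF f(1) M N] in metis)
qed

lemma dim_le1_iso:
  assumes M: "module R M" and N: "module R N" and f: "f \<in> lin M N" "f ` carrier M = carrier N"
    "\<And>x. x \<in> carrier M \<Longrightarrow> f x = \<zero>\<^bsub>N\<^esub> \<Longrightarrow> x = \<zero>\<^bsub>M\<^esub>" and d: "dim_le1 j M"
  shows "dim_le1 j N"
  unfolding dim_le1_def
proof (intro allI impI)
  fix z z' assume z: "cocyc j N z" "cocyc j N z'"
  obtain h where h: "h \<in> lin N M" "\<And>y. y \<in> carrier N \<Longrightarrow> f (h y) = y" using lin_inverse[OF M N f] by blast
  obtain r s where rs: "r \<in> carrier R" "s \<in> carrier R" "r \<notin> mx \<or> s \<notin> mx"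
    "cobdry j M (\<lambda>v. r \<odot>\<^bsub>M\<^esub> h (z v) \<oplus>\<^bsub>M\<^esub> s \<odot>\<^bsub>M\<^esub> h (z' v))"
    using d cocyc_image[OF N M h(1) z(1)] cocyc_image[OF N M h(1) z(2)] unfolding dim_le1_def by blast
  have "r \<odot>\<^bsub>N\<^esub> z v \<oplus>\<^bsub>N\<^esub> s \<odot>\<^bsub>N\<^esub> z' v = f (r \<odot>\<^bsub>M\<^esub> h (z v) \<oplus>\<^bsub>M\<^esub> s \<odot>\<^bsub>M\<^esub> h (z' v))" if v: "v \<in> carrier (F j)" for v
  proof -
    have c: "z v \<in> carrier N" "z' v \<in> carrier N" using lin_closed[OF cocyc_lin[OF z(1)] v] lin_closed[OF cocyc_lin[OF z(2)] v] by auto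
    then have "h (z v) \<in> carrier M" "h (z' v) \<in> carrier M" using lin_closed[OF h(1)] by auto
    then show ?thesis using M rs(1,2) h(2) c by (simp add: lin_add[OF f(1)] lin_smult[OF f(1)])
  qed
  then have "cobdry j N (\<lambda>v. r \<odot>\<^bsub>N\<^esub> z v \<oplus>\<^bsub>N\<^esub> s \<odot>\<^bsub>N\<^esub> z' v)" by (rule cobdry_cong[OF cobdry_image[OF M N f(1) rs(4)]])
  then show "\<exists>r\<in>carrier R. \<exists>s\<in>carrier R. (r \<notin> mx \<or> s \<notin> mx) \<and> cobdry j N (\<lambda>v. r \<odot>\<^bsub>N\<^esub> z v \<oplus>\<^bsub>N\<^esub> s \<odot>\<^bsub>N\<^esub> z' v)"
    using rs(1-3) by blast
qed

text \<open>One half of the description of depth by Ext, by descending induction along the sequence.\<close>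

lemma EV_regular_sequence:
  assumes M: "module R M" and xs: "wreg M xs" "set xs \<subseteq> mx" and j: "j < length xs"
  shows "EV j M"
proof -
  note xc = wreg_carr[OF xs(1)]
  have "\<forall>j. j < length xs - i \<longrightarrow> EV j (level M xs i)" if "i \<le> length xs" for i
    using that
  proof (induct i rule: inc_induct)
    case (step i)
    obtain \<pi> where r: "reg_step (xs ! i) (level M xs i) (level M xs (Suc i)) \<pi>" using level_step[OF M xs(1) step(2)] by blast
    have x: "xs ! i \<in> mx" using xs(2) step(2) nth_mem by blast
    show ?case using step by (intro allI impI EV_of_quotient[OF r x]) auto
  qed simp
  then have EV: "EV j (level M xs 0)" using j by simp
  show ?thesis
    by (rule EV_iso_back[OF M level_module[OF M xc] lproj_lin[OF M xc] lproj_surj[OF M xc] lproj0_inj[OF M xc] EV])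
qed

lemma EV_level:
  assumes M: "module R M" and xs: "wreg M xs" and EV: "\<And>j. j < r \<Longrightarrow> EV j M"
    and i: "i \<le> length xs" and j: "j + i < r"
  shows "EV j (level M xs i)"
  using i j
proof (induct i arbitrary: j)
  case 0
  note xc = wreg_carr[OF xs]
  show ?case
    by (rule EV_iso[OF M level_module[OF M xc] lproj_lin[OF M xc] lproj_surj[OF M xc] lproj0_inj[OF M xc] EV]) (use 0 in auto)
next
  case (Suc i)
  obtain \<pi> where r: "reg_step (xs ! i) (level M xs i) (level M xs (Suc i)) \<pi>" using level_step[OF M xs, of i] Suc(2) by auto
  show ?case using Suc by (intro EV_quotient[OF r]) auto
qed

lemma dim_le1_level:
  assumes M: "module R M" and xs: "wreg M xs" and EV: "\<And>j. j < d \<Longrightarrow> EV j M" and d: "dim_le1 d M"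
    and i: "i \<le> length xs" "i \<le> d"
  shows "dim_le1 (d - i) (level M xs i)"
  using i
proof (induct i)
  case 0
  note xc = wreg_carr[OF xs]
  show ?case
    using dim_le1_iso[OF M level_module[OF M xc] lproj_lin[OF M xc] lproj_surj[OF M xc] lproj0_inj[OF M xc] d] by simp
next
  case (Suc i)
  obtain \<pi> where r: "reg_step (xs ! i) (level M xs i) (level M xs (Suc i)) \<pi>" using level_step[OF M xs, of i] Suc(2) by auto
  have "EV (d - Suc i) (level M xs i)" by (rule EV_level[OF M xs EV]) (use Suc in auto)
  moreover have "dim_le1 (Suc (d - Suc i)) (level M xs i)" using Suc by (simp add: Suc_diff_Suc)
  ultimately show ?case by (rule dim_le1_quotient[OF r])
qed

lemma socle_cocycle:
  assumes M: "module R M" and y: "y \<in> carrier M" "\<And>a. a \<in> mx \<Longrightarrow> a \<odot>\<^bsub>M\<^esub> y = \<zero>\<^bsub>M\<^esub>"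
    and eps: "\<epsilon> \<in> lin (F 0) (self_module R)" "\<forall>y \<in> carrier (F 0). e y = \<zero>\<^bsub>rf\<^esub> \<longleftrightarrow> \<epsilon> y \<in> mx"
  shows "cocyc 0 M (\<lambda>v. \<epsilon> v \<odot>\<^bsub>M\<^esub> y)"
proof -
  have "(\<lambda>r. r \<odot>\<^bsub>M\<^esub> y) \<in> lin (self_module R) M" using M y by (intro linI) (simp_all add: mod_smult[OF M])
  then show ?thesis unfolding cocyc_def using lin_comp[OF _ eps(1)] augmentation_D[OF eps(2)] y(2) by simp
qed

text \<open>\<open>Hom(k, M)\<close> is the socle of \<open>M\<close>.\<close>

lemma EV0_no_socle:
  assumes M: "module R M" and EV: "EV 0 M" shows "no_socle M"
  unfolding no_socle_def
proof (intro ballI impI)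
  fix y assume y: "y \<in> carrier M" "\<forall>a \<in> mx. a \<odot>\<^bsub>M\<^esub> y = \<zero>\<^bsub>M\<^esub>"
  obtain \<epsilon> y0 u where eps: "\<epsilon> \<in> lin (F 0) (self_module R)" "\<forall>y \<in> carrier (F 0). e y = \<zero>\<^bsub>rf\<^esub> \<longleftrightarrow> \<epsilon> y \<in> mx"
    "y0 \<in> carrier (F 0)" "u \<in> carrier R" "u \<otimes> \<epsilon> y0 = \<one>" using augmentation by blast
  have "\<epsilon> y0 \<odot>\<^bsub>M\<^esub> y = \<zero>\<^bsub>M\<^esub>" using EVD[OF EV socle_cocycle[OF M y(1) _ eps(1,2)]] y(2) eps(3) by (simp add: cobdry_0)
  then have "(u \<otimes> \<epsilon> y0) \<odot>\<^bsub>M\<^esub> y = \<zero>\<^bsub>M\<^esub>" using mod_smult(3)[OF M eps(4) _ y(1), of "\<epsilon> y0"] lin_closed[OF eps(1,3)] M eps(4) by simp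
  then show "y = \<zero>\<^bsub>M\<^esub>" using eps(5) M y(1) by simp
qed

lemma dim_le1_socle:
  assumes M: "module R M" and d: "dim_le1 0 M"
    and y: "y \<in> carrier M" "\<And>a. a \<in> mx \<Longrightarrow> a \<odot>\<^bsub>M\<^esub> y = \<zero>\<^bsub>M\<^esub>"
    and y': "y' \<in> carrier M" "\<And>a. a \<in> mx \<Longrightarrow> a \<odot>\<^bsub>M\<^esub> y' = \<zero>\<^bsub>M\<^esub>"
  shows "\<exists>r \<in> carrier R. \<exists>s \<in> carrier R. (r \<notin> mx \<or> s \<notin> mx) \<and> r \<odot>\<^bsub>M\<^esub> y \<oplus>\<^bsub>M\<^esub> s \<odot>\<^bsub>M\<^esub> y' = \<zero>\<^bsub>M\<^esub>"
proof -
  obtain \<epsilon> y0 u where eps: "\<epsilon> \<in> lin (F 0) (self_module R)" "\<forall>y \<in> carrier (F 0). e y = \<zero>\<^bsub>rf\<^esub> \<longleftrightarrow> \<epsilon> y \<in> mx"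
    "y0 \<in> carrier (F 0)" "u \<in> carrier R" "u \<otimes> \<epsilon> y0 = \<one>" using augmentation by blast
  obtain r s where rs: "r \<in> carrier R" "s \<in> carrier R" "r \<notin> mx \<or> s \<notin> mx"
    "cobdry 0 M (\<lambda>v. r \<odot>\<^bsub>M\<^esub> (\<epsilon> v \<odot>\<^bsub>M\<^esub> y) \<oplus>\<^bsub>M\<^esub> s \<odot>\<^bsub>M\<^esub> (\<epsilon> v \<odot>\<^bsub>M\<^esub> y'))"
    using d socle_cocycle[OF M y eps(1,2)] socle_cocycle[OF M y' eps(1,2)] unfolding dim_le1_def by blast
  let ?e = "\<epsilon> y0"
  have ec: "?e \<in> carrier R" using lin_closed[OF eps(1,3)] by simp
  let ?s = "r \<odot>\<^bsub>M\<^esub> y \<oplus>\<^bsub>M\<^esub> s \<odot>\<^bsub>M\<^esub> y'"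
  have sc: "?s \<in> carrier M" using M y y' rs by simp
  have "?e \<odot>\<^bsub>M\<^esub> ?s = r \<odot>\<^bsub>M\<^esub> (?e \<odot>\<^bsub>M\<^esub> y) \<oplus>\<^bsub>M\<^esub> s \<odot>\<^bsub>M\<^esub> (?e \<odot>\<^bsub>M\<^esub> y')"
    using M y y' rs(1,2) ec by (simp add: mod_smult(1)[OF M] mod_smult_comm[OF M ec])
  then have "?e \<odot>\<^bsub>M\<^esub> ?s = \<zero>\<^bsub>M\<^esub>" using rs(4) eps(3) by (simp add: cobdry_0)
  then have "(u \<otimes> ?e) \<odot>\<^bsub>M\<^esub> ?s = \<zero>\<^bsub>M\<^esub>" using mod_smult(3)[OF M eps(4) ec sc] M eps(4) by simp
  then have "?s = \<zero>\<^bsub>M\<^esub>" using eps(5) M sc by simp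
  then show ?thesis using rs(1-3) by blast
qed

definition cochain_d :: "nat \<Rightarrow> ((nat \<Rightarrow> 'a) \<Rightarrow> 'm) \<Rightarrow> ((nat \<Rightarrow> 'a) \<Rightarrow> 'm)" where
  "cochain_d j f = compose (carrier (F (Suc j))) f (D j)"

lemma cochain_d_lin:
  assumes M: "module R M" shows "cochain_d j \<in> lin (hom_module R (F j) M) (hom_module R (F (Suc j)) M)"
proof (rule linI)
  let ?H = "hom_module R (F j) M" and ?H' = "hom_module R (F (Suc j)) M"
  note Dc = lin_closed[OF D_lin[of j]]
  have c: "cochain_d j f \<in> carrier ?H'" if "f \<in> carrier ?H" for f
    using lin_restrict[OF Fr_module lin_comp[OF _ D_lin[of j], of f M]] that
    by (simp add: cochain_d_def compose_def hom_simps(1))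
  fix f h assume fh: "f \<in> carrier ?H" 
  show "cochain_d j f \<in> carrier ?H'" using c fh by blast
  show "cochain_d j (f \<oplus>\<^bsub>?H\<^esub> h) = cochain_d j f \<oplus>\<^bsub>?H'\<^esub> cochain_d j h" if "h \<in> carrier ?H"
    using Dc by (auto simp: cochain_d_def compose_def hom_simps(3) fun_eq_iff)
  show "cochain_d j (r \<odot>\<^bsub>?H\<^esub> f) = r \<odot>\<^bsub>?H'\<^esub> cochain_d j f" if "r \<in> carrier R" for r
    using Dc by (auto simp: cochain_d_def compose_def hom_simps(4) fun_eq_iff)
qed

definition cocycles :: "nat \<Rightarrow> ('a, 'm) module \<Rightarrow> ((nat \<Rightarrow> 'a) \<Rightarrow> 'm) set" where
  "cocycles j M = {f \<in> carrier (hom_module R (F j) M). cochain_d j f = \<zero>\<^bsub>hom_module R (F (Suc j)) M\<^esub>}"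

definition cobdries :: "nat \<Rightarrow> ('a, 'm) module \<Rightarrow> ((nat \<Rightarrow> 'a) \<Rightarrow> 'm) set" where
  "cobdries j M = (case j of 0 \<Rightarrow> {\<zero>\<^bsub>hom_module R (F 0) M\<^esub>} | Suc i \<Rightarrow> cochain_d i ` carrier (hom_module R (F i) M))"

lemma hom_cohomology_eq:
  "hom_cohomology R n D j M = quot_module ((hom_module R (F j) M)\<lparr>carrier := cocycles j M\<rparr>) (cobdries j M)"
  unfolding hom_cohomology_def Let_def cocycles_def cobdries_def cochain_d_def by (cases j) simp_all

lemma in_cocycles_iff:
  assumes M: "module R M" and z: "z \<in> lin (F j) M"
  shows "restrict z (carrier (F j)) \<in> cocycles j M \<longleftrightarrow> cocyc j M z"
proof -
  have "cochain_d j (restrict z (carrier (F j))) = \<zero>\<^bsub>hom_module R (F (Suc j)) M\<^esub> \<longleftrightarrow>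
     (\<forall>v \<in> carrier (F (Suc j)). z (D j v) = \<zero>\<^bsub>M\<^esub>)"
    using lin_closed[OF D_lin[of j]] by (auto simp: cochain_d_def compose_def hom_simps(2) fun_eq_iff restrict_def)
  then show ?thesis using z lin_restrict[OF Fr_module z] unfolding cocycles_def cocyc_def by simp
qed

lemma in_cobdries_imp:
  assumes M: "module R M" and z: "restrict z (carrier (F j)) \<in> cobdries j M"
  shows "cobdry j M z"
proof (cases j)
  case 0
  then have "restrict z (carrier (F 0)) = (\<lambda>x \<in> carrier (F 0). \<zero>\<^bsub>M\<^esub>)" using z by (simp add: cobdries_def hom_simps(2))
  then have "z v = \<zero>\<^bsub>M\<^esub>" if "v \<in> carrier (F 0)" for v using that by (metis restrict_apply')
  then show ?thesis unfolding 0 cobdry_0 by blast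
next
  case (Suc i)
  then obtain h where h: "h \<in> carrier (hom_module R (F i) M)" "restrict z (carrier (F j)) = cochain_d i h" using z by (auto simp: cobdries_def)
  have "z v = h (D i v)" if "v \<in> carrier (F (Suc i))" for v
    using fun_cong[OF h(2), of v] that Suc by (simp add: cochain_d_def compose_def)
  then show ?thesis unfolding Suc cobdry_Suc using h(1) by (auto simp: hom_simps(1))
qed

lemma cocycles_cobdries_submodule:
  assumes M: "module R M"
  shows "submodule (cocycles j M) R (hom_module R (F j) M)"
    and "submodule (cobdries j M) R ((hom_module R (F j) M)\<lparr>carrier := cocycles j M\<rparr>)"
proof -
  let ?H = "hom_module R (F j) M"
  have H: "module R (hom_module R (F i) M)" for i using M by simp
  show Z: "submodule (cocycles j M) R ?H" unfolding cocycles_def by (rule submod_ker[OF H H cochain_d_lin[OF M]])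
  note Zm = submod_module[OF H Z]
  have B: "submodule (cobdries j M) R ?H"
    using submod_zero[OF H] submod_image[OF H H cochain_d_lin[OF M] submod_whole[OF H]]
    by (cases j) (simp_all add: cobdries_def)
  have BZ: "cobdries j M \<subseteq> cocycles j M"
  proof (cases j)
    case 0
    then show ?thesis using submodule_closed(2)[OF H Z] by (simp add: cobdries_def)
  next
    case (Suc i)
    have "cochain_d i h \<in> cocycles (Suc i) M" if h: "h \<in> carrier (hom_module R (F i) M)" for h
    proof -
      have hl: "h \<in> lin (F i) M" using h by (simp add: hom_simps(1))
      have "cochain_d i h = restrict (\<lambda>v. h (D i v)) (carrier (F (Suc i)))" by (simp add: cochain_d_def compose_def)
      moreover have "cocyc (Suc i) M (\<lambda>v. h (D i v))"
        unfolding cocyc_def using lin_comp[OF hl D_lin] DD lin_zero[OF hl Fr_module M] by simp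
      ultimately show ?thesis using in_cocycles_iff[OF M lin_comp[OF hl D_lin]] by simp
    qed
    then show ?thesis using Suc by (auto simp: cobdries_def)
  qed
  show "submodule (cobdries j M) R (?H\<lparr>carrier := cocycles j M\<rparr>)"
    using submodule_closed[OF H B] BZ by (intro submodI[OF Zm]) auto
qed

lemma EV_of_cohomology:
  assumes M: "module R M" and c: "carrier (hom_cohomology R n D j M) = {\<zero>\<^bsub>hom_cohomology R n D j M\<^esub>}"
  shows "EV j M"
  unfolding EV_def
proof (intro allI impI)
  fix z assume z: "cocyc j M z"
  let ?Z = "(hom_module R (F j) M)\<lparr>carrier := cocycles j M\<rparr>" and ?z = "restrict z (carrier (F j))"
  have H: "module R (hom_module R (F j) M)" using M by simp
  note S = cocycles_cobdries_submodule[OF M, of j]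
  note Q = quot_props[OF submod_module[OF H S(1)] S(2)]
  have zZ: "?z \<in> carrier ?Z" using in_cocycles_iff[OF M cocyc_lin[OF z]] z by simp
  then have "cobdries j M +>\<^bsub>?Z\<^esub> ?z = \<zero>\<^bsub>quot_module ?Z (cobdries j M)\<^esub>"
    using c Q(3) unfolding hom_cohomology_eq by blast
  then have "?z \<in> cobdries j M" using Q(4)[OF zZ] by simp
  then show "cobdry j M z" by (rule in_cobdries_imp[OF M])
qed

text \<open>Two classes with images \<open>a\<close> and \<open>b\<close> in the residue field satisfy the relation with coefficients \<open>b\<close> and \<open>-a\<close>, unless \<open>a\<close> is zero,
  when the first class vanishes.\<close>

lemma dim_le1_of_cohomology:
  assumes M: "module R M" and i: "iso_modules R (hom_cohomology R n D j M) rf"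
  shows "dim_le1 j M" and "carrier M \<noteq> {\<zero>\<^bsub>M\<^esub>}"
proof -
  let ?Z = "(hom_module R (F j) M)\<lparr>carrier := cocycles j M\<rparr>"
  let ?Q = "quot_module ?Z (cobdries j M)"
  have H: "module R (hom_module R (F j) M)" using M by simp
  note S = cocycles_cobdries_submodule[OF M, of j]
  note Zm = submod_module[OF H S(1)]
  note Q = quot_props[OF Zm S(2)]
  obtain f where f: "f \<in> lin ?Q rf" "bij_betw f (carrier ?Q) (carrier rf)" using i unfolding iso_modules_def hom_cohomology_eq by blast
  let ?k = "\<lambda>r. mx +>\<^bsub>self_module R\<^esub> r" and ?p = "\<lambda>z. cobdries j M +>\<^bsub>?Z\<^esub> z"
  have inj: "y = \<zero>\<^bsub>?Q\<^esub>" if "y \<in> carrier ?Q" "f y = \<zero>\<^bsub>rf\<^esub>" for y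
    using inj_onD[OF bij_betw_imp_inj_on[OF f(2)], of y "\<zero>\<^bsub>?Q\<^esub>"] that lin_zero[OF f(1) Q(1) rf_module] Q(1) by simp
  show "carrier M \<noteq> {\<zero>\<^bsub>M\<^esub>}"
  proof
    assume M0: "carrier M = {\<zero>\<^bsub>M\<^esub>}"
    have "z = \<zero>\<^bsub>hom_module R (F j) M\<^esub>" if "z \<in> carrier (hom_module R (F j) M)" for z
      by (rule hom_eqI[OF that mod_closed(1)[OF H]]) (use M0 that lin_closed[of z "F j" M] in \<open>auto simp: hom_simps(1,2)\<close>)
    then have "carrier ?Z \<subseteq> {\<zero>\<^bsub>?Z\<^esub>}" using submodule_closed(1)[OF H S(1)] by auto
    then have "carrier ?Q \<subseteq> {?p \<zero>\<^bsub>?Z\<^esub>}" using Q(3) by auto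
    then have "carrier rf \<subseteq> {f (?p \<zero>\<^bsub>?Z\<^esub>)}" using bij_betw_imp_surj_on[OF f(2)] by blast
    then have "?k \<one> = \<zero>\<^bsub>rf\<^esub>" using lin_closed[OF rf_lin, of \<one>] mod_closed(1)[OF rf_module] by auto
    then show False using rf_zero_iff[of \<one>] one_notin_mx by simp
  qed
  show "dim_le1 j M" unfolding dim_le1_def
  proof (intro allI impI)
    fix z z' assume z: "cocyc j M z" "cocyc j M z'"
    let ?z = "restrict z (carrier (F j))" and ?z' = "restrict z' (carrier (F j))"
    have zZ: "?z \<in> carrier ?Z" "?z' \<in> carrier ?Z"
      using in_cocycles_iff[OF M cocyc_lin[OF z(1)]] in_cocycles_iff[OF M cocyc_lin[OF z(2)]] z by simp_all
    then have pc: "?p ?z \<in> carrier ?Q" "?p ?z' \<in> carrier ?Q" using lin_closed[OF Q(2)] by blast+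
    have ex: "\<exists>a \<in> carrier R. f y = ?k a" if "y \<in> carrier ?Q" for y using lin_closed[OF f(1) that] rf_surj by blast
    obtain a where a: "a \<in> carrier R" "f (?p ?z) = ?k a" using ex[OF pc(1)] by blast
    obtain b where b: "b \<in> carrier R" "f (?p ?z') = ?k b" using ex[OF pc(2)] by blast
    have comb: "cobdry j M (\<lambda>v. r \<odot>\<^bsub>M\<^esub> z v \<oplus>\<^bsub>M\<^esub> s \<odot>\<^bsub>M\<^esub> z' v)" if rs: "r \<in> carrier R" "s \<in> carrier R" "r \<otimes> a \<oplus> s \<otimes> b \<in> mx" for r s
    proof -
      let ?w = "r \<odot>\<^bsub>?Z\<^esub> ?z \<oplus>\<^bsub>?Z\<^esub> s \<odot>\<^bsub>?Z\<^esub> ?z'"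
      have wZ: "?w \<in> carrier ?Z" using zZ rs(1,2) Zm by (intro mod_closed)
      have "f (?p ?w) = r \<odot>\<^bsub>rf\<^esub> ?k a \<oplus>\<^bsub>rf\<^esub> s \<odot>\<^bsub>rf\<^esub> ?k b"
      proof -
        have "?p ?w = r \<odot>\<^bsub>?Q\<^esub> ?p ?z \<oplus>\<^bsub>?Q\<^esub> s \<odot>\<^bsub>?Q\<^esub> ?p ?z'"
          using lin_add[OF Q(2) mod_closed(5)[OF Zm rs(1) zZ(1)] mod_closed(5)[OF Zm rs(2) zZ(2)]]
            lin_smult[OF Q(2) rs(1) zZ(1)] lin_smult[OF Q(2) rs(2) zZ(2)] by simp
        then show ?thesis using a b rs(1,2)
            lin_add[OF f(1) mod_closed(5)[OF Q(1) rs(1) pc(1)] mod_closed(5)[OF Q(1) rs(2) pc(2)]]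
            lin_smult[OF f(1) rs(1) pc(1)] lin_smult[OF f(1) rs(2) pc(2)] by simp
      qed
      also have "\<dots> = ?k (r \<otimes> a \<oplus> s \<otimes> b)"
        using a(1) b(1) rs(1,2) lin_add[OF rf_lin, of "r \<otimes> a" "s \<otimes> b"] lin_smult[OF rf_lin rs(1), of a] lin_smult[OF rf_lin rs(2), of b] by simp
      also have "\<dots> = \<zero>\<^bsub>rf\<^esub>" using rf_zero_iff rs a(1) b(1) by simp
      finally have "?p ?w = \<zero>\<^bsub>?Q\<^esub>" using inj lin_closed[OF Q(2) wZ] by blast
      then have wB: "?w \<in> cobdries j M" using Q(4)[OF wZ] by simp
      have weq: "?w = restrict (\<lambda>v. r \<odot>\<^bsub>M\<^esub> z v \<oplus>\<^bsub>M\<^esub> s \<odot>\<^bsub>M\<^esub> z' v) (carrier (F j))"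
        by (auto simp: hom_simps(3,4) fun_eq_iff)
      show ?thesis by (rule in_cobdries_imp[OF M wB[unfolded weq]])
    qed
    show "\<exists>r\<in>carrier R. \<exists>s\<in>carrier R. (r \<notin> mx \<or> s \<notin> mx) \<and> cobdry j M (\<lambda>v. r \<odot>\<^bsub>M\<^esub> z v \<oplus>\<^bsub>M\<^esub> s \<odot>\<^bsub>M\<^esub> z' v)"
    proof (cases "a \<in> mx")
      case True
      then have "\<one> \<otimes> a \<oplus> \<zero> \<otimes> b \<in> mx" using a(1) b(1) by simp
      then show ?thesis using comb[of \<one> \<zero>] one_notin_mx by blast
    next
      case False
      have "b \<otimes> a \<oplus> (\<ominus> a) \<otimes> b = \<zero>" using a(1) b(1) by algebra
      then have "b \<otimes> a \<oplus> (\<ominus> a) \<otimes> b \<in> mx" using mx_zero by simp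
      moreover have "\<ominus> a \<notin> mx" using False mx_neg[of "\<ominus> a"] a(1) by auto
      ultimately show ?thesis using comb[of b "\<ominus> a"] a(1) b(1) by blast
    qed
  qed
qed

end

section \<open>Modules whose duals are Cohen--Macaulay\<close>

context cring
begin

lemma seq_mult_lin_sub:
  assumes "module R M" "module R N" "f \<in> lin M N" "set xs \<subseteq> carrier R" "t \<in> seq_mult M xs"
  shows "f t \<in> seq_mult N xs"
proof -
  have "seq_mult M xs \<subseteq> {m \<in> carrier M. f m \<in> seq_mult N xs}"
  proof (rule seq_mult_least[OF assms(1,4)])
    show "submodule {m \<in> carrier M. f m \<in> seq_mult N xs} R M"
      by (rule submod_preimage[OF assms(1-3) seq_mult_submodule[OF assms(2,4)]])
    fix x m assume xm: "x \<in> set xs" "m \<in> carrier M"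
    then have "x \<in> carrier R" using assms(4) by blast
    then show "x \<odot>\<^bsub>M\<^esub> m \<in> {m \<in> carrier M. f m \<in> seq_mult N xs}"
      using xm assms(1) seq_mult_gen[OF assms(2,4) xm(1) lin_closed[OF assms(3) xm(2)]] lin_smult[OF assms(3)] by simp
  qed
  then show ?thesis using assms(5) by blast
qed

lemma wreg_iso:
  assumes M: "module R M" and N: "module R N" and f: "f \<in> lin M N" "f ` carrier M = carrier N"
    "\<And>x. x \<in> carrier M \<Longrightarrow> f x = \<zero>\<^bsub>N\<^esub> \<Longrightarrow> x = \<zero>\<^bsub>M\<^esub>" and xs: "wreg M xs"
  shows "wreg N xs"
  unfolding wreg_def
proof (intro conjI allI impI ballI)
  show xc: "set xs \<subseteq> carrier R" by (rule wreg_carr[OF xs])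
  obtain h where h: "h \<in> lin N M" "\<And>y. y \<in> carrier N \<Longrightarrow> f (h y) = y" using lin_inverse[OF M N f] by blast
  fix i y assume i: "i < length xs" and y: "y \<in> carrier N" "(xs ! i) \<odot>\<^bsub>N\<^esub> y \<in> seq_mult N (take i xs)"
  have tc: "set (take i xs) \<subseteq> carrier R" using xc set_take_subset[of i xs] by blast
  have x: "xs ! i \<in> carrier R" using xc i nth_mem by blast
  have "h ((xs ! i) \<odot>\<^bsub>N\<^esub> y) \<in> seq_mult M (take i xs)" by (rule seq_mult_lin_sub[OF N M h(1) tc y(2)])
  then have "(xs ! i) \<odot>\<^bsub>M\<^esub> h y \<in> seq_mult M (take i xs)" using lin_smult[OF h(1) x y(1)] by simp
  then have "h y \<in> seq_mult M (take i xs)" using wregD[OF xs i lin_closed[OF h(1) y(1)]] by simp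
  then have "f (h y) \<in> seq_mult N (take i xs)" by (rule seq_mult_lin_sub[OF M N f(1) tc])
  then show "y \<in> seq_mult N (take i xs)" using h(2) y(1) by simp
qed

text \<open>For direct powers all conditions on a sequence can be checked componentwise.\<close>

lemma seq_mult_dp:
  assumes M: "module R M" and xs: "set xs \<subseteq> carrier R" and y: "y \<in> carrier (direct_power n M)"
  shows "y \<in> seq_mult (direct_power n M) xs \<longleftrightarrow> (\<forall>i < n. y i \<in> seq_mult M xs)"
proof
  assume "y \<in> seq_mult (direct_power n M) xs"
  then show "\<forall>i < n. y i \<in> seq_mult M xs"
    using seq_mult_lin_sub[OF dp_module[OF M] M dp_coord_lin xs, of _ n y] by blast
next
  show "\<forall>i < n. y i \<in> seq_mult M xs \<Longrightarrow> y \<in> seq_mult (direct_power n M) xs" using xs y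
  proof (induct xs arbitrary: y rule: rev_induct)
    case Nil
    then have "y = \<zero>\<^bsub>direct_power n M\<^esub>"
    proof (intro dp_eqI[of y n M] mod_closed(1)[OF dp_module[OF M]])
      fix i assume "i < n"
      then show "y i = \<zero>\<^bsub>direct_power n M\<^esub> i" using Nil(1) by (simp add: seq_mult_Nil[OF M] dp_simps(2))
    qed
    then show ?case using seq_mult_Nil[OF dp_module[OF M]] by simp
  next
    case (snoc x xs)
    have xc: "set xs \<subseteq> carrier R" "x \<in> carrier R" using snoc(3) by auto
    have "\<forall>i. \<exists>t m. i < n \<longrightarrow> t \<in> seq_mult M xs \<and> m \<in> carrier M \<and> y i = t \<oplus>\<^bsub>M\<^esub> x \<odot>\<^bsub>M\<^esub> m"
      using snoc(2) seq_mult_snoc[OF M xc] by blast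
    then obtain t m where tm: "\<And>i. i < n \<Longrightarrow> t i \<in> seq_mult M xs \<and> m i \<in> carrier M \<and> y i = t i \<oplus>\<^bsub>M\<^esub> x \<odot>\<^bsub>M\<^esub> m i" by metis
    have sub: "seq_mult M xs \<subseteq> carrier M" by (rule submodule_closed(1)[OF M seq_mult_submodule[OF M xc(1)]])
    let ?t = "\<lambda>i\<in>{..<n}. t i" and ?m = "\<lambda>i\<in>{..<n}. m i"
    have c: "?t \<in> carrier (direct_power n M)" "?m \<in> carrier (direct_power n M)" using tm sub by (auto intro!: dpI)
    have "\<forall>i < n. ?t i \<in> seq_mult M xs" using tm by simp
    then have "?t \<in> seq_mult (direct_power n M) xs" using snoc(1)[OF _ xc(1) c(1)] by blast
    moreover have "y = ?t \<oplus>\<^bsub>direct_power n M\<^esub> x \<odot>\<^bsub>direct_power n M\<^esub> ?m"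
      using M c xc(2) tm by (intro dp_eqI[OF snoc(4)]) (simp_all add: dp_simps(3,4)[of n M], simp add: dp_simps(1) subset_iff PiE_iff extensional_def sub[THEN subsetD])
    ultimately show ?case using seq_mult_snoc[OF dp_module[OF M] xc, of n] c(2) by blast
  qed
qed

lemma wreg_dp:
  assumes M: "module R M" and xs: "wreg M xs" shows "wreg (direct_power n M) xs"
  unfolding wreg_def
proof (intro conjI allI impI ballI)
  show xc: "set xs \<subseteq> carrier R" by (rule wreg_carr[OF xs])
  fix i y assume i: "i < length xs" and y: "y \<in> carrier (direct_power n M)"
    "(xs ! i) \<odot>\<^bsub>direct_power n M\<^esub> y \<in> seq_mult (direct_power n M) (take i xs)"
  have tc: "set (take i xs) \<subseteq> carrier R" using xc set_take_subset[of i xs] by blast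
  have x: "xs ! i \<in> carrier R" using xc i nth_mem by blast
  have xy: "(xs ! i) \<odot>\<^bsub>direct_power n M\<^esub> y \<in> carrier (direct_power n M)" using y(1) x M by simp
  have "y l \<in> seq_mult M (take i xs)" if l: "l < n" for l
    using y(2) wregD[OF xs i dp_coord[OF y(1) l]] l unfolding seq_mult_dp[OF M tc xy] by (simp add: dp_simps(4))
  then show "y \<in> seq_mult (direct_power n M) (take i xs)" unfolding seq_mult_dp[OF M tc y(1)] by blast
qed

lemma seq_mult_submodule_sub:
  assumes A: "module R A" and S: "submodule S R A" and xs: "set xs \<subseteq> carrier R"
  shows "seq_mult (A\<lparr>carrier := S\<rparr>) xs \<subseteq> seq_mult A xs"
proof -
  have "(\<lambda>x. x) \<in> lin (A\<lparr>carrier := S\<rparr>) A" using submodule_closed(1)[OF A S] by (intro linI) auto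
  then show ?thesis using seq_mult_lin_sub[OF submod_module[OF A S] A _ xs] by blast
qed

text \<open>As the sequence is regular on \<open>B\<close>, \<open>Tor\<close> of \<open>B\<close> and \<open>R / (x\<^sub>1, \<dots>, x\<^sub>i)\<close> vanishes in degree one. So the intersection of the kernel \<open>S\<close> of
  \<open>A \<rightarrow> B\<close> with \<open>(x\<^sub>1, \<dots>, x\<^sub>i) A\<close> is \<open>(x\<^sub>1, \<dots>, x\<^sub>i) S\<close>; the proof is an elementary induction on \<open>i\<close>.\<close>

lemma seq_mult_kernel:
  assumes A: "module R A" and B: "module R B" and p: "p \<in> lin A B" "p ` carrier A = carrier B"
    and S: "S = {a \<in> carrier A. p a = \<zero>\<^bsub>B\<^esub>}" and xs: "wreg B xs" and i: "i \<le> length xs"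
    and t: "t \<in> S" "t \<in> seq_mult A (take i xs)"
  shows "t \<in> seq_mult (A\<lparr>carrier := S\<rparr>) (take i xs)"
  using i t
proof (induct i arbitrary: t)
  case 0
  have "submodule S R A" unfolding S by (rule submod_ker[OF A B p(1)])
  then show ?case using 0 seq_mult_Nil[OF A] seq_mult_Nil[OF submod_module[OF A]] by simp
next
  case (Suc i)
  note xc = wreg_carr[OF xs]
  have sS: "submodule S R A" unfolding S by (rule submod_ker[OF A B p(1)])
  note Sc = submodule_closed[OF A sS] and Sm = submod_module[OF A sS]
  have tc: "set (take i xs) \<subseteq> carrier R" using xc set_take_subset[of i xs] by blast
  have il: "i < length xs" using Suc(2) by simp
  let ?x = "xs ! i"
  have x: "?x \<in> carrier R" using xc il nth_mem by blast
  note TA = submodule_closed[OF A seq_mult_submodule[OF A tc]] and TB = submodule_closed[OF B seq_mult_submodule[OF B tc]]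
  obtain t1 y where t1: "t1 \<in> seq_mult A (take i xs)" "y \<in> carrier A" "t = t1 \<oplus>\<^bsub>A\<^esub> ?x \<odot>\<^bsub>A\<^esub> y"
    using Suc(4) seq_mult_take_Suc[OF A xc il] by blast
  have c: "t1 \<in> carrier A" "t \<in> carrier A" using t1 TA(1) Suc(3) Sc(1) by auto
  have e: "p t1 \<oplus>\<^bsub>B\<^esub> ?x \<odot>\<^bsub>B\<^esub> p y = \<zero>\<^bsub>B\<^esub>" using Suc(3) t1 c A x by (simp add: S lin_add[OF p(1)] lin_smult[OF p(1)])
  have pc: "p t1 \<in> carrier B" "p y \<in> carrier B" using lin_closed[OF p(1)] c t1(2) by auto
  have "?x \<odot>\<^bsub>B\<^esub> p y = \<ominus>\<^bsub>B\<^esub> p t1 \<oplus>\<^bsub>B\<^esub> (p t1 \<oplus>\<^bsub>B\<^esub> ?x \<odot>\<^bsub>B\<^esub> p y)"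
    using B x pc mod_simps(11)[OF B pc(1), of "?x \<odot>\<^bsub>B\<^esub> p y"] by simp
  also have "\<dots> = \<ominus>\<^bsub>B\<^esub> p t1" unfolding e using B pc by simp
  also have "\<dots> \<in> seq_mult B (take i xs)" using TB(4) seq_mult_lin_sub[OF A B p(1) tc t1(1)] by blast
  finally have "p y \<in> seq_mult B (take i xs)" using wregD[OF xs il pc(2)] by blast
  then have "p y \<in> p ` seq_mult A (take i xs)" using seq_mult_lin_surj[OF A B p(1) tc p(2)] by simp
  then obtain t2 where t2: "t2 \<in> seq_mult A (take i xs)" "p y = p t2" by blast
  have t2c: "t2 \<in> carrier A" using t2 TA(1) by blast
  let ?s = "y \<ominus>\<^bsub>A\<^esub> t2"
  have s: "?s \<in> S" using t2 t2c t1(2) A B pc lin_closed[OF p(1)] by (simp add: S lin_minus[OF p(1)])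
  then have sc: "?s \<in> carrier A" using Sc(1) by blast
  let ?q = "t1 \<oplus>\<^bsub>A\<^esub> ?x \<odot>\<^bsub>A\<^esub> t2"
  have eq: "t = ?q \<oplus>\<^bsub>A\<^esub> ?x \<odot>\<^bsub>A\<^esub> ?s"
    using t1(2,3) c(1) t2c x A by (simp add: mod_smult(6)[OF A], simp add: mod_ac[OF A])
  have qc: "?q \<in> carrier A" using c t2c x A by simp
  have "?q = t \<ominus>\<^bsub>A\<^esub> ?x \<odot>\<^bsub>A\<^esub> ?s" unfolding eq using qc sc x A by (simp add: mod_ac[OF A])
  then have "?q \<in> S" using Sc(6)[OF Suc(3) Sc(5)[OF x s]] by simp
  moreover have "?q \<in> seq_mult A (take i xs)" using TA(3)[OF t1(1) TA(5)[OF x t2(1)]] .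
  ultimately have "?q \<in> seq_mult (A\<lparr>carrier := S\<rparr>) (take i xs)" using Suc(1) Suc(2) by simp
  then have "t \<in> {t \<oplus>\<^bsub>A\<lparr>carrier := S\<rparr>\<^esub> ?x \<odot>\<^bsub>A\<lparr>carrier := S\<rparr>\<^esub> m | t m. t \<in> seq_mult (A\<lparr>carrier := S\<rparr>) (take i xs) \<and> m \<in> carrier (A\<lparr>carrier := S\<rparr>)}"
    using eq s by auto
  then show ?case using seq_mult_take_Suc[OF Sm xc il] by blast
qed

text \<open>The depth of a kernel exceeds that of the target by one, up to the depth of the source.\<close>

lemma wreg_kernel:
  assumes A: "module R A" and B: "module R B" and p: "p \<in> lin A B" "p ` carrier A = carrier B"
    and S: "S = {a \<in> carrier A. p a = \<zero>\<^bsub>B\<^esub>}" and xs: "wreg A xs" "\<And>i. i < length xs \<Longrightarrow> wreg B (take i xs)"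
  shows "wreg (A\<lparr>carrier := S\<rparr>) xs"
  unfolding wreg_def
proof (intro conjI allI impI ballI)
  show xc: "set xs \<subseteq> carrier R" by (rule wreg_carr[OF xs(1)])
  have sS: "submodule S R A" unfolding S by (rule submod_ker[OF A B p(1)])
  fix i m assume i: "i < length xs" and m: "m \<in> carrier (A\<lparr>carrier := S\<rparr>)"
    "(xs ! i) \<odot>\<^bsub>A\<lparr>carrier := S\<rparr>\<^esub> m \<in> seq_mult (A\<lparr>carrier := S\<rparr>) (take i xs)"
  have tc: "set (take i xs) \<subseteq> carrier R" using xc set_take_subset[of i xs] by blast
  have mS: "m \<in> S" using m by simp
  then have mc: "m \<in> carrier A" using submodule_closed(1)[OF A sS] by blast
  have "(xs ! i) \<odot>\<^bsub>A\<^esub> m \<in> seq_mult A (take i xs)" using m(2) seq_mult_submodule_sub[OF A sS tc] by auto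
  then have "m \<in> seq_mult A (take i xs)" using wregD[OF xs(1) i mc] by blast
  then show "m \<in> seq_mult (A\<lparr>carrier := S\<rparr>) (take i xs)"
    using seq_mult_kernel[OF A B p S xs(2)[OF i], of i m] mS i by (simp add: min_def)
qed

lemma wreg_extend:
  assumes M: "module R M" and xs: "wreg M xs" and x: "x \<in> carrier R"
    and r: "\<forall>y \<in> carrier (level M xs (length xs)). x \<odot>\<^bsub>level M xs (length xs)\<^esub> y = \<zero>\<^bsub>level M xs (length xs)\<^esub> \<longrightarrow> y = \<zero>\<^bsub>level M xs (length xs)\<^esub>"
  shows "wreg M (xs @ [x])"
proof (rule wreg_snoc[OF xs x])
  note xc = wreg_carr[OF xs]
  note L = level_props[OF M xc]
  fix m assume m: "m \<in> carrier M" "x \<odot>\<^bsub>M\<^esub> m \<in> seq_mult M xs"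
  let ?l = "lproj M xs (length xs)"
  have "x \<odot>\<^bsub>level M xs (length xs)\<^esub> ?l m = \<zero>\<^bsub>level M xs (length xs)\<^esub>"
    using lin_smult[OF L(2) x m(1), of "length xs"] L(4)[of "x \<odot>\<^bsub>M\<^esub> m" "length xs"] m M x by simp
  then have "?l m = \<zero>\<^bsub>level M xs (length xs)\<^esub>" using r lin_closed[OF L(2) m(1)] by blast
  then show "m \<in> seq_mult M xs" using L(4)[OF m(1), of "length xs"] by simp
qed

definition precomp :: "('a, 'm) module \<Rightarrow> ('m \<Rightarrow> 'n) \<Rightarrow> ('n \<Rightarrow> 'o) \<Rightarrow> ('m \<Rightarrow> 'o)" where
  "precomp A p f = restrict (\<lambda>x. f (p x)) (carrier A)"

lemma precomp_lin:
  assumes A: "module R A" and p: "p \<in> lin A B"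
  shows "precomp A p \<in> lin (hom_module R B C) (hom_module R A C)"
proof (rule linI)
  note pc = lin_closed[OF p]
  show "precomp A p f \<in> carrier (hom_module R A C)" if "f \<in> carrier (hom_module R B C)" for f
    using lin_restrict[OF A lin_comp[OF _ p, of f C]] that by (simp add: precomp_def hom_simps(1))
  show "precomp A p (f \<oplus>\<^bsub>hom_module R B C\<^esub> h) = precomp A p f \<oplus>\<^bsub>hom_module R A C\<^esub> precomp A p h" for f h
    using pc by (auto simp: precomp_def hom_simps(3) fun_eq_iff)
  show "precomp A p (r \<odot>\<^bsub>hom_module R B C\<^esub> f) = r \<odot>\<^bsub>hom_module R A C\<^esub> precomp A p f" for r f
    using pc by (auto simp: precomp_def hom_simps(4) fun_eq_iff)
qed

lemma precomp_inj:
  assumes B: "module R B" and C: "module R C" and p: "p \<in> lin A B" "p ` carrier A = carrier B"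
    and f: "f \<in> carrier (hom_module R B C)" "precomp A p f = \<zero>\<^bsub>hom_module R A C\<^esub>"
  shows "f = \<zero>\<^bsub>hom_module R B C\<^esub>"
proof (rule hom_eqI[OF f(1) mod_closed(1)[OF hom_is_module[OF B C]]])
  fix b assume b: "b \<in> carrier B"
  then obtain x where x: "x \<in> carrier A" "b = p x" unfolding p(2)[symmetric] by blast
  have "f (p x) = \<zero>\<^bsub>C\<^esub>" using fun_cong[OF f(2), of x] x(1) by (simp add: precomp_def hom_simps(2))
  then show "f b = \<zero>\<^bsub>hom_module R B C\<^esub> b" using x(2) b by (simp add: hom_simps(2))
qed

lemma precomp_image:
  assumes A: "module R A" and B: "module R B" and C: "module R C" and p: "p \<in> lin A B" "p ` carrier A = carrier B"
    and h: "h \<in> carrier (hom_module R A C)" "\<And>x. x \<in> carrier A \<Longrightarrow> p x = \<zero>\<^bsub>B\<^esub> \<Longrightarrow> h x = \<zero>\<^bsub>C\<^esub>"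
  shows "h \<in> precomp A p ` carrier (hom_module R B C)"
proof -
  have "h \<in> lin A C" using h(1) by (simp add: hom_simps(1))
  then have "\<exists>f \<in> lin B C. \<forall>x \<in> carrier A. f (p x) = h x" by (rule lin_factor[OF A B C p]) (rule h(2))
  then obtain f where f: "f \<in> lin B C" "\<forall>x \<in> carrier A. f (p x) = h x" by blast
  have "h = precomp A p (restrict f (carrier B))"
    by (rule hom_eqI[OF h(1) lin_closed[OF precomp_lin[OF A p(1)] lin_restrict[OF B f(1)]]])
      (use f(2) lin_closed[OF p(1)] in \<open>simp add: precomp_def\<close>)
  then show ?thesis using lin_restrict[OF B f(1)] by blast
qed

end

context resolved
begin

text \<open>As long as \<open>Ext\<^sup>j(k, M) = 0\<close> for \<open>j < r\<close>, the quotients by fewer than \<open>r\<close> elements have no socle, and prime avoidance finds the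
  next element.\<close>

lemma common_regular_sequence:
  fixes M1 :: "('a, 'm1) module" and M2 :: "('a, 'm2) module" and M3 :: "('a, 'm3) module"
  assumes M1: "noeth M1" "\<And>j. j < r \<Longrightarrow> EV j M1" and M2: "noeth M2" "\<And>j. j < r \<Longrightarrow> EV j M2"
    and M3: "noeth M3" "\<And>j. j < r \<Longrightarrow> EV j M3"
  shows "\<exists>xs. length xs = r \<and> set xs \<subseteq> mx \<and> wreg M1 xs \<and> wreg M2 xs \<and> wreg M3 xs"
proof -
  note m = noeth_module[OF M1(1)] noeth_module[OF M2(1)] noeth_module[OF M3(1)]
  have "\<exists>xs. length xs = k \<and> set xs \<subseteq> mx \<and> wreg M1 xs \<and> wreg M2 xs \<and> wreg M3 xs" if "k \<le> r" for k
    using that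
  proof (induct k)
    case 0
    then show ?case by (simp add: wreg_def)
  next
    case (Suc k)
    obtain xs where xs: "length xs = k" "set xs \<subseteq> mx" "wreg M1 xs" "wreg M2 xs" "wreg M3 xs" using Suc by auto
    note xc = wreg_carr[OF xs(3)]
    have EV: "EV 0 (level M1 xs k)" "EV 0 (level M2 xs k)" "EV 0 (level M3 xs k)"
      using Suc(2) xs by (auto intro!: EV_level[OF m(1) xs(3) M1(2)] EV_level[OF m(2) xs(4) M2(2)] EV_level[OF m(3) xs(5) M3(2)])
    have "\<exists>x \<in> mx. (\<forall>y \<in> carrier (level M1 xs k). x \<odot>\<^bsub>level M1 xs k\<^esub> y = \<zero>\<^bsub>level M1 xs k\<^esub> \<longrightarrow> y = \<zero>\<^bsub>level M1 xs k\<^esub>) \<and>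
      (\<forall>y \<in> carrier (level M2 xs k). x \<odot>\<^bsub>level M2 xs k\<^esub> y = \<zero>\<^bsub>level M2 xs k\<^esub> \<longrightarrow> y = \<zero>\<^bsub>level M2 xs k\<^esub>) \<and>
      (\<forall>y \<in> carrier (level M3 xs k). x \<odot>\<^bsub>level M3 xs k\<^esub> y = \<zero>\<^bsub>level M3 xs k\<^esub> \<longrightarrow> y = \<zero>\<^bsub>level M3 xs k\<^esub>)"
      by (rule exists_regular_element[OF level_noeth[OF M1(1) xc] EV0_no_socle[OF level_module[OF m(1) xc] EV(1)]
        level_noeth[OF M2(1) xc] EV0_no_socle[OF level_module[OF m(2) xc] EV(2)]
        level_noeth[OF M3(1) xc] EV0_no_socle[OF level_module[OF m(3) xc] EV(3)]])
    then obtain x where x: "x \<in> mx" and reg: "(\<forall>y \<in> carrier (level M1 xs k). x \<odot>\<^bsub>level M1 xs k\<^esub> y = \<zero>\<^bsub>level M1 xs k\<^esub> \<longrightarrow> y = \<zero>\<^bsub>level M1 xs k\<^esub>) \<and>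
      (\<forall>y \<in> carrier (level M2 xs k). x \<odot>\<^bsub>level M2 xs k\<^esub> y = \<zero>\<^bsub>level M2 xs k\<^esub> \<longrightarrow> y = \<zero>\<^bsub>level M2 xs k\<^esub>) \<and>
      (\<forall>y \<in> carrier (level M3 xs k). x \<odot>\<^bsub>level M3 xs k\<^esub> y = \<zero>\<^bsub>level M3 xs k\<^esub> \<longrightarrow> y = \<zero>\<^bsub>level M3 xs k\<^esub>)" ..
    have xR: "x \<in> carrier R" using mx_carr[OF x] .
    note w = wreg_extend[OF m(1) xs(3) xR, unfolded xs(1), OF reg[THEN conjunct1]]
      wreg_extend[OF m(2) xs(4) xR, unfolded xs(1), OF reg[THEN conjunct2, THEN conjunct1]]
      wreg_extend[OF m(3) xs(5) xR, unfolded xs(1), OF reg[THEN conjunct2, THEN conjunct2]]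
    have "length (xs @ [x]) = Suc k \<and> set (xs @ [x]) \<subseteq> mx \<and> wreg M1 (xs @ [x]) \<and> wreg M2 (xs @ [x]) \<and> wreg M3 (xs @ [x])"
      using xs x w by simp
    then show ?case by blast
  qed
  then show ?thesis by simp
qed

text \<open>If the dimension were infinite, all \<open>Ext\<^sup>j(k, R)\<close> would vanish, and every regular sequence in the maximal ideal could be
  extended. The ideals generated by such sequences would have no maximal element.\<close>

lemma cohen_macaulay_finite_dim:
  assumes cm: "cohen_macaulay_ring R" shows "krull_dim R \<noteq> \<infinity>"
proof
  assume "krull_dim R = \<infinity>"
  then have dep: "depth R (self_module R) = \<infinity>" using cm_ring_depth[OF cm] by simp
  let ?S = "self_module R"
  have EV: "EV j ?S" for j
  proof -
    obtain xs where "length xs = Suc j" "set xs \<subseteq> mx" "wreg ?S xs" using depth_ge[of "Suc j" ?S] dep by auto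
    then show ?thesis using EV_regular_sequence[OF self_is_module, of xs j] by simp
  qed
  let ?F = "{seq_mult ?S xs | xs. wreg ?S xs \<and> set xs \<subseteq> mx}"
  have ne: "?F \<noteq> {}" by (auto simp: wreg_def intro!: exI[of _ "[]"])
  have sm: "submodule K R ?S" if "K \<in> ?F" for K using that seq_mult_submodule[OF self_is_module wreg_carr] by auto
  have "\<exists>K \<in> ?F. \<forall>L \<in> ?F. K \<subseteq> L \<longrightarrow> L = K" by (rule noeth_maximal[OF noeth_R ne sm])
  then obtain K where K: "K \<in> ?F" "\<forall>L \<in> ?F. K \<subseteq> L \<longrightarrow> L = K" by blast
  obtain xs where xs: "wreg ?S xs" "set xs \<subseteq> mx" "K = seq_mult ?S xs" using K(1) by blast
  note xc = wreg_carr[OF xs(1)]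
  let ?L = "level ?S xs (length xs)"
  have "EV 0 ?L" by (rule EV_level[OF self_is_module xs(1) EV, where r = "Suc (length xs)"]) auto
  then have ns: "no_socle ?L" by (rule EV0_no_socle[OF level_module[OF self_is_module xc]])
  note nl = level_noeth[OF noeth_R xc, of "length xs"]
  obtain x where x: "x \<in> mx" "\<forall>y \<in> carrier ?L. x \<odot>\<^bsub>?L\<^esub> y = \<zero>\<^bsub>?L\<^esub> \<longrightarrow> y = \<zero>\<^bsub>?L\<^esub>"
    using exists_regular_element[OF nl ns nl ns nl ns] by blast
  have xR: "x \<in> carrier R" using mx_carr[OF x(1)] .
  have w: "wreg ?S (xs @ [x])" by (rule wreg_extend[OF self_is_module xs(1) xR x(2)])
  have "seq_mult ?S (xs @ [x]) \<in> ?F" using w x(1) xs(2) by (intro CollectI exI[of _ "xs @ [x]"]) simp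
  moreover have "K \<subseteq> seq_mult ?S (xs @ [x])"
    unfolding xs(3) using seq_mult_gen[OF self_is_module wreg_carr[OF w]]
    by (intro seq_mult_least[OF self_is_module xc seq_mult_submodule[OF self_is_module wreg_carr[OF w]]]) auto
  ultimately have eq: "seq_mult ?S (xs @ [x]) = K" using K(2) by blast
  have "x \<odot>\<^bsub>?S\<^esub> \<one> \<in> seq_mult ?S (xs @ [x])" by (rule seq_mult_gen[OF self_is_module wreg_carr[OF w]]) auto
  then have "x \<odot>\<^bsub>?S\<^esub> \<one> \<in> seq_mult ?S (take (length xs) (xs @ [x]))" using eq xs(3) by simp
  then have "\<one> \<in> seq_mult ?S xs" using wregD[OF w, of "length xs" \<one>] by simp
  moreover have "seq_mult ?S xs \<subseteq> mx"
    using xs(2) mx_mult(2) by (intro seq_mult_least[OF self_is_module xc mx_submodule]) auto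
  ultimately show False using one_notin_mx by blast
qed

definition syz :: "nat \<Rightarrow> ('a, nat \<Rightarrow> 'a) module" where
  "syz j = (F j)\<lparr>carrier := D j ` carrier (F (Suc j))\<rparr>"

lemma syz_submodule: "submodule (D j ` carrier (F (Suc j))) R (F j)"
  by (rule submod_image[OF Fr_module Fr_module D_lin submod_whole[OF Fr_module]])

lemma syz_module: "module R (syz j)"
  unfolding syz_def by (rule submod_module[OF Fr_module syz_submodule])

lemma D_lin_syz: "D j \<in> lin (F (Suc j)) (syz j)"
  by (rule linI) (simp_all add: syz_def lin_add[OF D_lin] lin_smult[OF D_lin])

lemma D_surj_syz: "D j ` carrier (F (Suc j)) = carrier (syz j)"
  by (simp add: syz_def)

lemma syz_Suc_kernel: "D (Suc j) ` carrier (F (Suc (Suc j))) = {v \<in> carrier (F (Suc j)). D j v = \<zero>\<^bsub>syz j\<^esub>}"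
  unfolding im_D syz_def by simp

text \<open>Every syzygy gains one in depth, so that from the \<open>dim R\<close>-th one on the syzygies have full depth.\<close>

lemma syz_wreg:
  assumes xs: "wreg (self_module R) xs" shows "wreg (syz j) (take (Suc j) xs)"
proof (induct j)
  case 0
  show ?case unfolding syz_def
  proof (rule wreg_kernel[OF Fr_module rf_module e_lin e_surj im_D0])
    show "wreg (F 0) (take (Suc 0) xs)" by (intro wreg_take wreg_dp self_is_module xs)
    fix i assume "i < length (take (Suc 0) xs)"
    then have "i = 0" by simp
    then show "wreg rf (take i (take (Suc 0) xs))" by (simp add: wreg_def)
  qed
next
  case (Suc j)
  have "wreg ((F (Suc j))\<lparr>carrier := D (Suc j) ` carrier (F (Suc (Suc j)))\<rparr>) (take (Suc (Suc j)) xs)"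
  proof (rule wreg_kernel[OF Fr_module syz_module D_lin_syz D_surj_syz syz_Suc_kernel])
    show "wreg (F (Suc j)) (take (Suc (Suc j)) xs)" by (intro wreg_take wreg_dp self_is_module xs)
    fix i assume "i < length (take (Suc (Suc j)) xs)"
    then have "i \<le> Suc j" by simp
    then have "take i (take (Suc (Suc j)) xs) = take i (take (Suc j) xs)" by (simp add: min_def)
    then show "wreg (syz j) (take i (take (Suc (Suc j)) xs))" using wreg_take[OF Suc] by metis
  qed
  then show ?case by (simp add: syz_def)
qed

lemma EV_zero_module: "module R M \<Longrightarrow> carrier M = {\<zero>\<^bsub>M\<^esub>} \<Longrightarrow> EV j M"
  unfolding EV_def
proof (intro allI impI)
  fix z assume M: "module R M" "carrier M = {\<zero>\<^bsub>M\<^esub>}" and z: "cocyc j M z"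
  then have "z v = \<zero>\<^bsub>M\<^esub>" if "v \<in> carrier (F j)" for v using lin_closed[OF cocyc_lin[OF z] that] by simp
  then show "cobdry j M z" using lin_zero_map[OF M(1)] unfolding cobdry_def
    by (cases j) (auto intro!: bexI[of _ "\<lambda>_. \<zero>\<^bsub>M\<^esub>"])
qed

text \<open>A diagram chase for an exact sequence \<open>0 \<rightarrow> A \<rightarrow> B \<rightarrow> C\<close>. Let \<open>I\<close> be the image of \<open>B\<close> in \<open>C\<close>. Since \<open>Ext\<^sup>1(k, I)\<close> lies between
  \<open>Ext\<^sup>1(k, B)\<close> and \<open>Ext\<^sup>2(k, A)\<close>, it vanishes. Hence \<open>Hom(k, C / I)\<close> is a quotient of \<open>Hom(k, C) = 0\<close>.\<close>

lemma cokernel_no_socle: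
  assumes A: "module R A" and B: "module R B" and C: "module R C"
    and psi: "\<psi> \<in> lin A B" "\<And>a. a \<in> carrier A \<Longrightarrow> \<psi> a = \<zero>\<^bsub>B\<^esub> \<Longrightarrow> a = \<zero>\<^bsub>A\<^esub>"
    and phi: "\<phi> \<in> lin B C" "\<And>b. b \<in> carrier B \<Longrightarrow> \<phi> b = \<zero>\<^bsub>C\<^esub> \<Longrightarrow> b \<in> \<psi> ` carrier A"
      "\<And>a. a \<in> carrier A \<Longrightarrow> \<phi> (\<psi> a) = \<zero>\<^bsub>C\<^esub>"
    and EV: "EV (Suc (Suc 0)) A" "EV (Suc 0) B" "EV 0 C"
    and c: "c \<in> carrier C" "\<And>a. a \<in> mx \<Longrightarrow> a \<odot>\<^bsub>C\<^esub> c \<in> \<phi> ` carrier B"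
  shows "c \<in> \<phi> ` carrier B"
proof -
  obtain \<epsilon> y0 u where eps: "\<epsilon> \<in> lin (F 0) (self_module R)" "\<forall>y \<in> carrier (F 0). e y = \<zero>\<^bsub>rf\<^esub> \<longleftrightarrow> \<epsilon> y \<in> mx"
    "y0 \<in> carrier (F 0)" "u \<in> carrier R" "u \<otimes> \<epsilon> y0 = \<one>" using augmentation by blast
  have "(\<lambda>r. r \<odot>\<^bsub>C\<^esub> c) \<in> lin (self_module R) C" using C c(1) by (intro linI) (simp_all add: mod_smult[OF C])
  then have c0: "(\<lambda>v. \<epsilon> v \<odot>\<^bsub>C\<^esub> c) \<in> lin (F 0) C" using lin_comp[OF _ eps(1)] by blast
  have Dc: "D i v \<in> carrier (F i)" if "v \<in> carrier (F (Suc i))" for i v using lin_closed[OF D_lin that] .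
  have "\<epsilon> (D 0 v) \<odot>\<^bsub>C\<^esub> c \<in> \<phi> ` carrier B" if "v \<in> carrier (F (Suc 0))" for v
    using c(2) augmentation_D[OF eps(2) that] by blast
  then obtain b where b: "b \<in> lin (F (Suc 0)) B" "\<And>v. v \<in> carrier (F (Suc 0)) \<Longrightarrow> \<phi> (b v) = \<epsilon> (D 0 v) \<odot>\<^bsub>C\<^esub> c"
    using free_lift[OF B C phi(1) lin_comp[OF c0 D_lin] _ submod_whole[OF B]] by blast
  have "b (D 1 v) \<in> \<psi> ` carrier A" if v: "v \<in> carrier (F (Suc (Suc 0)))" for v
  proof (rule phi(2))
    have D1: "D 1 v \<in> carrier (F (Suc 0))" using Dc[of v 1] v by simp
    show "b (D 1 v) \<in> carrier B" using lin_closed[OF b(1) D1] .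
    have "D 0 (D 1 v) = \<zero>\<^bsub>F 0\<^esub>" using DD[of v 0] v by simp
    then show "\<phi> (b (D 1 v)) = \<zero>\<^bsub>C\<^esub>" using b(2)[OF D1] lin_zero[OF c0 Fr_module C] by simp
  qed
  then obtain a where a: "a \<in> lin (F (Suc (Suc 0))) A" "\<And>v. v \<in> carrier (F (Suc (Suc 0))) \<Longrightarrow> \<psi> (a v) = b (D (Suc 0) v)"
    using lin_divide[OF Fr_module A B psi lin_comp[OF b(1) D_lin]] by auto
  have "a (D (Suc (Suc 0)) v) = \<zero>\<^bsub>A\<^esub>" if v: "v \<in> carrier (F (Suc (Suc (Suc 0))))" for v
    using psi(2)[OF lin_closed[OF a(1) Dc[OF v]]] a(2)[OF Dc[OF v]] DD[OF v] lin_zero[OF b(1) Fr_module B] by simp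
  then have "cocyc (Suc (Suc 0)) A a" using a(1) by (simp add: cocyc_def)
  then obtain a' where a': "a' \<in> lin (F (Suc 0)) A" "\<And>v. v \<in> carrier (F (Suc (Suc 0))) \<Longrightarrow> a v = a' (D (Suc 0) v)"
    using EVD[OF EV(1)] unfolding cobdry_Suc by blast
  let ?t = "\<lambda>v. b v \<ominus>\<^bsub>B\<^esub> \<psi> (a' v)"
  have t: "?t \<in> lin (F (Suc 0)) B" by (rule lin_diff[OF B b(1) lin_comp[OF psi(1) a'(1)]])
  have "?t (D (Suc 0) v) = \<zero>\<^bsub>B\<^esub>" if v: "v \<in> carrier (F (Suc (Suc 0)))" for v
    using a(2)[OF v] a'(2)[OF v] B lin_closed[OF b(1) Dc[OF v]] by simp
  then have "cocyc (Suc 0) B ?t" using t by (simp add: cocyc_def)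
  then obtain h where h: "h \<in> lin (F 0) B" "\<And>v. v \<in> carrier (F (Suc 0)) \<Longrightarrow> ?t v = h (D 0 v)"
    using EVD[OF EV(2)] unfolding cobdry_Suc by blast
  let ?s = "\<lambda>v. \<epsilon> v \<odot>\<^bsub>C\<^esub> c \<ominus>\<^bsub>C\<^esub> \<phi> (h v)"
  have s: "?s \<in> lin (F 0) C" by (rule lin_diff[OF C c0 lin_comp[OF phi(1) h(1)]])
  have "?s (D 0 v) = \<zero>\<^bsub>C\<^esub>" if v: "v \<in> carrier (F (Suc 0))" for v
  proof -
    have bc: "b v \<in> carrier B" "a' v \<in> carrier A" "\<psi> (a' v) \<in> carrier B" "\<phi> (b v) \<in> carrier C"
      using lin_closed[OF b(1) v] lin_closed[OF a'(1) v] lin_closed[OF psi(1)] lin_closed[OF phi(1)] by auto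
    have "\<phi> (h (D 0 v)) = \<phi> (b v) \<ominus>\<^bsub>C\<^esub> \<zero>\<^bsub>C\<^esub>" using h(2)[OF v, symmetric] bc B C phi(3) by (simp add: lin_minus[OF phi(1)])
    also have "\<dots> = \<phi> (b v)" using bc C by (simp add: mod_ac(4)[OF C])
    finally show ?thesis using b(2)[OF v, symmetric] bc C by simp
  qed
  then have "cocyc 0 C ?s" using s by (simp add: cocyc_def)
  then have "?s y0 = \<zero>\<^bsub>C\<^esub>" using EVD[OF EV(3)] eps(3) by (simp add: cobdry_0)
  moreover have ec: "\<epsilon> y0 \<in> carrier R" using lin_closed[OF eps(1,3)] by simp
  moreover note hc = lin_closed[OF h(1) eps(3)]
  ultimately have "\<epsilon> y0 \<odot>\<^bsub>C\<^esub> c = \<phi> (h y0)" using mod_eq_iff[OF C] C c(1) lin_closed[OF phi(1) hc] by simp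
  then have "(u \<otimes> \<epsilon> y0) \<odot>\<^bsub>C\<^esub> c = \<phi> (u \<odot>\<^bsub>B\<^esub> h y0)" using eps(4) ec c(1) hc lin_smult[OF phi(1)] by (simp add: mod_smult(3)[OF C])
  then have "c = \<phi> (u \<odot>\<^bsub>B\<^esub> h y0)" using eps(5) C c(1) by simp
  then show ?thesis by (rule image_eqI) (rule mod_closed(5)[OF B eps(4) hc])
qed

text \<open>For the syzygies \<open>Z\<^sub>j\<close> in the free modules \<open>F\<^sub>j\<close>, the cokernel of \<open>Hom(F\<^sub>j\<^sub>+\<^sub>1, N) \<rightarrow> Hom(Z\<^sub>j\<^sub>+\<^sub>1, N)\<close> is \<open>Ext\<^sup>j\<^sup>+\<^sup>2(k, N)\<close>, and the kernel is
  \<open>Hom(Z\<^sub>j, N)\<close>. The cokernel is killed by the maximal ideal, whereas by \<open>cokernel_no_socle\<close> it has no socle. So it is zero.\<close>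

lemma EV_of_dual_syzygies:
  assumes N: "module R N"
    and EV: "EV (Suc (Suc 0)) (hom_module R (syz j) N)" "EV (Suc 0) (hom_module R (F (Suc j)) N)"
      "EV 0 (hom_module R (syz (Suc j)) N)"
  shows "EV (Suc (Suc j)) N"
  unfolding EV_def
proof (intro allI impI)
  fix f assume f: "cocyc (Suc (Suc j)) N f"
  let ?A = "hom_module R (syz j) N" and ?B = "hom_module R (F (Suc j)) N" and ?C = "hom_module R (syz (Suc j)) N"
  have m: "module R ?A" "module R ?B" "module R ?C" using N syz_module by simp_all
  have inc: "(\<lambda>v. v) \<in> lin (syz (Suc j)) (F (Suc j))"
    using submodule_closed(1)[OF Fr_module syz_submodule[of "Suc j"]] by (intro linI) (auto simp: syz_def)
  let ?psi = "precomp (F (Suc j)) (D j) :: _ \<Rightarrow> _ \<Rightarrow> _" and ?phi = "precomp (syz (Suc j)) (\<lambda>v. v) :: _ \<Rightarrow> _ \<Rightarrow> _"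
  have fz: "f v = \<zero>\<^bsub>N\<^esub>" if v: "v \<in> carrier (F (Suc (Suc j)))" "D (Suc j) v = \<zero>\<^bsub>syz (Suc j)\<^esub>" for v
  proof -
    have "v \<in> D (Suc (Suc j)) ` carrier (F (Suc (Suc (Suc j))))" using v unfolding syz_Suc_kernel by simp
    then show ?thesis using f unfolding cocyc_def by auto
  qed
  have "\<exists>c \<in> lin (syz (Suc j)) N. \<forall>v \<in> carrier (F (Suc (Suc j))). c (D (Suc j) v) = f v"
    by (rule lin_factor[OF Fr_module syz_module N D_lin_syz D_surj_syz cocyc_lin[OF f] fz])
  then obtain c where c: "c \<in> lin (syz (Suc j)) N" "\<And>v. v \<in> carrier (F (Suc (Suc j))) \<Longrightarrow> c (D (Suc j) v) = f v" by blast
  let ?c = "restrict c (carrier (syz (Suc j)))"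
  have cC: "?c \<in> carrier ?C" by (rule lin_restrict[OF syz_module c(1)])
  have "?c \<in> ?phi ` carrier ?B"
  proof (rule cokernel_no_socle[OF m])
    show "?psi \<in> lin ?A ?B" by (rule precomp_lin[OF Fr_module D_lin_syz])
    show "?phi \<in> lin ?B ?C" by (rule precomp_lin[OF syz_module inc])
    show "a = \<zero>\<^bsub>?A\<^esub>" if "a \<in> carrier ?A" "?psi a = \<zero>\<^bsub>?B\<^esub>" for a
      by (rule precomp_inj[OF syz_module N D_lin_syz D_surj_syz that])
    show "b \<in> ?psi ` carrier ?A" if b: "b \<in> carrier ?B" "?phi b = \<zero>\<^bsub>?C\<^esub>" for b
    proof (rule precomp_image[OF Fr_module syz_module N D_lin_syz D_surj_syz b(1)])
      fix v assume "v \<in> carrier (F (Suc j))" "D j v = \<zero>\<^bsub>syz j\<^esub>"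
      then have "v \<in> carrier (syz (Suc j))" using syz_Suc_kernel by (simp add: syz_def)
      then show "b v = \<zero>\<^bsub>N\<^esub>" using fun_cong[OF b(2), of v] by (simp add: precomp_def hom_simps(2))
    qed
    show "?phi (?psi a) = \<zero>\<^bsub>?C\<^esub>" if a: "a \<in> carrier ?A" for a
    proof -
      have al: "a \<in> lin (syz j) N" using a by (simp add: hom_simps(1))
      have "v \<in> carrier (F (Suc j))" "D j v = \<zero>\<^bsub>syz j\<^esub>" if "v \<in> carrier (syz (Suc j))" for v
        using that syz_Suc_kernel by (auto simp: syz_def)
      then show ?thesis using lin_zero[OF al syz_module N]
        by (intro ext) (simp add: precomp_def hom_simps(2) restrict_def)
    qed
    show "?c \<in> carrier ?C" by (rule cC)
    fix a assume a: "a \<in> mx"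
    obtain h where h: "h \<in> lin (F (Suc j)) N" "\<And>v. v \<in> carrier (F (Suc (Suc j))) \<Longrightarrow> a \<odot>\<^bsub>N\<^esub> f v = h (D (Suc j) v)"
      using mx_kills_cohomology[OF a N f] unfolding cobdry_Suc by blast
    have hB: "restrict h (carrier (F (Suc j))) \<in> carrier ?B" by (rule lin_restrict[OF Fr_module h(1)])
    have "a \<odot>\<^bsub>?C\<^esub> ?c = ?phi (restrict h (carrier (F (Suc j))))"
    proof (rule hom_eqI)
      show "a \<odot>\<^bsub>?C\<^esub> ?c \<in> carrier ?C" using m(3) cC mx_carr[OF a] by simp
      show "?phi (restrict h (carrier (F (Suc j)))) \<in> carrier ?C"
        by (rule lin_closed[OF precomp_lin[OF syz_module inc] hB])
      fix w assume w: "w \<in> carrier (syz (Suc j))"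
      then obtain v where v: "v \<in> carrier (F (Suc (Suc j)))" "w = D (Suc j) v" by (auto simp: syz_def)
      then show "(a \<odot>\<^bsub>?C\<^esub> ?c) w = ?phi (restrict h (carrier (F (Suc j)))) w"
        using w c(2) h(2) lin_closed[OF inc w] by (simp add: hom_simps(4) precomp_def)
    qed
    then show "a \<odot>\<^bsub>?C\<^esub> ?c \<in> ?phi ` carrier ?B" using hB by blast
  qed (use EV in auto)
  then obtain g where g: "g \<in> carrier ?B" "?c = ?phi g" by blast
  have "f v = g (D (Suc j) v)" if v: "v \<in> carrier (F (Suc (Suc j)))" for v
  proof -
    have w: "D (Suc j) v \<in> carrier (syz (Suc j))" using lin_closed[OF D_lin_syz v] .
    then show ?thesis using fun_cong[OF g(2), of "D (Suc j) v"] c(2)[OF v] by (simp add: precomp_def)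
  qed
  then show "cobdry (Suc (Suc j)) N f" unfolding cobdry_Suc using g(1) by (auto simp: hom_simps(1))
qed

text \<open>The hypothesis speaks of modules whose elements are sets, so it is applied to \<open>K / 0\<close> in place of \<open>K\<close>. A dual that is zero is
  Cohen--Macaulay by convention, but all its Ext modules vanish as well.\<close>

lemma EV_hom_maximal_cm:
  fixes N :: "('a, 'm) module"
  assumes d: "krull_dim R = enat (length xs)" and xs: "set xs \<subseteq> mx" "wreg (self_module R) xs"
    and N: "module R N"
    and hyp: "\<And>M :: ('a, (nat \<Rightarrow> 'a) set) module.
           finite_module R M \<Longrightarrow> torsion_free R M \<Longrightarrow> cohen_macaulay R M \<Longrightarrow>
           torsion_free R (hom_module R M N) \<and> cohen_macaulay R (hom_module R M N)"
    and K: "submodule K R (Fr g)" "wreg ((Fr g)\<lparr>carrier := K\<rparr>) xs" and j: "j < length xs"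
  shows "EV j (hom_module R ((Fr g)\<lparr>carrier := K\<rparr>) N)"
proof -
  let ?K = "(Fr g)\<lparr>carrier := K\<rparr>"
  let ?M = "quot_module ?K {\<zero>\<^bsub>?K\<^esub>}" and ?p = "\<lambda>x. {\<zero>\<^bsub>?K\<^esub>} +>\<^bsub>?K\<^esub> x"
  have Km: "module R ?K" by (rule submod_module[OF Fr_module K(1)])
  note Q = quot_props[OF Km submod_zero[OF Km]]
  have inj: "x = \<zero>\<^bsub>?K\<^esub>" if "x \<in> carrier ?K" "?p x = \<zero>\<^bsub>?M\<^esub>" for x using Q(4)[OF that(1)] that(2) by simp
  have M: "noeth ?M" by (rule noeth_surj[OF noeth_sub[OF noeth_Fr K(1)] Q(1,2) Q(3)[symmetric]])
  have "wreg ?M xs" by (rule wreg_iso[OF Km Q(1,2) Q(3)[symmetric] inj K(2)])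
  then have H: "torsion_free R (hom_module R ?M N)" "cohen_macaulay R (hom_module R ?M N)"
    using hyp[OF noeth_imp_finite_module[OF M]] maximal_depth_imp_torsion_free_cm[OF d xs(1) M] by blast+
  have Hm: "module R (hom_module R ?M N)" "module R (hom_module R ?K N)" using Q(1) Km N by simp_all
  have "EV j (hom_module R ?M N)"
  proof (cases "carrier (hom_module R ?M N) = {\<zero>\<^bsub>hom_module R ?M N\<^esub>}")
    case True
    then show ?thesis by (rule EV_zero_module[OF Hm(1)])
  next
    case False
    obtain ys where "length ys = length xs" "set ys \<subseteq> mx" "wreg (hom_module R ?M N) ys"
      using depth_ge[OF torsion_free_cm_depth[OF xs(2,1) Hm(1) H False]] by blast
    then show ?thesis using EV_regular_sequence[OF Hm(1), of ys j] j by simp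
  qed
  moreover have "precomp ?K ?p ` carrier (hom_module R ?M N) = carrier (hom_module R ?K N)"
  proof
    show "precomp ?K ?p ` carrier (hom_module R ?M N) \<subseteq> carrier (hom_module R ?K N)"
      using lin_closed[OF precomp_lin[OF Km Q(2)]] by blast
    show "carrier (hom_module R ?K N) \<subseteq> precomp ?K ?p ` carrier (hom_module R ?M N)"
    proof
      fix h assume h: "h \<in> carrier (hom_module R ?K N)"
      then have hl: "h \<in> lin ?K N" by (simp add: hom_simps(1))
      have z: "h x = \<zero>\<^bsub>N\<^esub>" if "x \<in> carrier ?K" "?p x = \<zero>\<^bsub>?M\<^esub>" for x
        using inj[OF that] lin_zero[OF hl Km N] by simp
      show "h \<in> precomp ?K ?p ` carrier (hom_module R ?M N)"
        by (rule precomp_image[OF Km Q(1) N Q(2) Q(3)[symmetric] h z])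
    qed
  qed
  moreover have "f = \<zero>\<^bsub>hom_module R ?M N\<^esub>" if "f \<in> carrier (hom_module R ?M N)" "precomp ?K ?p f = \<zero>\<^bsub>hom_module R ?K N\<^esub>" for f
    by (rule precomp_inj[OF Q(1) N Q(2) Q(3)[symmetric] that])
  ultimately show ?thesis by (intro EV_iso[OF Hm precomp_lin[OF Km Q(2)]])
qed

text \<open>Below the dimension this is \<open>EV_hom_maximal_cm\<close> for the dual of \<open>R\<close>. Above it, the syzygies in question have full depth, and their
  duals have vanishing Ext in the degrees \<open>0\<close>, \<open>1\<close> and \<open>2\<close>, because the dimension is at least three.\<close>

lemma EV_of_cm_duals:
  fixes N :: "('a, 'm) module"
  assumes d: "krull_dim R = enat (length xs)" "3 \<le> length xs" and xs: "set xs \<subseteq> mx" "wreg (self_module R) xs"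
    and N: "module R N"
    and hyp: "\<And>M :: ('a, (nat \<Rightarrow> 'a) set) module.
           finite_module R M \<Longrightarrow> torsion_free R M \<Longrightarrow> cohen_macaulay R M \<Longrightarrow>
           torsion_free R (hom_module R M N) \<and> cohen_macaulay R (hom_module R M N)"
    and j: "j \<noteq> length xs"
  shows "EV j N"
proof (cases "j < length xs")
  case True
  let ?H = "hom_module R (Fr (Suc 0)) N"
  have "EV j (hom_module R ((Fr (Suc 0))\<lparr>carrier := carrier (Fr (Suc 0))\<rparr>) N)"
    by (rule EV_hom_maximal_cm[OF d(1) xs N hyp submod_whole[OF Fr_module] _ True])
      (use wreg_dp[OF self_is_module xs(2)] in auto)
  then have EV: "EV j ?H" by simp
  have Hm: "module R ?H" using N by simp
  let ?ev = "\<lambda>f. f (unitv (Suc 0) 0)"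
  have lin: "?ev \<in> lin ?H N"
    by (rule linI) (auto simp: hom_simps lin_closed[OF _ unitv_closed])
  have surj: "?ev ` carrier ?H = carrier N"
  proof
    show "?ev ` carrier ?H \<subseteq> carrier N" using lin_closed[OF lin] by blast
    show "carrier N \<subseteq> ?ev ` carrier ?H"
    proof
      fix m assume m: "m \<in> carrier N"
      let ?f = "lcomb N (Suc 0) (\<lambda>_. m)"
      have "restrict ?f (carrier (Fr (Suc 0))) \<in> carrier ?H" by (rule lin_restrict[OF Fr_module lcomb_lin[OF N m]])
      moreover have "?ev (restrict ?f (carrier (Fr (Suc 0)))) = m" using lcomb_unitv[OF N, of "Suc 0" "\<lambda>_. m" 0] m by simp
      ultimately show "m \<in> ?ev ` carrier ?H" by (metis (no_types, lifting) image_eqI)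
    qed
  qed
  have inj: "f = \<zero>\<^bsub>?H\<^esub>" if f: "f \<in> carrier ?H" "?ev f = \<zero>\<^bsub>N\<^esub>" for f
  proof (rule hom_eqI[OF f(1) mod_closed(1)[OF Hm]])
    fix v assume v: "v \<in> carrier (Fr (Suc 0))"
    have fl: "f \<in> lin (Fr (Suc 0)) N" using f(1) by (simp add: hom_simps(1))
    have "f v = (\<lambda>_. \<zero>\<^bsub>N\<^esub>) v" by (rule lin_Fr_eqI[OF N fl lin_zero_map[OF N] _ v]) (use f(2) in simp)
    then show "f v = \<zero>\<^bsub>?H\<^esub> v" using v by (simp add: hom_simps(2))
  qed
  show ?thesis by (rule EV_iso[OF Hm N lin surj inj EV])
next
  case False
  then obtain i where i: "j = Suc (Suc i)" "length xs \<le> Suc i" using j d(2) by (metis Suc_le_D le_neq_implies_less not_less_eq_eq not_less Suc_le_mono numeral_3_eq_3 le_trans)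
  have s: "wreg (syz l) xs" if "length xs \<le> Suc l" for l using syz_wreg[OF xs(2), of l] that by simp
  have f: "wreg ((F (Suc i))\<lparr>carrier := carrier (F (Suc i))\<rparr>) xs" using wreg_dp[OF self_is_module xs(2)] by simp
  note E = EV_hom_maximal_cm[OF d(1) xs N hyp]
  have "EV (Suc (Suc 0)) (hom_module R (syz i) N)"
    unfolding syz_def by (rule E[OF _ _ _ syz_submodule s[unfolded syz_def]]) (use i d(2) in auto)
  moreover have "EV 0 (hom_module R (syz (Suc i)) N)"
    unfolding syz_def by (rule E[OF _ _ _ syz_submodule s[unfolded syz_def]]) (use i d(2) in auto)
  moreover have "EV (Suc 0) (hom_module R ((F (Suc i))\<lparr>carrier := carrier (F (Suc i))\<rparr>) N)"
    by (rule E[OF _ _ _ submod_whole[OF Fr_module] f]) (use d(2) in auto)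
  ultimately show ?thesis unfolding i(1) by (intro EV_of_dual_syzygies[OF N]) simp_all
qed

end

section \<open>Injectivity modulo a regular sequence\<close>

context cring
begin

text \<open>The submodule \<open>I R\<^sup>g\<close> of \<open>R\<^sup>g\<close>.\<close>

definition idm :: "nat \<Rightarrow> 'a set \<Rightarrow> (nat \<Rightarrow> 'a) set" where
  "idm g I = {y \<in> carrier (Fr g). \<forall>l < g. y l \<in> I}"

lemma idm_submodule:
  assumes I: "ideal I R" shows "submodule (idm g I) R (Fr g)"
proof -
  have S: "submodule I R (self_module R)" using I self_submodule_iff by blast
  note c = submodule_closed[OF self_is_module S]
  show ?thesis
  proof (rule submodI[OF Fr_module])
    show "\<zero>\<^bsub>Fr g\<^esub> \<in> idm g I" using c(2) mod_closed(1)[OF Fr_module[of g]] by (simp add: idm_def dp_simps(2)[of g])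
    show "x \<oplus>\<^bsub>Fr g\<^esub> y \<in> idm g I" if "x \<in> idm g I" "y \<in> idm g I" for x y
    proof -
      have "x \<oplus>\<^bsub>Fr g\<^esub> y \<in> carrier (Fr g)" using that by (intro mod_closed(2)[OF Fr_module]) (auto simp: idm_def)
      then show ?thesis using that c(3) by (simp add: idm_def dp_simps(3)[of g])
    qed
    show "r \<odot>\<^bsub>Fr g\<^esub> x \<in> idm g I" if "r \<in> carrier R" "x \<in> idm g I" for r x
    proof -
      have "r \<odot>\<^bsub>Fr g\<^esub> x \<in> carrier (Fr g)" using that by (intro mod_closed(5)[OF Fr_module]) (auto simp: idm_def)
      then show ?thesis using that c(5) by (simp add: idm_def dp_simps(4)[of g])
    qed
  qed (auto simp: idm_def)
qed

lemma idm_killed: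
  assumes M: "module R M" and k: "\<And>r m. r \<in> I \<Longrightarrow> m \<in> carrier M \<Longrightarrow> r \<odot>\<^bsub>M\<^esub> m = \<zero>\<^bsub>M\<^esub>"
    and p: "p \<in> lin (Fr g) M" and y: "y \<in> idm g I"
  shows "p y = \<zero>\<^bsub>M\<^esub>"
proof -
  interpret M: module R M by fact
  have yc: "y \<in> carrier (Fr g)" using y by (simp add: idm_def)
  have "p y = finsum M (\<lambda>i. y i \<odot>\<^bsub>M\<^esub> p (unitv g i)) {..<g}" using lin_Fr_eq_lcomb[OF M p yc] by (simp add: lcomb_def)
  also have "\<dots> = finsum M (\<lambda>i. \<zero>\<^bsub>M\<^esub>) {..<g}"
    using k y lin_closed[OF p unitv_closed] by (intro M.finsum_cong') (auto simp: idm_def)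
  finally show ?thesis by simp
qed

lemma idm_lin_self:
  assumes I: "ideal I R" and p: "p \<in> lin (Fr g) (self_module R)" and y: "y \<in> idm g I"
  shows "p y \<in> I"
proof -
  have S: "submodule I R (self_module R)" using I self_submodule_iff by blast
  interpret ideal I R by fact
  note Q = quot_props[OF self_is_module S]
  let ?Q = "quot_module (self_module R) I" and ?q = "\<lambda>r. I +>\<^bsub>self_module R\<^esub> r"
  have k: "r \<odot>\<^bsub>?Q\<^esub> m = \<zero>\<^bsub>?Q\<^esub>" if r: "r \<in> I" and m: "m \<in> carrier ?Q" for r m
  proof -
    obtain s where s: "s \<in> carrier R" "m = ?q s" using m unfolding Q(3) by auto
    have rc: "r \<in> carrier R" using r a_subset by blast
    have "r \<odot>\<^bsub>?Q\<^esub> m = ?q (r \<otimes> s)" using lin_smult[OF Q(2) rc, of s] s by simp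
    then show ?thesis using Q(4)[of "r \<otimes> s"] I_r_closed[OF r s(1)] rc s(1) by simp
  qed
  have "?q (p y) = \<zero>\<^bsub>?Q\<^esub>" by (rule idm_killed[OF Q(1) k lin_comp[OF Q(2) p] y])
  moreover have "p y \<in> carrier (self_module R)" using lin_closed[OF p] y by (simp add: idm_def)
  ultimately show ?thesis using Q(4) by blast
qed

lemma idm_lin:
  assumes I: "ideal I R" and p: "p \<in> lin (Fr g) (Fr h)" and y: "y \<in> idm g I"
  shows "p y \<in> idm h I"
  using idm_lin_self[OF I lin_comp[OF dp_coord_lin p] y] lin_closed[OF p, of y] y by (auto simp: idm_def)

text \<open>For a submodule \<open>K\<close> of \<open>R\<^sup>g\<close> that contains \<open>I R\<^sup>g\<close> and a module \<open>M\<close> killed by \<open>I\<close>, this says that \<open>Ext\<^sup>j\<^sup>+\<^sup>1(R\<^sup>g / K, M)\<close>, formed over the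
  ring \<open>R / I\<close>, vanishes. In place of a resolution over \<open>R / I\<close>, the definition asks in every step for some cover of \<open>K / I R\<^sup>g\<close> by a
  free module. All maps are maps over \<open>R\<close>, so the quotient ring never occurs as a structure of its own.\<close>

primrec ext_van :: "'a set \<Rightarrow> ('a, 'm) module \<Rightarrow> nat \<Rightarrow> nat \<Rightarrow> (nat \<Rightarrow> 'a) set \<Rightarrow> bool" where
  "ext_van I M 0 = (\<lambda>g K. \<forall>f \<in> lin ((Fr g)\<lparr>carrier := K\<rparr>) M. (\<forall>y \<in> idm g I. f y = \<zero>\<^bsub>M\<^esub>) \<longrightarrow>
     (\<exists>h \<in> lin (Fr g) M. \<forall>y \<in> K. h y = f y))"
| "ext_van I M (Suc j) = (\<lambda>g K. \<exists>g' p. p \<in> lin (Fr g') (Fr g) \<and> (\<forall>y \<in> carrier (Fr g'). p y \<in> K) \<and>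
     (\<forall>k \<in> K. \<exists>y \<in> carrier (Fr g'). \<exists>t \<in> idm g I. k = p y \<oplus>\<^bsub>Fr g\<^esub> t) \<and>
     ext_van I M j g' {y \<in> carrier (Fr g'). p y \<in> idm g I})"

lemma ext_van_0D:
  assumes "ext_van I M 0 g K" "f \<in> lin ((Fr g)\<lparr>carrier := K\<rparr>) M" "\<And>y. y \<in> idm g I \<Longrightarrow> f y = \<zero>\<^bsub>M\<^esub>"
  shows "\<exists>h \<in> lin (Fr g) M. \<forall>y \<in> K. h y = f y"
  using assms by simp

lemma mod_diff_diff:
  assumes "module R M" "a \<in> carrier M" "b \<in> carrier M" shows "a \<ominus>\<^bsub>M\<^esub> (a \<ominus>\<^bsub>M\<^esub> b) = b"
proof -
  have "a \<ominus>\<^bsub>M\<^esub> (a \<ominus>\<^bsub>M\<^esub> b) = a \<oplus>\<^bsub>M\<^esub> (\<ominus>\<^bsub>M\<^esub> a \<oplus>\<^bsub>M\<^esub> b)" using assms by (simp add: mod_ac(4,5)[OF assms(1)])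
  then show ?thesis using assms by simp
qed

definition fstv :: "nat \<Rightarrow> (nat \<Rightarrow> 'a) \<Rightarrow> nat \<Rightarrow> 'a" where "fstv g y = (\<lambda>i\<in>{..<g}. y i)"
definition sndv :: "nat \<Rightarrow> nat \<Rightarrow> (nat \<Rightarrow> 'a) \<Rightarrow> nat \<Rightarrow> 'a" where "sndv g h y = (\<lambda>i\<in>{..<h}. y (g + i))"
definition pairv :: "nat \<Rightarrow> nat \<Rightarrow> (nat \<Rightarrow> 'a) \<Rightarrow> (nat \<Rightarrow> 'a) \<Rightarrow> nat \<Rightarrow> 'a" where
  "pairv g h a b = (\<lambda>i\<in>{..<g + h}. if i < g then a i else b (i - g))"

lemma fstv_lin: "fstv g \<in> lin (Fr (g + h)) (Fr g)"
  unfolding fstv_def by (rule linI) (auto simp: dp_simps PiE_iff)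

lemma sndv_lin: "sndv g h \<in> lin (Fr (g + h)) (Fr h)"
  unfolding sndv_def by (rule linI) (auto simp: dp_simps PiE_iff)

lemma pairv_closed: "a \<in> carrier (Fr g) \<Longrightarrow> b \<in> carrier (Fr h) \<Longrightarrow> pairv g h a b \<in> carrier (Fr (g + h))"
  unfolding pairv_def by (rule dpI) (auto simp: dp_simps PiE_iff)

lemma pairv_add:
  assumes "a \<in> carrier (Fr g)" "b \<in> carrier (Fr h)" "a' \<in> carrier (Fr g)" "b' \<in> carrier (Fr h)"
  shows "pairv g h (a \<oplus>\<^bsub>Fr g\<^esub> a') (b \<oplus>\<^bsub>Fr h\<^esub> b') = pairv g h a b \<oplus>\<^bsub>Fr (g + h)\<^esub> pairv g h a' b'"
  by (auto simp: pairv_def dp_simps fun_eq_iff)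

lemma pairv_smult:
  "pairv g h (r \<odot>\<^bsub>Fr g\<^esub> a) (r \<odot>\<^bsub>Fr h\<^esub> b) = r \<odot>\<^bsub>Fr (g + h)\<^esub> pairv g h a b"
  by (auto simp: pairv_def dp_simps fun_eq_iff)

lemma fstv_pairv: "a \<in> carrier (Fr g) \<Longrightarrow> fstv g (pairv g h a b) = a"
  by (rule dp_eqI[of _ g "self_module R"]) (auto simp: fstv_def pairv_def dp_simps PiE_iff)

lemma sndv_pairv: "b \<in> carrier (Fr h) \<Longrightarrow> sndv g h (pairv g h a b) = b"
  by (rule dp_eqI[of _ h "self_module R"]) (auto simp: sndv_def pairv_def dp_simps PiE_iff)

lemma pairv_fst_snd: "y \<in> carrier (Fr (g + h)) \<Longrightarrow> pairv g h (fstv g y) (sndv g h y) = y"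
  by (rule dp_eqI[of _ "g + h" "self_module R"]) (auto simp: sndv_def fstv_def pairv_def dp_simps PiE_iff)

lemma pairv_idm_iff:
  assumes "a \<in> carrier (Fr g)" "b \<in> carrier (Fr h)"
  shows "pairv g h a b \<in> idm (g + h) I \<longleftrightarrow> a \<in> idm g I \<and> b \<in> idm h I"
proof
  assume p: "pairv g h a b \<in> idm (g + h) I"
  have "a i \<in> I" if "i < g" for i using p that by (auto simp: idm_def pairv_def split: if_splits dest!: spec[of _ i])
  moreover have "b i \<in> I" if "i < h" for i
    using p that by (auto simp: idm_def pairv_def split: if_splits dest!: spec[of _ "g + i"])
  ultimately show "a \<in> idm g I \<and> b \<in> idm h I" using assms by (simp add: idm_def)
next
  assume "a \<in> idm g I \<and> b \<in> idm h I"
  then show "pairv g h a b \<in> idm (g + h) I" using pairv_closed[OF assms] by (auto simp: idm_def pairv_def)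
qed

lemma pairv_left_lin: "(\<lambda>a. pairv g h a \<zero>\<^bsub>Fr h\<^esub>) \<in> lin (Fr g) (Fr (g + h))"
proof (rule linI)
  have z: "\<zero>\<^bsub>Fr h\<^esub> \<in> carrier (Fr h)" by (rule mod_closed(1)[OF Fr_module])
  show "pairv g h a \<zero>\<^bsub>Fr h\<^esub> \<in> carrier (Fr (g + h))" if "a \<in> carrier (Fr g)" for a using pairv_closed[OF that z] .
  show "pairv g h (a \<oplus>\<^bsub>Fr g\<^esub> b) \<zero>\<^bsub>Fr h\<^esub> = pairv g h a \<zero>\<^bsub>Fr h\<^esub> \<oplus>\<^bsub>Fr (g + h)\<^esub> pairv g h b \<zero>\<^bsub>Fr h\<^esub>"
    if "a \<in> carrier (Fr g)" "b \<in> carrier (Fr g)" for a b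
    using pairv_add[OF that(1) z that(2) z] z by simp
  show "pairv g h (r \<odot>\<^bsub>Fr g\<^esub> a) \<zero>\<^bsub>Fr h\<^esub> = r \<odot>\<^bsub>Fr (g + h)\<^esub> pairv g h a \<zero>\<^bsub>Fr h\<^esub>" if "r \<in> carrier R" for r a
    using pairv_smult[of g h r a "\<zero>\<^bsub>Fr h\<^esub>"] that by simp
qed

lemma idm_zero: "ideal I R \<Longrightarrow> \<zero>\<^bsub>Fr h\<^esub> \<in> idm h I"
  using submodule_closed(2)[OF Fr_module idm_submodule] .

text \<open>Here \<open>R\<^sup>g\<^sup>+\<^sup>h\<close> modulo the new submodule is the direct sum of \<open>R\<^sup>g / K\<close> and the free module \<open>(R / I)\<^sup>h\<close>.\<close>

lemma ext_van_add_free: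
  assumes I: "ideal I R" and M: "module R M" and K: "submodule K R (Fr g)" and ev: "ext_van I M j g K"
  shows "ext_van I M j (g + h) {y \<in> carrier (Fr (g + h)). fstv g y \<in> K \<and> sndv g h y \<in> idm h I}"
proof -
  note Kc = submodule_closed[OF Fr_module K]
  have z: "\<zero>\<^bsub>Fr h\<^esub> \<in> carrier (Fr h)" "\<zero>\<^bsub>Fr g\<^esub> \<in> carrier (Fr g)" by (rule mod_closed(1)[OF Fr_module])+
  note zI = idm_zero[OF I]
  let ?K = "{y \<in> carrier (Fr (g + h)). fstv g y \<in> K \<and> sndv g h y \<in> idm h I}"
  have split: "y = pairv g h (fstv g y) \<zero>\<^bsub>Fr h\<^esub> \<oplus>\<^bsub>Fr (g + h)\<^esub> pairv g h \<zero>\<^bsub>Fr g\<^esub> (sndv g h y)"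
    if "y \<in> carrier (Fr (g + h))" for y
    using pairv_add[OF lin_closed[OF fstv_lin that] z(1) z(2) lin_closed[OF sndv_lin that]] pairv_fst_snd[OF that]
      lin_closed[OF fstv_lin that] lin_closed[OF sndv_lin that] by simp
  have inK: "pairv g h a b \<in> ?K" if "a \<in> K" "b \<in> idm h I" for a b
  proof -
    have "a \<in> carrier (Fr g)" "b \<in> carrier (Fr h)" using that Kc(1) by (auto simp: idm_def)
    then show ?thesis using that by (simp add: pairv_closed fstv_pairv sndv_pairv)
  qed
  show ?thesis
  proof (cases j)
    case 0
    show ?thesis unfolding 0 ext_van.simps
    proof (intro ballI impI)
      fix f assume f: "f \<in> lin ((Fr (g + h))\<lparr>carrier := ?K\<rparr>) M" "\<forall>y \<in> idm (g + h) I. f y = \<zero>\<^bsub>M\<^esub>"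
      have pl: "(\<lambda>a. pairv g h a \<zero>\<^bsub>Fr h\<^esub>) \<in> lin ((Fr g)\<lparr>carrier := K\<rparr>) ((Fr (g + h))\<lparr>carrier := ?K\<rparr>)"
        using inK[OF _ zI] Kc(1) lin_add[OF pairv_left_lin, of _ g _ h] lin_smult[OF pairv_left_lin, of _ _ g h]
        by (intro linI) (simp_all add: subset_iff)
      have fz: "f (pairv g h a \<zero>\<^bsub>Fr h\<^esub>) = \<zero>\<^bsub>M\<^esub>" if "a \<in> idm g I" for a
        using f(2) pairv_idm_iff[of a g "\<zero>\<^bsub>Fr h\<^esub>" h I] that zI z by (simp add: idm_def)
      have "\<exists>h1 \<in> lin (Fr g) M. \<forall>a \<in> K. h1 a = f (pairv g h a \<zero>\<^bsub>Fr h\<^esub>)"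
        by (rule ext_van_0D[OF ev[unfolded 0] lin_comp[OF f(1) pl] fz])
      then obtain h1 where h1: "h1 \<in> lin (Fr g) M" "\<And>a. a \<in> K \<Longrightarrow> h1 a = f (pairv g h a \<zero>\<^bsub>Fr h\<^esub>)" by blast
      have he: "h1 (fstv g y) = f y" if y: "y \<in> ?K" for y
      proof -
        have yc: "y \<in> carrier (Fr (g + h))" "fstv g y \<in> K" "sndv g h y \<in> idm h I" using y by auto
        have i: "pairv g h \<zero>\<^bsub>Fr g\<^esub> (sndv g h y) \<in> idm (g + h) I"
          using pairv_idm_iff[OF z(2) lin_closed[OF sndv_lin yc(1)]] zI yc(3) by blast
        have a: "pairv g h (fstv g y) \<zero>\<^bsub>Fr h\<^esub> \<in> ?K" "pairv g h \<zero>\<^bsub>Fr g\<^esub> (sndv g h y) \<in> ?K"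
          using inK yc zI Kc(2) by blast+
        have "f y = f (pairv g h (fstv g y) \<zero>\<^bsub>Fr h\<^esub>) \<oplus>\<^bsub>M\<^esub> f (pairv g h \<zero>\<^bsub>Fr g\<^esub> (sndv g h y))"
          using lin_add[OF f(1), of "pairv g h (fstv g y) \<zero>\<^bsub>Fr h\<^esub>" "pairv g h \<zero>\<^bsub>Fr g\<^esub> (sndv g h y)"] a split[OF yc(1)] by simp
        also have "\<dots> = h1 (fstv g y)" using f(2)[rule_format, OF i] h1(2)[OF yc(2)] lin_closed[OF f(1)] a(1) M by simp
        finally show ?thesis by simp
      qed
      show "\<exists>h' \<in> lin (Fr (g + h)) M. \<forall>y \<in> ?K. h' y = f y"
        by (rule bexI[OF _ lin_comp[OF h1(1) fstv_lin]]) (rule ballI, rule he)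
    qed
  next
    case (Suc j')
    obtain g' p where p: "p \<in> lin (Fr g') (Fr g)" "\<forall>y \<in> carrier (Fr g'). p y \<in> K"
      "\<forall>k \<in> K. \<exists>y \<in> carrier (Fr g'). \<exists>t \<in> idm g I. k = p y \<oplus>\<^bsub>Fr g\<^esub> t"
      "ext_van I M j' g' {y \<in> carrier (Fr g'). p y \<in> idm g I}" using ev unfolding Suc ext_van.simps by blast
    let ?p = "\<lambda>y. pairv g h (p y) \<zero>\<^bsub>Fr h\<^esub>"
    have "{y \<in> carrier (Fr g'). ?p y \<in> idm (g + h) I} = {y \<in> carrier (Fr g'). p y \<in> idm g I}"
      using pairv_idm_iff[OF lin_closed[OF p(1)] z(1)] zI by blast
    moreover have "\<exists>y \<in> carrier (Fr g'). \<exists>t \<in> idm (g + h) I. k = ?p y \<oplus>\<^bsub>Fr (g + h)\<^esub> t" if k: "k \<in> ?K" for k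
    proof -
      have kc: "k \<in> carrier (Fr (g + h))" "fstv g k \<in> K" "sndv g h k \<in> idm h I" using k by auto
      obtain y t where yt: "y \<in> carrier (Fr g')" "t \<in> idm g I" "fstv g k = p y \<oplus>\<^bsub>Fr g\<^esub> t" using p(3) kc(2) by blast
      have tc: "t \<in> carrier (Fr g)" using yt(2) by (simp add: idm_def)
      have "k = pairv g h (p y \<oplus>\<^bsub>Fr g\<^esub> t) (\<zero>\<^bsub>Fr h\<^esub> \<oplus>\<^bsub>Fr h\<^esub> sndv g h k)"
        using pairv_fst_snd[OF kc(1)] yt(3) lin_closed[OF sndv_lin kc(1)] by simp
      then have "k = ?p y \<oplus>\<^bsub>Fr (g + h)\<^esub> pairv g h t (sndv g h k)"
        using pairv_add[OF lin_closed[OF p(1) yt(1)] z(1) tc lin_closed[OF sndv_lin kc(1)]] by simp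
      moreover have "pairv g h t (sndv g h k) \<in> idm (g + h) I"
        using pairv_idm_iff[OF tc lin_closed[OF sndv_lin kc(1)]] yt(2) kc(3) by blast
      ultimately show ?thesis using yt(1) by blast
    qed
    moreover have "?p y \<in> ?K" if "y \<in> carrier (Fr g')" for y using inK[OF _ zI] p(2) that by blast
    ultimately show ?thesis unfolding Suc ext_van.simps using lin_comp[OF pairv_left_lin p(1)] p(4)
      by (intro exI[of _ g'] exI[of _ ?p] conjI) auto
  qed
qed

text \<open>The condition on \<open>l\<close> says that \<open>l\<close> embeds the free module \<open>(R / I)\<^sup>h\<close> into \<open>R\<^sup>g / K\<close>. The new submodule modulo \<open>I R\<^sup>g\<close> is therefore the direct
  sum of \<open>K / I R\<^sup>g\<close> and \<open>(R / I)\<^sup>h\<close>, and the free summand does not contribute to Ext in positive degrees.\<close>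

lemma ext_van_free_summand:
  assumes I: "ideal I R" and M: "module R M" and K: "submodule K R (Fr g)" "idm g I \<subseteq> K"
    and ev: "ext_van I M (Suc j) g K"
    and l: "l \<in> lin (Fr h) (Fr g)" "\<And>f. f \<in> carrier (Fr h) \<Longrightarrow> l f \<in> K \<Longrightarrow> f \<in> idm h I"
  shows "ext_van I M (Suc j) g {k \<oplus>\<^bsub>Fr g\<^esub> l f | k f. k \<in> K \<and> f \<in> carrier (Fr h)}"
proof -
  note Kc = submodule_closed[OF Fr_module K(1)] and Ic = submodule_closed[OF Fr_module idm_submodule[OF I, of g]]
  let ?K = "{k \<oplus>\<^bsub>Fr g\<^esub> l f | k f. k \<in> K \<and> f \<in> carrier (Fr h)}"
  obtain g' p where p: "p \<in> lin (Fr g') (Fr g)" "\<forall>y \<in> carrier (Fr g'). p y \<in> K"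
    "\<forall>k \<in> K. \<exists>y \<in> carrier (Fr g'). \<exists>t \<in> idm g I. k = p y \<oplus>\<^bsub>Fr g\<^esub> t"
    "ext_van I M j g' {y \<in> carrier (Fr g'). p y \<in> idm g I}" using ev unfolding ext_van.simps by blast
  let ?p = "\<lambda>y. p (fstv g' y) \<oplus>\<^bsub>Fr g\<^esub> l (sndv g' h y)"
  have pl: "?p \<in> lin (Fr (g' + h)) (Fr g)"
    by (rule lin_plus[OF Fr_module lin_comp[OF p(1) fstv_lin] lin_comp[OF l(1) sndv_lin]])
  have 1: "?p y \<in> ?K" if "y \<in> carrier (Fr (g' + h))" for y
    using p(2) lin_closed[OF fstv_lin that] lin_closed[OF sndv_lin that] by blast
  have 2: "\<exists>y \<in> carrier (Fr (g' + h)). \<exists>t \<in> idm g I. k = ?p y \<oplus>\<^bsub>Fr g\<^esub> t" if k: "k \<in> ?K" for k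
  proof -
    obtain k' f where kf: "k' \<in> K" "f \<in> carrier (Fr h)" "k = k' \<oplus>\<^bsub>Fr g\<^esub> l f" using k by blast
    obtain y t where yt: "y \<in> carrier (Fr g')" "t \<in> idm g I" "k' = p y \<oplus>\<^bsub>Fr g\<^esub> t" using p(3) kf(1) by blast
    have c: "t \<in> carrier (Fr g)" "p y \<in> carrier (Fr g)" "l f \<in> carrier (Fr g)"
      using yt(2) lin_closed[OF p(1) yt(1)] lin_closed[OF l(1) kf(2)] by (auto simp: idm_def)
    have "k = (p y \<oplus>\<^bsub>Fr g\<^esub> l f) \<oplus>\<^bsub>Fr g\<^esub> t" using kf(3) yt(3) c by (simp add: mod_ac(1-3)[OF Fr_module])
    then have "k = ?p (pairv g' h y f) \<oplus>\<^bsub>Fr g\<^esub> t" using fstv_pairv[OF yt(1)] sndv_pairv[OF kf(2)] by simp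
    then show ?thesis using pairv_closed[OF yt(1) kf(2)] yt(2) by blast
  qed
  let ?K1 = "{y \<in> carrier (Fr g'). p y \<in> idm g I}"
  have eq: "{y \<in> carrier (Fr (g' + h)). ?p y \<in> idm g I} = {y \<in> carrier (Fr (g' + h)). fstv g' y \<in> ?K1 \<and> sndv g' h y \<in> idm h I}"
  proof (intro equalityI subsetI)
    fix y assume y: "y \<in> {y \<in> carrier (Fr (g' + h)). ?p y \<in> idm g I}"
    then have yc: "y \<in> carrier (Fr (g' + h))" "?p y \<in> idm g I" by auto
    have c: "fstv g' y \<in> carrier (Fr g')" "sndv g' h y \<in> carrier (Fr h)" "p (fstv g' y) \<in> carrier (Fr g)"
        "l (sndv g' h y) \<in> carrier (Fr g)"
      using lin_closed[OF fstv_lin yc(1)] lin_closed[OF sndv_lin yc(1)] lin_closed[OF p(1)] lin_closed[OF l(1)] by auto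
    have "?p y \<ominus>\<^bsub>Fr g\<^esub> p (fstv g' y) \<in> K" using K(2) yc(2) p(2) c(1) Kc(6) by blast
    moreover have "?p y \<ominus>\<^bsub>Fr g\<^esub> p (fstv g' y) = l (sndv g' h y)" using c by (simp add: mod_ac[OF Fr_module])
    ultimately have s: "sndv g' h y \<in> idm h I" using l(2) c(2) by simp
    then have "?p y \<ominus>\<^bsub>Fr g\<^esub> l (sndv g' h y) \<in> idm g I" using idm_lin[OF I l(1)] yc(2) Ic(6) by blast
    moreover have "?p y \<ominus>\<^bsub>Fr g\<^esub> l (sndv g' h y) = p (fstv g' y)" using c by (simp add: mod_ac[OF Fr_module])
    ultimately show "y \<in> {y \<in> carrier (Fr (g' + h)). fstv g' y \<in> ?K1 \<and> sndv g' h y \<in> idm h I}" using s yc(1) c(1) by simp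
  next
    fix y assume "y \<in> {y \<in> carrier (Fr (g' + h)). fstv g' y \<in> ?K1 \<and> sndv g' h y \<in> idm h I}"
    then show "y \<in> {y \<in> carrier (Fr (g' + h)). ?p y \<in> idm g I}" using Ic(3) idm_lin[OF I l(1)] by blast
  qed
  have "submodule ?K1 R (Fr g')" by (rule submod_preimage[OF Fr_module Fr_module p(1) idm_submodule[OF I]])
  then have ev': "ext_van I M j (g' + h) {y \<in> carrier (Fr (g' + h)). ?p y \<in> idm g I}"
    unfolding eq by (rule ext_van_add_free[OF I M _ p(4)])
  show ?thesis unfolding ext_van.simps
    by (intro exI[of _ "g' + h"] exI[of _ ?p] conjI ballI pl 1 2 ev')
qed

text \<open>Rees' change of rings: for \<open>x\<close> regular on \<open>R / I\<close> and on \<open>M\<close>, and \<open>I' = I + xR\<close>, the module \<open>Ext\<^sup>j\<^sup>+\<^sup>2(_, M)\<close> over \<open>R / I\<close> is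
  \<open>Ext\<^sup>j\<^sup>+\<^sup>1(_, M / xM)\<close> over \<open>R / I'\<close>. In the step of the induction, a cover of \<open>K / I R\<^sup>g\<close> also covers \<open>K / I' R\<^sup>g\<close>, and the kernels differ by a
  free summand, which is the image of a lift of the multiplication by \<open>x\<close>.\<close>

lemma ext_van_rees:
  assumes I: "ideal I R" and I': "ideal I' R" "I' = {r \<oplus> x \<otimes> s | r s. r \<in> I \<and> s \<in> carrier R}"
    and xI: "\<And>r. r \<in> carrier R \<Longrightarrow> x \<otimes> r \<in> I \<Longrightarrow> r \<in> I"
    and rs: "reg_step x M M' \<pi>" and kill: "\<And>r m. r \<in> I \<Longrightarrow> m \<in> carrier M \<Longrightarrow> r \<odot>\<^bsub>M\<^esub> m = \<zero>\<^bsub>M\<^esub>"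
    and K: "submodule K R (Fr g)" "idm g I' \<subseteq> K" and ev: "ext_van I M (Suc j) g K"
  shows "ext_van I' M' j g K"
  using K ev
proof (induct j arbitrary: g K)
  note r = reg_stepD[OF rs]
  have II: "I \<subseteq> I'"
  proof
    fix s assume s: "s \<in> I"
    then have "s = s \<oplus> x \<otimes> \<zero>" using r(3) ideal.Icarr[OF I] by simp
    then show "s \<in> I'" unfolding I'(2) using s by blast
  qed
  have idm_sub: "idm g I \<subseteq> idm g I'" for g using II by (auto simp: idm_def)
  have x_idm: "x \<odot>\<^bsub>Fr g\<^esub> y \<in> idm g I'" if y: "y \<in> carrier (Fr g)" for g y
  proof -
    have "x \<otimes> y l \<in> I'" if l: "l < g" for l
    proof -
      have "y l \<in> carrier R" using dp_coord[OF y l] by simp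
      moreover have "x \<otimes> y l = \<zero> \<oplus> x \<otimes> y l" using r(3) calculation by simp
      moreover have "\<zero> \<in> I" using additive_subgroup.zero_closed[OF ideal.axioms(1)[OF I]] .
      ultimately show ?thesis unfolding I'(2) by blast
    qed
    then show ?thesis using mod_closed(5)[OF Fr_module r(3) y] by (simp add: idm_def dp_simps(4)[of g])
  qed
  have x_inj: "f \<in> idm g I" if "f \<in> carrier (Fr g)" "x \<odot>\<^bsub>Fr g\<^esub> f \<in> idm g I" for g f
    using that xI dp_coord[OF that(1)] by (simp add: idm_def dp_simps(4)[of g])
  have idm_decomp: "\<exists>t \<in> idm g I. \<exists>f \<in> carrier (Fr g). y = t \<oplus>\<^bsub>Fr g\<^esub> x \<odot>\<^bsub>Fr g\<^esub> f" if y: "y \<in> idm g I'" for g y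
  proof -
    have "\<forall>l. \<exists>a b. l < g \<longrightarrow> a \<in> I \<and> b \<in> carrier R \<and> y l = a \<oplus> x \<otimes> b" using y unfolding idm_def I'(2) by blast
    then obtain a b where ab: "\<And>l. l < g \<Longrightarrow> a l \<in> I \<and> b l \<in> carrier R \<and> y l = a l \<oplus> x \<otimes> b l" by metis
    let ?a = "\<lambda>l\<in>{..<g}. a l" and ?b = "\<lambda>l\<in>{..<g}. b l"
    have c: "?a \<in> carrier (Fr g)" "?b \<in> carrier (Fr g)" using ab ideal.Icarr[OF I] by (auto intro!: dpI)
    have "y = ?a \<oplus>\<^bsub>Fr g\<^esub> x \<odot>\<^bsub>Fr g\<^esub> ?b"
    proof (rule dp_eqI)
      show "y \<in> carrier (Fr g)" using y by (simp add: idm_def)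
      show "?a \<oplus>\<^bsub>Fr g\<^esub> x \<odot>\<^bsub>Fr g\<^esub> ?b \<in> carrier (Fr g)" using c r(3) by simp
    qed (use ab in \<open>simp add: dp_simps(3,4)[of g]\<close>)
    moreover have "?a \<in> idm g I" using c(1) ab by (simp add: idm_def)
    ultimately show ?thesis using c(2) by blast
  qed
  {
    case 0
    note K = 0(1,2) and Kc = submodule_closed[OF Fr_module 0(1)]
    let ?K = "(Fr g)\<lparr>carrier := K\<rparr>"
    have Km: "module R ?K" by (rule submod_module[OF Fr_module K(1)])
    have IK: "idm g I \<subseteq> K" using idm_sub K(2) by blast
    obtain g' p where p: "p \<in> lin (Fr g') (Fr g)" "\<forall>y \<in> carrier (Fr g'). p y \<in> K"
      "\<forall>k \<in> K. \<exists>y \<in> carrier (Fr g'). \<exists>t \<in> idm g I. k = p y \<oplus>\<^bsub>Fr g\<^esub> t"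
      "ext_van I M 0 g' {y \<in> carrier (Fr g'). p y \<in> idm g I}" using 0(3) unfolding ext_van.simps(2) by blast
    have pK: "p \<in> lin (Fr g') ?K" using p(2) lin_add[OF p(1)] lin_smult[OF p(1)] by (intro linI) auto
    let ?K' = "{y \<in> carrier (Fr g'). p y \<in> idm g I}"
    have K': "submodule ?K' R (Fr g')" by (rule submod_preimage[OF Fr_module Fr_module p(1) idm_submodule[OF I]])
    have IK': "idm g' I \<subseteq> ?K'" using idm_lin[OF I p(1)] by (auto simp: idm_def)
    show ?case unfolding ext_van.simps(1)
    proof (intro ballI impI)
      fix u assume u: "u \<in> lin ?K M'" "\<forall>y \<in> idm g I'. u y = \<zero>\<^bsub>M'\<^esub>"
      have "u (p y) \<in> \<pi> ` carrier M" if "y \<in> carrier (Fr g')" for y using lin_closed[OF u(1) lin_closed[OF pK that]] r(5) by simp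
      then have "\<exists>w \<in> lin (Fr g') M. \<forall>y \<in> carrier (Fr g'). \<pi> (w y) = u (p y) \<and> w y \<in> carrier M"
        by (rule free_lift[OF r(1,2,4) lin_comp[OF u(1) pK] _ submod_whole[OF r(1)]])
      then obtain w where w: "w \<in> lin (Fr g') M" "\<And>y. y \<in> carrier (Fr g') \<Longrightarrow> \<pi> (w y) = u (p y)" by blast
      have wK: "w \<in> lin ((Fr g')\<lparr>carrier := ?K'\<rparr>) M"
        using lin_add[OF w(1)] lin_smult[OF w(1)] lin_closed[OF w(1)] by (intro linI) auto
      have divk: "w y \<in> (\<lambda>m. x \<odot>\<^bsub>M\<^esub> m) ` carrier M" if y: "y \<in> carrier ((Fr g')\<lparr>carrier := ?K'\<rparr>)" for y
      proof -
        have yc: "y \<in> carrier (Fr g')" "p y \<in> idm g I" using y by auto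
        then have "\<pi> (w y) = \<zero>\<^bsub>M'\<^esub>" using w(2) u(2) idm_sub by auto
        then show ?thesis using r(6)[OF lin_closed[OF w(1) yc(1)]] by blast
      qed
      have "\<exists>w1 \<in> lin ((Fr g')\<lparr>carrier := ?K'\<rparr>) M. \<forall>y \<in> carrier ((Fr g')\<lparr>carrier := ?K'\<rparr>). x \<odot>\<^bsub>M\<^esub> w1 y = w y"
        by (rule lin_divide[OF submod_module[OF Fr_module K'] r(1,1) lin_mult[OF r(1,3)] r(8) wK divk])
      then obtain w1 where w1: "w1 \<in> lin ((Fr g')\<lparr>carrier := ?K'\<rparr>) M" "\<And>y. y \<in> ?K' \<Longrightarrow> x \<odot>\<^bsub>M\<^esub> w1 y = w y" by auto
      have "w1 y = \<zero>\<^bsub>M\<^esub>" if y: "y \<in> idm g' I" for y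
        using r(8)[of "w1 y"] w1(2)[of y] idm_killed[OF r(1) kill w(1) y] lin_closed[OF w1(1)] IK' y by auto
      then have "\<exists>g1 \<in> lin (Fr g') M. \<forall>y \<in> ?K'. g1 y = w1 y" by (rule ext_van_0D[OF p(4) w1(1)])
      then obtain g1 where g1: "g1 \<in> lin (Fr g') M" "\<And>y. y \<in> ?K' \<Longrightarrow> g1 y = w1 y" by blast
      let ?w = "\<lambda>y. w y \<ominus>\<^bsub>M\<^esub> x \<odot>\<^bsub>M\<^esub> g1 y"
      have wl: "?w \<in> lin (Fr g') M" by (rule lin_diff[OF r(1) w(1) lin_scale[OF r(1) g1(1) r(3)]])
      have w0: "?w y = \<zero>\<^bsub>M\<^esub>" if y: "y \<in> ?K'" for y using g1(2)[OF y] w1(2)[OF y] lin_closed[OF w(1)] y r(1) by simp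
      \<comment> \<open>\<open>?w\<close> descends to \<open>K / I R\<^sup>g\<close>\<close>
      have IS: "submodule (idm g I) R ?K"
        using submodule_closed[OF Fr_module idm_submodule[OF I]] IK by (intro submodI[OF Km]) auto
      note Q = quot_props[OF Km IS]
      let ?q = "\<lambda>k. idm g I +>\<^bsub>?K\<^esub> k"
      have ql: "(\<lambda>y. ?q (p y)) \<in> lin (Fr g') (quot_module ?K (idm g I))" by (rule lin_comp[OF Q(2) pK])
      have qpt: "?q (p y \<oplus>\<^bsub>Fr g\<^esub> t) = ?q (p y)" if "y \<in> carrier (Fr g')" "t \<in> idm g I" for y t
      proof -
        have tc: "p y \<in> carrier ?K" "t \<in> carrier ?K" using that p(2) IK by auto
        have "?q (p y \<oplus>\<^bsub>?K\<^esub> t) = ?q (p y) \<oplus>\<^bsub>quot_module ?K (idm g I)\<^esub> ?q t" by (rule lin_add[OF Q(2) tc])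
        also have "?q t = \<zero>\<^bsub>quot_module ?K (idm g I)\<^esub>" using Q(4)[OF tc(2)] that(2) by simp
        also have "?q (p y) \<oplus>\<^bsub>quot_module ?K (idm g I)\<^esub> \<zero>\<^bsub>quot_module ?K (idm g I)\<^esub> = ?q (p y)"
          using mod_simps(2)[OF Q(1) lin_closed[OF Q(2) tc(1)]] .
        finally show ?thesis by simp
      qed
      have qs: "(\<lambda>y. ?q (p y)) ` carrier (Fr g') = carrier (quot_module ?K (idm g I))"
      proof
        show "(\<lambda>y. ?q (p y)) ` carrier (Fr g') \<subseteq> carrier (quot_module ?K (idm g I))" using lin_closed[OF ql] by blast
        show "carrier (quot_module ?K (idm g I)) \<subseteq> (\<lambda>y. ?q (p y)) ` carrier (Fr g')"
        proof
          fix c assume "c \<in> carrier (quot_module ?K (idm g I))"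
          then obtain k where k: "k \<in> K" "c = ?q k" unfolding Q(3) by auto
          obtain y t where yt: "y \<in> carrier (Fr g')" "t \<in> idm g I" "k = p y \<oplus>\<^bsub>Fr g\<^esub> t" using p(3) k(1) by blast
          have "c = ?q (p y)" using k(2) yt(3) qpt[OF yt(1,2)] by simp
          then show "c \<in> (\<lambda>y. ?q (p y)) ` carrier (Fr g')" using yt(1) by (rule image_eqI)
        qed
      qed
      have "\<exists>v \<in> lin (quot_module ?K (idm g I)) M. \<forall>y \<in> carrier (Fr g'). v (?q (p y)) = ?w y"
      proof (rule lin_factor[OF Fr_module Q(1) r(1) ql qs wl])
        fix y assume y: "y \<in> carrier (Fr g')" "?q (p y) = \<zero>\<^bsub>quot_module ?K (idm g I)\<^esub>"
        then have "p y \<in> idm g I" using Q(4)[of "p y"] p(2) by simp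
        then show "?w y = \<zero>\<^bsub>M\<^esub>" using w0 y(1) by blast
      qed
      then obtain v0 where v0: "v0 \<in> lin (quot_module ?K (idm g I)) M" "\<And>y. y \<in> carrier (Fr g') \<Longrightarrow> v0 (?q (p y)) = ?w y" by blast
      let ?v = "\<lambda>k. v0 (?q k)"
      have vl: "?v \<in> lin ?K M" by (rule lin_comp[OF v0(1) Q(2)])
      have vu: "\<pi> (?v k) = u k" if k: "k \<in> K" for k
      proof -
        obtain y t where yt: "y \<in> carrier (Fr g')" "t \<in> idm g I" "k = p y \<oplus>\<^bsub>Fr g\<^esub> t" using p(3) k by blast
        have c: "p y \<in> carrier ?K" "t \<in> carrier ?K" using yt p(2) IK by auto
        have "\<pi> (?v k) = \<pi> (?w y)" using yt qpt v0(2) by simp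
        also have "\<dots> = \<pi> (w y) \<ominus>\<^bsub>M'\<^esub> \<zero>\<^bsub>M'\<^esub>"
          using lin_closed[OF w(1) yt(1)] lin_closed[OF g1(1) yt(1)] r(1,2,3,7) by (simp add: lin_minus[OF r(4)])
        also have "\<dots> = u (p y)" using w(2)[OF yt(1)] lin_closed[OF u(1) c(1)] r(2) by (simp add: mod_ac(4)[OF r(2)])
        also have "\<dots> = u k"
        proof -
          have "u t = \<zero>\<^bsub>M'\<^esub>" using u(2) idm_sub[of g] yt(2) by blast
          then show ?thesis using lin_add[OF u(1) c] yt(3) lin_closed[OF u(1) c(1)] r(2) by simp
        qed
        finally show ?thesis .
      qed
      \<comment> \<open>\<open>?v\<close> is a lift of \<open>u\<close>; the map \<open>f \<mapsto> ?v (x f)\<close> is divisible by \<open>x\<close>, and the quotient extends \<open>?v\<close> to \<open>R\<^sup>g\<close>\<close>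
      have xK: "x \<odot>\<^bsub>Fr g\<^esub> f \<in> K" if "f \<in> carrier (Fr g)" for f using x_idm[OF that] K(2) by blast
      have xl: "(\<lambda>f. x \<odot>\<^bsub>Fr g\<^esub> f) \<in> lin (Fr g) ?K"
        using xK lin_add[OF lin_mult[OF Fr_module r(3)]] lin_smult[OF lin_mult[OF Fr_module r(3)]] by (intro linI) auto
      have divk: "?v (x \<odot>\<^bsub>Fr g\<^esub> f) \<in> (\<lambda>m. x \<odot>\<^bsub>M\<^esub> m) ` carrier M" if f: "f \<in> carrier (Fr g)" for f
      proof -
        have "\<pi> (?v (x \<odot>\<^bsub>Fr g\<^esub> f)) = \<zero>\<^bsub>M'\<^esub>" using vu[OF xK[OF f]] u(2) x_idm[OF f] by simp
        then show ?thesis using r(6)[OF lin_closed[OF vl]] xK[OF f] by auto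
      qed
      have "\<exists>z \<in> lin (Fr g) M. \<forall>f \<in> carrier (Fr g). x \<odot>\<^bsub>M\<^esub> z f = ?v (x \<odot>\<^bsub>Fr g\<^esub> f)"
        by (rule lin_divide[OF Fr_module r(1,1) lin_mult[OF r(1,3)] r(8) lin_comp[OF vl xl] divk])
      then obtain z where z: "z \<in> lin (Fr g) M" "\<And>f. f \<in> carrier (Fr g) \<Longrightarrow> x \<odot>\<^bsub>M\<^esub> z f = ?v (x \<odot>\<^bsub>Fr g\<^esub> f)" by blast
      have "z s = ?v s" if s: "s \<in> K" for s
      proof (rule inj_onD[OF inj_on_lin[OF r(1,1) lin_mult[OF r(1,3)] r(8)]])
        have sc: "s \<in> carrier (Fr g)" using s Kc(1) by blast
        have "?v (x \<odot>\<^bsub>?K\<^esub> s) = x \<odot>\<^bsub>M\<^esub> ?v s" using lin_smult[OF vl r(3), of s] s by simp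
        then show "x \<odot>\<^bsub>M\<^esub> z s = x \<odot>\<^bsub>M\<^esub> ?v s" using z(2)[OF sc] by simp
        show "z s \<in> carrier M" "?v s \<in> carrier M" using lin_closed[OF z(1) sc] lin_closed[OF vl] s by auto
      qed
      then have zu: "\<pi> (z s) = u s" if "s \<in> K" for s using vu that by simp
      show "\<exists>h \<in> lin (Fr g) M'. \<forall>y \<in> K. h y = u y"
        by (rule bexI[OF _ lin_comp[OF r(4) z(1)]]) (rule ballI, rule zu)
    qed
  next
    case (Suc j)
    note K = Suc(2,3) and Kc = submodule_closed[OF Fr_module Suc(2)]
    obtain g' p where p: "p \<in> lin (Fr g') (Fr g)" "\<forall>y \<in> carrier (Fr g'). p y \<in> K"
      "\<forall>k \<in> K. \<exists>y \<in> carrier (Fr g'). \<exists>t \<in> idm g I. k = p y \<oplus>\<^bsub>Fr g\<^esub> t"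
      "ext_van I M (Suc j) g' {y \<in> carrier (Fr g'). p y \<in> idm g I}" using Suc(4) unfolding ext_van.simps(2)[of I M "Suc j"] by blast
    let ?K1 = "{y \<in> carrier (Fr g'). p y \<in> idm g I}" and ?K2 = "{y \<in> carrier (Fr g'). p y \<in> idm g I'}"
    note IS = idm_submodule[OF I, of g] and IS' = idm_submodule[OF I'(1), of g]
    note Ic = submodule_closed[OF Fr_module IS] and Ic' = submodule_closed[OF Fr_module IS']
    have K1: "submodule ?K1 R (Fr g')" by (rule submod_preimage[OF Fr_module Fr_module p(1) IS])
    have K2: "submodule ?K2 R (Fr g')" by (rule submod_preimage[OF Fr_module Fr_module p(1) IS'])
    have IK1: "idm g' I \<subseteq> ?K1" using idm_lin[OF I p(1)] by (auto simp: idm_def)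
    have IK2: "idm g' I' \<subseteq> ?K2" using idm_lin[OF I'(1) p(1)] by (auto simp: idm_def)
    \<comment> \<open>lift multiplication by \<open>x\<close> through \<open>p\<close>, modulo \<open>I\<close>\<close>
    note Q = quot_props[OF Fr_module IS]
    let ?q = "\<lambda>k. idm g I +>\<^bsub>Fr g\<^esub> k" and ?Q = "quot_module (Fr g) (idm g I)"
    have "?q (x \<odot>\<^bsub>Fr g\<^esub> f) \<in> (\<lambda>y. ?q (p y)) ` carrier (Fr g')" if f: "f \<in> carrier (Fr g)" for f
    proof -
      have "x \<odot>\<^bsub>Fr g\<^esub> f \<in> K" using x_idm[OF f] K(2) by blast
      then obtain y t where yt: "y \<in> carrier (Fr g')" "t \<in> idm g I" "x \<odot>\<^bsub>Fr g\<^esub> f = p y \<oplus>\<^bsub>Fr g\<^esub> t" using p(3) by blast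
      have c: "p y \<in> carrier (Fr g)" "t \<in> carrier (Fr g)" using lin_closed[OF p(1) yt(1)] yt(2) Ic(1) by auto
      have "?q (p y \<oplus>\<^bsub>Fr g\<^esub> t) = ?q (p y) \<oplus>\<^bsub>?Q\<^esub> ?q t" by (rule lin_add[OF Q(2) c])
      also have "?q t = \<zero>\<^bsub>?Q\<^esub>" using Q(4)[OF c(2)] yt(2) by simp
      also have "?q (p y) \<oplus>\<^bsub>?Q\<^esub> \<zero>\<^bsub>?Q\<^esub> = ?q (p y)" using mod_simps(2)[OF Q(1) lin_closed[OF Q(2) c(1)]] .
      finally show ?thesis using yt by auto
    qed
    then have "\<exists>l \<in> lin (Fr g) (Fr g'). \<forall>f \<in> carrier (Fr g). ?q (p (l f)) = ?q (x \<odot>\<^bsub>Fr g\<^esub> f) \<and> l f \<in> carrier (Fr g')"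
      by (rule free_lift[OF Fr_module Q(1) lin_comp[OF Q(2) p(1)] lin_comp[OF Q(2) lin_mult[OF Fr_module r(3)]] _ submod_whole[OF Fr_module]])
    then obtain l where l: "l \<in> lin (Fr g) (Fr g')" "\<And>f. f \<in> carrier (Fr g) \<Longrightarrow> ?q (p (l f)) = ?q (x \<odot>\<^bsub>Fr g\<^esub> f)" by blast
    have pl: "p (l f) \<ominus>\<^bsub>Fr g\<^esub> x \<odot>\<^bsub>Fr g\<^esub> f \<in> idm g I" if f: "f \<in> carrier (Fr g)" for f
    proof -
      have c: "p (l f) \<in> carrier (Fr g)" "x \<odot>\<^bsub>Fr g\<^esub> f \<in> carrier (Fr g)" using lin_closed[OF p(1) lin_closed[OF l(1) f]] f r(3) by auto
      have "?q (p (l f) \<ominus>\<^bsub>Fr g\<^esub> x \<odot>\<^bsub>Fr g\<^esub> f) = \<zero>\<^bsub>?Q\<^esub>"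
        using lin_minus[OF Q(2) Fr_module Q(1) c] l(2)[OF f] mod_simps(6)[OF Q(1) lin_closed[OF Q(2) c(2)]] by simp
      then show ?thesis using Q(4) c by simp
    qed
    have "f \<in> idm g I" if f: "f \<in> carrier (Fr g)" "l f \<in> ?K1" for f
    proof (rule x_inj[OF f(1)])
      have c: "p (l f) \<in> carrier (Fr g)" "x \<odot>\<^bsub>Fr g\<^esub> f \<in> carrier (Fr g)" using lin_closed[OF p(1) lin_closed[OF l(1) f(1)]] f(1) r(3) by auto
      have "p (l f) \<ominus>\<^bsub>Fr g\<^esub> (p (l f) \<ominus>\<^bsub>Fr g\<^esub> x \<odot>\<^bsub>Fr g\<^esub> f) \<in> idm g I" using Ic(6) f(2) pl[OF f(1)] by blast
      then show "x \<odot>\<^bsub>Fr g\<^esub> f \<in> idm g I" using mod_diff_diff[OF Fr_module c] by simp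
    qed
    then have ev1: "ext_van I M (Suc j) g' {k \<oplus>\<^bsub>Fr g'\<^esub> l f | k f. k \<in> ?K1 \<and> f \<in> carrier (Fr g)}"
      by (rule ext_van_free_summand[OF I r(1) K1 IK1 p(4) l(1)])
    have eq: "{k \<oplus>\<^bsub>Fr g'\<^esub> l f | k f. k \<in> ?K1 \<and> f \<in> carrier (Fr g)} = ?K2"
    proof (intro equalityI subsetI)
      fix y assume "y \<in> {k \<oplus>\<^bsub>Fr g'\<^esub> l f | k f. k \<in> ?K1 \<and> f \<in> carrier (Fr g)}"
      then obtain k f where kf: "k \<in> ?K1" "f \<in> carrier (Fr g)" "y = k \<oplus>\<^bsub>Fr g'\<^esub> l f" by blast
      have c: "k \<in> carrier (Fr g')" "l f \<in> carrier (Fr g')" "p (l f) \<in> carrier (Fr g)" "x \<odot>\<^bsub>Fr g\<^esub> f \<in> carrier (Fr g)"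
        using kf lin_closed[OF l(1) kf(2)] lin_closed[OF p(1)] r(3) by auto
      have "p (l f) = x \<odot>\<^bsub>Fr g\<^esub> f \<oplus>\<^bsub>Fr g\<^esub> (p (l f) \<ominus>\<^bsub>Fr g\<^esub> x \<odot>\<^bsub>Fr g\<^esub> f)"
        using mod_solve[OF Fr_module c(3,4)] c mod_closed(4)[OF Fr_module c(3,4)] by blast
      moreover have "\<dots> \<in> idm g I'" using Ic'(3) x_idm[OF kf(2)] pl[OF kf(2)] idm_sub by blast
      ultimately have "p (l f) \<in> idm g I'" by simp
      then have "p k \<oplus>\<^bsub>Fr g\<^esub> p (l f) \<in> idm g I'" using Ic'(3) kf(1) idm_sub by blast
      then show "y \<in> ?K2" using kf(3) c lin_add[OF p(1) c(1,2)] by simp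
    next
      fix y assume y: "y \<in> ?K2"
      then obtain t f where tf: "t \<in> idm g I" "f \<in> carrier (Fr g)" "p y = t \<oplus>\<^bsub>Fr g\<^esub> x \<odot>\<^bsub>Fr g\<^esub> f" using idm_decomp by blast
      have c: "y \<in> carrier (Fr g')" "l f \<in> carrier (Fr g')" "p (l f) \<in> carrier (Fr g)" "x \<odot>\<^bsub>Fr g\<^esub> f \<in> carrier (Fr g)" "t \<in> carrier (Fr g)"
        using y tf lin_closed[OF l(1) tf(2)] lin_closed[OF p(1)] r(3) Ic(1) by auto
      have "p (y \<ominus>\<^bsub>Fr g'\<^esub> l f) = t \<ominus>\<^bsub>Fr g\<^esub> (p (l f) \<ominus>\<^bsub>Fr g\<^esub> x \<odot>\<^bsub>Fr g\<^esub> f)"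
        using c tf(3) by (simp add: lin_minus[OF p(1)], simp add: mod_ac[OF Fr_module])
      also have "\<dots> \<in> idm g I" using Ic(6)[OF tf(1) pl[OF tf(2)]] .
      finally have "y \<ominus>\<^bsub>Fr g'\<^esub> l f \<in> ?K1" using c by simp
      moreover have "y = (y \<ominus>\<^bsub>Fr g'\<^esub> l f) \<oplus>\<^bsub>Fr g'\<^esub> l f" using c by (simp add: mod_ac[OF Fr_module])
      ultimately show "y \<in> {k \<oplus>\<^bsub>Fr g'\<^esub> l f | k f. k \<in> ?K1 \<and> f \<in> carrier (Fr g)}" using tf(2) by blast
    qed
    have "ext_van I' M' j g' ?K2" by (rule Suc(1)[OF K2 IK2 ev1[unfolded eq]])
    moreover have "\<exists>y \<in> carrier (Fr g'). \<exists>t \<in> idm g I'. k = p y \<oplus>\<^bsub>Fr g\<^esub> t" if "k \<in> K" for k using p(3) idm_sub that by blast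
    ultimately show ?case unfolding ext_van.simps(2) using p(1,2) by blast
  }
qed

lemma seq_mult_kill:
  fixes M :: "('a, 'm) module"
  assumes M: "module R M" and xs: "set xs \<subseteq> carrier R" and y: "y \<in> carrier M"
    and k: "\<And>x. x \<in> set xs \<Longrightarrow> x \<odot>\<^bsub>M\<^esub> y = \<zero>\<^bsub>M\<^esub>" and r: "r \<in> seq_mult (self_module R) xs"
  shows "r \<odot>\<^bsub>M\<^esub> y = \<zero>\<^bsub>M\<^esub>"
proof -
  have "seq_mult (self_module R) xs \<subseteq> annihilator R M y"
  proof (rule seq_mult_least[OF self_is_module xs])
    show "submodule (annihilator R M y) R (self_module R)" using ann_ideal[OF M y] self_submodule_iff by blast
    fix x m assume xm: "x \<in> set xs" "m \<in> carrier (self_module R)"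
    have "x \<in> carrier R" using xm xs by blast
    then show "x \<odot>\<^bsub>self_module R\<^esub> m \<in> annihilator R M y"
      using xm k[OF xm(1)] M y mod_smult(3)[OF M, of m x y] m_comm[of x m] by (simp add: annihilator_def)
  qed
  then show ?thesis using r by (auto simp: annihilator_def)
qed

lemma killed_seq_mult:
  assumes M: "module R M" and xs: "set xs \<subseteq> carrier R" and k: "\<And>x y. x \<in> set xs \<Longrightarrow> y \<in> carrier M \<Longrightarrow> x \<odot>\<^bsub>M\<^esub> y = \<zero>\<^bsub>M\<^esub>"
  shows "seq_mult M xs \<subseteq> {\<zero>\<^bsub>M\<^esub>}"
  using k by (intro seq_mult_least[OF M xs submod_zero[OF M]]) simp

lemma noeth_hom:
  assumes A: "noeth A" and M: "noeth M" shows "noeth (hom_module R A M)"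
proof -
  note A' = noeth_module[OF A] and M' = noeth_module[OF M]
  obtain g p where p: "p \<in> lin (Fr g) A" "p ` carrier (Fr g) = carrier A"
    using fg_sub_cover[OF A' submod_whole[OF A'] noeth_fg_sub[OF A submod_whole[OF A']]] by blast
  let ?H = "hom_module R A M" and ?j = "\<lambda>f. (\<lambda>l\<in>{..<g}. f (p (unitv g l)))"
  have H: "module R ?H" using A' M' by simp
  have pc: "p (unitv g l) \<in> carrier A" for l using lin_closed[OF p(1) unitv_closed] .
  show ?thesis
  proof (rule noeth_inj[OF H noeth_dp[OF M, of g], of ?j])
    show "?j \<in> lin ?H (direct_power g M)"
    proof (rule linI)
      show "?j f \<in> carrier (direct_power g M)" if "f \<in> carrier ?H" for f
        using that pc lin_closed[of f A M] by (intro dpI) (simp add: hom_simps(1))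
    qed (use pc in \<open>simp_all add: hom_simps(3,4) dp_simps(3,4) cong: restrict_cong\<close>)
    fix f assume f: "f \<in> carrier ?H" "?j f = \<zero>\<^bsub>direct_power g M\<^esub>"
    have fl: "f \<in> lin A M" using f(1) by (simp add: hom_simps(1))
    show "f = \<zero>\<^bsub>?H\<^esub>"
    proof (rule hom_eqI[OF f(1) mod_closed(1)[OF H]])
      fix a assume a: "a \<in> carrier A"
      then obtain y where y: "y \<in> carrier (Fr g)" "a = p y" unfolding p(2)[symmetric] by blast
      have "f (p y) = (\<lambda>_. \<zero>\<^bsub>M\<^esub>) y"
      proof (rule lin_Fr_eqI[OF M' lin_comp[OF fl p(1)] lin_zero_map[OF M'] _ y(1)])
        fix l assume "l < g"
        then show "f (p (unitv g l)) = \<zero>\<^bsub>M\<^esub>" using fun_cong[OF f(2), of l] by (simp add: dp_simps(2))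
      qed
      then show "f a = \<zero>\<^bsub>?H\<^esub> a" using y a by (simp add: hom_simps(2))
    qed
  qed
qed

text \<open>For \<open>S\<close> the kernel of a surjection from \<open>R\<^sup>g\<close> to \<open>W\<close>, this is the vanishing of \<open>Ext\<^sup>1(W, M)\<close> over \<open>R\<close>.\<close>

definition extends_from :: "nat \<Rightarrow> (nat \<Rightarrow> 'a) set \<Rightarrow> ('a, 'm) module \<Rightarrow> bool" where
  "extends_from g S M \<longleftrightarrow> (\<forall>f \<in> lin ((Fr g)\<lparr>carrier := S\<rparr>) M. \<exists>h \<in> lin (Fr g) M. \<forall>s \<in> S. h s = f s)"

end

context noeth_local
begin

text \<open>For \<open>M\<close> killed by \<open>I\<close>, this is \<open>Ext\<^sup>1(k, M) = 0\<close> over the ring \<open>R / I\<close>. If the maximal ideal is the only prime that contains \<open>I\<close>, it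
  makes \<open>M\<close> injective for the noetherian modules over \<open>R / I\<close>; see \<open>injective_extension\<close>.\<close>

definition injective_mod :: "'a set \<Rightarrow> ('a, 'm) module \<Rightarrow> bool" where
  "injective_mod I M \<longleftrightarrow> (\<forall>u \<in> lin ((self_module R)\<lparr>carrier := mx\<rparr>) M. (\<forall>a \<in> I. u a = \<zero>\<^bsub>M\<^esub>) \<longrightarrow>
     (\<exists>m \<in> carrier M. \<forall>a \<in> mx. u a = a \<odot>\<^bsub>M\<^esub> m))"

text \<open>A maximal extension is defined on all of \<open>A\<close>: otherwise the quotient of \<open>A\<close> by its domain has a socle element, and the condition
  on the maximal ideal permits an extension to one more generator.\<close>

lemma injective_extension:
  fixes E :: "('a, 'm) module" and A :: "('a, 'x) module"
  assumes E: "module R E" "injective_mod (seq_mult (self_module R) xs) E"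
    and xs: "set xs \<subseteq> carrier R" "\<And>q. primeideal q R \<Longrightarrow> set xs \<subseteq> q \<Longrightarrow> q = mx"
    and A: "noeth A" "\<And>x y. x \<in> set xs \<Longrightarrow> y \<in> carrier A \<Longrightarrow> x \<odot>\<^bsub>A\<^esub> y = \<zero>\<^bsub>A\<^esub>"
    and K: "submodule K R A" and f: "f \<in> lin (A\<lparr>carrier := K\<rparr>) E"
  shows "\<exists>h \<in> lin A E. \<forall>k \<in> K. h k = f k"
proof -
  note A' = noeth_module[OF A(1)]
  let ?F = "{L. submodule L R A \<and> K \<subseteq> L \<and> (\<exists>h \<in> lin (A\<lparr>carrier := L\<rparr>) E. \<forall>k \<in> K. h k = f k)}"
  have ne: "?F \<noteq> {}" using K f by auto
  have "\<exists>L \<in> ?F. \<forall>L' \<in> ?F. L \<subseteq> L' \<longrightarrow> L' = L" by (rule noeth_maximal[OF A(1) ne]) simp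
  then obtain L where L0: "L \<in> ?F" "\<forall>L' \<in> ?F. L \<subseteq> L' \<longrightarrow> L' = L" by blast
  have L: "submodule L R A" "K \<subseteq> L" using L0(1) by auto
  obtain h where h: "h \<in> lin (A\<lparr>carrier := L\<rparr>) E" "\<And>k. k \<in> K \<Longrightarrow> h k = f k" using L0(1) by blast
  note Lc = submodule_closed[OF A' L(1)]
  have hadd: "h (a \<oplus>\<^bsub>A\<^esub> b) = h a \<oplus>\<^bsub>E\<^esub> h b" if "a \<in> L" "b \<in> L" for a b using lin_add[OF h(1), of a b] that by simp
  have hsm: "h (r \<odot>\<^bsub>A\<^esub> a) = r \<odot>\<^bsub>E\<^esub> h a" if "a \<in> L" "r \<in> carrier R" for a r using lin_smult[OF h(1), of r a] that by simp
  have hc: "h a \<in> carrier E" if "a \<in> L" for a using lin_closed[OF h(1), of a] that by simp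
  have h0: "h \<zero>\<^bsub>A\<^esub> = \<zero>\<^bsub>E\<^esub>" using hsm[OF Lc(2) zero_closed] A' E(1) hc[OF Lc(2)] by simp
  have "L = carrier A"
  proof (rule ccontr)
    assume "L \<noteq> carrier A"
    then obtain y where y: "y \<in> carrier A" "y \<notin> L" using Lc(1) by blast
    note Q = quot_props[OF A' L(1)]
    let ?q = "\<lambda>z. L +>\<^bsub>A\<^esub> z" and ?Q = "quot_module A L"
    have qs: "r \<odot>\<^bsub>?Q\<^esub> ?q z = ?q (r \<odot>\<^bsub>A\<^esub> z)" if "r \<in> carrier R" "z \<in> carrier A" for r z using lin_smult[OF Q(2) that] by simp
    have qy: "?q y \<in> carrier ?Q" "?q y \<noteq> \<zero>\<^bsub>?Q\<^esub>" using lin_closed[OF Q(2) y(1)] Q(4)[OF y(1)] y(2) by auto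
    have "x \<odot>\<^bsub>?Q\<^esub> ?q y = \<zero>\<^bsub>?Q\<^esub>" if x: "x \<in> set xs" for x
    proof -
      have xc: "x \<in> carrier R" using x xs(1) by blast
      have "x \<odot>\<^bsub>A\<^esub> y \<in> L" using A(2)[OF x y(1)] Lc(2) by simp
      then show ?thesis using qs[OF xc y(1)] Q(4)[of "x \<odot>\<^bsub>A\<^esub> y"] A' xc y(1) by simp
    qed
    then have "\<exists>r \<in> carrier R. r \<odot>\<^bsub>?Q\<^esub> ?q y \<noteq> \<zero>\<^bsub>?Q\<^esub> \<and> (\<forall>a \<in> mx. a \<odot>\<^bsub>?Q\<^esub> (r \<odot>\<^bsub>?Q\<^esub> ?q y) = \<zero>\<^bsub>?Q\<^esub>)"
      using xs by (intro socle_multiple[OF Q(1) qy, of "set xs"])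
    then obtain r where r: "r \<in> carrier R" "r \<odot>\<^bsub>?Q\<^esub> ?q y \<noteq> \<zero>\<^bsub>?Q\<^esub>" "\<forall>a \<in> mx. a \<odot>\<^bsub>?Q\<^esub> (r \<odot>\<^bsub>?Q\<^esub> ?q y) = \<zero>\<^bsub>?Q\<^esub>" by blast
    let ?y = "r \<odot>\<^bsub>A\<^esub> y"
    have yc: "?y \<in> carrier A" using A' r(1) y(1) by simp
    have yL: "?y \<notin> L" using r(2) qs[OF r(1) y(1)] Q(4)[OF yc] by simp
    have aL: "a \<odot>\<^bsub>A\<^esub> ?y \<in> L" if a: "a \<in> mx" for a
    proof -
      have "?q (a \<odot>\<^bsub>A\<^esub> ?y) = \<zero>\<^bsub>?Q\<^esub>" using r(3)[rule_format, OF a] qs[OF r(1) y(1)] qs[OF mx_carr[OF a] yc] by simp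
      then show ?thesis using Q(4)[of "a \<odot>\<^bsub>A\<^esub> ?y"] A' yc mx_carr[OF a] by simp
    qed
    let ?u = "\<lambda>a. h (a \<odot>\<^bsub>A\<^esub> ?y)"
    have u: "?u \<in> lin ((self_module R)\<lparr>carrier := mx\<rparr>) E"
      using hc aL hadd hsm yc mx_carr by (intro linI) (simp_all add: mod_smult(2,3)[OF A'])
    have "?u a = \<zero>\<^bsub>E\<^esub>" if a: "a \<in> seq_mult (self_module R) xs" for a
      using seq_mult_kill[OF A' xs(1) yc A(2)[OF _ yc] a] h0 by simp
    then have "\<exists>m \<in> carrier E. \<forall>a \<in> mx. ?u a = a \<odot>\<^bsub>E\<^esub> m" using bspec[OF E(2)[unfolded injective_mod_def] u] by blast
    then obtain m where m: "m \<in> carrier E" "\<And>a. a \<in> mx \<Longrightarrow> ?u a = a \<odot>\<^bsub>E\<^esub> m" by blast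
    \<comment> \<open>extend by sending the new generator to \<open>m\<close>\<close>
    have wd: "h l \<oplus>\<^bsub>E\<^esub> a \<odot>\<^bsub>E\<^esub> m = h l' \<oplus>\<^bsub>E\<^esub> a' \<odot>\<^bsub>E\<^esub> m"
      if lc: "l \<in> L" "l' \<in> L" and ac: "a \<in> carrier R" "a' \<in> carrier R" and eq: "l \<oplus>\<^bsub>A\<^esub> a \<odot>\<^bsub>A\<^esub> ?y = l' \<oplus>\<^bsub>A\<^esub> a' \<odot>\<^bsub>A\<^esub> ?y" for l l' a a'
    proof -
      have c: "l \<in> carrier A" "l' \<in> carrier A" "a \<odot>\<^bsub>A\<^esub> ?y \<in> carrier A" "a' \<odot>\<^bsub>A\<^esub> ?y \<in> carrier A" using lc ac Lc(1) yc A' by auto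
      have d: "(a \<ominus> a') \<odot>\<^bsub>A\<^esub> ?y = l' \<ominus>\<^bsub>A\<^esub> l"
      proof -
        have "(a \<ominus> a') \<odot>\<^bsub>A\<^esub> ?y = (l \<oplus>\<^bsub>A\<^esub> a \<odot>\<^bsub>A\<^esub> ?y) \<ominus>\<^bsub>A\<^esub> (l \<oplus>\<^bsub>A\<^esub> a' \<odot>\<^bsub>A\<^esub> ?y)"
          using c ac yc A' by (simp add: mod_smult(7)[OF A'], simp add: mod_ac[OF A'])
        also have "\<dots> = l' \<ominus>\<^bsub>A\<^esub> l" unfolding eq using c A' by (simp add: mod_ac[OF A'])
        finally show ?thesis .
      qed
      have dm: "a \<ominus> a' \<in> mx"
      proof (rule ccontr)
        assume "a \<ominus> a' \<notin> mx"
        then obtain s where s: "s \<in> carrier R" "s \<otimes> (a \<ominus> a') = \<one>" using unit_notin_mx[of "a \<ominus> a'"] ac by auto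
        have "s \<odot>\<^bsub>A\<^esub> ((a \<ominus> a') \<odot>\<^bsub>A\<^esub> ?y) \<in> L" unfolding d using Lc(5)[OF s(1) Lc(6)[OF lc(2,1)]] .
        then have "?y \<in> L" using s ac yc A' by (simp add: mod_smult(3)[OF A', symmetric])
        then show False using yL by simp
      qed
      have "h (l' \<ominus>\<^bsub>A\<^esub> l) = (a \<ominus> a') \<odot>\<^bsub>E\<^esub> m" using m(2)[OF dm] d by simp
      then have "h l' = h l \<oplus>\<^bsub>E\<^esub> (a \<ominus> a') \<odot>\<^bsub>E\<^esub> m"
        using hadd[OF lc(1) Lc(6)[OF lc(2,1)]] c A' by (simp add: mod_ac[OF A'])
      moreover have e: "h l \<in> carrier E" "a \<odot>\<^bsub>E\<^esub> m \<in> carrier E" "a' \<odot>\<^bsub>E\<^esub> m \<in> carrier E" using hc lc ac m(1) E(1) by auto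
      moreover have "a \<odot>\<^bsub>E\<^esub> m = a' \<odot>\<^bsub>E\<^esub> m \<oplus>\<^bsub>E\<^esub> (a \<odot>\<^bsub>E\<^esub> m \<ominus>\<^bsub>E\<^esub> a' \<odot>\<^bsub>E\<^esub> m)"
        using mod_solve[OF E(1) e(2,3) mod_closed(4)[OF E(1) e(2,3)]] by blast
      ultimately show ?thesis using mod_closed(4)[OF E(1) e(2,3)] ac m(1)
        by (metis mod_smult(7)[OF E(1) ac m(1)] mod_ac(1)[OF E(1)] mod_ac(2)[OF E(1)])
    qed
    let ?L = "{l \<oplus>\<^bsub>A\<^esub> z | l z. l \<in> L \<and> z \<in> {a \<odot>\<^bsub>A\<^esub> ?y | a. a \<in> carrier R}}"
    have L': "submodule ?L R A" by (rule submod_sum[OF A' L(1) submod_span1[OF A' yc]])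
    have ex: "\<forall>z. \<exists>v. z \<in> ?L \<longrightarrow> (\<exists>l a. l \<in> L \<and> a \<in> carrier R \<and> z = l \<oplus>\<^bsub>A\<^esub> a \<odot>\<^bsub>A\<^esub> ?y \<and> v = h l \<oplus>\<^bsub>E\<^esub> a \<odot>\<^bsub>E\<^esub> m)" by blast
    obtain H where H: "\<And>z. z \<in> ?L \<Longrightarrow> \<exists>l a. l \<in> L \<and> a \<in> carrier R \<and> z = l \<oplus>\<^bsub>A\<^esub> a \<odot>\<^bsub>A\<^esub> ?y \<and> H z = h l \<oplus>\<^bsub>E\<^esub> a \<odot>\<^bsub>E\<^esub> m"
      using choice[OF ex] by blast
    have Heq: "H (l \<oplus>\<^bsub>A\<^esub> a \<odot>\<^bsub>A\<^esub> ?y) = h l \<oplus>\<^bsub>E\<^esub> a \<odot>\<^bsub>E\<^esub> m" if la: "l \<in> L" "a \<in> carrier R" for l a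
    proof -
      have "l \<oplus>\<^bsub>A\<^esub> a \<odot>\<^bsub>A\<^esub> ?y \<in> ?L" using la by blast
      then obtain l' a' where "l' \<in> L" "a' \<in> carrier R" "l \<oplus>\<^bsub>A\<^esub> a \<odot>\<^bsub>A\<^esub> ?y = l' \<oplus>\<^bsub>A\<^esub> a' \<odot>\<^bsub>A\<^esub> ?y"
        "H (l \<oplus>\<^bsub>A\<^esub> a \<odot>\<^bsub>A\<^esub> ?y) = h l' \<oplus>\<^bsub>E\<^esub> a' \<odot>\<^bsub>E\<^esub> m" using H by blast
      then show ?thesis using wd[of l l' a a'] la by simp
    qed
    have Hl: "H \<in> lin (A\<lparr>carrier := ?L\<rparr>) E"
    proof (rule linI)
      fix z assume z: "z \<in> carrier (A\<lparr>carrier := ?L\<rparr>)"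
      then obtain l a where la: "l \<in> L" "a \<in> carrier R" "z = l \<oplus>\<^bsub>A\<^esub> a \<odot>\<^bsub>A\<^esub> ?y" by auto
      show "H z \<in> carrier E" using Heq[OF la(1,2)] la hc m(1) E(1) by simp
      have c: "l \<in> carrier A" "a \<odot>\<^bsub>A\<^esub> ?y \<in> carrier A" using la Lc(1) yc A' by auto
      show "H (s \<odot>\<^bsub>A\<lparr>carrier := ?L\<rparr>\<^esub> z) = s \<odot>\<^bsub>E\<^esub> H z" if s: "s \<in> carrier R" for s
      proof -
        have "s \<odot>\<^bsub>A\<^esub> z = s \<odot>\<^bsub>A\<^esub> l \<oplus>\<^bsub>A\<^esub> (s \<otimes> a) \<odot>\<^bsub>A\<^esub> ?y" using la c s yc by (simp add: mod_smult(1,3)[OF A'])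
        then have "H (s \<odot>\<^bsub>A\<^esub> z) = h (s \<odot>\<^bsub>A\<^esub> l) \<oplus>\<^bsub>E\<^esub> (s \<otimes> a) \<odot>\<^bsub>E\<^esub> m" using Heq[OF Lc(5)[OF s la(1)], of "s \<otimes> a"] s la(2) by simp
        also have "\<dots> = s \<odot>\<^bsub>E\<^esub> H z" using Heq[OF la(1,2)] la hsm hc m(1) E(1) s by (simp add: mod_smult(1,3)[OF E(1)])
        finally show ?thesis by simp
      qed
      fix z' assume z': "z' \<in> carrier (A\<lparr>carrier := ?L\<rparr>)"
      then obtain l' a' where la': "l' \<in> L" "a' \<in> carrier R" "z' = l' \<oplus>\<^bsub>A\<^esub> a' \<odot>\<^bsub>A\<^esub> ?y" by auto
      have c': "l' \<in> carrier A" "a' \<odot>\<^bsub>A\<^esub> ?y \<in> carrier A" using la' Lc(1) yc A' by auto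
      have "z \<oplus>\<^bsub>A\<^esub> z' = (l \<oplus>\<^bsub>A\<^esub> l') \<oplus>\<^bsub>A\<^esub> (a \<oplus> a') \<odot>\<^bsub>A\<^esub> ?y"
        using la la' c c' yc A' by (simp add: mod_smult(2)[OF A'] mod_ac[OF A'])
      then have "H (z \<oplus>\<^bsub>A\<^esub> z') = h (l \<oplus>\<^bsub>A\<^esub> l') \<oplus>\<^bsub>E\<^esub> (a \<oplus> a') \<odot>\<^bsub>E\<^esub> m"
        using Heq[OF Lc(3)[OF la(1) la'(1)], of "a \<oplus> a'"] la(2) la'(2) by simp
      also have "\<dots> = H z \<oplus>\<^bsub>E\<^esub> H z'"
        using Heq[OF la(1,2)] Heq[OF la'(1,2)] la la' hadd hc m(1) E(1) by (simp add: mod_smult(2)[OF E(1)] mod_ac[OF E(1)])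
      finally show "H (z \<oplus>\<^bsub>A\<lparr>carrier := ?L\<rparr>\<^esub> z') = H z \<oplus>\<^bsub>E\<^esub> H z'" by simp
    qed
    have lL: "l \<in> ?L" "H l = h l" if l: "l \<in> L" for l
    proof -
      have e: "l = l \<oplus>\<^bsub>A\<^esub> \<zero> \<odot>\<^bsub>A\<^esub> ?y" using l Lc(1) yc A' by auto
      then show "l \<in> ?L" using l by blast
      show "H l = h l" using Heq[OF l zero_closed] e m(1) E(1) hc[OF l] by simp
    qed
    have "H k = f k" if "k \<in> K" for k using lL(2)[OF subsetD[OF L(2) that]] h(2)[OF that] by (rule trans)
    then have HK: "\<forall>k \<in> K. H k = f k" by (rule ballI)
    have sub: "L \<subseteq> ?L" by (rule subsetI, rule lL(1))
    have "\<exists>h \<in> lin (A\<lparr>carrier := ?L\<rparr>) E. \<forall>k \<in> K. h k = f k" using HK Hl by (rule bexI[where x=H])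
    then have "?L \<in> ?F" by (intro CollectI conjI L' subset_trans[OF L(2) sub])
    then have "?L = L" by (rule L0(2)[rule_format, OF _ sub])
    moreover have "?y = \<zero>\<^bsub>A\<^esub> \<oplus>\<^bsub>A\<^esub> \<one> \<odot>\<^bsub>A\<^esub> ?y" using yc A' by simp
    then have "?y \<in> ?L" using Lc(2) by blast
    ultimately show False using yL by simp
  qed
  then have "A\<lparr>carrier := L\<rparr> = A" by simp
  then show ?thesis using h by auto
qed

text \<open>Let \<open>f\<close> be a map from \<open>S\<close> to \<open>M\<close>. Its reduction modulo \<open>x\<close> extends to \<open>R\<^sup>g\<close>, and the extension lifts to \<open>M\<close>. So \<open>f\<close> is the sum of a
  map that extends and a multiple of \<open>x\<close>, and Nakayama's lemma applies to \<open>Hom(S, M)\<close>.\<close>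

lemma extends_from_descend:
  assumes rs: "reg_step x M M' \<pi>" and x: "x \<in> mx" and M: "noeth M" and S: "submodule S R (Fr g)"
    and ex: "extends_from g S M'"
  shows "extends_from g S M"
proof -
  note r = reg_stepD[OF rs]
  let ?S = "(Fr g)\<lparr>carrier := S\<rparr>"
  have Sm: "module R ?S" by (rule submod_module[OF Fr_module S])
  let ?H = "hom_module R ?S M" and ?i = "precomp ?S (\<lambda>y. y) :: _ \<Rightarrow> _ \<Rightarrow> _"
  have H: "module R ?H" using Sm r(1) by simp
  have inc: "(\<lambda>y. y) \<in> lin ?S (Fr g)" using submodule_closed(1)[OF Fr_module S] by (intro linI) auto
  note il = precomp_lin[OF Sm inc, of M]
  have V: "submodule (?i ` carrier (hom_module R (Fr g) M)) R ?H"
    by (rule submod_image[OF hom_is_module[OF Fr_module r(1)] H il submod_whole[OF hom_is_module[OF Fr_module r(1)]]])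
  have "carrier ?H \<subseteq> ?i ` carrier (hom_module R (Fr g) M)"
  proof (rule nakayama[OF noeth_hom[OF noeth_sub[OF noeth_Fr S] M] submod_whole[OF H] V x])
    fix f assume f: "f \<in> carrier ?H"
    then have fl: "f \<in> lin ?S M" by (simp add: hom_simps(1))
    have "\<exists>h' \<in> lin (Fr g) M'. \<forall>s \<in> S. h' s = \<pi> (f s)"
      using bspec[OF ex[unfolded extends_from_def] lin_comp[OF r(4) fl]] .
    then obtain h' where h': "h' \<in> lin (Fr g) M'" "\<And>s. s \<in> S \<Longrightarrow> h' s = \<pi> (f s)" by blast
    have "h' y \<in> \<pi> ` carrier M" if "y \<in> carrier (Fr g)" for y using lin_closed[OF h'(1) that] r(5) by simp
    then have "\<exists>h \<in> lin (Fr g) M. \<forall>y \<in> carrier (Fr g). \<pi> (h y) = h' y \<and> h y \<in> carrier M"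
      by (rule free_lift[OF r(1,2,4) h'(1) _ submod_whole[OF r(1)]])
    then obtain h where h: "h \<in> lin (Fr g) M" "\<And>y. y \<in> carrier (Fr g) \<Longrightarrow> \<pi> (h y) = h' y" by blast
    have hS: "h \<in> lin ?S M" by (rule lin_comp[OF h(1) inc])
    let ?t = "\<lambda>s. f s \<ominus>\<^bsub>M\<^esub> h s"
    have t: "?t \<in> lin ?S M" by (rule lin_diff[OF r(1) fl hS])
    have divk: "?t s \<in> (\<lambda>m. x \<odot>\<^bsub>M\<^esub> m) ` carrier M" if s: "s \<in> carrier ?S" for s
    proof -
      have c: "f s \<in> carrier M" "h s \<in> carrier M" using lin_closed[OF fl s] lin_closed[OF hS s] by auto
      have "\<pi> (?t s) = \<zero>\<^bsub>M'\<^esub>" using c r(1,2) h(2)[OF lin_closed[OF inc s]] h'(2) s lin_closed[OF r(4)] by (simp add: lin_minus[OF r(4)])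
      then show ?thesis using r(6) lin_closed[OF t s] by blast
    qed
    have "\<exists>f1 \<in> lin ?S M. \<forall>s \<in> carrier ?S. x \<odot>\<^bsub>M\<^esub> f1 s = ?t s"
      by (rule lin_divide[OF Sm r(1,1) lin_mult[OF r(1,3)] r(8) t divk])
    then obtain f1 where f1: "f1 \<in> lin ?S M" "\<And>s. s \<in> carrier ?S \<Longrightarrow> x \<odot>\<^bsub>M\<^esub> f1 s = ?t s" by blast
    let ?h = "restrict h (carrier (Fr g))" and ?f1 = "restrict f1 (carrier ?S)"
    have hH: "?h \<in> carrier (hom_module R (Fr g) M)" "?f1 \<in> carrier ?H"
      by (rule lin_restrict[OF Fr_module h(1)], rule lin_restrict[OF Sm f1(1)])
    have "f = ?i ?h \<oplus>\<^bsub>?H\<^esub> x \<odot>\<^bsub>?H\<^esub> ?f1"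
    proof (rule hom_eqI[OF f])
      show "?i ?h \<oplus>\<^bsub>?H\<^esub> x \<odot>\<^bsub>?H\<^esub> ?f1 \<in> carrier ?H"
        by (rule mod_closed(2)[OF H lin_closed[OF il hH(1)] mod_closed(5)[OF H r(3) hH(2)]])
      fix s assume s: "s \<in> carrier ?S"
      have c: "f s \<in> carrier M" "h s \<in> carrier M" "s \<in> carrier (Fr g)" using lin_closed[OF fl s] lin_closed[OF hS s] lin_closed[OF inc s] by auto
      have "(?i ?h \<oplus>\<^bsub>?H\<^esub> x \<odot>\<^bsub>?H\<^esub> ?f1) s = h s \<oplus>\<^bsub>M\<^esub> ?t s"
        using s c(3) f1(2)[OF s] by (simp add: hom_simps(3,4) precomp_def)
      then show "f s = (?i ?h \<oplus>\<^bsub>?H\<^esub> x \<odot>\<^bsub>?H\<^esub> ?f1) s" using c r(1) by (simp add: mod_ac[OF r(1)])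
    qed
    then show "\<exists>v\<in>?i ` carrier (hom_module R (Fr g) M). \<exists>k'\<in>carrier ?H. f = v \<oplus>\<^bsub>?H\<^esub> x \<odot>\<^bsub>?H\<^esub> k'" using hH by blast
  qed
  note main = this
  show ?thesis unfolding extends_from_def
  proof
    fix f assume f: "f \<in> lin ?S M"
    have "restrict f (carrier ?S) \<in> ?i ` carrier (hom_module R (Fr g) M)" using main lin_restrict[OF Sm f] by blast
    then obtain h where h: "h \<in> carrier (hom_module R (Fr g) M)" "restrict f (carrier ?S) = ?i h" by blast
    have "h s = f s" if "s \<in> S" for s using fun_cong[OF h(2), of s] that by (simp add: precomp_def)
    then show "\<exists>h \<in> lin (Fr g) M. \<forall>s \<in> S. h s = f s" using h(1) by (auto simp: hom_simps(1))
  qed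
qed

text \<open>A map from \<open>S\<close> to a module killed by the sequence vanishes on the products of \<open>S\<close> with the sequence. By \<open>seq_mult_kernel\<close> it is
  defined on the image of \<open>S\<close> in \<open>R\<^sup>g\<close> modulo the sequence, from where injectivity extends it.\<close>

lemma extends_from_kernel:
  fixes E :: "('a, 'm) module" and W :: "('a, 'w) module"
  assumes E: "module R E" "injective_mod (seq_mult (self_module R) xs) E"
      "\<And>x y. x \<in> set xs \<Longrightarrow> y \<in> carrier E \<Longrightarrow> x \<odot>\<^bsub>E\<^esub> y = \<zero>\<^bsub>E\<^esub>"
    and xs: "\<And>q. primeideal q R \<Longrightarrow> set xs \<subseteq> q \<Longrightarrow> q = mx"
    and W: "module R W" "wreg W xs" and p: "p \<in> lin (Fr g) W" "p ` carrier (Fr g) = carrier W"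
    and S: "S = {y \<in> carrier (Fr g). p y = \<zero>\<^bsub>W\<^esub>}"
  shows "extends_from g S E"
  unfolding extends_from_def
proof
  note xc = wreg_carr[OF W(2)]
  let ?S = "(Fr g)\<lparr>carrier := S\<rparr>" and ?T = "seq_mult (Fr g) xs"
  have sS: "submodule S R (Fr g)" unfolding S by (rule submod_ker[OF Fr_module W(1) p(1)])
  have Sm: "module R ?S" by (rule submod_module[OF Fr_module sS])
  fix f assume f: "f \<in> lin ?S E"
  have T: "submodule ?T R (Fr g)" by (rule seq_mult_submodule[OF Fr_module xc])
  note Q = quot_props[OF Fr_module T]
  let ?Q = "quot_module (Fr g) ?T" and ?q = "\<lambda>y. ?T +>\<^bsub>Fr g\<^esub> y"
  have QS: "submodule (?q ` S) R ?Q" by (rule submod_image[OF Fr_module Q(1,2) sS])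
  have Qn: "noeth ?Q" by (rule noeth_surj[OF noeth_Fr Q(1,2) Q(3)[symmetric]])
  have Qk: "x \<odot>\<^bsub>?Q\<^esub> y = \<zero>\<^bsub>?Q\<^esub>" if x: "x \<in> set xs" and y: "y \<in> carrier ?Q" for x y
  proof -
    obtain z where z: "z \<in> carrier (Fr g)" "y = ?q z" using y unfolding Q(3) by blast
    have xR: "x \<in> carrier R" using x xc by blast
    show ?thesis using lin_smult[OF Q(2) xR z(1)] Q(4)[of "x \<odot>\<^bsub>Fr g\<^esub> z"] seq_mult_gen[OF Fr_module xc x z(1)] z xR by simp
  qed
  have "\<exists>f' \<in> lin (?Q\<lparr>carrier := ?q ` S\<rparr>) E. \<forall>s \<in> carrier ?S. f' (?q s) = f s"
  proof (rule lin_factor[OF Sm submod_module[OF Q(1) QS] E(1) _ _ f])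
    show "?q \<in> lin ?S (?Q\<lparr>carrier := ?q ` S\<rparr>)"
      using submodule_closed(1)[OF Fr_module sS] lin_add[OF Q(2)] lin_smult[OF Q(2)] by (intro linI) (auto simp: subset_iff)
    fix s assume s: "s \<in> carrier ?S" "?q s = \<zero>\<^bsub>?Q\<lparr>carrier := ?q ` S\<rparr>\<^esub>"
    have sc: "s \<in> S" "s \<in> carrier (Fr g)" using s(1) submodule_closed(1)[OF Fr_module sS] by auto
    have "s \<in> ?T" using Q(4)[OF sc(2)] s(2) by simp
    then have "s \<in> seq_mult ?S xs" using seq_mult_kernel[OF Fr_module W(1) p S W(2) order_refl sc(1)] by simp
    then have "f s \<in> seq_mult E xs" by (rule seq_mult_lin_sub[OF Sm E(1) f xc])
    then show "f s = \<zero>\<^bsub>E\<^esub>" using killed_seq_mult[OF E(1) xc E(3)] by blast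
  qed simp
  then obtain f' where f': "f' \<in> lin (?Q\<lparr>carrier := ?q ` S\<rparr>) E" "\<And>s. s \<in> S \<Longrightarrow> f' (?q s) = f s" by auto
  have "\<exists>h \<in> lin ?Q E. \<forall>k \<in> ?q ` S. h k = f' k"
    by (rule injective_extension[OF E(1,2) xc xs Qn Qk QS f'(1)])
  then obtain h where h: "h \<in> lin ?Q E" "\<And>k. k \<in> ?q ` S \<Longrightarrow> h k = f' k" by blast
  show "\<exists>h \<in> lin (Fr g) E. \<forall>s \<in> S. h s = f s"
    using lin_comp[OF h(1) Q(2)] h(2) f'(2) by (intro bexI[of _ "\<lambda>y. h (?q y)"]) auto
qed

text \<open>With \<open>N\<^sub>i\<close> for level \<open>i\<close> of \<open>N\<close> and \<open>W\<^sub>i\<close> for that of \<open>W\<close>, the obstruction to lifting a map \<open>W\<^sub>i\<^sub>+\<^sub>1 \<rightarrow> N\<^sub>i\<^sub>+\<^sub>1\<close> lies in \<open>Ext\<^sup>1(W, N\<^sub>i)\<close>. In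
  concrete terms, lift the map on the free cover of \<open>W\<close>. On the kernel \<open>S\<close> of the cover the lift is \<open>x\<close> times a map \<open>f1\<close>; subtract
  \<open>x\<close> times an extension of \<open>f1\<close>.\<close>

lemma lift_hom_level:
  fixes W :: "('a, 'w) module" and N :: "('a, 'm) module"
  assumes W: "module R W" "wreg W xs" and N: "module R N" "wreg N xs" and i: "i < length xs"
    and p: "p \<in> lin (Fr g) W" "p ` carrier (Fr g) = carrier W" and S: "S = {y \<in> carrier (Fr g). p y = \<zero>\<^bsub>W\<^esub>}"
    and ex: "extends_from g S (level N xs i)"
    and rW: "reg_step (xs ! i) (level W xs i) (level W xs (Suc i)) \<pi>W"
    and rN: "reg_step (xs ! i) (level N xs i) (level N xs (Suc i)) \<pi>N"
    and phi: "\<phi>' \<in> lin (level W xs (Suc i)) (level N xs (Suc i))"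
  shows "\<exists>\<phi> \<in> lin (level W xs i) (level N xs i). \<forall>y \<in> carrier (level W xs i). \<pi>N (\<phi> y) = \<phi>' (\<pi>W y)"
proof -
  let ?W = "level W xs i" and ?N = "level N xs i" and ?x = "xs ! i" and ?S = "(Fr g)\<lparr>carrier := S\<rparr>"
  note xc = wreg_carr[OF W(2)] and r = reg_stepD[OF rW] and s = reg_stepD[OF rN]
  note LW = level_props[OF W(1) xc] and LN = level_props[OF N(1) xc]
  have sS: "submodule S R (Fr g)" unfolding S by (rule submod_ker[OF Fr_module W(1) p(1)])
  note Sc = submodule_closed[OF Fr_module sS] and Sm = submod_module[OF Fr_module sS]
  let ?q = "\<lambda>y. lproj W xs i (p y)"
  have q: "?q \<in> lin (Fr g) ?W" by (rule lin_comp[OF LW(2) p(1)])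
  have qs: "?q ` carrier (Fr g) = carrier ?W" unfolding LW(3)[of i, symmetric] p(2)[symmetric] by (simp add: image_image)
  let ?g = "\<lambda>y. \<phi>' (\<pi>W (?q y))"
  have gl: "?g \<in> lin (Fr g) (level N xs (Suc i))" by (rule lin_comp[OF phi lin_comp[OF r(4) q]])
  have "?g y \<in> \<pi>N ` carrier ?N" if "y \<in> carrier (Fr g)" for y using lin_closed[OF gl that] s(5) by simp
  then have "\<exists>h \<in> lin (Fr g) ?N. \<forall>y \<in> carrier (Fr g). \<pi>N (h y) = ?g y \<and> h y \<in> carrier ?N"
    by (rule free_lift[OF s(1,2,4) gl _ submod_whole[OF s(1)]])
  then obtain h where h: "h \<in> lin (Fr g) ?N" "\<And>y. y \<in> carrier (Fr g) \<Longrightarrow> \<pi>N (h y) = ?g y" by blast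
  have inc: "(\<lambda>y. y) \<in> lin ?S (Fr g)" using Sc(1) by (intro linI) auto
  have hS: "h \<in> lin ?S ?N" by (rule lin_comp[OF h(1) inc])
  have divk: "h y \<in> (\<lambda>m. ?x \<odot>\<^bsub>?N\<^esub> m) ` carrier ?N" if y: "y \<in> carrier ?S" for y
  proof -
    have yc: "y \<in> carrier (Fr g)" "p y = \<zero>\<^bsub>W\<^esub>" using y by (auto simp: S)
    have "?g y = \<zero>\<^bsub>level N xs (Suc i)\<^esub>"
      using yc(2) lin_zero[OF LW(2) W(1) LW(1)] lin_zero[OF r(4,1,2)] lin_zero[OF phi r(2) s(2)] by simp
    then show ?thesis using s(6)[OF lin_closed[OF h(1) yc(1)]] h(2)[OF yc(1)] by auto
  qed
  have "\<exists>f1 \<in> lin ?S ?N. \<forall>y \<in> carrier ?S. ?x \<odot>\<^bsub>?N\<^esub> f1 y = h y"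
    by (rule lin_divide[OF Sm s(1,1) lin_mult[OF s(1,3)] s(8) hS divk])
  then obtain f1 where f1: "f1 \<in> lin ?S ?N" "\<And>y. y \<in> S \<Longrightarrow> ?x \<odot>\<^bsub>?N\<^esub> f1 y = h y" by auto
  have "\<exists>g1 \<in> lin (Fr g) ?N. \<forall>y \<in> S. g1 y = f1 y" using bspec[OF ex[unfolded extends_from_def] f1(1)] .
  then obtain g1 where g1: "g1 \<in> lin (Fr g) ?N" "\<And>y. y \<in> S \<Longrightarrow> g1 y = f1 y" by blast
  let ?t = "\<lambda>y. h y \<ominus>\<^bsub>?N\<^esub> ?x \<odot>\<^bsub>?N\<^esub> g1 y"
  have t: "?t \<in> lin (Fr g) ?N" by (rule lin_diff[OF s(1) h(1) lin_scale[OF s(1) g1(1) s(3)]])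
  have tS: "?t y = \<zero>\<^bsub>?N\<^esub>" if y: "y \<in> S" for y
    using f1(2)[OF y] g1(2)[OF y] lin_closed[OF h(1)] Sc(1) y s(1) by auto
  have tc: "set (take i xs) \<subseteq> carrier R" using xc set_take_subset[of i xs] by blast
  have "\<exists>\<phi> \<in> lin ?W ?N. \<forall>y \<in> carrier (Fr g). \<phi> (?q y) = ?t y"
  proof (rule lin_factor[OF Fr_module r(1) s(1) q qs t])
    fix y assume y: "y \<in> carrier (Fr g)" "?q y = \<zero>\<^bsub>?W\<^esub>"
    then have "p y \<in> seq_mult W (take i xs)" using LW(4)[OF lin_closed[OF p(1) y(1)]] by simp
    then have "p y \<in> p ` seq_mult (Fr g) (take i xs)" using seq_mult_lin_surj[OF Fr_module W(1) p(1) tc p(2)] by simp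
    then obtain z where z: "z \<in> seq_mult (Fr g) (take i xs)" "p y = p z" by blast
    have zc: "z \<in> carrier (Fr g)" using z(1) submodule_closed(1)[OF Fr_module seq_mult_submodule[OF Fr_module tc]] by blast
    have "y \<ominus>\<^bsub>Fr g\<^esub> z \<in> S" using y zc z(2) W(1) lin_closed[OF p(1) zc] by (simp add: S lin_minus[OF p(1)])
    then have 1: "?t (y \<ominus>\<^bsub>Fr g\<^esub> z) = \<zero>\<^bsub>?N\<^esub>" by (rule tS)
    have "?t z \<in> seq_mult ?N (take i xs)" by (rule seq_mult_lin_sub[OF Fr_module s(1) t tc z(1)])
    then have 2: "?t z = \<zero>\<^bsub>?N\<^esub>" using killed_seq_mult[OF s(1) tc] level_killed[OF N(1) xc] by blast
    have "?t (y \<ominus>\<^bsub>Fr g\<^esub> z) = ?t y \<ominus>\<^bsub>?N\<^esub> ?t z" by (rule lin_minus[OF t Fr_module s(1) y(1) zc])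
    then show "?t y = \<zero>\<^bsub>?N\<^esub>" using 1 2 mod_eq_iff[OF s(1) lin_closed[OF t y(1)] lin_closed[OF t zc]] by simp
  qed
  then obtain \<phi> where \<phi>: "\<phi> \<in> lin ?W ?N" "\<And>y. y \<in> carrier (Fr g) \<Longrightarrow> \<phi> (?q y) = ?t y" by blast
  have "\<pi>N (\<phi> w) = \<phi>' (\<pi>W w)" if w: "w \<in> carrier ?W" for w
  proof -
    obtain y where y: "y \<in> carrier (Fr g)" "w = ?q y" using w unfolding qs[symmetric] by blast
    have "\<pi>N (?t y) = \<pi>N (h y) \<ominus>\<^bsub>level N xs (Suc i)\<^esub> \<zero>\<^bsub>level N xs (Suc i)\<^esub>"
      using lin_closed[OF h(1) y(1)] lin_closed[OF g1(1) y(1)] s(1,2,3,7) by (simp add: lin_minus[OF s(4)])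
    also have "\<dots> = ?g y" using h(2)[OF y(1)] lin_closed[OF gl y(1)] s(2) by (simp add: mod_ac(4)[OF s(2)])
    finally show ?thesis using \<phi>(2)[OF y(1)] y(2) by simp
  qed
  then show ?thesis using \<phi>(1) by blast
qed

end

context resolved
begin

lemma ext_van_of_EV:
  assumes M: "module R M" and EV: "EV (Suc (i + j)) M"
  shows "ext_van {\<zero>} M j (n i) (D i ` carrier (F (Suc i)))"
  using EV
proof (induct j arbitrary: i)
  case 0
  show ?case unfolding ext_van.simps
  proof (intro ballI impI)
    fix f assume f: "f \<in> lin ((F i)\<lparr>carrier := D i ` carrier (F (Suc i))\<rparr>) M"
    then have fl: "f \<in> lin (syz i) M" by (simp add: syz_def)
    have "f (D i (D (Suc i) v)) = \<zero>\<^bsub>M\<^esub>" if v: "v \<in> carrier (F (Suc (Suc i)))" for v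
      using DD[OF v] lin_zero[OF fl syz_module M] by (simp add: syz_def)
    then have "cocyc (Suc i) M (\<lambda>v. f (D i v))" using lin_comp[OF fl D_lin_syz] by (simp add: cocyc_def)
    moreover have "EV (Suc i) M" using 0 by simp
    ultimately have "cobdry (Suc i) M (\<lambda>v. f (D i v))" using EVD[of "Suc i" M "\<lambda>v. f (D i v)"] by blast
    then obtain h where "h \<in> lin (F i) M" "\<forall>v \<in> carrier (F (Suc i)). f (D i v) = h (D i v)" unfolding cobdry_Suc by blast
    then show "\<exists>h\<in>lin (F i) M. \<forall>y\<in>D i ` carrier (F (Suc i)). h y = f y" by (intro bexI[of _ h]) auto
  qed
next
  case (Suc j)
  have z: "y \<in> idm (n i) {\<zero>} \<longleftrightarrow> y = \<zero>\<^bsub>F i\<^esub>" if y: "y \<in> carrier (F i)" for y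
  proof
    assume "y \<in> idm (n i) {\<zero>}"
    then show "y = \<zero>\<^bsub>F i\<^esub>" by (intro dp_eqI[OF y mod_closed(1)[OF Fr_module]]) (simp add: idm_def dp_simps(2))
  next
    assume "y = \<zero>\<^bsub>F i\<^esub>"
    then show "y \<in> idm (n i) {\<zero>}" using y by (simp add: idm_def dp_simps(2)[of "n i"])
  qed
  have eq: "{y \<in> carrier (F (Suc i)). D i y \<in> idm (n i) {\<zero>}} = D (Suc i) ` carrier (F (Suc (Suc i)))"
    unfolding im_D using z[OF lin_closed[OF D_lin]] by blast
  have "ext_van {\<zero>} M j (n (Suc i)) {y \<in> carrier (F (Suc i)). D i y \<in> idm (n i) {\<zero>}}"
    unfolding eq using Suc by simp
  moreover have "\<exists>y\<in>carrier (F (Suc i)). \<exists>t\<in>idm (n i) {\<zero>}. k = D i y \<oplus>\<^bsub>F i\<^esub> t" if k: "k \<in> D i ` carrier (F (Suc i))" for k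
  proof -
    obtain y where y: "y \<in> carrier (F (Suc i))" "k = D i y" using k by blast
    have "\<zero>\<^bsub>F i\<^esub> \<in> idm (n i) {\<zero>}" using z[OF mod_closed(1)[OF Fr_module]] by blast
    moreover have "k = D i y \<oplus>\<^bsub>F i\<^esub> \<zero>\<^bsub>F i\<^esub>" using y lin_closed[OF D_lin y(1)] by simp
    ultimately show ?thesis using y(1) by blast
  qed
  ultimately show ?case unfolding ext_van.simps(2) using D_lin[of i] by blast
qed

lemma seq_mult_self_sub_mx:
  assumes "set xs \<subseteq> mx" shows "seq_mult (self_module R) xs \<subseteq> mx"
  using assms mx_sub mx_mult(2) by (intro seq_mult_least[OF self_is_module _ mx_submodule]) auto

text \<open>Rees' change of rings, applied to all elements of the sequence, turns \<open>Ext\<^sup>d\<^sup>+\<^sup>1(k, M) = 0\<close> over \<open>R\<close> into \<open>Ext\<^sup>1(k, M / xs M) = 0\<close> over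
  \<open>R / (xs)\<close>, for a sequence \<open>xs\<close> of length \<open>d\<close>.\<close>

lemma injective_of_EV:
  assumes M: "module R M" "wreg M xs" and xs: "wreg (self_module R) xs" "set xs \<subseteq> mx"
    and EV: "EV (Suc (length xs)) M"
  shows "injective_mod (seq_mult (self_module R) xs) (level M xs (length xs))"
proof -
  note xc = wreg_carr[OF xs(1)]
  let ?I = "\<lambda>i. seq_mult (self_module R) (take i xs)" and ?Z = "D 0 ` carrier (F (Suc 0))"
  note L = level_props[OF M(1) xc]
  have tc: "set (take i xs) \<subseteq> carrier R" for i using xc set_take_subset[of i xs] by blast
  have I: "ideal (?I i) R" for i using seq_mult_submodule[OF self_is_module tc] self_submodule_iff by blast
  have Imx: "?I i \<subseteq> mx" for i using seq_mult_self_sub_mx[of "take i xs"] set_take_subset[of i xs] xs(2) by blast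
  have Z: "submodule ?Z R (F 0)" by (rule syz_submodule)
  have rfk: "r \<odot>\<^bsub>rf\<^esub> m = \<zero>\<^bsub>rf\<^esub>" if rm: "r \<in> mx" "m \<in> carrier rf" for r m
  proof -
    obtain s where s: "s \<in> carrier R" "m = mx +>\<^bsub>self_module R\<^esub> s" using rm(2) unfolding rf_surj[symmetric] by blast
    show ?thesis using lin_smult[OF rf_lin mx_carr[OF rm(1)], of s] s rf_zero_iff[of "r \<otimes> s"] mx_mult(2)[OF rm(1) s(1)] mx_carr[OF rm(1)] by simp
  qed
  have IZ: "idm (n 0) (?I i) \<subseteq> ?Z" for i
  proof
    fix y assume y: "y \<in> idm (n 0) (?I i)"
    have "e y = \<zero>\<^bsub>rf\<^esub>" by (rule idm_killed[OF rf_module rfk e_lin y]) (use Imx in blast)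
    then show "y \<in> ?Z" unfolding im_D0 using y by (simp add: idm_def)
  qed
  have kill: "r \<odot>\<^bsub>level M xs i\<^esub> m = \<zero>\<^bsub>level M xs i\<^esub>" if "r \<in> ?I i" "m \<in> carrier (level M xs i)" for i r m
    by (rule seq_mult_kill[OF L(1) tc that(2) level_killed[OF M(1) xc _ that(2)] that(1)])
  have "ext_van (?I i) (level M xs i) (length xs - i) (n 0) ?Z" if "i \<le> length xs" for i
    using that
  proof (induct i)
    case 0
    have "EV (Suc (length xs)) (level M xs 0)"
      by (rule EV_iso[OF M(1) L(1) L(2) L(3) lproj0_inj[OF M(1) xc] EV])
    then show ?case using ext_van_of_EV[OF L(1), of 0 "length xs" 0] seq_mult_Nil[OF self_is_module] by simp
  next
    case (Suc i)
    then have i: "i < length xs" by simp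
    obtain \<pi> where r: "reg_step (xs ! i) (level M xs i) (level M xs (Suc i)) \<pi>" using level_step[OF M i] by blast
    have "ext_van (?I i) (level M xs i) (Suc (length xs - Suc i)) (n 0) ?Z" using Suc by (simp add: Suc_diff_Suc)
    moreover have "?I (Suc i) = {r \<oplus> (xs ! i) \<otimes> s | r s. r \<in> ?I i \<and> s \<in> carrier R}"
      using seq_mult_take_Suc[OF self_is_module xc i] by simp
    moreover have "s \<in> ?I i" if "s \<in> carrier R" "(xs ! i) \<otimes> s \<in> ?I i" for s
      using wregD[OF xs(1) i, of s] that by simp
    ultimately show ?case by (intro ext_van_rees[OF I I _ _ r kill Z IZ])
  qed
  from this[of "length xs"] have ev: "ext_van (seq_mult (self_module R) xs) (level M xs (length xs)) 0 (n 0) ?Z" by simp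
  obtain \<epsilon> y0 w where eps: "\<epsilon> \<in> lin (F 0) (self_module R)" "\<forall>y \<in> carrier (F 0). e y = \<zero>\<^bsub>rf\<^esub> \<longleftrightarrow> \<epsilon> y \<in> mx"
    "y0 \<in> carrier (F 0)" "w \<in> carrier R" "w \<otimes> \<epsilon> y0 = \<one>" using augmentation by blast
  let ?E = "level M xs (length xs)"
  note Em = L(1)[of "length xs"]
  show ?thesis unfolding injective_mod_def
  proof (intro ballI impI)
    fix u assume u: "u \<in> lin ((self_module R)\<lparr>carrier := mx\<rparr>) ?E" "\<forall>a\<in>seq_mult (self_module R) xs. u a = \<zero>\<^bsub>?E\<^esub>"
    have eZ: "z \<in> carrier (F 0)" "\<epsilon> z \<in> mx" if "z \<in> ?Z" for z using that eps(2) unfolding im_D0 by auto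
    have "\<epsilon> \<in> lin ((F 0)\<lparr>carrier := ?Z\<rparr>) ((self_module R)\<lparr>carrier := mx\<rparr>)"
      using eZ lin_add[OF eps(1)] lin_smult[OF eps(1)] by (intro linI) simp_all
    then have ul: "(\<lambda>z. u (\<epsilon> z)) \<in> lin ((F 0)\<lparr>carrier := ?Z\<rparr>) ?E" by (rule lin_comp[OF u(1)])
    have "ideal (seq_mult (self_module R) xs) R" using I[of "length xs"] by simp
    then have "u (\<epsilon> y) = \<zero>\<^bsub>?E\<^esub>" if "y \<in> idm (n 0) (seq_mult (self_module R) xs)" for y
      using idm_lin_self[OF _ eps(1) that] u(2) by blast
    then have "\<exists>h \<in> lin (F 0) ?E. \<forall>z \<in> ?Z. h z = u (\<epsilon> z)" by (rule ext_van_0D[OF ev ul])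
    then obtain h where h: "h \<in> lin (F 0) ?E" "\<And>z. z \<in> ?Z \<Longrightarrow> h z = u (\<epsilon> z)" by blast
    note hy = lin_closed[OF h(1) eps(3)]
    have ec: "\<epsilon> y0 \<in> carrier R" using lin_closed[OF eps(1,3)] by simp
    have "u a = a \<odot>\<^bsub>?E\<^esub> (w \<odot>\<^bsub>?E\<^esub> h y0)" if a: "a \<in> mx" for a
    proof -
      have ac: "a \<in> carrier R" using mx_carr[OF a] .
      have ea: "\<epsilon> (a \<odot>\<^bsub>F 0\<^esub> y0) = \<epsilon> y0 \<otimes> a" using lin_smult[OF eps(1) ac eps(3)] m_comm[OF ac ec] by simp
      have "a \<odot>\<^bsub>F 0\<^esub> y0 \<in> ?Z" unfolding im_D0 using eps(2,3) ac ea mx_mult(1)[OF a ec] by simp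
      then have "h (a \<odot>\<^bsub>F 0\<^esub> y0) = u (\<epsilon> y0 \<otimes> a)" using h(2) ea by simp
      then have "a \<odot>\<^bsub>?E\<^esub> h y0 = \<epsilon> y0 \<odot>\<^bsub>?E\<^esub> u a" using lin_smult[OF h(1) ac eps(3)] lin_smult[OF u(1) ec, of a] a by simp
      then have "a \<odot>\<^bsub>?E\<^esub> (w \<odot>\<^bsub>?E\<^esub> h y0) = w \<odot>\<^bsub>?E\<^esub> (\<epsilon> y0 \<odot>\<^bsub>?E\<^esub> u a)" using mod_smult_comm[OF Em ac eps(4) hy] by simp
      also have "\<dots> = u a" using mod_smult(3)[OF Em eps(4) ec, of "u a"] lin_closed[OF u(1), of a] a eps(5) Em by simp
      finally show ?thesis by simp
    qed
    then show "\<exists>m\<in>carrier ?E. \<forall>a\<in>mx. u a = a \<odot>\<^bsub>?E\<^esub> m" using Em eps(4) hy by (intro bexI[of _ "w \<odot>\<^bsub>?E\<^esub> h y0"]) auto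
  qed
qed

end

section \<open>Lifting an isomorphism along a regular sequence\<close>

context cring
begin

text \<open>The map \<open>W\<^sup>k \<rightarrow> N\<close> with the components \<open>\<phi> 0, \<dots>, \<phi> (k - 1)\<close>.\<close>

definition dsum :: "('a, 'm) module \<Rightarrow> nat \<Rightarrow> (nat \<Rightarrow> 'w \<Rightarrow> 'm) \<Rightarrow> (nat \<Rightarrow> 'w) \<Rightarrow> 'm" where
  "dsum N k \<phi> v = finsum N (\<lambda>i. \<phi> i (v i)) {..<k}"

lemma dsum_lin:
  assumes "module R W" "module R N" "\<And>i. i < k \<Longrightarrow> \<phi> i \<in> lin W N"
  shows "dsum N k \<phi> \<in> lin (direct_power k W) N"
proof -
  have "dsum N k \<phi> = (\<lambda>x. finsum N (\<lambda>i. \<phi> i (x i)) {..<k})" by (simp add: dsum_def fun_eq_iff)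
  then show ?thesis using dp_sum_lin[OF assms] by simp
qed

lemma dsum_cong:
  assumes N: "module R N" and "\<And>i. i < k \<Longrightarrow> \<phi>' i (v' i) \<in> carrier N" "\<And>i. i < k \<Longrightarrow> \<phi> i (v i) = \<phi>' i (v' i)"
  shows "dsum N k \<phi> v = dsum N k \<phi>' v'"
proof -
  interpret N: module R N by fact
  show ?thesis unfolding dsum_def using assms(2,3) by (intro N.finsum_cong') auto
qed

lemma dsum_Suc:
  assumes N: "module R N" and c: "\<And>i. i < Suc k \<Longrightarrow> \<phi> i (v i) \<in> carrier N"
  shows "dsum N (Suc k) \<phi> v = \<phi> k (v k) \<oplus>\<^bsub>N\<^esub> dsum N k \<phi> v"
proof -
  interpret N: module R N by fact
  show ?thesis unfolding dsum_def lessThan_Suc using c by (subst N.finsum_insert) auto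
qed

lemma dsum_0: assumes "module R N" shows "dsum N 0 \<phi> v = \<zero>\<^bsub>N\<^esub>"
proof -
  interpret N: module R N by fact
  show ?thesis by (simp add: dsum_def)
qed

lemma dsum_closed:
  assumes N: "module R N" and c: "\<And>i. i < k \<Longrightarrow> \<phi> i (v i) \<in> carrier N"
  shows "dsum N k \<phi> v \<in> carrier N"
proof -
  interpret N: module R N by fact
  show ?thesis unfolding dsum_def using c by (intro N.finsum_closed) auto
qed

lemma dsum_image:
  assumes N: "module R N" and N': "module R N'" and p: "\<pi> \<in> lin N N'"
    and c: "\<And>i. i < k \<Longrightarrow> \<phi> i (v i) \<in> carrier N"
  shows "\<pi> (dsum N k \<phi> v) = dsum N' k (\<lambda>i y. \<pi> (\<phi> i y)) v"
  using c
proof (induct k)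
  case 0
  show ?case using dsum_0[OF N, of \<phi> v] dsum_0[OF N', of "\<lambda>i y. \<pi> (\<phi> i y)" v] lin_zero[OF p N N'] by simp
next
  case (Suc k)
  have "dsum N (Suc k) \<phi> v = \<phi> k (v k) \<oplus>\<^bsub>N\<^esub> dsum N k \<phi> v" by (rule dsum_Suc[OF N]) (rule Suc(2))
  moreover have "dsum N' (Suc k) (\<lambda>i y. \<pi> (\<phi> i y)) v = \<pi> (\<phi> k (v k)) \<oplus>\<^bsub>N'\<^esub> dsum N' k (\<lambda>i y. \<pi> (\<phi> i y)) v"
    by (rule dsum_Suc[OF N']) (rule lin_closed[OF p Suc(2)])
  moreover have "dsum N k \<phi> v \<in> carrier N" by (rule dsum_closed[OF N]) (use Suc(2) in simp)
  ultimately show ?case using lin_add[OF p, of "\<phi> k (v k)" "dsum N k \<phi> v"] Suc by simp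
qed

definition power_iso :: "('a, 'w) module \<Rightarrow> ('a, 'm) module \<Rightarrow> nat \<Rightarrow> (nat \<Rightarrow> 'w \<Rightarrow> 'm) \<Rightarrow> bool" where
  "power_iso W N k \<phi> \<longleftrightarrow> (\<forall>i<k. \<phi> i \<in> lin W N) \<and>
    (\<forall>v \<in> carrier (direct_power k W). dsum N k \<phi> v = \<zero>\<^bsub>N\<^esub> \<longrightarrow> v = \<zero>\<^bsub>direct_power k W\<^esub>) \<and>
    carrier N \<subseteq> dsum N k \<phi> ` carrier (direct_power k W)"

lemma power_isoI:
  assumes "\<And>i. i < k \<Longrightarrow> \<phi> i \<in> lin W N"
    and "\<And>v. v \<in> carrier (direct_power k W) \<Longrightarrow> dsum N k \<phi> v = \<zero>\<^bsub>N\<^esub> \<Longrightarrow> v = \<zero>\<^bsub>direct_power k W\<^esub>"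
    and "carrier N \<subseteq> dsum N k \<phi> ` carrier (direct_power k W)"
  shows "power_iso W N k \<phi>"
  unfolding power_iso_def using assms(3) by (intro conjI allI impI ballI assms(1,2))

lemma power_isoD:
  assumes "power_iso W N k \<phi>"
  shows "\<And>i. i < k \<Longrightarrow> \<phi> i \<in> lin W N"
    and "\<And>v. v \<in> carrier (direct_power k W) \<Longrightarrow> dsum N k \<phi> v = \<zero>\<^bsub>N\<^esub> \<Longrightarrow> v = \<zero>\<^bsub>direct_power k W\<^esub>"
    and "carrier N \<subseteq> dsum N k \<phi> ` carrier (direct_power k W)"
  using assms unfolding power_iso_def by blast+

lemma reg_step_dp:
  assumes r: "reg_step x M M' \<pi>"
  shows "reg_step x (direct_power k M) (direct_power k M') (\<lambda>v. \<lambda>i\<in>{..<k}. \<pi> (v i))"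
proof -
  note s = reg_stepD[OF r]
  let ?A = "direct_power k M" and ?B = "direct_power k M'" and ?p = "\<lambda>v. \<lambda>i\<in>{..<k}. \<pi> (v i)"
  note A = dp_module[OF s(1), of k] and B = dp_module[OF s(2), of k]
  have l: "?p \<in> lin ?A ?B"
  proof (rule linI)
    show "?p v \<in> carrier ?B" if "v \<in> carrier ?A" for v using lin_closed[OF s(4) dp_coord[OF that]] by (intro dpI)
    show "?p (v \<oplus>\<^bsub>?A\<^esub> w) = ?p v \<oplus>\<^bsub>?B\<^esub> ?p w" if "v \<in> carrier ?A" "w \<in> carrier ?A" for v w
      using lin_add[OF s(4) dp_coord[OF that(1)] dp_coord[OF that(2)]] by (simp add: dp_simps(3) cong: restrict_cong)
    show "?p (a \<odot>\<^bsub>?A\<^esub> v) = a \<odot>\<^bsub>?B\<^esub> ?p v" if "a \<in> carrier R" "v \<in> carrier ?A" for a v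
      using lin_smult[OF s(4) that(1) dp_coord[OF that(2)]] by (simp add: dp_simps(4) cong: restrict_cong)
  qed
  have surj: "?p ` carrier ?A = carrier ?B"
  proof
    show "?p ` carrier ?A \<subseteq> carrier ?B" using lin_closed[OF l] by blast
    show "carrier ?B \<subseteq> ?p ` carrier ?A"
    proof
      fix w assume w: "w \<in> carrier ?B"
      have "\<forall>i. \<exists>m. i < k \<longrightarrow> m \<in> carrier M \<and> w i = \<pi> m" using reg_step_surjD[OF r dp_coord[OF w]] by blast
      then obtain m where m: "\<And>i. i < k \<Longrightarrow> m i \<in> carrier M \<and> w i = \<pi> (m i)" by metis
      have mc: "(\<lambda>i\<in>{..<k}. m i) \<in> carrier ?A" using m by (intro dpI) simp
      moreover have "w = ?p (\<lambda>i\<in>{..<k}. m i)" by (rule dp_eqI[OF w lin_closed[OF l mc]]) (use m in simp)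
      ultimately show "w \<in> ?p ` carrier ?A" by blast
    qed
  qed
  have ker: "\<exists>w \<in> carrier ?A. v = x \<odot>\<^bsub>?A\<^esub> w" if v: "v \<in> carrier ?A" "?p v = \<zero>\<^bsub>?B\<^esub>" for v
  proof -
    have "\<pi> (v i) = \<zero>\<^bsub>M'\<^esub>" if "i < k" for i using fun_cong[OF v(2), of i] that by (simp add: dp_simps(2))
    then have "\<forall>i. \<exists>m. i < k \<longrightarrow> m \<in> carrier M \<and> v i = x \<odot>\<^bsub>M\<^esub> m" using s(6)[OF dp_coord[OF v(1)]] by blast
    then obtain m where m: "\<And>i. i < k \<Longrightarrow> m i \<in> carrier M \<and> v i = x \<odot>\<^bsub>M\<^esub> m i" by metis
    have mc: "(\<lambda>i\<in>{..<k}. m i) \<in> carrier ?A" using m by (intro dpI) simp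
    moreover have "v = x \<odot>\<^bsub>?A\<^esub> (\<lambda>i\<in>{..<k}. m i)"
      by (rule dp_eqI[OF v(1) mod_closed(5)[OF A s(3) mc]]) (use m in \<open>simp add: dp_simps(4)\<close>)
    ultimately show ?thesis by blast
  qed
  have kx: "?p (x \<odot>\<^bsub>?A\<^esub> v) = \<zero>\<^bsub>?B\<^esub>" if v: "v \<in> carrier ?A" for v
    using s(7)[OF dp_coord[OF v]] by (simp add: dp_simps(2,4) cong: restrict_cong)
  have inj: "v = \<zero>\<^bsub>?A\<^esub>" if v: "v \<in> carrier ?A" "x \<odot>\<^bsub>?A\<^esub> v = \<zero>\<^bsub>?A\<^esub>" for v
  proof (rule dp_eqI[OF v(1) mod_closed(1)[OF A]])
    fix i assume i: "i < k"
    have "x \<odot>\<^bsub>M\<^esub> v i = \<zero>\<^bsub>M\<^esub>" using fun_cong[OF v(2), of i] i by (simp add: dp_simps(2,4))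
    then show "v i = \<zero>\<^bsub>?A\<^esub> i" using s(8)[OF dp_coord[OF v(1) i]] i by (simp add: dp_simps(2))
  qed
  show ?thesis unfolding reg_step_def using A B s(3) l surj ker kx inj by blast
qed

end

context noeth_local
begin

text \<open>Two applications of Nakayama's lemma: the kernel \<open>K\<close> of \<open>\<theta>\<close> satisfies \<open>K = xK\<close>, and the image together with \<open>xB\<close> is all of \<open>B\<close>.\<close>

lemma reg_step_bijective:
  assumes rA: "reg_step x A A' \<alpha>" and rB: "reg_step x B B' \<beta>" and x: "x \<in> mx" and n: "noeth A" "noeth B"
    and t: "\<theta> \<in> lin A B" and t': "\<theta>' \<in> lin A' B'" and comm: "\<And>a. a \<in> carrier A \<Longrightarrow> \<beta> (\<theta> a) = \<theta>' (\<alpha> a)"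
    and bij: "\<And>a. a \<in> carrier A' \<Longrightarrow> \<theta>' a = \<zero>\<^bsub>B'\<^esub> \<Longrightarrow> a = \<zero>\<^bsub>A'\<^esub>" "carrier B' \<subseteq> \<theta>' ` carrier A'"
  shows "a \<in> carrier A \<Longrightarrow> \<theta> a = \<zero>\<^bsub>B\<^esub> \<Longrightarrow> a = \<zero>\<^bsub>A\<^esub>" and "carrier B \<subseteq> \<theta> ` carrier A"
proof -
  note a = reg_stepD[OF rA] and b = reg_stepD[OF rB]
  let ?K = "{a \<in> carrier A. \<theta> a = \<zero>\<^bsub>B\<^esub>}"
  have "?K \<subseteq> {\<zero>\<^bsub>A\<^esub>}"
  proof (rule nakayama[OF n(1) submod_ker[OF a(1) b(1) t] submod_zero[OF a(1)] x])
    fix k assume "k \<in> ?K"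
    then have k: "k \<in> carrier A" "\<theta> k = \<zero>\<^bsub>B\<^esub>" by auto
    have "\<theta>' (\<alpha> k) = \<zero>\<^bsub>B'\<^esub>" using comm[OF k(1)] k(2) lin_zero[OF b(4,1,2)] by simp
    then have "\<alpha> k = \<zero>\<^bsub>A'\<^esub>" by (rule bij(1)[OF lin_closed[OF a(4) k(1)]])
    then obtain k' where k': "k' \<in> carrier A" "k = x \<odot>\<^bsub>A\<^esub> k'" using a(6)[OF k(1)] by blast
    have "x \<odot>\<^bsub>B\<^esub> \<theta> k' = \<zero>\<^bsub>B\<^esub>" using lin_smult[OF t a(3) k'(1)] k(2) k'(2) by simp
    then have "\<theta> k' = \<zero>\<^bsub>B\<^esub>" by (rule b(8)[OF lin_closed[OF t k'(1)]])
    moreover have "k = \<zero>\<^bsub>A\<^esub> \<oplus>\<^bsub>A\<^esub> x \<odot>\<^bsub>A\<^esub> k'" using k' k(1) a(1) by simp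
    ultimately show "\<exists>v\<in>{\<zero>\<^bsub>A\<^esub>}. \<exists>k'\<in>?K. k = v \<oplus>\<^bsub>A\<^esub> x \<odot>\<^bsub>A\<^esub> k'" using k'(1) by blast
  qed
  then show "a \<in> carrier A \<Longrightarrow> \<theta> a = \<zero>\<^bsub>B\<^esub> \<Longrightarrow> a = \<zero>\<^bsub>A\<^esub>" by blast
  show "carrier B \<subseteq> \<theta> ` carrier A"
  proof (rule nakayama[OF n(2) submod_whole[OF b(1)] submod_image[OF a(1) b(1) t submod_whole[OF a(1)]] x])
    fix y assume y: "y \<in> carrier B"
    obtain u' where u': "u' \<in> carrier A'" "\<beta> y = \<theta>' u'" using bij(2) lin_closed[OF b(4) y] by blast
    obtain u where u: "u \<in> carrier A" "u' = \<alpha> u" using reg_step_surjD[OF rA u'(1)] by blast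
    note tu = lin_closed[OF t u(1)]
    have "\<beta> (y \<ominus>\<^bsub>B\<^esub> \<theta> u) = \<zero>\<^bsub>B'\<^esub>"
      using lin_minus[OF b(4,1,2) y tu] comm[OF u(1)] u'(2) u(2) mod_simps(6)[OF b(2) lin_closed[OF b(4) y]] by simp
    then obtain z where z: "z \<in> carrier B" "y \<ominus>\<^bsub>B\<^esub> \<theta> u = x \<odot>\<^bsub>B\<^esub> z" using b(6)[OF mod_closed(4)[OF b(1) y tu]] by blast
    have "y = \<theta> u \<oplus>\<^bsub>B\<^esub> x \<odot>\<^bsub>B\<^esub> z" using z(2) mod_solve[OF b(1) y tu mod_closed(5)[OF b(1,3) z(1)]] by blast
    then show "\<exists>v\<in>\<theta> ` carrier A. \<exists>k'\<in>carrier B. y = v \<oplus>\<^bsub>B\<^esub> x \<odot>\<^bsub>B\<^esub> k'" using u(1) z(1) by blast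
  qed
qed

lemma unit_smult_zero:
  assumes M: "module R M" and r: "r \<in> carrier R" "r \<notin> mx" and m: "m \<in> carrier M" "r \<odot>\<^bsub>M\<^esub> m = \<zero>\<^bsub>M\<^esub>"
  shows "m = \<zero>\<^bsub>M\<^esub>"
proof -
  obtain s where s: "s \<in> carrier R" "s \<otimes> r = \<one>" using unit_notin_mx[OF r] by blast
  have "m = s \<odot>\<^bsub>M\<^esub> (r \<odot>\<^bsub>M\<^esub> m)" using mod_smult(3)[OF M s(1) r(1) m(1)] s(2) M m(1) by simp
  then show ?thesis using m(2) M s(1) by simp
qed

definition simple_socle :: "('a, 'm) module \<Rightarrow> 'm \<Rightarrow> bool" where
  "simple_socle E w \<longleftrightarrow> w \<in> carrier E \<and> w \<noteq> \<zero>\<^bsub>E\<^esub> \<and> (\<forall>a \<in> mx. a \<odot>\<^bsub>E\<^esub> w = \<zero>\<^bsub>E\<^esub>) \<and>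
     (\<forall>y \<in> carrier E. (\<forall>a \<in> mx. a \<odot>\<^bsub>E\<^esub> y = \<zero>\<^bsub>E\<^esub>) \<longrightarrow> (\<exists>r \<in> carrier R. y = r \<odot>\<^bsub>E\<^esub> w))"

lemma extend_from_socle:
  fixes E :: "('a, 'w) module" and N :: "('a, 'm) module"
  assumes E: "noeth E" "\<And>x y. x \<in> set xs \<Longrightarrow> y \<in> carrier E \<Longrightarrow> x \<odot>\<^bsub>E\<^esub> y = \<zero>\<^bsub>E\<^esub>" and w: "simple_socle E w"
    and N: "module R N" "injective_mod (seq_mult (self_module R) xs) N"
    and xs: "set xs \<subseteq> carrier R" "\<And>q. primeideal q R \<Longrightarrow> set xs \<subseteq> q \<Longrightarrow> q = mx"
    and c: "c \<in> carrier N" "\<And>a. a \<in> mx \<Longrightarrow> a \<odot>\<^bsub>N\<^esub> c = \<zero>\<^bsub>N\<^esub>"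
  shows "\<exists>h \<in> lin E N. h w = c"
proof -
  note E' = noeth_module[OF E(1)]
  have ww: "w \<in> carrier E" "w \<noteq> \<zero>\<^bsub>E\<^esub>" using w by (auto simp: simple_socle_def)
  let ?K = "{r \<odot>\<^bsub>E\<^esub> w | r. r \<in> carrier R}"
  note K = submod_span1[OF E' ww(1)]
  have pl: "(\<lambda>r. r \<odot>\<^bsub>E\<^esub> w) \<in> lin (self_module R) (E\<lparr>carrier := ?K\<rparr>)"
    using ww(1) by (intro linI) (auto simp: mod_smult(2,3)[OF E'])
  have cl: "(\<lambda>r. r \<odot>\<^bsub>N\<^esub> c) \<in> lin (self_module R) N"
    using c(1) N(1) by (intro linI) (auto simp: mod_smult(2,3)[OF N(1)])
  have "\<exists>f \<in> lin (E\<lparr>carrier := ?K\<rparr>) N. \<forall>r \<in> carrier (self_module R). f (r \<odot>\<^bsub>E\<^esub> w) = r \<odot>\<^bsub>N\<^esub> c"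
  proof (rule lin_factor[OF self_is_module submod_module[OF E' K] N(1) pl _ cl])
    show "(\<lambda>r. r \<odot>\<^bsub>E\<^esub> w) ` carrier (self_module R) = carrier (E\<lparr>carrier := ?K\<rparr>)" by auto
    fix r assume r: "r \<in> carrier (self_module R)" "r \<odot>\<^bsub>E\<^esub> w = \<zero>\<^bsub>E\<lparr>carrier := ?K\<rparr>\<^esub>"
    then have "r \<in> mx" using unit_smult_zero[OF E', of r w] ww by auto
    then show "r \<odot>\<^bsub>N\<^esub> c = \<zero>\<^bsub>N\<^esub>" by (rule c(2))
  qed
  then obtain f where f: "f \<in> lin (E\<lparr>carrier := ?K\<rparr>) N" "\<And>r. r \<in> carrier R \<Longrightarrow> f (r \<odot>\<^bsub>E\<^esub> w) = r \<odot>\<^bsub>N\<^esub> c" by auto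
  have "\<exists>h \<in> lin E N. \<forall>k \<in> ?K. h k = f k" by (rule injective_extension[OF N xs E K f(1)])
  then obtain h where h: "h \<in> lin E N" "\<And>k. k \<in> ?K \<Longrightarrow> h k = f k" by blast
  have e: "w = \<one> \<odot>\<^bsub>E\<^esub> w" using E' ww(1) by simp
  then have "w \<in> ?K" by blast
  then have "h w = f (\<one> \<odot>\<^bsub>E\<^esub> w)" using h(2) e by simp
  then have "h w = c" using f(2)[OF one_closed] N(1) c(1) by simp
  then show ?thesis using h(1) by blast
qed

text \<open>Among the images of embeddings of direct powers of \<open>E\<close> into \<open>N\<close> choose a maximal one. As \<open>E\<close> is injective, the embedding has a
  retraction. If it is not surjective, the kernel of the retraction contains a socle element \<open>c\<close>, and the map from \<open>E\<close> that takes the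
  generator of the socle of \<open>E\<close> to \<open>c\<close> enlarges the image. The enlarged map is injective, since it is so on socles.\<close>

lemma injective_direct_sum:
  fixes E :: "('a, 'w) module" and N :: "('a, 'm) module"
  assumes E: "noeth E" "\<And>x y. x \<in> set xs \<Longrightarrow> y \<in> carrier E \<Longrightarrow> x \<odot>\<^bsub>E\<^esub> y = \<zero>\<^bsub>E\<^esub>"
      "injective_mod (seq_mult (self_module R) xs) E" and w: "simple_socle E w"
    and N: "noeth N" "\<And>x y. x \<in> set xs \<Longrightarrow> y \<in> carrier N \<Longrightarrow> x \<odot>\<^bsub>N\<^esub> y = \<zero>\<^bsub>N\<^esub>"
      "injective_mod (seq_mult (self_module R) xs) N"
    and xs: "set xs \<subseteq> carrier R" "\<And>q. primeideal q R \<Longrightarrow> set xs \<subseteq> q \<Longrightarrow> q = mx"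
  shows "\<exists>k \<phi>. power_iso E N k \<phi>"
proof -
  note E' = noeth_module[OF E(1)] and N' = noeth_module[OF N(1)]
  have ww: "w \<in> carrier E" "w \<noteq> \<zero>\<^bsub>E\<^esub>" "\<And>y. y \<in> carrier E \<Longrightarrow> \<forall>a \<in> mx. a \<odot>\<^bsub>E\<^esub> y = \<zero>\<^bsub>E\<^esub> \<Longrightarrow> \<exists>r \<in> carrier R. y = r \<odot>\<^bsub>E\<^esub> w"
    "\<And>a. a \<in> mx \<Longrightarrow> a \<odot>\<^bsub>E\<^esub> w = \<zero>\<^bsub>E\<^esub>" using w unfolding simple_socle_def by blast+
  let ?P = "\<lambda>k \<phi>. (\<forall>i<k. \<phi> i \<in> lin E N) \<and>
    (\<forall>v \<in> carrier (direct_power k E). dsum N k \<phi> v = \<zero>\<^bsub>N\<^esub> \<longrightarrow> v = \<zero>\<^bsub>direct_power k E\<^esub>)"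
  let ?im = "\<lambda>k \<phi>. dsum N k \<phi> ` carrier (direct_power k E)"
  let ?F = "{?im k \<phi> | k \<phi>. ?P k \<phi>}"
  have "?P 0 (\<lambda>_ _. \<zero>\<^bsub>N\<^esub>)" by (auto simp: dp_simps fun_eq_iff)
  then have ne: "?F \<noteq> {}" by blast
  have "\<exists>L \<in> ?F. \<forall>L' \<in> ?F. L \<subseteq> L' \<longrightarrow> L' = L"
  proof (rule noeth_maximal[OF N(1) ne])
    fix L assume "L \<in> ?F"
    then obtain k \<phi> where kp: "L = ?im k \<phi>" "?P k \<phi>" by blast
    have "dsum N k \<phi> \<in> lin (direct_power k E) N" by (rule dsum_lin[OF E' N']) (use kp(2) in blast)
    then show "submodule L R N" unfolding kp(1)
      by (rule submod_image[OF dp_module[OF E'] N' _ submod_whole[OF dp_module[OF E']]])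
  qed
  then obtain L where L1: "L \<in> ?F" "\<forall>L' \<in> ?F. L \<subseteq> L' \<longrightarrow> L' = L" by (rule bexE)
  note L = L1(1) L1(2)[rule_format]
  obtain k \<phi> where kp: "L = ?im k \<phi>" "\<And>i. i < k \<Longrightarrow> \<phi> i \<in> lin E N"
    "\<And>v. v \<in> carrier (direct_power k E) \<Longrightarrow> dsum N k \<phi> v = \<zero>\<^bsub>N\<^esub> \<Longrightarrow> v = \<zero>\<^bsub>direct_power k E\<^esub>" using L(1) by blast
  let ?E = "direct_power k E" and ?E1 = "direct_power (Suc k) E"
  note Em = dp_module[OF E', of k] and E1m = dp_module[OF E', of "Suc k"]
  have Pl: "dsum N k \<phi> \<in> lin ?E N" by (rule dsum_lin[OF E' N' kp(2)])
  have "carrier N \<subseteq> L"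
  proof (rule ccontr)
    assume "\<not> carrier N \<subseteq> L"
    then obtain y where y: "y \<in> carrier N" "y \<notin> L" by blast
    \<comment> \<open>\<open>E\<close> being injective, there is a retraction onto the image\<close>
    have sL: "submodule L R N" unfolding kp(1) by (rule submod_image[OF Em N' Pl submod_whole[OF Em]])
    note Lm = submod_module[OF N' sL]
    have PL: "dsum N k \<phi> \<in> lin ?E (N\<lparr>carrier := L\<rparr>)"
      using lin_add[OF Pl] lin_smult[OF Pl] by (intro linI) (auto simp: kp(1))
    have "\<exists>h \<in> lin (N\<lparr>carrier := L\<rparr>) ?E. (\<forall>y \<in> carrier (N\<lparr>carrier := L\<rparr>). dsum N k \<phi> (h y) = y) \<and> (\<forall>x \<in> carrier ?E. h (dsum N k \<phi> x) = x)"
      by (rule lin_inverse[OF Em Lm PL]) (simp add: kp(1), use kp(3) in simp)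
    then obtain h where h: "h \<in> lin (N\<lparr>carrier := L\<rparr>) ?E" "\<And>x. x \<in> carrier ?E \<Longrightarrow> h (dsum N k \<phi> x) = x" by blast
    have "\<exists>g \<in> lin N E. \<forall>l \<in> L. g l = h l i" if i: "i < k" for i
      by (rule injective_extension[OF E' E(3) xs N(1,2) sL lin_comp[OF dp_coord_lin[OF i] h(1)]])
    then have "\<forall>i. \<exists>g. i < k \<longrightarrow> g \<in> lin N E \<and> (\<forall>l \<in> L. g l = h l i)" by blast
    then obtain g where g: "\<And>i. i < k \<Longrightarrow> g i \<in> lin N E" "\<And>i l. i < k \<Longrightarrow> l \<in> L \<Longrightarrow> g i l = h l i" by metis
    have gP: "g i (dsum N k \<phi> v) = v i" if "i < k" "v \<in> carrier ?E" for i v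
      using g(2)[OF that(1), of "dsum N k \<phi> v"] h(2)[OF that(2)] that(2) kp(1) by simp
    let ?\<rho> = "\<lambda>m. \<lambda>i\<in>{..<k}. g i m"
    have \<rho>c: "?\<rho> m \<in> carrier ?E" if "m \<in> carrier N" for m using lin_closed[OF g(1) that] by (intro dpI)
    let ?c0 = "y \<ominus>\<^bsub>N\<^esub> dsum N k \<phi> (?\<rho> y)"
    note Py = lin_closed[OF Pl \<rho>c[OF y(1)]]
    note c0 = mod_closed(4)[OF N' y(1) Py]
    have c0z: "?c0 \<noteq> \<zero>\<^bsub>N\<^esub>" using mod_eq_iff[OF N' y(1) Py] y(2) \<rho>c[OF y(1)] kp(1) by auto
    have g0: "g i ?c0 = \<zero>\<^bsub>E\<^esub>" if i: "i < k" for i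
      using lin_minus[OF g(1)[OF i] N' E' y(1) Py] gP[OF i \<rho>c[OF y(1)]] i
        mod_simps(6)[OF E' lin_closed[OF g(1)[OF i] y(1)]] by simp
    obtain r where r: "r \<in> carrier R" "r \<odot>\<^bsub>N\<^esub> ?c0 \<noteq> \<zero>\<^bsub>N\<^esub>" "\<And>a. a \<in> mx \<Longrightarrow> a \<odot>\<^bsub>N\<^esub> (r \<odot>\<^bsub>N\<^esub> ?c0) = \<zero>\<^bsub>N\<^esub>"
      using socle_multiple[OF N' c0 c0z, of "set xs"] xs N(2)[OF _ c0] by blast
    \<comment> \<open>a socle element in the kernel of the retraction\<close>
    define c where "c = r \<odot>\<^bsub>N\<^esub> ?c0"
    have c: "c \<in> carrier N" "c \<noteq> \<zero>\<^bsub>N\<^esub>" "\<And>a. a \<in> mx \<Longrightarrow> a \<odot>\<^bsub>N\<^esub> c = \<zero>\<^bsub>N\<^esub>"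
      using mod_closed(5)[OF N' r(1) c0] r(2,3) unfolding c_def by blast+
    have gc: "g i c = \<zero>\<^bsub>E\<^esub>" if i: "i < k" for i
      unfolding c_def using lin_smult[OF g(1)[OF i] r(1) c0] g0[OF i] E' r(1) by simp
    obtain \<psi> where psi: "\<psi> \<in> lin E N" "\<psi> w = c"
      using extend_from_socle[OF E(1,2) w N' N(3) xs c(1,3)] by blast
    let ?\<phi> = "\<phi>(k := \<psi>)" and ?r = "\<lambda>v. \<lambda>i\<in>{..<k}. v i"
    have phl: "?\<phi> i \<in> lin E N" if "i < Suc k" for i using that kp(2)[of i] psi(1) by (cases "i = k") auto
    have rc: "?r v \<in> carrier ?E" if "v \<in> carrier ?E1" for v using dp_coord[OF that] by (intro dpI) simp
    have eq: "dsum N (Suc k) ?\<phi> v = \<psi> (v k) \<oplus>\<^bsub>N\<^esub> dsum N k \<phi> (?r v)" if v: "v \<in> carrier ?E1" for v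
    proof -
      have "dsum N (Suc k) ?\<phi> v = ?\<phi> k (v k) \<oplus>\<^bsub>N\<^esub> dsum N k ?\<phi> v"
        by (rule dsum_Suc[OF N']) (rule lin_closed[OF phl dp_coord[OF v]])
      moreover have "dsum N k ?\<phi> v = dsum N k \<phi> (?r v)"
      proof (rule dsum_cong[OF N'])
        show "\<phi> i (?r v i) \<in> carrier N" if "i < k" for i using lin_closed[OF kp(2)[OF that] dp_coord[OF v, of i]] that by simp
      qed simp
      ultimately show ?thesis by simp
    qed
    have inj: "v = \<zero>\<^bsub>?E1\<^esub>" if v: "v \<in> carrier ?E1" "dsum N (Suc k) ?\<phi> v = \<zero>\<^bsub>N\<^esub>" for v
    proof (rule ccontr)
      assume nz: "v \<noteq> \<zero>\<^bsub>?E1\<^esub>"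
      have Pl1: "dsum N (Suc k) ?\<phi> \<in> lin ?E1 N" by (rule dsum_lin[OF E' N' phl])
      have "x \<odot>\<^bsub>?E1\<^esub> v = \<zero>\<^bsub>?E1\<^esub>" if x: "x \<in> set xs" for x
        using E(2)[OF x dp_coord[OF v(1)]] by (simp add: dp_simps(2,4) cong: restrict_cong)
      then obtain s where s: "s \<in> carrier R" "s \<odot>\<^bsub>?E1\<^esub> v \<noteq> \<zero>\<^bsub>?E1\<^esub>" "\<And>a. a \<in> mx \<Longrightarrow> a \<odot>\<^bsub>?E1\<^esub> (s \<odot>\<^bsub>?E1\<^esub> v) = \<zero>\<^bsub>?E1\<^esub>"
        using socle_multiple[OF E1m v(1) nz, of "set xs"] xs by blast
      \<comment> \<open>a nonzero kernel would contain a nonzero socle element, all of whose components lie in the socle of \<open>E\<close>\<close>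
      define u where "u = s \<odot>\<^bsub>?E1\<^esub> v"
      have uc: "u \<in> carrier ?E1" unfolding u_def by (rule mod_closed(5)[OF E1m s(1) v(1)])
      have u0: "dsum N (Suc k) ?\<phi> u = \<zero>\<^bsub>N\<^esub>" unfolding u_def using lin_smult[OF Pl1 s(1) v(1)] v(2) N' s(1) by simp
      have ua: "a \<odot>\<^bsub>E\<^esub> u i = \<zero>\<^bsub>E\<^esub>" if "a \<in> mx" "i < Suc k" for a i
        using fun_cong[OF s(3)[OF that(1)], of i] that(2) unfolding u_def by (simp add: dp_simps(2,4))
      have uk: "u k \<in> carrier E" using dp_coord[OF uc, of k] by simp
      obtain t where t: "t \<in> carrier R" "u k = t \<odot>\<^bsub>E\<^esub> w" using ww(3)[OF uk] ua by auto
      have pk: "\<psi> (u k) = t \<odot>\<^bsub>N\<^esub> c" using lin_smult[OF psi(1) t(1) ww(1)] t(2) psi(2) by simp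
      have tc: "t \<odot>\<^bsub>N\<^esub> c \<in> carrier N" using N' t(1) c(1) by simp
      note Pr = lin_closed[OF Pl rc[OF uc]]
      have sum0: "t \<odot>\<^bsub>N\<^esub> c \<oplus>\<^bsub>N\<^esub> dsum N k \<phi> (?r u) = \<zero>\<^bsub>N\<^esub>" using eq[OF uc] u0 pk by simp
      have ui: "u i = \<zero>\<^bsub>E\<^esub>" if i: "i < k" for i
      proof -
        have "g i (t \<odot>\<^bsub>N\<^esub> c \<oplus>\<^bsub>N\<^esub> dsum N k \<phi> (?r u)) = t \<odot>\<^bsub>E\<^esub> g i c \<oplus>\<^bsub>E\<^esub> u i"
          using lin_add[OF g(1)[OF i] tc Pr] lin_smult[OF g(1)[OF i] t(1) c(1)] gP[OF i rc[OF uc]] i by simp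
        then show ?thesis using sum0 lin_zero[OF g(1)[OF i] N' E'] gc[OF i] E' t(1) dp_coord[OF uc, of i] i by simp
      qed
      then have "?r u = \<zero>\<^bsub>?E\<^esub>" by (simp add: dp_simps(2) cong: restrict_cong)
      then have "t \<odot>\<^bsub>N\<^esub> c = \<zero>\<^bsub>N\<^esub>" using sum0 lin_zero[OF Pl Em N'] tc N' by simp
      then have "t \<in> mx" using unit_smult_zero[OF N' t(1) _ c(1)] c(2) by blast
      then have "u k = \<zero>\<^bsub>E\<^esub>" using t(2) ww(4) by simp
      then have "u = \<zero>\<^bsub>?E1\<^esub>" using ui by (intro dp_eqI[OF uc mod_closed(1)[OF E1m]]) (auto simp: dp_simps(2) less_Suc_eq)
      then show False using s(2) by (simp add: u_def)
    qed
    have in1: "?im (Suc k) ?\<phi> \<in> ?F" using phl inj by blast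
    have ext: "(\<lambda>i\<in>{..<Suc k}. if i = k then a else b i) \<in> carrier ?E1" if "a \<in> carrier E" "b \<in> carrier ?E" for a b
      using that dp_coord[OF that(2)] by (intro dpI) (auto simp: less_Suc_eq)
    have extd: "dsum N (Suc k) ?\<phi> (\<lambda>i\<in>{..<Suc k}. if i = k then a else b i) = \<psi> a \<oplus>\<^bsub>N\<^esub> dsum N k \<phi> b"
      if ab: "a \<in> carrier E" "b \<in> carrier ?E" for a b
    proof -
      have "?r (\<lambda>i\<in>{..<Suc k}. if i = k then a else b i) = b"
        by (rule dp_eqI[OF rc[OF ext[OF ab]] ab(2)]) simp
      then show ?thesis using eq[OF ext[OF ab]] by simp
    qed
    have "L \<subseteq> ?im (Suc k) ?\<phi>"
    proof
      fix l assume "l \<in> L"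
      then obtain b where b: "b \<in> carrier ?E" "l = dsum N k \<phi> b" unfolding kp(1) by blast
      have "l = dsum N (Suc k) ?\<phi> (\<lambda>i\<in>{..<Suc k}. if i = k then \<zero>\<^bsub>E\<^esub> else b i)"
        using extd[OF mod_closed(1)[OF E'] b(1)] lin_zero[OF psi(1) E' N'] b(2) N' lin_closed[OF Pl b(1)] by simp
      then show "l \<in> ?im (Suc k) ?\<phi>" using ext[OF mod_closed(1)[OF E'] b(1)] by (rule image_eqI)
    qed
    then have "?im (Suc k) ?\<phi> = L" by (rule L(2)[OF in1])
    moreover have "c = dsum N (Suc k) ?\<phi> (\<lambda>i\<in>{..<Suc k}. if i = k then w else \<zero>\<^bsub>?E\<^esub> i)"
      using extd[OF ww(1) mod_closed(1)[OF Em]] lin_zero[OF Pl Em N'] psi(2) N' c(1) by simp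
    then have "c \<in> ?im (Suc k) ?\<phi>" using ext[OF ww(1) mod_closed(1)[OF Em]] by (rule image_eqI)
    ultimately have "c \<in> L" by simp
    then obtain v where v: "v \<in> carrier ?E" "c = dsum N k \<phi> v" unfolding kp(1) by blast
    have "v i = \<zero>\<^bsub>E\<^esub>" if "i < k" for i using gP[OF that v(1)] gc[OF that] v(2) by simp
    then have "v = \<zero>\<^bsub>?E\<^esub>" by (intro dp_eqI[OF v(1) mod_closed(1)[OF Em]]) (simp add: dp_simps(2))
    then show False using c(2) v(2) lin_zero[OF Pl Em N'] by simp
  qed
  then have sub: "carrier N \<subseteq> dsum N k \<phi> ` carrier ?E" unfolding kp(1) .
  have "power_iso E N k \<phi>" by (rule power_isoI[OF _ _ sub]) (erule kp(2), erule (1) kp(3))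
  then show ?thesis by blast
qed

end

context resolved
begin

text \<open>The modules \<open>E = W / xs W\<close> and \<open>N / xs N\<close> are injective over \<open>R / (xs)\<close>, which has the maximal ideal as its only prime, and the
  socle of \<open>E\<close> is simple. So \<open>N / xs N\<close> is a direct power of \<open>E\<close>, and the isomorphism lifts to \<open>W\<close> and \<open>N\<close> in \<open>length xs\<close> steps.\<close>

lemma iso_of_dual_vanishing:
  fixes W :: "('a, 'w) module" and N :: "('a, 'm) module"
  assumes d: "krull_dim R = enat (length xs)" and xs: "set xs \<subseteq> mx" "wreg (self_module R) xs"
    and W: "noeth W" "wreg W xs" "carrier W \<noteq> {\<zero>\<^bsub>W\<^esub>}" "\<And>j. j \<noteq> length xs \<Longrightarrow> EV j W" "dim_le1 (length xs) W"
    and N: "noeth N" "wreg N xs" "EV (Suc (length xs)) N"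
  shows "\<exists>k. iso_modules R N (direct_power k W)"
proof -
  note xc = wreg_carr[OF xs(2)] and W' = noeth_module[OF W(1)] and N' = noeth_module[OF N(1)]
  let ?d = "length xs"
  note LW = level_props[OF W' xc] and LN = level_props[OF N' xc]
  have sop: "q = mx" if "primeideal q R" "set xs \<subseteq> q" for q by (rule prime_contains_sop[OF d xs(2) refl that])
  have nW: "noeth (level W xs i)" and nN: "noeth (level N xs i)" for i
    by (rule level_noeth[OF W(1) xc], rule level_noeth[OF N(1) xc])
  have kW: "x \<odot>\<^bsub>level W xs ?d\<^esub> y = \<zero>\<^bsub>level W xs ?d\<^esub>" if "x \<in> set xs" "y \<in> carrier (level W xs ?d)" for x y
    using level_killed[OF W' xc, of x ?d y] that by simp
  have kN: "x \<odot>\<^bsub>level N xs ?d\<^esub> y = \<zero>\<^bsub>level N xs ?d\<^esub>" if "x \<in> set xs" "y \<in> carrier (level N xs ?d)" for x y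
    using level_killed[OF N' xc, of x ?d y] that by simp
  have iW: "injective_mod (seq_mult (self_module R) xs) (level W xs ?d)"
    by (rule injective_of_EV[OF W' W(2) xs(2,1) W(4)]) simp
  have iN: "injective_mod (seq_mult (self_module R) xs) (level N xs ?d)"
    by (rule injective_of_EV[OF N' N(2) xs(2,1) N(3)])
  let ?E = "level W xs ?d"
  obtain w where w: "simple_socle ?E w"
  proof -
    have "seq_mult W xs \<noteq> carrier W" by (rule seq_mult_proper[OF W(1,3) xs(1)])
    then obtain m where m: "m \<in> carrier W" "m \<notin> seq_mult W xs"
      using submodule_closed(1)[OF W' seq_mult_submodule[OF W' xc]] by blast
    have y: "lproj W xs ?d m \<in> carrier ?E" "lproj W xs ?d m \<noteq> \<zero>\<^bsub>?E\<^esub>"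
      using lin_closed[OF LW(2) m(1)] LW(4)[OF m(1), of ?d] m(2) by auto
    obtain r where r: "r \<in> carrier R" "r \<odot>\<^bsub>?E\<^esub> lproj W xs ?d m \<noteq> \<zero>\<^bsub>?E\<^esub>"
      "\<And>a. a \<in> mx \<Longrightarrow> a \<odot>\<^bsub>?E\<^esub> (r \<odot>\<^bsub>?E\<^esub> lproj W xs ?d m) = \<zero>\<^bsub>?E\<^esub>"
      using socle_multiple[OF LW(1) y, of "set xs"] sop kW[OF _ y(1)] xc by blast
    define w where "w = r \<odot>\<^bsub>?E\<^esub> lproj W xs ?d m"
    have w: "w \<in> carrier ?E" "w \<noteq> \<zero>\<^bsub>?E\<^esub>" "\<And>a. a \<in> mx \<Longrightarrow> a \<odot>\<^bsub>?E\<^esub> w = \<zero>\<^bsub>?E\<^esub>"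
      using mod_closed(5)[OF LW(1) r(1) y(1)] r(2,3) unfolding w_def by blast+
    have dl: "dim_le1 0 ?E" using dim_le1_level[OF W' W(2) _ W(5), of ?d] W(4) by simp
    have "\<exists>r \<in> carrier R. y = r \<odot>\<^bsub>?E\<^esub> w" if y: "y \<in> carrier ?E" "\<forall>a \<in> mx. a \<odot>\<^bsub>?E\<^esub> y = \<zero>\<^bsub>?E\<^esub>" for y
    proof -
      obtain r s where rs: "r \<in> carrier R" "s \<in> carrier R" "r \<notin> mx \<or> s \<notin> mx" "r \<odot>\<^bsub>?E\<^esub> y \<oplus>\<^bsub>?E\<^esub> s \<odot>\<^bsub>?E\<^esub> w = \<zero>\<^bsub>?E\<^esub>"
        using dim_le1_socle[OF LW(1) dl y(1) _ w(1,3)] y(2) by blast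
      have sw: "s \<odot>\<^bsub>?E\<^esub> w \<in> carrier ?E" and ry: "r \<odot>\<^bsub>?E\<^esub> y \<in> carrier ?E" using LW(1) rs(1,2) w(1) y(1) by simp_all
      have "r \<notin> mx"
      proof
        assume rm: "r \<in> mx"
        then have "s \<odot>\<^bsub>?E\<^esub> w = \<zero>\<^bsub>?E\<^esub>" using rs(4) y(2) sw LW(1) by simp
        then show False using unit_smult_zero[OF LW(1) rs(2) _ w(1)] rm rs(3) w(2) by blast
      qed
      then obtain u where u: "u \<in> carrier R" "u \<otimes> r = \<one>" using unit_notin_mx[OF rs(1)] by blast
      have "r \<odot>\<^bsub>?E\<^esub> y = \<ominus>\<^bsub>?E\<^esub> (s \<odot>\<^bsub>?E\<^esub> w)"
      proof -
        have "r \<odot>\<^bsub>?E\<^esub> y = (r \<odot>\<^bsub>?E\<^esub> y \<oplus>\<^bsub>?E\<^esub> s \<odot>\<^bsub>?E\<^esub> w) \<oplus>\<^bsub>?E\<^esub> \<ominus>\<^bsub>?E\<^esub> (s \<odot>\<^bsub>?E\<^esub> w)"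
          using ry sw LW(1) by (simp add: mod_ac(1)[OF LW(1)])
        then show ?thesis using rs(4) sw LW(1) by simp
      qed
      then have "r \<odot>\<^bsub>?E\<^esub> y = \<ominus> s \<odot>\<^bsub>?E\<^esub> w" using mod_smult(4)[OF LW(1) rs(2) w(1)] by simp
      then have "u \<odot>\<^bsub>?E\<^esub> (r \<odot>\<^bsub>?E\<^esub> y) = (u \<otimes> \<ominus> s) \<odot>\<^bsub>?E\<^esub> w" using mod_smult(3)[OF LW(1) u(1) _ w(1)] rs(2) by simp
      moreover have "u \<odot>\<^bsub>?E\<^esub> (r \<odot>\<^bsub>?E\<^esub> y) = y" using mod_smult(3)[OF LW(1) u(1) rs(1) y(1)] u(2) y(1) LW(1) by simp
      ultimately show ?thesis using u(1) rs(2) by (metis a_inv_closed m_closed)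
    qed
    then have "simple_socle ?E w" using w by (simp add: simple_socle_def)
    then show ?thesis by (rule that)
  qed
  obtain k \<phi>d where top: "power_iso ?E (level N xs ?d) k \<phi>d"
    using injective_direct_sum[OF nW kW iW w nN kN iN xc sop] by blast
  obtain g p where p: "p \<in> lin (Fr g) W" "p ` carrier (Fr g) = carrier W"
    using finite_module_cover[OF noeth_imp_finite_module[OF W(1)]] by blast
  define S where "S = {y \<in> carrier (Fr g). p y = \<zero>\<^bsub>W\<^esub>}"
  have sS: "submodule S R (Fr g)" unfolding S_def by (rule submod_ker[OF Fr_module W' p(1)])
  have xi: "xs ! i \<in> mx" if "i < ?d" for i using xs(1) that by auto
  have ex: "extends_from g S (level N xs i)" if "i \<le> ?d" for i
    using that
  proof (induct i rule: inc_induct)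
    case base
    show ?case by (rule extends_from_kernel[OF LN(1) iN kN sop W' W(2) p S_def])
  next
    case (step i)
    obtain \<pi> where "reg_step (xs ! i) (level N xs i) (level N xs (Suc i)) \<pi>" using level_step[OF N' N(2) step(2)] by blast
    then show ?case by (rule extends_from_descend[OF _ xi[OF step(2)] nN sS step(3)])
  qed
  let ?Q = "\<lambda>i. \<exists>\<phi>. power_iso (level W xs i) (level N xs i) k \<phi>"
  have "?Q 0"
  proof (rule inc_induct[of 0 ?d ?Q])
    show "?Q ?d" using top by blast
    fix i assume i: "i < ?d" and Q: "?Q (Suc i)"
    let ?W = "level W xs i" and ?N = "level N xs i" and ?W' = "level W xs (Suc i)" and ?N' = "level N xs (Suc i)"
    obtain \<phi>' where "power_iso ?W' ?N' k \<phi>'" using Q by blast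
    note f' = power_isoD[OF this]
    obtain \<alpha> where a: "reg_step (xs ! i) ?W ?W' \<alpha>" using level_step[OF W' W(2) i] by blast
    obtain \<beta> where b: "reg_step (xs ! i) ?N ?N' \<beta>" using level_step[OF N' N(2) i] by blast
    have "\<exists>\<phi> \<in> lin ?W ?N. \<forall>y \<in> carrier ?W. \<beta> (\<phi> y) = \<phi>' j (\<alpha> y)" if j: "j < k" for j
      by (rule lift_hom_level[OF W' W(2) N' N(2) i p S_def ex[OF less_imp_le[OF i]] a b f'(1)[OF j]])
    then have "\<forall>j. \<exists>\<phi>. j < k \<longrightarrow> \<phi> \<in> lin ?W ?N \<and> (\<forall>y \<in> carrier ?W. \<beta> (\<phi> y) = \<phi>' j (\<alpha> y))" by blast
    then obtain \<phi> where f: "\<And>j. j < k \<Longrightarrow> \<phi> j \<in> lin ?W ?N" "\<And>j y. j < k \<Longrightarrow> y \<in> carrier ?W \<Longrightarrow> \<beta> (\<phi> j y) = \<phi>' j (\<alpha> y)" by metis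
    let ?\<alpha> = "\<lambda>v. \<lambda>j\<in>{..<k}. \<alpha> (v j)"
    have comm: "\<beta> (dsum ?N k \<phi> v) = dsum ?N' k \<phi>' (?\<alpha> v)" if v: "v \<in> carrier (direct_power k ?W)" for v
    proof -
      have "\<beta> (dsum ?N k \<phi> v) = dsum ?N' k (\<lambda>i y. \<beta> (\<phi> i y)) v"
        by (rule dsum_image[OF LN(1) LN(1) reg_stepD(4)[OF b]]) (rule lin_closed[OF f(1) dp_coord[OF v]])
      also have "\<dots> = dsum ?N' k \<phi>' (?\<alpha> v)"
      proof (rule dsum_cong[OF LN(1)])
        fix j assume j: "j < k"
        show "\<phi>' j (?\<alpha> v j) \<in> carrier ?N'" using lin_closed[OF f'(1)[OF j] lin_closed[OF reg_stepD(4)[OF a] dp_coord[OF v j]]] j by simp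
        show "\<beta> (\<phi> j (v j)) = \<phi>' j (?\<alpha> v j)" using f(2)[OF j dp_coord[OF v j]] j by simp
      qed
      finally show ?thesis .
    qed
    have tl: "dsum ?N k \<phi> \<in> lin (direct_power k ?W) ?N" by (rule dsum_lin[OF LW(1) LN(1) f(1)])
    have tl': "dsum ?N' k \<phi>' \<in> lin (direct_power k ?W') ?N'" by (rule dsum_lin[OF LW(1) LN(1) f'(1)])
    note bij = reg_step_bijective[OF reg_step_dp[OF a, of k] b xi[OF i] noeth_dp[OF nW[of i], of k] nN[of i] tl tl']
    have "power_iso ?W ?N k \<phi>"
    proof (rule power_isoI)
      show "\<phi> j \<in> lin ?W ?N" if "j < k" for j by (rule f(1)[OF that])
      show "v = \<zero>\<^bsub>direct_power k ?W\<^esub>" if "v \<in> carrier (direct_power k ?W)" "dsum ?N k \<phi> v = \<zero>\<^bsub>?N\<^esub>" for v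
        by (rule bij(1)[OF _ _ _ that]) (erule comm, erule (1) f'(2), rule f'(3))
      show "carrier ?N \<subseteq> dsum ?N k \<phi> ` carrier (direct_power k ?W)"
        by (rule bij(2)) (erule comm, erule (1) f'(2), rule f'(3))
    qed
    then show "?Q i" by blast
  qed simp
  then obtain \<phi> where "power_iso (level W xs 0) (level N xs 0) k \<phi>" by blast
  note f = power_isoD[OF this]
  let ?N = "level N xs 0" and ?l = "lproj W xs 0"
  let ?f = "dsum ?N k (\<lambda>j y. \<phi> j (?l y))"
  have fl: "?f \<in> lin (direct_power k W) ?N" by (rule dsum_lin[OF W' LN(1) lin_comp[OF f(1) LW(2)]])
  have feq: "?f v = dsum ?N k \<phi> (\<lambda>j\<in>{..<k}. ?l (v j))" if v: "v \<in> carrier (direct_power k W)" for v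
  proof (rule dsum_cong[OF LN(1)])
    show "\<phi> j ((\<lambda>j\<in>{..<k}. ?l (v j)) j) \<in> carrier ?N" if j: "j < k" for j
      using lin_closed[OF f(1)[OF j] lin_closed[OF LW(2) dp_coord[OF v j]]] j by simp
  qed simp
  have lc: "(\<lambda>j\<in>{..<k}. ?l (v j)) \<in> carrier (direct_power k (level W xs 0))" if v: "v \<in> carrier (direct_power k W)" for v
    using lin_closed[OF LW(2) dp_coord[OF v]] by (intro dpI)
  have finj: "v = \<zero>\<^bsub>direct_power k W\<^esub>" if v: "v \<in> carrier (direct_power k W)" "?f v = \<zero>\<^bsub>?N\<^esub>" for v
  proof (rule dp_eqI[OF v(1) mod_closed(1)[OF dp_module[OF W']]])
    fix j assume j: "j < k"
    have "(\<lambda>j\<in>{..<k}. ?l (v j)) = \<zero>\<^bsub>direct_power k (level W xs 0)\<^esub>" using f(2)[OF lc[OF v(1)]] feq[OF v(1)] v(2) by simp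
    then have "?l (v j) = \<zero>\<^bsub>level W xs 0\<^esub>" using j by (auto simp: dp_simps(2) dest!: fun_cong[of _ _ j])
    then show "v j = \<zero>\<^bsub>direct_power k W\<^esub> j" using lproj0_inj[OF W' xc dp_coord[OF v(1) j]] j by (simp add: dp_simps(2))
  qed
  have fsurj: "?f ` carrier (direct_power k W) = carrier ?N"
  proof
    show "?f ` carrier (direct_power k W) \<subseteq> carrier ?N" using lin_closed[OF fl] by blast
    show "carrier ?N \<subseteq> ?f ` carrier (direct_power k W)"
    proof
      fix y assume "y \<in> carrier ?N"
      then obtain v' where v': "v' \<in> carrier (direct_power k (level W xs 0))" "y = dsum ?N k \<phi> v'" using f(3) by blast
      have "\<forall>j. \<exists>m. j < k \<longrightarrow> m \<in> carrier W \<and> v' j = ?l m" using level_surjD[OF W' xc dp_coord[OF v'(1)]] by blast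
      then obtain m where m: "\<And>j. j < k \<Longrightarrow> m j \<in> carrier W \<and> v' j = ?l (m j)" by metis
      have mc: "(\<lambda>j\<in>{..<k}. m j) \<in> carrier (direct_power k W)" using m by (intro dpI) simp
      have "v' = (\<lambda>j\<in>{..<k}. ?l ((\<lambda>j\<in>{..<k}. m j) j))" by (rule dp_eqI[OF v'(1) lc[OF mc]]) (use m in simp)
      then have "y = ?f (\<lambda>j\<in>{..<k}. m j)" using feq[OF mc] v'(2) by simp
      then show "y \<in> ?f ` carrier (direct_power k W)" using mc by (rule image_eqI)
    qed
  qed
  have "\<exists>h \<in> lin ?N (direct_power k W). (\<forall>y \<in> carrier ?N. ?f (h y) = y) \<and> (\<forall>x \<in> carrier (direct_power k W). h (?f x) = x)"
    by (rule lin_inverse[OF dp_module[OF W'] LN(1) fl fsurj finj])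
  then obtain h where h0: "h \<in> lin ?N (direct_power k W)"
    "(\<forall>y \<in> carrier ?N. ?f (h y) = y) \<and> (\<forall>x \<in> carrier (direct_power k W). h (?f x) = x)" by (rule bexE)
  note h = h0(1) h0(2)[THEN conjunct1, rule_format] h0(2)[THEN conjunct2, rule_format]
  let ?h = "\<lambda>m. h (lproj N xs 0 m)"
  have hl: "?h \<in> lin N (direct_power k W)" by (rule lin_comp[OF h(1) LN(2)])
  have "inj_on ?h (carrier N)"
  proof (rule inj_on_lin[OF N' dp_module[OF W'] hl])
    fix m assume m: "m \<in> carrier N" "?h m = \<zero>\<^bsub>direct_power k W\<^esub>"
    have "lproj N xs 0 m = \<zero>\<^bsub>?N\<^esub>" using h(2)[OF lin_closed[OF LN(2) m(1)]] m(2) lin_zero[OF fl dp_module[OF W'] LN(1)] by simp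
    then show "m = \<zero>\<^bsub>N\<^esub>" by (rule lproj0_inj[OF N' xc m(1)])
  qed
  moreover have "?h ` carrier N = carrier (direct_power k W)"
  proof
    show "?h ` carrier N \<subseteq> carrier (direct_power k W)" using lin_closed[OF hl] by blast
    show "carrier (direct_power k W) \<subseteq> ?h ` carrier N"
    proof
      fix x assume x: "x \<in> carrier (direct_power k W)"
      obtain m where "m \<in> carrier N" "?f x = lproj N xs 0 m" using level_surjD[OF N' xc lin_closed[OF fl x]] by blast
      then show "x \<in> ?h ` carrier N" using h(3)[OF x] by (metis image_eqI)
    qed
  qed
  ultimately show ?thesis using hl unfolding iso_modules_def bij_betw_def by blast
qed

end

theorem theorem74:
  fixes R :: "('a, 'r) ring_scheme"
    and \<Omega> :: "('a, 'b) module"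
    and \<omega> :: "('a, 'c) module"
  assumes "local_ring R" and "noetherian_ring R" and "cohen_macaulay_ring R"
    and "krull_dim R \<ge> 3"
    and "dualizing_module R \<omega>"
    and "finite_module R \<Omega>" and "torsion_free R \<Omega>"
    and "\<And>M :: ('a, (nat \<Rightarrow> 'a) set) module.
           finite_module R M \<Longrightarrow> torsion_free R M \<Longrightarrow> cohen_macaulay R M \<Longrightarrow>
           torsion_free R (hom_module R M \<Omega>) \<and> cohen_macaulay R (hom_module R M \<Omega>)"
  shows "\<exists>n. iso_modules R \<Omega> (direct_power n \<omega>)"
proof -
  interpret cring R using assms(1) by (simp add: local_ring_def)
  interpret noeth_local R by (intro noeth_local.intro noeth_local_axioms.intro is_cring assms(1,2))
  \<comment> \<open>the resolution in the definition of \<open>Ext\<close> is the one to work with throughout\<close>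
  obtain n D where nD: "(SOME (n, d). \<exists>e. free_resolution R (residue_field R) n d e) = (n, D)" by (metis surj_pair)
  have "\<exists>p. case p of (n, d) \<Rightarrow> \<exists>e. free_resolution R (residue_field R) n d e"
    using free_resolution_exists[OF rf_noeth] by auto
  from someI_ex[OF this] obtain e where e: "free_resolution R (residue_field R) n D e" unfolding nD by auto
  interpret resolved R n D e by (intro resolved.intro resolved_axioms.intro noeth_local_axioms e)
  have Ext: "Ext R i (residue_field R) \<omega> = hom_cohomology R n D i \<omega>" for i
    unfolding Ext_def nD by simp
  have W: "noeth \<omega>" using assms(5) finite_module_noeth by (auto simp: dualizing_module_def)
  have N: "noeth \<Omega>" by (rule finite_module_noeth[OF assms(6)])
  note W' = noeth_module[OF W] and N' = noeth_module[OF N]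
  obtain d where d: "krull_dim R = enat d" using cohen_macaulay_finite_dim[OF assms(3)] by auto
  have d3: "3 \<le> d" using assms(4) unfolding d by (simp add: numeral_eq_enat)
  have WEV: "EV j \<omega>" if "j \<noteq> d" for j
  proof (rule EV_of_cohomology[OF W'])
    have "enat j \<noteq> krull_dim R" using that d by simp
    then have "carrier (Ext R j (residue_field R) \<omega>) = {\<zero>\<^bsub>Ext R j (residue_field R) \<omega>\<^esub>}"
      using assms(5) unfolding dualizing_module_def by metis
    then show "carrier (hom_cohomology R n D j \<omega>) = {\<zero>\<^bsub>hom_cohomology R n D j \<omega>\<^esub>}" unfolding Ext .
  qed
  have "iso_modules R (hom_cohomology R n D d \<omega>) (residue_field R)"
    using assms(5) by (auto simp: dualizing_module_def Ext d dest: spec[of _ d])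
  note Wd = dim_le1_of_cohomology[OF W' this]
  have "enat d \<le> depth R (self_module R)" unfolding cm_ring_depth[OF assms(3)] d by (rule order_refl)
  then obtain zs where zs: "length zs = d" "set zs \<subseteq> mx" "wreg (self_module R) zs" using depth_ge[of d "self_module R"] by blast
  have NEV: "EV j \<Omega>" if "j \<noteq> d" for j
  proof (rule EV_of_cm_duals[where xs = zs])
    show "krull_dim R = enat (length zs)" "3 \<le> length zs" "j \<noteq> length zs" using d d3 zs(1) that by auto
  qed (use zs(2,3) N' assms(8) in auto)
  have REV: "EV j (self_module R)" if "j < d" for j
    by (rule EV_regular_sequence[OF self_is_module zs(3,2)]) (use that zs(1) in simp)
  have "\<exists>xs. length xs = d \<and> set xs \<subseteq> mx \<and> wreg (self_module R) xs \<and> wreg \<omega> xs \<and> wreg \<Omega> xs"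
  proof (rule common_regular_sequence[OF noeth_R _ W _ N])
    fix j assume j: "j < d"
    show "EV j (self_module R)" by (rule REV[OF j])
    show "EV j \<omega>" "EV j \<Omega>" using WEV[of j] NEV[of j] j by blast+
  qed
  then obtain xs where xs: "length xs = d" "set xs \<subseteq> mx" "wreg (self_module R) xs" "wreg \<omega> xs" "wreg \<Omega> xs" by blast
  show ?thesis
  proof (rule iso_of_dual_vanishing[OF _ xs(2,3) W xs(4) Wd(2) _ _ N xs(5)])
    show "krull_dim R = enat (length xs)" using d xs(1) by simp
    show "EV j \<omega>" if "j \<noteq> length xs" for j using WEV that xs(1) by simp
    show "dim_le1 (length xs) \<omega>" using Wd(1) xs(1) by simp
    show "EV (Suc (length xs)) \<Omega>" using NEV xs(1) by simp
  qed
qed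

end
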